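(* Assume that $\mathcal G_{\mathrm A}\in\mathbb C^{md\times md}$ is an invertible Hermitian matrix satisfying $\mathcal G_{\mathrm A}\mathfrak M_d=\mathfrak M_d^*\mathcal G_{\mathrm A}$. Define $\Gamma^{\mathrm A}=(\Gamma^{\mathrm A}_0,\Gamma^{\mathrm A}_1):\operatorname{dom}A_{\max}\to\mathbb C^d\times\mathbb C^d$ by $$\Gamma^{\mathrm A}_0(f^\#+h_{m+1}(c)+k):=c,\qquad \Gamma^{\mathrm A}_1(f^\#+h_{m+1}(c)+k):=\langle\varphi,f^\#\rangle-[\mathcal G_{\mathrm A}d(k)]_m,$$ for $f^\#\in\mathfrak H_{m+2}$, $k\in\mathfrak K_{\mathrm A}$, $c\in\mathbb C^d$, where $[\mathcal G_{\mathrm A}d(k)]_m:=([\mathcal G_{\mathrm A}d(k)]_{\sigma m})_\sigma\in\mathbb C^d$. Then: (1) The operator $A_{\min}:=A_{\max}|_{\ker\Gamma^{\mathrm A}}$ is a densely defined, closed, symmetric operator in $\mathcal H_{\mathrm A}$, its adjoint in $\mathcal H_{\mathrm A}$ is $A_{\min}^*=A_{\max}$, and $(\mathbb C^d,\Gamma^{\mathrm A}_0,\Gamma^{\mathrm A}_1)$ is an ordinary boundary triple for $A_{\min}^*=A_{\max}$. (2) For a (closed) linear relation $\Theta$ in $\mathbb C^d$, the proper extension $A_\Theta$ of $A_{\min}$ is the restriction of $A_{\max}$ to the set of $f\in\operatorname{dom}A_{\max}$ such that $\Gamma^{\mathrm A}f\in\Theta$. For $z\in\operatorname{res}A_0\cap\operatorname{res}A_\Theta$,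 $$(A_\Theta-z)^{-1}=(A_0-z)^{-1}+\gamma_{\mathrm A}(z)(\Theta-M_{\mathrm A}(z))^{-1}\gamma_{\mathrm A}(\overline z)^*,$$ where $A_0:=A_{\{0\}\times\mathbb C^d}$ is a (distinguished) self-adjoint extension of $A_{\min}$, and $\gamma_{\mathrm A}$, $M_{\mathrm A}$ are the $\gamma$-field and the Weyl function corresponding to $(\mathbb C^d,\Gamma^{\mathrm A}_0,\Gamma^{\mathrm A}_1)$. (3) $\operatorname{res}A_0=\operatorname{res}L\setminus\{z_1\}$, and for $z\in\operatorname{res}A_0$ $$(A_0-z)^{-1}=U_{\mathrm A}^*\big[(L-z)^{-1}\oplus(\mathfrak M_d-z)^{-1}\big]U_{\mathrm A}.$$ (4) For $z\in\operatorname{res}A_0$, $$\gamma_{\mathrm A}(z)\mathbb C^d=\ker(A_{\max}-z)=\Big\{\sum_\sigma c_\sigma F_\sigma(z)\ \Big|\ c_\sigma\in\mathbb C\Big\},\qquad F_\sigma(z):=\frac{g_\sigma(z)}{(z-z_1)^m},$$ and $M_{\mathrm A}(z)=q(z)+r(z)$ on $\mathbb C^d$, where $q(z)$, $r(z)$ are the $d\times d$ matrices with entries $$[q(z)]_{\sigma\sigma'}:=(z-z_1)\langle\varphi_\sigma,(L-z)^{-1}h_{\sigma',m+1}\rangle\quad(z\in\operatorname{res}L),$$ $$[r(z)]_{\sigma\sigma'}:=-\sum_{j=1}^m\frac{[\mathcal G_{\mathrm A}]_{\sigma m,\sigma'j}}{(z-z_1)^{m-j+1}}\quad(z\in\mathbb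 C\setminus\{z_1\}).$$
   Context: Inner products are conjugate-linear in the first argument. Let $L$ be a lower semibounded self-adjoint operator in a Hilbert space $\mathfrak H_0$, and fix a real $z_1<\inf\sigma(L)$ (so $z_1\in\operatorname{res}L$, the resolvent set). Put $b_n(L):=(L-z_1)^n$, $n\in\mathbb Z$. The scale $\mathfrak H_{n+1}\subseteq\mathfrak H_n$ ($n\in\mathbb Z$) is: $\mathfrak H_n=\operatorname{dom}b_n(L)^{1/2}$ for $n\ge0$, and for $n<0$ the completion of $\mathfrak H_0$, with inner product $\langle f,g\rangle_n:=\langle b_n(L)^{1/2}f,b_n(L)^{1/2}g\rangle_0$; $\mathfrak H_2=\operatorname{dom}L$. The operators $b_l(L)^{1/2}$ are regarded as unitary maps $\mathfrak H_k\to\mathfrak H_{k-l}$ for all $k,l\in\mathbb Z$. $L$ acts on the whole scale, as the self-adjoint operator $L_n$ in $\mathfrak H_n$ with domain $\mathfrak H_{n+2}$, and $\operatorname{res}L_n=\operatorname{res}L$; the subscript is dropped. Fix $m,d\in\mathbb N=\{1,2,\dots\}$, an index set $\mathcal S$ with $d$ elements and $J:=\{1,\dots,m\}$. Let $\varphi_\sigma\in\mathfrak H_{-m-2}\setminus\mathfrak H_{-m-1}$, $\sigma\in\mathcal S$, be linearly independent functionals, in the sense that no nontrivial linear combination of them lies in $\mathfrak H_{-m-1}$. Duality pairing: $\langle\varphi_\sigma,f\rangle:=\langle b_{m+2}(L)^{-1/2}\varphi_\sigma,b_{m+2}(L)^{1/2}f\rangle_0$ for $f\in\mathfrak H_{m+2}$;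 $\langle\varphi,f\rangle:=(\langle\varphi_\sigma,f\rangle)_\sigma\in\mathbb C^d$. Put $g_\sigma(z):=(L-z)^{-1}\varphi_\sigma\in\mathfrak H_{-m}$, $h_{\sigma j}:=(L-z_1)^{-j}\varphi_\sigma$ ($j\ge1$), and $h_{m+1}(c):=\sum_\sigma c_\sigma h_{\sigma,m+1}\in\mathfrak H_m$ for $c\in\mathbb C^d$. $\mathfrak K_{\mathrm A}:=\operatorname{span}\{h_\alpha:\alpha=(\sigma,j)\in\mathcal S\times J\}$, of dimension $md$; for $k\in\mathfrak K_{\mathrm A}$ write $k=\sum_\alpha d_\alpha(k)h_\alpha$ and $d(k)=(d_\alpha(k))\in\mathbb C^{md}$. One has $\mathfrak K_{\mathrm A}\cap\mathfrak H_{m-1}=\{0\}$. For a Hermitian matrix $\mathcal G_{\mathrm A}=([\mathcal G_{\mathrm A}]_{\alpha\alpha'})\in\mathbb C^{md\times md}$, $\mathcal H_{\mathrm A}$ is the direct sum $\mathfrak H_m\dotplus\mathfrak K_{\mathrm A}$ with $[f+k,f'+k']_{\mathrm A}:=\langle f,f'\rangle_m+\langle d(k),\mathcal G_{\mathrm A}d(k')\rangle_{\mathbb C^{md}}$ (a Hilbert or Pontryagin space for invertible $\mathcal G_{\mathrm A}$). $\mathcal H'_{\mathrm A}$ is $\mathfrak H_m\oplus\mathbb C^{md}$ with $[(f,\xi),(f',\xi')]'_{\mathrm A}:=\langle f,f'\rangle_m+\langle\xi,\mathcal G_{\mathrm A}\xi'\rangle_{\mathbb C^{md}}$, and $U_{\mathrm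 A}:\mathcal H_{\mathrm A}\to\mathcal H'_{\mathrm A}$, $f+k\mapsto(f,d(k))$, is the corresponding unitary map. $\mathfrak M\in\mathbb C^{m\times m}$: $\mathfrak M_{jj'}:=\delta_{jj'}z_1+\delta_{j+1,j'}$ for $j\in J\setminus\{m\}$, $j'\in J$, and $\mathfrak M_{mj'}:=\delta_{j'm}z_1$ (for $m=1$, $\mathfrak M:=z_1$). $\mathfrak M_d:=\mathfrak M\oplus\cdots\oplus\mathfrak M$ ($d$ copies, indexed by $\sigma$). $\eta(c):=(\delta_{jm}c_\sigma)_{(\sigma,j)}\in\mathbb C^{md}$. The operator $A_{\max}$ in $\mathcal H_{\mathrm A}$: $\operatorname{dom}A_{\max}=\{f^\#+h_{m+1}(c)+k: f^\#\in\mathfrak H_{m+2},\ c\in\mathbb C^d,\ k\in\mathfrak K_{\mathrm A}\}$, $A_{\max}(f^\#+h_{m+1}(c)+k)=Lf^\#+z_1h_{m+1}(c)+\tilde k$, where $\tilde k\in\mathfrak K_{\mathrm A}$ has $d(\tilde k)=\mathfrak M_dd(k)+\eta(c)$. Boundary triples: for a densely defined closed symmetric operator $A$ in a Hilbert or Pontryagin space $(\mathfrak H,[\cdot,\cdot])$, $(\mathcal H,\Gamma_0,\Gamma_1)$ ($\mathcal H$ a Hilbert space, $\Gamma_i:\operatorname{dom}A^*\to\mathcal H$) is an ordinary boundary triple for $A^*$ if $(\Gamma_0,\Gamma_1):\operatorname{dom}A^*\to\mathcal H^2$ is surjective and $[f,A^*g]-[A^*f,g]=\langle\Gamma_0f,\Gamma_1g\rangle-\langle\Gamma_1f,\Gamma_0g\rangle$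 for all $f,g\in\operatorname{dom}A^*$. A proper extension $A'$ satisfies $A\subseteq A'\subseteq A^*$. With $A_0:=A^*|_{\ker\Gamma_0}$ and $\operatorname{res}A_0\neq\emptyset$, for $z\in\operatorname{res}A_0$ the $\gamma$-field is $\gamma(z):=(\Gamma_0|_{\ker(A^*-z)})^{-1}$ and the Weyl function is $M(z):=\Gamma_1\gamma(z)$. *)

theory Defs
  imports
    "HOL-Analysis.Analysis"
    "HOL-Library.Function_Algebras"
begin

section \<open>Complex vector spaces\<close>

class complex_vector = ab_group_add +
  fixes scaleC :: "complex \<Rightarrow> 'a \<Rightarrow> 'a"  (infixr "*\<^sub>C" 75)
  assumes scaleC_add_right: "a *\<^sub>C (x + y) = a *\<^sub>C x + a *\<^sub>C y"
    and scaleC_add_left: "(a + b) *\<^sub>C x = a *\<^sub>C x + b *\<^sub>C x"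
    and scaleC_scaleC: "a *\<^sub>C b *\<^sub>C x = (a * b) *\<^sub>C x"
    and scaleC_one: "1 *\<^sub>C x = x"

global_interpretation complex_vector: vector_space "scaleC :: complex \<Rightarrow> 'a \<Rightarrow> 'a::complex_vector"
  by unfold_locales
    (rule scaleC_add_right scaleC_add_left scaleC_scaleC scaleC_one)+

instantiation complex :: complex_vector
begin
definition scaleC_complex :: "complex \<Rightarrow> complex \<Rightarrow> complex" where
  "scaleC_complex a x = a * x"
instance by standard (auto simp: scaleC_complex_def algebra_simps)
end

instantiation "fun" :: (type, complex_vector) complex_vector
begin
definition scaleC_fun :: "complex \<Rightarrow> ('a \<Rightarrow> 'b) \<Rightarrow> 'a \<Rightarrow> 'b" where
  "scaleC_fun a f = (\<lambda>i. a *\<^sub>C f i)"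
instance
  by standard
    (auto simp: scaleC_fun_def fun_eq_iff scaleC_add_right scaleC_add_left scaleC_scaleC scaleC_one)
end

instantiation prod :: (complex_vector, complex_vector) complex_vector
begin
definition scaleC_prod :: "complex \<Rightarrow> 'a \<times> 'b \<Rightarrow> 'a \<times> 'b" where
  "scaleC_prod a p = (a *\<^sub>C fst p, a *\<^sub>C snd p)"
instance
  by standard
    (auto simp: scaleC_prod_def prod_eq_iff scaleC_add_right scaleC_add_left scaleC_scaleC scaleC_one)
end


section \<open>Hilbert and Pontryagin spaces\<close>

text \<open>
  A space is a subspace \<open>car X\<close> of an ambient complex vector space with a (possibly indefinite)
  inner product \<open>ip X\<close>, conjugate-linear in the first argument. The values of \<open>ip X\<close> outside
  \<open>car X\<close> are irrelevant.
\<close>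

record 'v ipspace =
  car :: "'v set"
  ip :: "'v \<Rightarrow> 'v \<Rightarrow> complex"

definition inner_space :: "'v::complex_vector ipspace \<Rightarrow> bool" where
  "inner_space X \<longleftrightarrow> complex_vector.subspace (car X) \<and>
    (\<forall>x\<in>car X. \<forall>y\<in>car X. ip X y x = cnj (ip X x y)) \<and>
    (\<forall>x\<in>car X. \<forall>y\<in>car X. \<forall>z\<in>car X. ip X x (y + z) = ip X x y + ip X x z) \<and>
    (\<forall>x\<in>car X. \<forall>y\<in>car X. \<forall>a. ip X x (a *\<^sub>C y) = a * ip X x y)"

definition ipnorm :: "'v::complex_vector ipspace \<Rightarrow> 'v \<Rightarrow> real" where
  "ipnorm X x = sqrt (Re (ip X x x))"

definition hilbert_space :: "'v::complex_vector ipspace \<Rightarrow> bool" where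
  "hilbert_space X \<longleftrightarrow> inner_space X \<and> (\<forall>x\<in>car X. x \<noteq> 0 \<longrightarrow> 0 < Re (ip X x x)) \<and>
    (\<forall>u. (\<forall>i. u i \<in> car X) \<and> (\<forall>e>0. \<exists>N::nat. \<forall>i\<ge>N. \<forall>j\<ge>N. ipnorm X (u i - u j) < e) \<longrightarrow>
      (\<exists>x\<in>car X. (\<lambda>i. ipnorm X (u i - x)) \<longlonglongrightarrow> 0))"

definition fundamental_decomposition ::
    "'v::complex_vector ipspace \<Rightarrow> 'v set \<Rightarrow> 'v set \<Rightarrow> bool" where
  "fundamental_decomposition X P N \<longleftrightarrow>
    P \<subseteq> car X \<and> N \<subseteq> car X \<and>
    (\<forall>x\<in>car X. \<exists>p\<in>P. \<exists>n\<in>N. x = p + n) \<and>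
    (\<forall>p\<in>P. \<forall>n\<in>N. ip X p n = 0) \<and>
    hilbert_space \<lparr>car = P, ip = ip X\<rparr> \<and>
    hilbert_space \<lparr>car = N, ip = (\<lambda>x y. - ip X x y)\<rparr> \<and>
    (\<exists>B. finite B \<and> N = complex_vector.span B)"

text \<open>Hilbert spaces are the Pontryagin spaces with a decomposition whose negative part is zero.\<close>

definition pontryagin_space :: "'v::complex_vector ipspace \<Rightarrow> bool" where
  "pontryagin_space X \<longleftrightarrow> inner_space X \<and> (\<exists>P N. fundamental_decomposition X P N)"

text \<open>
  Norm convergence. The norm is the one belonging to a fundamental decomposition, for \<open>p \<in> P\<close> and
  \<open>n \<in> N\<close> the square root of \<open>ip X p p - ip X n n\<close>; all fundamental decompositions give equivalent
  norms. In a Hilbert space \<open>N = {0}\<close>, and this is convergence in \<open>ipnorm X\<close>.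
\<close>

definition ip_converges :: "'v::complex_vector ipspace \<Rightarrow> (nat \<Rightarrow> 'v) \<Rightarrow> 'v \<Rightarrow> bool" where
  "ip_converges X u x \<longleftrightarrow> (\<forall>i. u i \<in> car X) \<and> x \<in> car X \<and>
    (\<exists>P N p n. fundamental_decomposition X P N \<and>
      (\<forall>i. p i \<in> P \<and> n i \<in> N \<and> u i - x = p i + n i) \<and>
      (\<lambda>i. sqrt (Re (ip X (p i) (p i)) - Re (ip X (n i) (n i)))) \<longlonglongrightarrow> 0)"

definition dense_subset :: "'v::complex_vector ipspace \<Rightarrow> 'v set \<Rightarrow> bool" where
  "dense_subset X D \<longleftrightarrow> D \<subseteq> car X \<and> (\<forall>x\<in>car X. \<exists>u. (\<forall>i. u i \<in> D) \<and> ip_converges X u x)"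


section \<open>Linear relations and operators\<close>

text \<open>
  Operators are identified with their graphs, so that (restrictions of) operators, inverses and
  linear relations are all sets of pairs. In \<open>R O S\<close> the relation \<open>R\<close> is applied first.
\<close>

definition linear_relation ::
    "'v::complex_vector ipspace \<Rightarrow> 'w::complex_vector ipspace \<Rightarrow> ('v \<times> 'w) set \<Rightarrow> bool" where
  "linear_relation X Y A \<longleftrightarrow> A \<subseteq> car X \<times> car Y \<and> complex_vector.subspace A"

definition linear_operator ::
    "'v::complex_vector ipspace \<Rightarrow> 'w::complex_vector ipspace \<Rightarrow> ('v \<times> 'w) set \<Rightarrow> bool" where
  "linear_operator X Y A \<longleftrightarrow> linear_relation X Y A \<and> single_valued A"

definition rel_app :: "('v \<times> 'w) set \<Rightarrow> 'v \<Rightarrow> 'w" where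
  "rel_app A x = (THE y. (x, y) \<in> A)"

definition densely_defined :: "'v::complex_vector ipspace \<Rightarrow> 'v rel \<Rightarrow> bool" where
  "densely_defined X A \<longleftrightarrow> dense_subset X (Domain A)"

definition closed_relation ::
    "'v::complex_vector ipspace \<Rightarrow> 'w::complex_vector ipspace \<Rightarrow> ('v \<times> 'w) set \<Rightarrow> bool" where
  "closed_relation X Y A \<longleftrightarrow>
    (\<forall>u v x y. (\<forall>i. (u i, v i) \<in> A) \<and> ip_converges X u x \<and> ip_converges Y v y \<longrightarrow> (x, y) \<in> A)"

definition adjoint_relation ::
    "'v ipspace \<Rightarrow> 'w ipspace \<Rightarrow> ('v \<times> 'w) set \<Rightarrow> ('w \<times> 'v) set" where
  "adjoint_relation X Y A =
    {(y, x). y \<in> car Y \<and> x \<in> car X \<and> (\<forall>(u, v)\<in>A. ip Y v y = ip X u x)}"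

definition symmetric_operator :: "'v::complex_vector ipspace \<Rightarrow> 'v rel \<Rightarrow> bool" where
  "symmetric_operator X A \<longleftrightarrow> linear_operator X X A \<and> A \<subseteq> adjoint_relation X X A"

definition selfadjoint_operator :: "'v::complex_vector ipspace \<Rightarrow> 'v rel \<Rightarrow> bool" where
  "selfadjoint_operator X A \<longleftrightarrow>
    linear_operator X X A \<and> densely_defined X A \<and> adjoint_relation X X A = A"

definition rel_shift :: "'v::complex_vector rel \<Rightarrow> complex \<Rightarrow> 'v rel" where
  "rel_shift A z = {(x, y - z *\<^sub>C x) | x y. (x, y) \<in> A}"

definition resolvent :: "'v::complex_vector rel \<Rightarrow> complex \<Rightarrow> 'v rel" where
  "resolvent A z = (rel_shift A z)\<inverse>"

definition bounded_everywhere_defined ::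
    "'v::complex_vector ipspace \<Rightarrow> 'w::complex_vector ipspace \<Rightarrow> ('v \<times> 'w) set \<Rightarrow> bool" where
  "bounded_everywhere_defined X Y T \<longleftrightarrow> linear_operator X Y T \<and> Domain T = car X \<and>
    (\<forall>u v. (\<forall>i. (u i, v i) \<in> T) \<and> ip_converges X u 0 \<longrightarrow> ip_converges Y v 0)"

definition resolvent_set :: "'v::complex_vector ipspace \<Rightarrow> 'v rel \<Rightarrow> complex set" where
  "resolvent_set X A = {z. bounded_everywhere_defined X X (resolvent A z)}"

definition spectrum_set :: "'v::complex_vector ipspace \<Rightarrow> 'v rel \<Rightarrow> complex set" where
  "spectrum_set X A = - resolvent_set X A"

definition lower_semibounded :: "'v::complex_vector ipspace \<Rightarrow> 'v rel \<Rightarrow> bool" where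
  "lower_semibounded X A \<longleftrightarrow> (\<exists>a. \<forall>(x, y)\<in>A. a * (ipnorm X x)\<^sup>2 \<le> Re (ip X x y))"

definition nonneg_operator :: "'v ipspace \<Rightarrow> 'v rel \<Rightarrow> bool" where
  "nonneg_operator X A \<longleftrightarrow> (\<forall>(x, y)\<in>A. 0 \<le> Re (ip X x y))"

text \<open>The unique nonnegative self-adjoint square root of a nonnegative self-adjoint operator.\<close>

definition sqrt_operator :: "'v::complex_vector ipspace \<Rightarrow> 'v rel \<Rightarrow> 'v rel" where
  "sqrt_operator X T = (THE Q. selfadjoint_operator X Q \<and> nonneg_operator X Q \<and> Q O Q = T)"

definition int_power :: "'v ipspace \<Rightarrow> 'v rel \<Rightarrow> int \<Rightarrow> 'v rel" where
  "int_power X T n =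
    (if n = 0 then Id_on (car X) else if 0 < n then T ^^ nat n else (T ^^ nat (- n))\<inverse>)"

definition rel_plus :: "('v \<times> 'w::plus) set \<Rightarrow> ('v \<times> 'w) set \<Rightarrow> ('v \<times> 'w) set" where
  "rel_plus A B = {(x, y + y') | x y y'. (x, y) \<in> A \<and> (x, y') \<in> B}"

definition rel_minus :: "('v \<times> 'w::minus) set \<Rightarrow> ('v \<times> 'w) set \<Rightarrow> ('v \<times> 'w) set" where
  "rel_minus A B = {(x, y - y') | x y y'. (x, y) \<in> A \<and> (x, y') \<in> B}"

definition rel_dsum :: "'v rel \<Rightarrow> 'w rel \<Rightarrow> ('v \<times> 'w) rel" where
  "rel_dsum A B = {((x, u), (y, v)) | x y u v. (x, y) \<in> A \<and> (u, v) \<in> B}"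

text \<open>Extension by continuity (closure in \<open>X \<times> Y\<close>) of a densely given operator.\<close>

definition continuous_extension ::
    "'v::complex_vector ipspace \<Rightarrow> 'w::complex_vector ipspace \<Rightarrow> ('v \<times> 'w) set \<Rightarrow> ('v \<times> 'w) set" where
  "continuous_extension X Y T =
    {(x, y). \<exists>u v. (\<forall>i. (u i, v i) \<in> T) \<and> ip_converges X u x \<and> ip_converges Y v y}"


section \<open>Boundary triples\<close>

definition boundary_triple ::
    "'v::complex_vector ipspace \<Rightarrow> 'v rel \<Rightarrow> 'w::complex_vector ipspace \<Rightarrow> ('v \<Rightarrow> 'w) \<Rightarrow> ('v \<Rightarrow> 'w) \<Rightarrow> bool" where
  "boundary_triple X A Y \<Gamma>0 \<Gamma>1 \<longleftrightarrow>
    pontryagin_space X \<and> hilbert_space Y \<and>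
    densely_defined X A \<and> closed_relation X X A \<and> symmetric_operator X A \<and>
    (\<lambda>x. (\<Gamma>0 x, \<Gamma>1 x)) ` Domain (adjoint_relation X X A) = car Y \<times> car Y \<and>
    (\<forall>(f, f')\<in>adjoint_relation X X A. \<forall>(g, g')\<in>adjoint_relation X X A.
      ip X f g' - ip X f' g = ip Y (\<Gamma>0 f) (\<Gamma>1 g) - ip Y (\<Gamma>1 f) (\<Gamma>0 g))"

definition gamma_field :: "'v::complex_vector rel \<Rightarrow> ('v \<Rightarrow> 'w) \<Rightarrow> complex \<Rightarrow> ('w \<times> 'v) set" where
  "gamma_field Aadj \<Gamma>0 z = {(\<Gamma>0 x, x) | x. (x, z *\<^sub>C x) \<in> Aadj}"

definition weyl_function ::
    "'v::complex_vector rel \<Rightarrow> ('v \<Rightarrow> 'w) \<Rightarrow> ('v \<Rightarrow> 'w) \<Rightarrow> complex \<Rightarrow> 'w rel" where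
  "weyl_function Aadj \<Gamma>0 \<Gamma>1 z = {(c, \<Gamma>1 x) | c x. (c, x) \<in> gamma_field Aadj \<Gamma>0 z}"


section \<open>Coordinate spaces and matrices over a finite index set\<close>

definition coord_space :: "'i set \<Rightarrow> ('i \<Rightarrow> complex) ipspace" where
  "coord_space I = \<lparr>car = {x. \<forall>i. i \<notin> I \<longrightarrow> x i = 0}, ip = (\<lambda>x y. \<Sum>i\<in>I. cnj (x i) * y i)\<rparr>"

definition mat_app :: "'i set \<Rightarrow> ('i \<Rightarrow> 'i \<Rightarrow> complex) \<Rightarrow> ('i \<Rightarrow> complex) \<Rightarrow> 'i \<Rightarrow> complex" where
  "mat_app I A x = (\<lambda>i. if i \<in> I then \<Sum>j\<in>I. A i j * x j else 0)"

definition mat_rel :: "'i set \<Rightarrow> ('i \<Rightarrow> 'i \<Rightarrow> complex) \<Rightarrow> ('i \<Rightarrow> complex) rel" where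
  "mat_rel I A = {(x, mat_app I A x) | x. x \<in> car (coord_space I)}"

definition mat_prod ::
    "'i set \<Rightarrow> ('i \<Rightarrow> 'i \<Rightarrow> complex) \<Rightarrow> ('i \<Rightarrow> 'i \<Rightarrow> complex) \<Rightarrow> 'i \<Rightarrow> 'i \<Rightarrow> complex" where
  "mat_prod I A B = (\<lambda>i k. \<Sum>j\<in>I. A i j * B j k)"

definition mat_adjoint :: "('i \<Rightarrow> 'i \<Rightarrow> complex) \<Rightarrow> 'i \<Rightarrow> 'i \<Rightarrow> complex" where
  "mat_adjoint A = (\<lambda>i j. cnj (A j i))"

definition mat_eq_on :: "'i set \<Rightarrow> ('i \<Rightarrow> 'i \<Rightarrow> complex) \<Rightarrow> ('i \<Rightarrow> 'i \<Rightarrow> complex) \<Rightarrow> bool" where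
  "mat_eq_on I A B \<longleftrightarrow> (\<forall>i\<in>I. \<forall>j\<in>I. A i j = B i j)"

definition mat_invertible :: "'i set \<Rightarrow> ('i \<Rightarrow> 'i \<Rightarrow> complex) \<Rightarrow> bool" where
  "mat_invertible I A \<longleftrightarrow> (\<exists>B. mat_eq_on I (mat_prod I A B) (\<lambda>i j. if i = j then 1 else 0) \<and>
                               mat_eq_on I (mat_prod I B A) (\<lambda>i j. if i = j then 1 else 0))"


section \<open>The scale of Hilbert spaces of a self-adjoint operator\<close>

definition b_half :: "'v::complex_vector ipspace \<Rightarrow> 'v rel \<Rightarrow> real \<Rightarrow> int \<Rightarrow> 'v rel" where
  "b_half X L z1 n = sqrt_operator X (int_power X (rel_shift L (of_real z1)) n)"

text \<open>
  All spaces \<open>H n\<close> are realized as subspaces of one ambient vector space. For \<open>n < 0\<close> the space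
  \<open>H n\<close> is a completion of \<open>H 0\<close> (complete, with \<open>H 0\<close> as a dense subspace); continuity of the
  inclusions makes the realizations of the completions for different \<open>n\<close> compatible.
\<close>

definition hilbert_scale ::
    "(int \<Rightarrow> 'v::complex_vector ipspace) \<Rightarrow> 'v rel \<Rightarrow> real \<Rightarrow> bool" where
  "hilbert_scale H L z1 \<longleftrightarrow>
    (\<forall>n. hilbert_space (H n)) \<and>
    selfadjoint_operator (H 0) L \<and>
    lower_semibounded (H 0) L \<and>
    ereal z1 < (INF z\<in>spectrum_set (H 0) L. ereal (Re z)) \<and>
    (\<forall>n\<ge>0. car (H n) = Domain (b_half (H 0) L z1 n)) \<and>
    (\<forall>n<0. dense_subset (H n) (car (H 0))) \<and>
    (\<forall>n. \<forall>f\<in>car (H 0) \<inter> car (H n). \<forall>g\<in>car (H 0) \<inter> car (H n).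
      ip (H n) f g =
        ip (H 0) (rel_app (b_half (H 0) L z1 n) f) (rel_app (b_half (H 0) L z1 n) g)) \<and>
    (\<forall>n. car (H (n + 1)) \<subseteq> car (H n) \<and>
      (\<forall>u x. ip_converges (H (n + 1)) u x \<longrightarrow> ip_converges (H n) u x))"

text \<open>
  \<open>scale_op H L n\<close> is \<open>L\<close> as an operator in \<open>H n\<close> with domain \<open>H (n + 2)\<close>;
  \<open>scale_b_half H L z1 l k\<close> is the \<open>l\<close>-th half power \<open>(L - z1) powr (l/2)\<close> as a unitary map from
  \<open>H k\<close> onto \<open>H (k - l)\<close>.
\<close>

definition scale_op ::
    "(int \<Rightarrow> 'v::complex_vector ipspace) \<Rightarrow> 'v rel \<Rightarrow> int \<Rightarrow> 'v rel" where
  "scale_op H L n = continuous_extension (H (n + 2)) (H n) L"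

definition scale_b_half ::
    "(int \<Rightarrow> 'v::complex_vector ipspace) \<Rightarrow> 'v rel \<Rightarrow> real \<Rightarrow> int \<Rightarrow> int \<Rightarrow> 'v rel" where
  "scale_b_half H L z1 l k = continuous_extension (H k) (H (k - l)) (b_half (H 0) L z1 l)"


section \<open>The A-model\<close>

text \<open>
  The functionals are indexed by the finite set \<open>S\<close>; the locale makes no assumptions on
  its parameters. The definite descriptions below denote the components of decompositions that are
  unique because \<open>K_A\<close> meets \<open>H (m - 1)\<close> only in 0 and the \<open>h_vec \<alpha>\<close> are linearly independent.
\<close>

locale A_model =
  fixes H :: "int \<Rightarrow> 'v::complex_vector ipspace"
    and L :: "'v rel"
    and z1 :: real
    and m :: nat
    and S :: "'s set"
    and \<phi> :: "'s \<Rightarrow> 'v"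
    and \<G> :: "('s \<times> nat) \<Rightarrow> ('s \<times> nat) \<Rightarrow> complex"
begin

abbreviation SJ :: "('s \<times> nat) set" where
  "SJ \<equiv> S \<times> {1..m}"

definition pairing :: "'s \<Rightarrow> 'v \<Rightarrow> complex" where
  "pairing \<sigma> f =
    ip (H 0) (rel_app (scale_b_half H L z1 (- int m - 2) (- int m - 2)) (\<phi> \<sigma>))
             (rel_app (scale_b_half H L z1 (int m + 2) (int m + 2)) f)"

definition pairing_vec :: "'v \<Rightarrow> 's \<Rightarrow> complex" where
  "pairing_vec f = (\<lambda>\<sigma>. if \<sigma> \<in> S then pairing \<sigma> f else 0)"

definition g_vec :: "'s \<Rightarrow> complex \<Rightarrow> 'v" where
  "g_vec \<sigma> z = rel_app (resolvent (scale_op H L (- int m - 2)) z) (\<phi> \<sigma>)"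

definition h_vec :: "'s \<times> nat \<Rightarrow> 'v" where
  "h_vec = (\<lambda>(\<sigma>, j). rel_app (resolvent (scale_op H L (- int m - 2)) (of_real z1) ^^ j) (\<phi> \<sigma>))"

definition h_top :: "('s \<Rightarrow> complex) \<Rightarrow> 'v" where
  "h_top c = (\<Sum>\<sigma>\<in>S. c \<sigma> *\<^sub>C h_vec (\<sigma>, m + 1))"

definition K_A :: "'v set" where
  "K_A = complex_vector.span (h_vec ` SJ)"

definition d_coord :: "'v \<Rightarrow> 's \<times> nat \<Rightarrow> complex" where
  "d_coord k = (THE \<xi>. \<xi> \<in> car (coord_space SJ) \<and> k = (\<Sum>\<alpha>\<in>SJ. \<xi> \<alpha> *\<^sub>C h_vec \<alpha>))"

definition decomp_HA :: "'v \<Rightarrow> 'v \<times> 'v" where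
  "decomp_HA x = (THE (f, k). f \<in> car (H (int m)) \<and> k \<in> K_A \<and> x = f + k)"

definition form_A :: "'v \<times> ('s \<times> nat \<Rightarrow> complex) \<Rightarrow> 'v \<times> ('s \<times> nat \<Rightarrow> complex) \<Rightarrow> complex" where
  "form_A = (\<lambda>(f, \<xi>) (f', \<xi>'). ip (H (int m)) f f' + ip (coord_space SJ) \<xi> (mat_app SJ \<G> \<xi>'))"

definition HA :: "'v ipspace" where
  "HA = \<lparr>car = {f + k | f k. f \<in> car (H (int m)) \<and> k \<in> K_A},
         ip = (\<lambda>x x'. let (f, k) = decomp_HA x; (f', k') = decomp_HA x'
                      in form_A (f, d_coord k) (f', d_coord k'))\<rparr>"

definition HA' :: "('v \<times> ('s \<times> nat \<Rightarrow> complex)) ipspace" where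
  "HA' = \<lparr>car = car (H (int m)) \<times> car (coord_space SJ), ip = form_A\<rparr>"

definition U_A :: "('v \<times> ('v \<times> ('s \<times> nat \<Rightarrow> complex))) set" where
  "U_A = {(f + k, (f, d_coord k)) | f k. f \<in> car (H (int m)) \<and> k \<in> K_A}"

definition M_mat :: "nat \<Rightarrow> nat \<Rightarrow> complex" where
  "M_mat j j' =
    (if j = m then (if j' = m then of_real z1 else 0)
     else (if j = j' then of_real z1 else 0) + (if j + 1 = j' then 1 else 0))"

definition M_d :: "('s \<times> nat) \<Rightarrow> ('s \<times> nat) \<Rightarrow> complex" where
  "M_d = (\<lambda>(\<sigma>, j) (\<sigma>', j'). if \<sigma> = \<sigma>' then M_mat j j' else 0)"

definition eta :: "('s \<Rightarrow> complex) \<Rightarrow> 's \<times> nat \<Rightarrow> complex" where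
  "eta c = (\<lambda>(\<sigma>, j). if j = m then c \<sigma> else 0)"

definition A_max :: "'v rel" where
  "A_max = {(f + h_top c + k, rel_app (scale_op H L (int m)) f + of_real z1 *\<^sub>C h_top c + k') | f c k k'.
      f \<in> car (H (int m + 2)) \<and> c \<in> car (coord_space S) \<and> k \<in> K_A \<and> k' \<in> K_A \<and>
      d_coord k' = mat_app SJ M_d (d_coord k) + eta c}"

definition decomp_Amax :: "'v \<Rightarrow> 'v \<times> ('s \<Rightarrow> complex) \<times> 'v" where
  "decomp_Amax x = (THE (f, c, k).
      f \<in> car (H (int m + 2)) \<and> c \<in> car (coord_space S) \<and> k \<in> K_A \<and> x = f + h_top c + k)"

text \<open>\<open>block_m \<xi>\<close> is the vector of the components of \<open>\<xi>\<close> with indices \<open>(\<sigma>, m)\<close>.\<close>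

definition block_m :: "('s \<times> nat \<Rightarrow> complex) \<Rightarrow> 's \<Rightarrow> complex" where
  "block_m \<xi> = (\<lambda>\<sigma>. \<xi> (\<sigma>, m))"

definition Gamma0 :: "'v \<Rightarrow> 's \<Rightarrow> complex" where
  "Gamma0 x = (let (f, c, k) = decomp_Amax x in c)"

definition Gamma1 :: "'v \<Rightarrow> 's \<Rightarrow> complex" where
  "Gamma1 x = (let (f, c, k) = decomp_Amax x
               in pairing_vec f - block_m (mat_app SJ \<G> (d_coord k)))"

definition A_min :: "'v rel" where
  "A_min = {(x, y) \<in> A_max. Gamma0 x = 0 \<and> Gamma1 x = 0}"

definition A_ext :: "(('s \<Rightarrow> complex) rel) \<Rightarrow> 'v rel" where
  "A_ext \<Theta> = {(x, y) \<in> A_max. (Gamma0 x, Gamma1 x) \<in> \<Theta>}"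

definition F_vec :: "'s \<Rightarrow> complex \<Rightarrow> 'v" where
  "F_vec \<sigma> z = (1 / (z - of_real z1) ^ m) *\<^sub>C g_vec \<sigma> z"

definition q_mat :: "complex \<Rightarrow> 's \<Rightarrow> 's \<Rightarrow> complex" where
  "q_mat z \<sigma> \<sigma>' = (z - of_real z1) *
      pairing \<sigma> (rel_app (resolvent (scale_op H L (int m)) z) (h_vec (\<sigma>', m + 1)))"

definition r_mat :: "complex \<Rightarrow> 's \<Rightarrow> 's \<Rightarrow> complex" where
  "r_mat z \<sigma> \<sigma>' = - (\<Sum>j\<in>{1..m}. \<G> (\<sigma>, m) (\<sigma>', j) / (z - of_real z1) ^ (m - j + 1))"

end

end

theory Submission
  imports Defs "HOL-Computational_Algebra.Polynomial"
begin

text \<open>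
  Everything is transported to \<open>H 0\<close> by unitary maps \<open>V n\<close> from \<open>H n\<close> onto \<open>H 0\<close>, the powers
  \<open>(L - z\<^sub>1)\<^bsup>n/2\<^esup>\<close>. These exist because \<open>R = (L - z\<^sub>1)\<inverse>\<close> is bounded and nonnegative and hence has a
  square root. Writing \<open>f = R s\<close> in \<open>H (m + 2)\<close> removes all domain conditions: with
  \<open>a \<sigma> = V (- m - 2) (\<phi> \<sigma>)\<close>, the operator \<open>A_max\<close> becomes
  \<open>(R s + \<Sum>c \<sigma> a \<sigma>, \<xi>) \<mapsto> (s + z\<^sub>1 (R s + \<Sum>c \<sigma> a \<sigma>), M \<xi> + \<eta> c)\<close> in \<open>H 0 \<oplus> C\<^bsup>md\<^esup>\<close>, and
  \<open>\<Gamma>\<^sub>0 = c\<close>, \<open>\<Gamma>\<^sub>1 = (\<langle>a \<sigma>, s\<rangle>) - [G \<xi>]\<^sub>m\<close>. Green's identity is then a direct computation; the adjoint of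
  \<open>A_min\<close> is found by testing first with \<open>s = 0\<close> and then using the self-adjointness of \<open>L\<close>; and for
  \<open>c = 0\<close> one is left with the orthogonal sum of \<open>L\<close> and \<open>M\<close>. Krein's formula and the Weyl function
  follow by solving the resulting equations.
\<close>

section \<open>Inner product spaces on a carrier\<close>

text \<open>The scale is given only through \<open>b_half\<close>, a definite description of roots
  of powers of the unbounded operator \<open>L - z1\<close>, so these roots must be computed first.
  The negative powers are bounded; their roots come from a power series, and uniqueness passes to
  the positive powers by taking converses of graphs. After that only \<open>R\<close>, the vectors
  \<open>a \<sigma>\<close> and the matrix \<open>\<G>\<close> matter. Independence of the
  functionals modulo \<open>H (- m - 1)\<close> implies that no nontrivial combination of the
  \<open>a \<sigma>\<close> lies in the range of \<open>R\<close>, and this one fact makes every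
  decomposition unique. The term with \<open>\<G>\<close> in \<open>\<Gamma>1\<close> is forced:
  \<open>M\<close> is symmetric for the form of \<open>\<G>\<close>, so the finite-dimensional part
  of Green's identity stems from \<open>\<eta>\<close> alone, whose adjoint picks the components
  \<open>(\<sigma>, m)\<close>. A further obstacle is that convergence in a possibly indefinite
  space refers to some fundamental decomposition; it is replaced by convergence of inner products,
  which mentions none.\<close>

locale inner_prod =
  fixes X :: "'v::complex_vector ipspace"
  assumes inner_prod: "inner_space X"
begin

lemma subspace: "complex_vector.subspace (car X)"
  using inner_prod unfolding inner_space_def by blast

lemma zero_mem [simp]: "0 \<in> car X"
  using subspace by (rule complex_vector.subspace_0)

lemma add_mem [simp]: "x \<in> car X \<Longrightarrow> y \<in> car X \<Longrightarrow> x + y \<in> car X"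
  using subspace by (rule complex_vector.subspace_add)

lemma scale_mem [simp]: "x \<in> car X \<Longrightarrow> a *\<^sub>C x \<in> car X"
  using subspace by (rule complex_vector.subspace_scale)

lemma diff_mem [simp]: "x \<in> car X \<Longrightarrow> y \<in> car X \<Longrightarrow> x - y \<in> car X"
  using subspace by (rule complex_vector.subspace_diff)

lemma neg_mem [simp]: "x \<in> car X \<Longrightarrow> - x \<in> car X"
  using subspace by (rule complex_vector.subspace_neg)

lemma sum_mem [simp]: "(\<And>i. i \<in> A \<Longrightarrow> f i \<in> car X) \<Longrightarrow> sum f A \<in> car X"
  using subspace by (rule complex_vector.subspace_sum)

lemma ip_cnj: "x \<in> car X \<Longrightarrow> y \<in> car X \<Longrightarrow> ip X y x = cnj (ip X x y)"
  using inner_prod unfolding inner_space_def by blast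

lemma ip_add_right: "x \<in> car X \<Longrightarrow> y \<in> car X \<Longrightarrow> z \<in> car X \<Longrightarrow> ip X x (y + z) = ip X x y + ip X x z"
  using inner_prod unfolding inner_space_def by blast

lemma ip_scale_right: "x \<in> car X \<Longrightarrow> y \<in> car X \<Longrightarrow> ip X x (a *\<^sub>C y) = a * ip X x y"
  using inner_prod unfolding inner_space_def by blast

lemma ip_add_left: "x \<in> car X \<Longrightarrow> y \<in> car X \<Longrightarrow> z \<in> car X \<Longrightarrow> ip X (x + y) z = ip X x z + ip X y z"
  using ip_cnj[of z "x + y"] ip_cnj[of z x] ip_cnj[of z y] by (simp add: ip_add_right)

lemma ip_scale_left: "x \<in> car X \<Longrightarrow> y \<in> car X \<Longrightarrow> ip X (a *\<^sub>C x) y = cnj a * ip X x y"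
  using ip_cnj[of y "a *\<^sub>C x"] ip_cnj[of y x] by (simp add: ip_scale_right)

lemma ip_zero_right [simp]: "x \<in> car X \<Longrightarrow> ip X x 0 = 0"
  using ip_add_right[of x 0 0] by simp

lemma ip_zero_left [simp]: "x \<in> car X \<Longrightarrow> ip X 0 x = 0"
  using ip_add_left[of 0 0 x] by simp

lemma ip_diff_right: "x \<in> car X \<Longrightarrow> y \<in> car X \<Longrightarrow> z \<in> car X \<Longrightarrow> ip X x (y - z) = ip X x y - ip X x z"
  using ip_add_right[of x "y - z" z] by simp

lemma ip_diff_left: "x \<in> car X \<Longrightarrow> y \<in> car X \<Longrightarrow> z \<in> car X \<Longrightarrow> ip X (x - y) z = ip X x z - ip X y z"
  using ip_add_left[of "x - y" y z] by simp

lemma ip_neg_right: "x \<in> car X \<Longrightarrow> y \<in> car X \<Longrightarrow> ip X x (- y) = - ip X x y"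
  using ip_diff_right[of x 0 y] by simp

lemma ip_neg_left: "x \<in> car X \<Longrightarrow> y \<in> car X \<Longrightarrow> ip X (- x) y = - ip X x y"
  using ip_diff_left[of 0 x y] by simp

lemma ip_sum_right: "x \<in> car X \<Longrightarrow> (\<And>i. i \<in> A \<Longrightarrow> f i \<in> car X) \<Longrightarrow> ip X x (sum f A) = (\<Sum>i\<in>A. ip X x (f i))"
  by (induction A rule: infinite_finite_induct) (auto simp: ip_add_right)

lemma ip_sum_left: "x \<in> car X \<Longrightarrow> (\<And>i. i \<in> A \<Longrightarrow> f i \<in> car X) \<Longrightarrow> ip X (sum f A) x = (\<Sum>i\<in>A. ip X (f i) x)"
  by (induction A rule: infinite_finite_induct) (auto simp: ip_add_left)

lemmas ip_linear = ip_add_left ip_add_right ip_diff_left ip_diff_right ip_scale_left ip_scale_right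
  ip_neg_left ip_neg_right

lemma ip_self_Im [simp]: "x \<in> car X \<Longrightarrow> Im (ip X x x) = 0"
  using ip_cnj[of x x] by (metis cnj.simps(2) equal_neg_zero)

lemma ip_self: "x \<in> car X \<Longrightarrow> ip X x x = of_real (Re (ip X x x))"
  by (simp add: complex_eq_iff)

text \<open>The form may be degenerate: this is applied to \<open>\<langle>x, B y\<rangle>\<close> with \<open>B\<close> a nonnegative operator.\<close>

lemma Cauchy_Schwarz_semidefinite:
  assumes pos: "\<And>x. x \<in> car X \<Longrightarrow> 0 \<le> Re (ip X x x)" and x: "x \<in> car X" and y: "y \<in> car X"
  shows "(cmod (ip X x y))\<^sup>2 \<le> Re (ip X x x) * Re (ip X y y)"
proof -
  define w where "w = ip X x y"
  define a where "a = Re (ip X x x)"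
  define b where "b = Re (ip X y y)"
  have yx: "ip X y x = cnj w" using ip_cnj[OF x y] by (simp add: w_def)
  \<comment> \<open>The factor \<open>cnj w\<close> in \<open>v\<close> absorbs the phase of
    \<open>ip X x y\<close>, so a quadratic in the real variable \<open>t\<close> remains; for
    \<open>b > 0\<close> its minimum is at \<open>t = 1 / b\<close>.\<close>
  have key: "0 \<le> a - 2 * t * (cmod w)\<^sup>2 + t\<^sup>2 * (cmod w)\<^sup>2 * b" for t :: real
  proof -
    define v where "v = x - (of_real t * cnj w) *\<^sub>C y"
    have "ip X v v = ip X x x - of_real t * cnj w * w - of_real t * w * cnj w
        + of_real t * w * of_real t * cnj w * ip X y y"
      using x y by (simp add: v_def ip_linear yx w_def[symmetric] algebra_simps)
    also have "\<dots> = of_real (a - 2 * t * (cmod w)\<^sup>2 + t\<^sup>2 * (cmod w)\<^sup>2 * b)"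
      using ip_self[OF x] ip_self[OF y] complex_norm_square[of w]
      by (simp add: a_def b_def algebra_simps power2_eq_square)
    finally have "Re (ip X v v) = a - 2 * t * (cmod w)\<^sup>2 + t\<^sup>2 * (cmod w)\<^sup>2 * b" by simp
    then show ?thesis using pos[of v] x y by (simp add: v_def)
  qed
  have a: "0 \<le> a" and b: "0 \<le> b" using pos x y by (auto simp: a_def b_def)
  show ?thesis
  proof (cases "w = 0")
    case True then show ?thesis using a b by (simp add: w_def a_def b_def)
  next
    case False
    then have w: "(cmod w)\<^sup>2 > 0" by simp
    show ?thesis
    proof (cases "b = 0")
      case True
      \<comment> \<open>For \<open>b = 0\<close> the expression is affine in \<open>t\<close>; this
        \<open>t\<close> gives it the value \<open>- a - 2 < 0\<close>.\<close>
      have "0 \<le> a - 2 * ((a + 1) / (cmod w)\<^sup>2) * (cmod w)\<^sup>2" using key[of "(a + 1) / (cmod w)\<^sup>2"] True by simp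
      also have "\<dots> = - a - 2" using w by (simp add: field_simps)
      finally show ?thesis using a by linarith
    next
      case nb: False
      then have b': "b > 0" using b by simp
      have "0 \<le> a - 2 * (1 / b) * (cmod w)\<^sup>2 + (1 / b)\<^sup>2 * (cmod w)\<^sup>2 * b" by (rule key)
      also have "\<dots> = a - (cmod w)\<^sup>2 / b" using b' by (simp add: field_simps power2_eq_square)
      finally show ?thesis using b' by (simp add: field_simps a_def b_def w_def)
    qed
  qed
qed

end

section \<open>Hilbert spaces\<close>

text \<open>Norm convergence without the fundamental decompositions of \<open>ip_converges\<close>;
  the two agree on Hilbert spaces.\<close>

definition cvg :: "'v::complex_vector ipspace \<Rightarrow> (nat \<Rightarrow> 'v) \<Rightarrow> 'v \<Rightarrow> bool" where
  "cvg X u x \<longleftrightarrow> (\<forall>i. u i \<in> car X) \<and> x \<in> car X \<and> (\<lambda>i. ipnorm X (u i - x)) \<longlonglongrightarrow> 0"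

locale hilbert =
  fixes X :: "'v::complex_vector ipspace"
  assumes hilbert: "hilbert_space X"

sublocale hilbert \<subseteq> inner_prod
  using hilbert by unfold_locales (simp add: hilbert_space_def)

context hilbert
begin

lemma ip_pos: "x \<in> car X \<Longrightarrow> x \<noteq> 0 \<Longrightarrow> 0 < Re (ip X x x)"
  using hilbert by (simp add: hilbert_space_def)

lemma ip_nonneg [simp]: "x \<in> car X \<Longrightarrow> 0 \<le> Re (ip X x x)"
  using ip_pos[of x] by (cases "x = 0") auto

lemma norm_sq: "x \<in> car X \<Longrightarrow> (ipnorm X x)\<^sup>2 = Re (ip X x x)"
  by (simp add: ipnorm_def)

lemma ip_self_norm: "x \<in> car X \<Longrightarrow> ip X x x = of_real ((ipnorm X x)\<^sup>2)"
  by (simp add: norm_sq complex_eq_iff)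

lemma norm_ge_0 [simp]: "x \<in> car X \<Longrightarrow> 0 \<le> ipnorm X x"
  by (simp add: ipnorm_def)

lemma norm_zero [simp]: "ipnorm X 0 = 0"
  by (simp add: ipnorm_def)

lemma norm_eq_0 [simp]: "x \<in> car X \<Longrightarrow> ipnorm X x = 0 \<longleftrightarrow> x = 0"
  using ip_pos[of x] by (cases "x = 0") (auto simp: ipnorm_def)

lemma Cauchy_Schwarz: "x \<in> car X \<Longrightarrow> y \<in> car X \<Longrightarrow> cmod (ip X x y) \<le> ipnorm X x * ipnorm X y"
  using Cauchy_Schwarz_semidefinite[of x y]
  by (rule_tac power2_le_imp_le) (auto simp: power_mult_distrib norm_sq)

lemma norm_scale: "x \<in> car X \<Longrightarrow> ipnorm X (a *\<^sub>C x) = cmod a * ipnorm X x"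
proof -
  assume x: "x \<in> car X"
  have "ip X (a *\<^sub>C x) (a *\<^sub>C x) = of_real ((cmod a)\<^sup>2) * ip X x x"
    using x complex_norm_square[of a] by (simp add: ip_linear mult_ac)
  then have "Re (ip X (a *\<^sub>C x) (a *\<^sub>C x)) = (cmod a)\<^sup>2 * Re (ip X x x)" by simp
  then show ?thesis by (simp add: ipnorm_def real_sqrt_mult)
qed

lemma norm_neg: "x \<in> car X \<Longrightarrow> ipnorm X (- x) = ipnorm X x"
  by (simp add: ipnorm_def ip_linear)

lemma norm_diff_commute: "x \<in> car X \<Longrightarrow> y \<in> car X \<Longrightarrow> ipnorm X (x - y) = ipnorm X (y - x)"
  using norm_neg[of "x - y"] by simp

lemma norm_add_sq:
  "x \<in> car X \<Longrightarrow> y \<in> car X \<Longrightarrow> (ipnorm X (x + y))\<^sup>2 = (ipnorm X x)\<^sup>2 + 2 * Re (ip X x y) + (ipnorm X y)\<^sup>2"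
  using ip_cnj[of x y] by (simp add: norm_sq ip_linear)

lemma norm_diff_sq:
  "x \<in> car X \<Longrightarrow> y \<in> car X \<Longrightarrow> (ipnorm X (x - y))\<^sup>2 = (ipnorm X x)\<^sup>2 - 2 * Re (ip X x y) + (ipnorm X y)\<^sup>2"
  using ip_cnj[of x y] by (simp add: norm_sq ip_linear)

lemma norm_triangle: "x \<in> car X \<Longrightarrow> y \<in> car X \<Longrightarrow> ipnorm X (x + y) \<le> ipnorm X x + ipnorm X y"
proof -
  assume x: "x \<in> car X" and y: "y \<in> car X"
  have "Re (ip X x y) \<le> ipnorm X x * ipnorm X y"
    using Cauchy_Schwarz[OF x y] complex_Re_le_cmod order_trans by blast
  then have "(ipnorm X (x + y))\<^sup>2 \<le> (ipnorm X x + ipnorm X y)\<^sup>2"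
    using norm_add_sq[OF x y] by (simp add: power2_sum)
  then show ?thesis using x y by (rule_tac power2_le_imp_le) auto
qed

lemma norm_triangle_diff: "x \<in> car X \<Longrightarrow> y \<in> car X \<Longrightarrow> z \<in> car X \<Longrightarrow>
    ipnorm X (x - z) \<le> ipnorm X (x - y) + ipnorm X (y - z)"
  using norm_triangle[of "x - y" "y - z"] by simp

lemma norm_reverse_triangle: "x \<in> car X \<Longrightarrow> y \<in> car X \<Longrightarrow> \<bar>ipnorm X x - ipnorm X y\<bar> \<le> ipnorm X (x - y)"
  using norm_triangle[of "x - y" y] norm_triangle[of "y - x" x] norm_diff_commute[of x y] by simp

lemma complete:
  assumes "\<And>i. u i \<in> car X" "\<And>e. e > 0 \<Longrightarrow> \<exists>N::nat. \<forall>i\<ge>N. \<forall>j\<ge>N. ipnorm X (u i - u j) < e"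
  shows "\<exists>x. cvg X u x"
  using hilbert assms unfolding hilbert_space_def cvg_def by blast

lemma cvg_mem: "cvg X u x \<Longrightarrow> u i \<in> car X" "cvg X u x \<Longrightarrow> x \<in> car X"
  by (auto simp: cvg_def)

lemma cvg_bound:
  assumes "\<And>i. u i \<in> car X" "x \<in> car X" "\<And>i. ipnorm X (u i - x) \<le> e i" "e \<longlonglongrightarrow> 0"
  shows "cvg X u x"
  unfolding cvg_def
proof (intro conjI allI assms(1,2))
  show "(\<lambda>i. ipnorm X (u i - x)) \<longlonglongrightarrow> 0"
    by (rule tendsto_sandwich[OF _ _ tendsto_const assms(4)]) (use assms in auto)
qed

lemma cvg_const: "x \<in> car X \<Longrightarrow> cvg X (\<lambda>_. x) x"
  by (simp add: cvg_def)

lemma cvg_add: assumes "cvg X u x" "cvg X v y" shows "cvg X (\<lambda>i. u i + v i) (x + y)"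
proof (rule cvg_bound[where e = "\<lambda>i. ipnorm X (u i - x) + ipnorm X (v i - y)"])
  show "(\<lambda>i. ipnorm X (u i - x) + ipnorm X (v i - y)) \<longlonglongrightarrow> 0"
    using assms by (auto simp: cvg_def intro: tendsto_add_zero)
  show "ipnorm X (u i + v i - (x + y)) \<le> ipnorm X (u i - x) + ipnorm X (v i - y)" for i
    using norm_triangle[of "u i - x" "v i - y"] assms by (simp add: cvg_def add_diff_add)
qed (use assms in \<open>auto simp: cvg_def\<close>)

lemma cvg_scale: assumes "cvg X u x" shows "cvg X (\<lambda>i. a *\<^sub>C u i) (a *\<^sub>C x)"
proof (rule cvg_bound[where e = "\<lambda>i. cmod a * ipnorm X (u i - x)"])
  show "(\<lambda>i. cmod a * ipnorm X (u i - x)) \<longlonglongrightarrow> 0"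
    using assms by (auto simp: cvg_def intro: tendsto_mult_right_zero)
  show "ipnorm X (a *\<^sub>C u i - a *\<^sub>C x) \<le> cmod a * ipnorm X (u i - x)" for i
    using assms norm_scale[of "u i - x" a]
    by (simp add: cvg_def complex_vector.scale_right_diff_distrib)
qed (use assms in \<open>auto simp: cvg_def\<close>)

lemma cvg_diff: assumes "cvg X u x" "cvg X v y" shows "cvg X (\<lambda>i. u i - v i) (x - y)"
  using cvg_add[OF assms(1) cvg_scale[OF assms(2), of "-1"]]
  by (simp add: complex_vector.scale_minus_left)

lemma cvg_diff_iff: "(\<And>i. u i \<in> car X) \<Longrightarrow> x \<in> car X \<Longrightarrow> cvg X (\<lambda>i. u i - x) 0 \<longleftrightarrow> cvg X u x"
  by (simp add: cvg_def)

lemma cvg_norm: assumes "cvg X u x" shows "(\<lambda>i. ipnorm X (u i)) \<longlonglongrightarrow> ipnorm X x"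
proof -
  have "(\<lambda>i. ipnorm X (u i) - ipnorm X x) \<longlonglongrightarrow> 0"
  proof (rule tendsto_rabs_zero_cancel, rule tendsto_sandwich[of "\<lambda>_. 0" _ _ "\<lambda>i. ipnorm X (u i - x)"])
    show "\<forall>\<^sub>F i in sequentially. \<bar>ipnorm X (u i) - ipnorm X x\<bar> \<le> ipnorm X (u i - x)"
      using assms by (simp add: cvg_def norm_reverse_triangle)
  qed (use assms in \<open>auto simp: cvg_def\<close>)
  then show ?thesis by (rule LIM_zero_cancel)
qed

lemma cvg_ip:
  assumes "cvg X u x" "cvg X v y" shows "(\<lambda>i. ip X (u i) (v i)) \<longlonglongrightarrow> ip X x y"
proof -
  have "(\<lambda>i. ip X (u i) (v i) - ip X x y) \<longlonglongrightarrow> 0"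
  proof (rule tendsto_norm_zero_cancel, rule tendsto_sandwich[of "\<lambda>_. 0" _ _
        "\<lambda>i. ipnorm X (u i) * ipnorm X (v i - y) + ipnorm X (u i - x) * ipnorm X y"])
    have "(\<lambda>i. ipnorm X (u i) * ipnorm X (v i - y) + ipnorm X (u i - x) * ipnorm X y)
        \<longlonglongrightarrow> ipnorm X x * 0 + 0 * ipnorm X y"
      using assms cvg_norm[OF assms(1)] by (intro tendsto_intros) (auto simp: cvg_def)
    then show "(\<lambda>i. ipnorm X (u i) * ipnorm X (v i - y) + ipnorm X (u i - x) * ipnorm X y) \<longlonglongrightarrow> 0"
      by simp
    have "cmod (ip X (u i) (v i) - ip X x y) \<le> ipnorm X (u i) * ipnorm X (v i - y) + ipnorm X (u i - x) * ipnorm X y" for i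
    proof -
      have m: "u i \<in> car X" "v i \<in> car X" "x \<in> car X" "y \<in> car X" using assms by (auto simp: cvg_def)
      have "ip X (u i) (v i) - ip X x y = ip X (u i) (v i - y) + ip X (u i - x) y"
        using m by (simp add: ip_linear)
      then show ?thesis
        using m norm_triangle_ineq[of "ip X (u i) (v i - y)" "ip X (u i - x) y"]
          Cauchy_Schwarz[of "u i" "v i - y"] Cauchy_Schwarz[of "u i - x" y] by simp
    qed
    then show "\<forall>\<^sub>F i in sequentially. cmod (ip X (u i) (v i) - ip X x y)
        \<le> ipnorm X (u i) * ipnorm X (v i - y) + ipnorm X (u i - x) * ipnorm X y" by simp
  qed auto
  then show ?thesis by (rule LIM_zero_cancel)
qed

lemma cvg_unique: assumes "cvg X u x" "cvg X u y" shows "x = y"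
proof -
  have "cvg X (\<lambda>i. 0) (x - y)" using cvg_diff[OF assms] by simp
  then have "(\<lambda>i. ipnorm X 0) \<longlonglongrightarrow> ipnorm X (x - y)" by (rule cvg_norm)
  then have "ipnorm X (x - y) = 0" by (simp add: LIMSEQ_const_iff)
  then show ?thesis using assms by (simp add: cvg_def)
qed

lemma cvg_Cauchy:
  assumes "cvg X u x" "e > 0" shows "\<exists>N::nat. \<forall>i\<ge>N. \<forall>j\<ge>N. ipnorm X (u i - u j) < e"
proof -
  have "(\<lambda>i. ipnorm X (u i - x)) \<longlonglongrightarrow> 0" using assms by (simp add: cvg_def)
  from LIMSEQ_D[OF this, of "e/2"] assms(2) obtain N where
    N: "\<And>i. i \<ge> N \<Longrightarrow> \<bar>ipnorm X (u i - x)\<bar> < e/2" by auto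
  have "ipnorm X (u i - u j) < e" if "i \<ge> N" "j \<ge> N" for i j
  proof -
    have m: "u i \<in> car X" "u j \<in> car X" "x \<in> car X" using assms by (auto simp: cvg_def)
    show ?thesis using N[OF that(1)] N[OF that(2)] norm_triangle_diff[OF m(1,3,2)] norm_diff_commute[OF m(3,2)]
      by simp
  qed
  then show ?thesis by blast
qed

lemma ip_eqI: assumes "x \<in> car X" "y \<in> car X" "\<And>z. z \<in> car X \<Longrightarrow> ip X z x = ip X z y" shows "x = y"
proof -
  have "ip X (x - y) (x - y) = 0" using assms by (simp add: ip_diff_right)
  then have "ipnorm X (x - y) = 0" by (simp add: ipnorm_def)
  then show ?thesis using assms by simp
qed

lemma ip_eqI_left: assumes "x \<in> car X" "y \<in> car X" "\<And>z. z \<in> car X \<Longrightarrow> ip X x z = ip X y z" shows "x = y"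
proof (rule ip_eqI)
  show "ip X z x = ip X z y" if "z \<in> car X" for z
    using assms that ip_cnj[of x z] ip_cnj[of y z] by simp
qed (use assms in auto)

text \<open>A nonzero vector of the negative part \<open>N\<close> would have a negative as well as
  a nonnegative square, so \<open>N\<close> is trivial in every decomposition, and the trivial
  decomposition exists.\<close>

lemma ip_converges_iff_cvg: "ip_converges X u x \<longleftrightarrow> cvg X u x"
proof
  assume "ip_converges X u x"
  then obtain P N p n where *: "\<forall>i. u i \<in> car X" "x \<in> car X" "fundamental_decomposition X P N"
      "\<forall>i. p i \<in> P \<and> n i \<in> N \<and> u i - x = p i + n i"
      "(\<lambda>i. sqrt (Re (ip X (p i) (p i)) - Re (ip X (n i) (n i)))) \<longlonglongrightarrow> 0"
    by (auto simp: ip_converges_def)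
  have "n i = 0" for i
  proof (rule ccontr)
    assume "n i \<noteq> 0"
    with * have "0 < Re (- ip X (n i) (n i))" "n i \<in> car X"
      by (auto simp: fundamental_decomposition_def hilbert_space_def)
    then show False using ip_nonneg[of "n i"] by (simp del: ip_nonneg)
  qed
  with * show "cvg X u x" by (simp add: cvg_def ipnorm_def)
next
  assume c: "cvg X u x"
  have z: "hilbert_space \<lparr>car = {0}, ip = (\<lambda>x y. - ip X x y)\<rparr>"
    by (auto simp: hilbert_space_def inner_space_def ipnorm_def complex_vector.subspace_def)
  have eta: "\<lparr>car = car X, ip = ip X\<rparr> = X" by (cases X) simp
  have "hilbert_space \<lparr>car = car X, ip = ip X\<rparr>" by (subst eta) (rule hilbert)
  with z have "fundamental_decomposition X (car X) {0}"
    using complex_vector.span_empty unfolding fundamental_decomposition_def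
    by (auto intro!: exI[of _ "{}"])
  then have "\<exists>P N p n. fundamental_decomposition X P N \<and>
      (\<forall>i. p i \<in> P \<and> n i \<in> N \<and> u i - x = p i + n i) \<and>
      (\<lambda>i. sqrt (Re (ip X (p i) (p i)) - Re (ip X (n i) (n i)))) \<longlonglongrightarrow> 0"
    using c by (intro exI[of _ "car X"] exI[of _ "{0}"] exI[of _ "\<lambda>i. u i - x"] exI[of _ "\<lambda>i. 0"])
      (simp add: cvg_def ipnorm_def)
  then show "ip_converges X u x" using c unfolding ip_converges_def cvg_def by blast
qed

text \<open>Minimise \<open>\<parallel>u\<parallel>\<^sup>2 - 2 Re (l u)\<close> over \<open>D\<close>; minimising sequences are Cauchy by the parallelogram law.\<close>

lemma Riesz:
  assumes D: "D \<subseteq> car X" "complex_vector.subspace D"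
    and l_add: "\<And>u v. u \<in> D \<Longrightarrow> v \<in> D \<Longrightarrow> l (u + v) = l u + l v"
    and l_scale: "\<And>u a. u \<in> D \<Longrightarrow> l (a *\<^sub>C u) = a * l u"
    and bound: "\<And>u. u \<in> D \<Longrightarrow> cmod (l u) \<le> c * ipnorm X u"
  obtains w b where "\<And>i. w i \<in> D" "cvg X w b" "\<And>u. u \<in> D \<Longrightarrow> ip X b u = l u"
proof -
  define J where "J u = (ipnorm X u)\<^sup>2 - 2 * Re (l u)" for u
  have D0: "0 \<in> D" using D by (simp add: complex_vector.subspace_0)
  have Dm: "u \<in> car X" if "u \<in> D" for u using D that by auto
  have Dadd: "u + v \<in> D" if "u \<in> D" "v \<in> D" for u v using D that by (simp add: complex_vector.subspace_add)
  have Dsc: "a *\<^sub>C u \<in> D" if "u \<in> D" for a u using D that by (simp add: complex_vector.subspace_scale)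
  have lower: "- c\<^sup>2 \<le> J u" if "u \<in> D" for u
  proof -
    have "Re (l u) \<le> c * ipnorm X u" using bound[OF that] complex_Re_le_cmod order_trans by blast
    moreover have "0 \<le> (ipnorm X u - c)\<^sup>2" by simp
    ultimately show ?thesis by (simp add: J_def power2_diff algebra_simps)
  qed
  define \<mu> where "\<mu> = (INF u\<in>D. J u)"
  have bdd: "bdd_below (J ` D)" using lower by (intro bdd_belowI2)
  have mu: "\<mu> \<le> J u" if "u \<in> D" for u unfolding \<mu>_def using bdd that by (rule cINF_lower)
  have "\<exists>u\<in>D. J u < \<mu> + 1 / real (Suc i)" for i
    using cINF_less_iff[of D J "\<mu> + 1 / real (Suc i)"] bdd D0 unfolding \<mu>_def by auto
  then obtain w where w: "\<And>i. w i \<in> D" "\<And>i. J (w i) < \<mu> + 1 / real (Suc i)" by metis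
  have par: "(ipnorm X (u - v))\<^sup>2 \<le> 2 * (J u - \<mu>) + 2 * (J v - \<mu>)" if u: "u \<in> D" and v: "v \<in> D" for u v
  proof -
    define s where "s = (1/2) *\<^sub>C (u + v)"
    have sD: "s \<in> D" using Dsc Dadd u v by (simp add: s_def)
    have n: "(ipnorm X s)\<^sup>2 = (ipnorm X (u + v))\<^sup>2 / 4"
      using Dm u v unfolding s_def by (subst norm_scale) (auto simp: power_mult_distrib power2_eq_square)
    have "2 * l s = l u + l v" using u v by (simp add: s_def l_scale l_add Dadd)
    from arg_cong[OF this, of Re] have r: "2 * Re (l s) = Re (l u) + Re (l v)" by simp
    have "(ipnorm X (u - v))\<^sup>2 = 2 * J u + 2 * J v - 4 * J s"
      using norm_add_sq[of u v] norm_diff_sq[of u v] Dm u v n r by (simp add: J_def)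
    then show ?thesis using mu[OF sD] by simp
  qed
  have "\<exists>b. cvg X w b"
  proof (rule complete)
    fix e :: real assume e: "e > 0"
    obtain N where N: "inverse (real (Suc N)) < e\<^sup>2 / 4" using reals_Archimedean[of "e\<^sup>2/4"] e by auto
    have "ipnorm X (w i - w j) < e" if "i \<ge> N" "j \<ge> N" for i j
    proof -
      have "1 / real (Suc i) \<le> 1 / real (Suc N)" "1 / real (Suc j) \<le> 1 / real (Suc N)"
        using that by (auto intro!: divide_left_mono)
      then have "(ipnorm X (w i - w j))\<^sup>2 < e\<^sup>2"
        using par[OF w(1) w(1), of i j] w(2)[of i] w(2)[of j] N by (simp add: inverse_eq_divide)
      then show ?thesis using e by (simp add: power2_less_imp_less)
    qed
    then show "\<exists>N. \<forall>i\<ge>N. \<forall>j\<ge>N. ipnorm X (w i - w j) < e" by blast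
  qed (use w Dm in auto)
  then obtain b where b: "cvg X w b" ..
  have "ip X b v = l v" if v: "v \<in> D" for v
  proof (rule ccontr)
    define \<delta> where "\<delta> = ip X b v - l v"
    assume "ip X b v \<noteq> l v"
    then have d: "cmod \<delta> > 0" by (simp add: \<delta>_def)
    \<comment> \<open>First variation: \<open>J (w i + t v)\<close> is at least the infimum,
      \<open>J (w i)\<close> exceeds it by less than \<open>1 / (i + 1)\<close>, and the difference
      of the two values converges.\<close>
    have key: "0 \<le> 2 * Re (t * \<delta>) + (cmod t)\<^sup>2 * (ipnorm X v)\<^sup>2" for t
    proof -
      have "J (w i + t *\<^sub>C v) - J (w i) = 2 * Re (t * (ip X (w i) v - l v)) + (cmod t)\<^sup>2 * (ipnorm X v)\<^sup>2" for i
        using w(1)[of i] v Dm[of v] Dm[of "w i"]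
        by (simp add: J_def norm_add_sq l_add l_scale Dsc norm_scale ip_linear power_mult_distrib algebra_simps)
      moreover have "- (1 / real (Suc i)) \<le> J (w i + t *\<^sub>C v) - J (w i)" for i
        using mu[OF Dadd[OF w(1) Dsc[OF v]], of i t] w(2)[of i] by linarith
      ultimately have "- (1 / real (Suc i)) \<le> 2 * Re (t * (ip X (w i) v - l v)) + (cmod t)\<^sup>2 * (ipnorm X v)\<^sup>2" for i
        by simp
      moreover have "(\<lambda>i. 2 * Re (t * (ip X (w i) v - l v)) + (cmod t)\<^sup>2 * (ipnorm X v)\<^sup>2)
          \<longlonglongrightarrow> 2 * Re (t * \<delta>) + (cmod t)\<^sup>2 * (ipnorm X v)\<^sup>2"
        unfolding \<delta>_def by (intro tendsto_intros cvg_ip[OF b cvg_const] Dm v)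
      moreover have "(\<lambda>i. - (1 / real (Suc i))) \<longlonglongrightarrow> 0"
        using tendsto_minus[OF LIMSEQ_inverse_real_of_nat] by (simp add: inverse_eq_divide)
      ultimately show ?thesis by (rule_tac LIMSEQ_le) auto
    qed
    \<comment> \<open>The choice \<open>t = - s * cnj \<delta>\<close> makes
      \<open>t * \<delta>\<close> the negative real number \<open>- s |\<delta>|^2\<close>.\<close>
    have key2: "0 \<le> - 2 * s + s\<^sup>2 * (ipnorm X v)\<^sup>2" if "s > 0" for s
    proof -
      have "0 \<le> 2 * Re (- of_real s * cnj \<delta> * \<delta>) + (cmod (- of_real s * cnj \<delta>))\<^sup>2 * (ipnorm X v)\<^sup>2" by (rule key)
      also have "\<dots> = (cmod \<delta>)\<^sup>2 * (- 2 * s + s\<^sup>2 * (ipnorm X v)\<^sup>2)"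
        using complex_norm_square[of \<delta>] by (simp add: norm_mult power_mult_distrib algebra_simps cmod_power2)
          (simp add: power2_eq_square algebra_simps)
      finally show ?thesis using d by (simp add: zero_le_mult_iff)
    qed
    have "0 \<le> - 2 + s * (ipnorm X v)\<^sup>2" if "s > 0" for s
    proof -
      have "0 \<le> s * (- 2 + s * (ipnorm X v)\<^sup>2)" using key2[OF that] by (simp add: algebra_simps power2_eq_square)
      then show ?thesis using that by (simp add: zero_le_mult_iff)
    qed
    \<comment> \<open>With \<open>n = |v|^2\<close> and \<open>s = 1 / (n + 1)\<close> the
      inequality reads \<open>2 \<le> n / (n + 1)\<close>.\<close>
    from this[of "1 / ((ipnorm X v)\<^sup>2 + 1)"] show False
      by (simp add: field_simps add_pos_nonneg) (smt (verit) zero_le_power2)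
  qed
  then show thesis using w(1) b that by blast
qed

section \<open>Density of subspaces\<close>

definition dense_in :: "'v set \<Rightarrow> bool" where
  "dense_in D \<longleftrightarrow> D \<subseteq> car X \<and> (\<forall>x\<in>car X. \<exists>w. (\<forall>i. w i \<in> D) \<and> cvg X w x)"

lemma dense_subset_iff: "dense_subset X D \<longleftrightarrow> dense_in D"
  by (simp add: dense_subset_def dense_in_def ip_converges_iff_cvg)

text \<open>Riesz for the functional \<open>ip X x\<close> restricted to \<open>D\<close> yields a
  limit \<open>b\<close> of elements of \<open>D\<close> such that \<open>x - b\<close> is
  orthogonal to \<open>D\<close>; no closure of \<open>D\<close> has to be formed.\<close>

lemma dense_if_trivial_complement:
  assumes D: "D \<subseteq> car X" "complex_vector.subspace D"
    and perp: "\<And>y. y \<in> car X \<Longrightarrow> (\<And>u. u \<in> D \<Longrightarrow> ip X y u = 0) \<Longrightarrow> y = 0"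
  shows "dense_in D"
  unfolding dense_in_def
proof (intro conjI ballI D(1))
  fix x assume x: "x \<in> car X"
  obtain w b where w: "\<And>i. w i \<in> D" "cvg X w b" "\<And>u. u \<in> D \<Longrightarrow> ip X b u = ip X x u"
    by (rule Riesz[OF D, of "ip X x" "ipnorm X x"])
      (use D x in \<open>auto simp: subset_iff ip_linear Cauchy_Schwarz\<close>)
  have "x - b = 0"
    by (rule perp) (use w x D cvg_mem in \<open>auto simp: subset_iff ip_linear\<close>)
  then show "\<exists>w. (\<forall>i. w i \<in> D) \<and> cvg X w x" using w by auto
qed

end

section \<open>Square roots of bounded nonnegative operators\<close>

text \<open>For such \<open>p\<close> and a contraction \<open>S\<close> the norm of
  \<open>p(S)\<close> is at most \<open>p(1)\<close>. Convergence of operators thereby reduces to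
  convergence of a monotone sequence of reals.\<close>

definition nonneg_poly :: "real poly \<Rightarrow> bool" where
  "nonneg_poly p \<longleftrightarrow> (\<forall>i. 0 \<le> coeff p i)"

lemma nonneg_poly_0 [simp]: "nonneg_poly 0"
  by (simp add: nonneg_poly_def)

lemma nonneg_poly_pCons [simp]: "nonneg_poly (pCons a p) \<longleftrightarrow> 0 \<le> a \<and> nonneg_poly p"
  unfolding nonneg_poly_def by (auto simp: coeff_pCons split: nat.splits)

lemma nonneg_poly_add: "nonneg_poly p \<Longrightarrow> nonneg_poly q \<Longrightarrow> nonneg_poly (p + q)"
  by (simp add: nonneg_poly_def)

lemma nonneg_poly_smult: "0 \<le> a \<Longrightarrow> nonneg_poly p \<Longrightarrow> nonneg_poly (smult a p)"
  by (simp add: nonneg_poly_def)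

lemma nonneg_poly_mult: "nonneg_poly p \<Longrightarrow> nonneg_poly q \<Longrightarrow> nonneg_poly (p * q)"
  by (auto simp: nonneg_poly_def coeff_mult intro!: sum_nonneg)

lemma nonneg_poly_poly: "nonneg_poly p \<Longrightarrow> 0 \<le> poly p 1"
  by (induction p) auto

text \<open>Iterating \<open>y \<mapsto> (x + y\<^sup>2) / 2\<close> converges to the solution \<open>y\<close> of \<open>(1 - y)\<^sup>2 = 1 - x\<close>.\<close>

fun sqrt_poly :: "nat \<Rightarrow> real poly" where
  "sqrt_poly 0 = 0"
| "sqrt_poly (Suc k) = smult (1/2) ([:0, 1:] + sqrt_poly k * sqrt_poly k)"

lemma nonneg_sqrt_poly: "nonneg_poly (sqrt_poly k)"
  by (induction k) (auto intro!: nonneg_poly_smult nonneg_poly_add nonneg_poly_mult)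

text \<open>Difference of squares: twice the next increment is the previous increment times the sum
  of the two iterates, and both factors have nonnegative coefficients.\<close>

lemma nonneg_sqrt_poly_step: "nonneg_poly (sqrt_poly (Suc k) - sqrt_poly k)"
proof (induction k)
  case 0
  show ?case by simp
next
  case (Suc k)
  have "sqrt_poly (Suc (Suc k)) - sqrt_poly (Suc k)
      = smult (1/2) ((sqrt_poly (Suc k) - sqrt_poly k) * (sqrt_poly (Suc k) + sqrt_poly k))"
    unfolding sqrt_poly.simps(2)[of "Suc k"] sqrt_poly.simps(2)[of k, THEN arg_cong[where f = "\<lambda>p. q - p" for q]]
    by (simp only: smult_diff_right[symmetric]) (simp add: algebra_simps del: sqrt_poly.simps)
  then show ?case
    by (simp only:) (intro nonneg_poly_smult nonneg_poly_mult Suc nonneg_poly_add nonneg_sqrt_poly; simp)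
qed

lemma nonneg_sqrt_poly_diff: "j \<le> k \<Longrightarrow> nonneg_poly (sqrt_poly k - sqrt_poly j)"
proof (induction k rule: dec_induct)
  case (step k)
  have "sqrt_poly (Suc k) - sqrt_poly j = (sqrt_poly (Suc k) - sqrt_poly k) + (sqrt_poly k - sqrt_poly j)"
    by simp
  then show ?case using step nonneg_sqrt_poly_step nonneg_poly_add by metis
qed simp

lemma sqrt_poly_le_1: "poly (sqrt_poly k) 1 \<le> 1"
proof (induction k)
  case (Suc k)
  have "poly (sqrt_poly k) 1 * poly (sqrt_poly k) 1 \<le> 1 * 1"
    using Suc nonneg_poly_poly[OF nonneg_sqrt_poly[of k]] by (intro mult_mono) auto
  then show ?case by simp
qed simp

text \<open>At 1 the iterates increase and stay below the fixed point 1 of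
  \<open>y \<mapsto> (1 + y^2) / 2\<close>.\<close>

lemma sqrt_poly_Cauchy: "Cauchy (\<lambda>k. poly (sqrt_poly k) 1)"
proof -
  have "incseq (\<lambda>k. poly (sqrt_poly k) 1)"
    using nonneg_poly_poly[OF nonneg_sqrt_poly_step] by (intro incseq_SucI) (simp del: sqrt_poly.simps)
  then show ?thesis
    using sqrt_poly_le_1 incseq_convergent[of "\<lambda>k. poly (sqrt_poly k) 1" 1] LIMSEQ_imp_Cauchy by blast
qed

context hilbert
begin

section \<open>Bounded, symmetric and nonnegative operators on the carrier\<close>

definition linop :: "('v \<Rightarrow> 'v) \<Rightarrow> bool" where
  "linop T \<longleftrightarrow> (\<forall>x\<in>car X. T x \<in> car X) \<and> (\<forall>x\<in>car X. \<forall>y\<in>car X. T (x + y) = T x + T y) \<and>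
    (\<forall>a. \<forall>x\<in>car X. T (a *\<^sub>C x) = a *\<^sub>C T x)"

definition bounded_op :: "('v \<Rightarrow> 'v) \<Rightarrow> bool" where
  "bounded_op T \<longleftrightarrow> linop T \<and> (\<exists>c>0. \<forall>x\<in>car X. ipnorm X (T x) \<le> c * ipnorm X x)"

definition symm_op :: "('v \<Rightarrow> 'v) \<Rightarrow> bool" where
  "symm_op T \<longleftrightarrow> (\<forall>x\<in>car X. \<forall>y\<in>car X. ip X (T x) y = ip X x (T y))"

definition pos_op :: "('v \<Rightarrow> 'v) \<Rightarrow> bool" where
  "pos_op T \<longleftrightarrow> bounded_op T \<and> symm_op T \<and> (\<forall>x\<in>car X. 0 \<le> Re (ip X x (T x)))"

definition commute_op :: "('v \<Rightarrow> 'v) \<Rightarrow> ('v \<Rightarrow> 'v) \<Rightarrow> bool" where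
  "commute_op C T \<longleftrightarrow> (\<forall>x\<in>car X. C (T x) = T (C x))"

lemma linop_mem: "linop T \<Longrightarrow> x \<in> car X \<Longrightarrow> T x \<in> car X"
  and linop_add: "linop T \<Longrightarrow> x \<in> car X \<Longrightarrow> y \<in> car X \<Longrightarrow> T (x + y) = T x + T y"
  and linop_scale: "linop T \<Longrightarrow> x \<in> car X \<Longrightarrow> T (a *\<^sub>C x) = a *\<^sub>C T x"
  by (auto simp: linop_def)

lemma linop_0: "linop T \<Longrightarrow> T 0 = 0"
  using linop_scale[of T 0 0] by (simp add: complex_vector.scale_zero_left)

lemma linop_diff: "linop T \<Longrightarrow> x \<in> car X \<Longrightarrow> y \<in> car X \<Longrightarrow> T (x - y) = T x - T y"
  using linop_add[of T "x - y" y] by simp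

lemma linop_sum: "linop T \<Longrightarrow> (\<And>i. i \<in> A \<Longrightarrow> f i \<in> car X) \<Longrightarrow> T (sum f A) = (\<Sum>i\<in>A. T (f i))"
  by (induction A rule: infinite_finite_induct) (auto simp: linop_0 linop_add)

lemma bounded_op_linop: "bounded_op T \<Longrightarrow> linop T"
  by (simp add: bounded_op_def)

lemma pos_opD: "pos_op T \<Longrightarrow> bounded_op T" "pos_op T \<Longrightarrow> symm_op T" "pos_op T \<Longrightarrow> linop T"
  by (auto simp: pos_op_def bounded_op_def)

lemma bounded_op_cvg: assumes "bounded_op T" "cvg X u x" shows "cvg X (\<lambda>i. T (u i)) (T x)"
proof -
  obtain c where c: "\<And>x. x \<in> car X \<Longrightarrow> ipnorm X (T x) \<le> c * ipnorm X x" and T: "linop T"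
    using assms(1) by (auto simp: bounded_op_def)
  show ?thesis
  proof (rule cvg_bound[where e = "\<lambda>i. c * ipnorm X (u i - x)"])
    show "(\<lambda>i. c * ipnorm X (u i - x)) \<longlonglongrightarrow> 0"
      using assms(2) by (auto simp: cvg_def intro: tendsto_mult_right_zero)
    show "ipnorm X (T (u i) - T x) \<le> c * ipnorm X (u i - x)" for i
      using c[of "u i - x"] assms(2) T by (simp add: linop_diff cvg_def)
  qed (use assms(2) T in \<open>auto simp: cvg_def linop_mem\<close>)
qed

lemma bounded_op_comp: assumes "bounded_op T" "bounded_op U" shows "bounded_op (\<lambda>x. T (U x))"
proof -
  obtain c d where c: "c > 0" "\<And>x. x \<in> car X \<Longrightarrow> ipnorm X (T x) \<le> c * ipnorm X x"
    and d: "d > 0" "\<And>x. x \<in> car X \<Longrightarrow> ipnorm X (U x) \<le> d * ipnorm X x"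
    and T: "linop T" and U: "linop U"
    using assms by (auto simp: bounded_op_def)
  have "ipnorm X (T (U x)) \<le> (c * d) * ipnorm X x" if "x \<in> car X" for x
    using order_trans[OF c(2)[OF linop_mem[OF U that]] mult_left_mono[OF d(2)[OF that], of c]] c(1)
    by (simp add: mult.assoc)
  moreover have "linop (\<lambda>x. T (U x))" using T U by (auto simp: linop_def)
  ultimately show ?thesis using c(1) d(1) by (auto simp: bounded_op_def intro!: exI[of _ "c * d"])
qed

lemma bounded_op_id: "bounded_op (\<lambda>x. x)"
  by (auto simp: bounded_op_def linop_def intro: exI[of _ 1])

text \<open>Cauchy-Schwarz for the semidefinite form \<open>ip X x (T y)\<close>, applied to
  \<open>x\<close> and \<open>T x\<close>, bounds \<open>|T x|^4\<close> by the product of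
  \<open>Re (ip X x (T x))\<close> and \<open>c |T x|^2\<close>. In particular \<open>T x\<close>
  vanishes as soon as \<open>ip X x (T x)\<close> does.\<close>

lemma pos_op_norm_bound:
  assumes T: "pos_op T" and c: "\<And>x. x \<in> car X \<Longrightarrow> ipnorm X (T x) \<le> c * ipnorm X x" and x: "x \<in> car X"
  shows "(ipnorm X (T x))\<^sup>2 \<le> c * Re (ip X x (T x))"
proof -
  define Y where "Y = \<lparr>car = car X, ip = (\<lambda>x y. ip X x (T y))\<rparr>"
  have lin: "linop T" and sym: "\<And>x y. x \<in> car X \<Longrightarrow> y \<in> car X \<Longrightarrow> ip X (T x) y = ip X x (T y)"
    and pos: "\<And>x. x \<in> car X \<Longrightarrow> 0 \<le> Re (ip X x (T x))"
    using T by (auto simp: pos_op_def bounded_op_def symm_op_def)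
  have cnj: "ip X y (T x) = cnj (ip X x (T y))" if "x \<in> car X" "y \<in> car X" for x y
    using sym[OF that] ip_cnj[of "T x" y] that lin by (simp add: linop_mem)
  interpret Y: inner_prod Y
  proof (unfold_locales, unfold inner_space_def, intro conjI ballI allI)
    show "complex_vector.subspace (car Y)" using subspace by (simp add: Y_def)
    show "ip Y y x = cnj (ip Y x y)" if "x \<in> car Y" "y \<in> car Y" for x y
      using cnj[of x y] that by (simp add: Y_def)
  qed (use lin in \<open>auto simp: Y_def linop_add linop_scale linop_mem ip_linear\<close>)
  have Tx: "T x \<in> car X" using lin x by (rule linop_mem)
  define n where "n = (ipnorm X (T x))\<^sup>2"
  have "(cmod (ip Y x (T x)))\<^sup>2 \<le> Re (ip Y x x) * Re (ip Y (T x) (T x))"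
    by (rule Y.Cauchy_Schwarz_semidefinite) (use pos Tx x in \<open>auto simp: Y_def\<close>)
  moreover have "ip Y x (T x) = of_real n" using sym[OF x Tx] ip_self_norm[OF Tx] by (simp add: Y_def n_def)
  moreover have "Re (ip Y (T x) (T x)) \<le> c * n"
  proof -
    have "Re (ip X (T x) (T (T x))) \<le> ipnorm X (T x) * ipnorm X (T (T x))"
      using Cauchy_Schwarz[OF Tx linop_mem[OF lin Tx]] complex_Re_le_cmod order_trans by blast
    also have "\<dots> \<le> ipnorm X (T x) * (c * ipnorm X (T x))" using c[OF Tx] Tx by (intro mult_left_mono) auto
    finally show ?thesis by (simp add: Y_def n_def power2_eq_square mult_ac)
  qed
  ultimately have nn: "n * n \<le> Re (ip X x (T x)) * (c * n)"
    using mult_left_mono[of "Re (ip Y (T x) (T x))" "c * n" "Re (ip X x (T x))"] pos[OF x]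
    by (simp add: Y_def power2_eq_square)
  then show ?thesis
  proof (cases "n = 0")
    case True
    have "0 \<le> c * Re (ip X x (T x))"
    proof (cases "x = 0")
      case False
      then have "0 < ipnorm X x" using x by (metis norm_eq_0 norm_ge_0 less_eq_real_def)
      moreover have "0 \<le> c * ipnorm X x" using c[OF x] Tx by (meson norm_ge_0 order_trans)
      ultimately have "0 \<le> c" by (simp add: zero_le_mult_iff)
      then show ?thesis using pos[OF x] by simp
    qed (use lin in \<open>simp add: linop_0\<close>)
    then show ?thesis using True by (simp add: n_def)
  next
    case False
    then have "n > 0" by (simp add: n_def)
    moreover have "n * n \<le> (c * Re (ip X x (T x))) * n" using nn by (simp only: mult_ac)
    ultimately show ?thesis unfolding n_def[symmetric] by (rule_tac mult_right_le_imp_le)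
  qed
qed

section \<open>Polynomials in an operator, evaluated by Horner's scheme\<close>

definition pop :: "('v \<Rightarrow> 'v) \<Rightarrow> real poly \<Rightarrow> 'v \<Rightarrow> 'v" where
  "pop S p x = fold_coeffs (\<lambda>a y. of_real a *\<^sub>C x + S y) p 0"

context
  fixes S :: "'v \<Rightarrow> 'v"
  assumes S: "linop S"
begin

lemma pop_0 [simp]: "pop S 0 x = 0"
  by (simp add: pop_def)

lemma pop_pCons [simp]: "pop S (pCons a p) x = of_real a *\<^sub>C x + S (pop S p x)"
  using linop_0[OF S]
  by (cases "p = 0"; cases "a = 0")
    (simp_all add: pop_def fold_coeffs_pCons_not_0_0_eq fold_coeffs_pCons_coeff_not_0_eq complex_vector.scale_zero_left)

lemma pop_mem [simp]: "x \<in> car X \<Longrightarrow> pop S p x \<in> car X"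
  using S by (induction p) (auto simp: linop_mem)

lemma pop_add: "x \<in> car X \<Longrightarrow> pop S (p + q) x = pop S p x + pop S q x"
  using S by (induction p q rule: poly_induct2) (auto simp: linop_add scaleC_add_left)

lemma pop_smult: "x \<in> car X \<Longrightarrow> pop S (smult a p) x = of_real a *\<^sub>C pop S p x"
  using S by (induction p) (auto simp: linop_scale scaleC_add_right scaleC_scaleC)

lemma pop_diff: "x \<in> car X \<Longrightarrow> pop S (p - q) x = pop S p x - pop S q x"
  using pop_add[of x "p - q" q] by simp

lemma pop_mult: "x \<in> car X \<Longrightarrow> pop S (p * q) x = pop S p (pop S q x)"
proof (induction p)
  case (pCons a p)
  then show ?case
    by (simp add: pop_add pop_smult complex_vector.scale_zero_left)
qed simp

lemma pop_linear: "linop (pop S p)"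
proof (induction p)
  case 0
  show ?case by (simp add: linop_def)
next
  case (pCons a p)
  then show ?case using S
    by (auto simp: linop_def scaleC_add_right complex_vector.scale_left_commute)
qed

lemma pop_commute:
  assumes "linop C" "\<And>x. x \<in> car X \<Longrightarrow> C (S x) = S (C x)" "x \<in> car X"
  shows "C (pop S p x) = pop S p (C x)"
  using assms S by (induction p) (auto simp: linop_0 linop_add linop_scale linop_mem)

lemma pop_symm:
  assumes "symm_op S" "x \<in> car X" "y \<in> car X"
  shows "ip X (pop S p x) y = ip X x (pop S p y)"
  using assms(2,3)
proof (induction p arbitrary: y)
  case (pCons a p)
  have m: "S (pop S p x) \<in> car X" "S (pop S p y) \<in> car X" "S y \<in> car X" using pCons S by (auto simp: linop_mem)
  have "ip X (S (pop S p x)) y = ip X (pop S p x) (S y)" using assms(1) pCons by (simp add: symm_op_def)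
  also have "\<dots> = ip X x (S (pop S p y))" using pCons m pop_commute[OF S, of y p] by simp
  finally show ?case using pCons m by (simp add: ip_linear)
qed simp

text \<open>With nonnegative coefficients the triangle inequality in Horner's scheme adds up exactly
  to the value of the polynomial at 1.\<close>

lemma pop_norm:
  assumes "\<And>x. x \<in> car X \<Longrightarrow> ipnorm X (S x) \<le> ipnorm X x" "x \<in> car X" "nonneg_poly p"
  shows "ipnorm X (pop S p x) \<le> poly p 1 * ipnorm X x"
  using assms(3)
proof (induction p)
  case (pCons a p)
  have m: "pop S p x \<in> car X" "S (pop S p x) \<in> car X" using assms S by (auto simp: linop_mem)
  have "ipnorm X (of_real a *\<^sub>C x + S (pop S p x)) \<le> a * ipnorm X x + ipnorm X (S (pop S p x))"
    using norm_triangle[of "of_real a *\<^sub>C x" "S (pop S p x)"] pCons m assms by (simp add: norm_scale)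
  also have "\<dots> \<le> a * ipnorm X x + poly p 1 * ipnorm X x"
    using pCons assms(1)[OF m(1)] by simp
  finally show ?case by (simp add: distrib_right)
qed simp

text \<open>The limit \<open>Y\<close> satisfies \<open>(1 - Y)\<^sup>2 = 1 - S\<close>.\<close>

lemma sqrt_iteration_limit:
  assumes contr: "\<And>x. x \<in> car X \<Longrightarrow> ipnorm X (S x) \<le> ipnorm X x" and sym: "symm_op S"
  obtains Y where "linop Y" "symm_op Y" "\<And>x. x \<in> car X \<Longrightarrow> ipnorm X (Y x) \<le> ipnorm X x"
    "\<And>x. x \<in> car X \<Longrightarrow> 2 *\<^sub>C Y x = S x + Y (Y x)"
    "\<And>C. bounded_op C \<Longrightarrow> commute_op C S \<Longrightarrow> commute_op C Y"
proof -
  let ?p = "\<lambda>k. pop S (sqrt_poly k)"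
  \<comment> \<open>A later iterate minus an earlier one again has nonnegative coefficients, so
    \<open>pop_norm\<close> applies to the difference.\<close>
  have diff: "ipnorm X (?p k x - ?p j x) \<le> \<bar>poly (sqrt_poly k) 1 - poly (sqrt_poly j) 1\<bar> * ipnorm X x"
    if x: "x \<in> car X" for x j k
  proof (induction j k rule: linorder_wlog)
    case (le j k)
    have "ipnorm X (pop S (sqrt_poly k - sqrt_poly j) x) \<le> poly (sqrt_poly k - sqrt_poly j) 1 * ipnorm X x"
      by (rule pop_norm[OF contr x nonneg_sqrt_poly_diff[OF le]])
    moreover have "0 \<le> poly (sqrt_poly k - sqrt_poly j) 1"
      by (rule nonneg_poly_poly[OF nonneg_sqrt_poly_diff[OF le]])
    ultimately show ?case using x by (simp add: pop_diff)
  next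
    case (sym j k)
    then show ?case using x norm_diff_commute[of "?p j x" "?p k x"] by (simp add: abs_minus_commute)
  qed
  have ex: "\<exists>y. cvg X (\<lambda>k. ?p k x) y" if x: "x \<in> car X" for x
  proof (rule complete)
    fix e :: real assume e: "e > 0"
    have pos: "0 < ipnorm X x + 1" using x by (simp add: add_nonneg_pos)
    obtain N where N: "\<And>i j. i \<ge> N \<Longrightarrow> j \<ge> N \<Longrightarrow> \<bar>poly (sqrt_poly i) 1 - poly (sqrt_poly j) 1\<bar> < e / (ipnorm X x + 1)"
      using CauchyD[OF sqrt_poly_Cauchy, of "e / (ipnorm X x + 1)"] e pos by auto
    have "ipnorm X (?p i x - ?p j x) < e" if "i \<ge> N" "j \<ge> N" for i j
    proof -
      have "ipnorm X (?p i x - ?p j x) \<le> \<bar>poly (sqrt_poly i) 1 - poly (sqrt_poly j) 1\<bar> * (ipnorm X x + 1)"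
        using diff[OF x, of i j] by (rule order_trans) (simp add: mult_left_mono)
      also have "\<dots> < e" using N[OF that] pos by (simp add: pos_less_divide_eq)
      finally show ?thesis .
    qed
    then show "\<exists>N. \<forall>i\<ge>N. \<forall>j\<ge>N. ipnorm X (?p i x - ?p j x) < e" by blast
  qed (use x in simp)
  define Y where "Y x = (SOME y. cvg X (\<lambda>k. ?p k x) y)" for x
  have Y: "cvg X (\<lambda>k. ?p k x) (Y x)" if "x \<in> car X" for x
    unfolding Y_def using ex[OF that] by (rule someI_ex)
  have Ym: "Y x \<in> car X" if "x \<in> car X" for x using Y[OF that] by (rule cvg_mem)
  have lin: "linop Y"
    unfolding linop_def
  proof (intro conjI ballI allI)
    fix x y assume xy: "x \<in> car X" "y \<in> car X"
    show "Y (x + y) = Y x + Y y"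
      by (rule cvg_unique[OF Y]) (use xy cvg_add[OF Y Y, of x y] in \<open>auto simp: linop_add[OF pop_linear]\<close>)
  next
    fix a x assume x: "x \<in> car X"
    show "Y (a *\<^sub>C x) = a *\<^sub>C Y x"
      by (rule cvg_unique[OF Y]) (use x cvg_scale[OF Y, of x] in \<open>auto simp: linop_scale[OF pop_linear]\<close>)
  qed (rule Ym)
  have bound: "ipnorm X (?p k x) \<le> ipnorm X x" if x: "x \<in> car X" for x k
    using order_trans[OF pop_norm[OF contr x nonneg_sqrt_poly[of k]] mult_right_mono[OF sqrt_poly_le_1[of k], of "ipnorm X x"]] x
    by simp
  have Yb: "ipnorm X (Y x) \<le> ipnorm X x" if x: "x \<in> car X" for x
    by (rule LIMSEQ_le_const2[OF cvg_norm[OF Y[OF x]]]) (use bound x in auto)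
  have Ys: "symm_op Y"
    unfolding symm_op_def
  proof (intro ballI)
    fix x y assume xy: "x \<in> car X" "y \<in> car X"
    show "ip X (Y x) y = ip X x (Y y)"
      using LIMSEQ_unique[OF cvg_ip[OF Y[OF xy(1)] cvg_const[OF xy(2)]]]
        cvg_ip[OF cvg_const[OF xy(1)] Y[OF xy(2)]] pop_symm[OF sym xy] by simp
  qed
  \<comment> \<open>Each polynomial iterate is a contraction, so \<open>p_k (p_k x)\<close> is as
    close to \<open>p_k (Y x)\<close> as \<open>p_k x\<close> is to \<open>Y x\<close>.\<close>
  have YY: "cvg X (\<lambda>k. ?p k (?p k x)) (Y (Y x))" if x: "x \<in> car X" for x
  proof (rule cvg_bound[where e = "\<lambda>k. ipnorm X (?p k x - Y x) + ipnorm X (?p k (Y x) - Y (Y x))"])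
    show "(\<lambda>k. ipnorm X (?p k x - Y x) + ipnorm X (?p k (Y x) - Y (Y x))) \<longlonglongrightarrow> 0"
      using Y[OF x] Y[OF Ym[OF x]] by (auto simp: cvg_def intro: tendsto_add_zero)
    show "ipnorm X (?p k (?p k x) - Y (Y x)) \<le> ipnorm X (?p k x - Y x) + ipnorm X (?p k (Y x) - Y (Y x))" for k
      using norm_triangle_diff[of "?p k (?p k x)" "?p k (Y x)" "Y (Y x)"] bound[of "?p k x - Y x" k] x Ym
      by (simp add: linop_diff[OF pop_linear])
  qed (use x Ym in auto)
  have eq: "2 *\<^sub>C Y x = S x + Y (Y x)" if x: "x \<in> car X" for x
  proof -
    have m: "S x \<in> car X" using S x by (rule linop_mem)
    have "(\<lambda>k. 2 *\<^sub>C ?p (Suc k) x) = (\<lambda>k. S x + ?p k (?p k x))"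
      using x m linop_0[OF S]
      by (intro ext) (simp add: pop_smult pop_add pop_mult scaleC_add_right scaleC_scaleC scaleC_one complex_vector.scale_zero_left)
    moreover have "cvg X (\<lambda>k. S x + ?p k (?p k x)) (S x + Y (Y x))"
      using cvg_add[OF cvg_const[OF m] YY[OF x]] .
    moreover have "cvg X (\<lambda>k. ?p (Suc k) x) (Y x)"
      using Y[OF x] by (auto simp del: sqrt_poly.simps simp: cvg_def intro: LIMSEQ_Suc)
    ultimately show ?thesis using cvg_scale[of "\<lambda>k. ?p (Suc k) x" "Y x" 2] cvg_unique by metis
  qed
  \<comment> \<open>\<open>C\<close> commutes with every polynomial in \<open>S\<close> and, being
    bounded, passes through the limit.\<close>
  have comm: "commute_op C Y" if C: "bounded_op C" "commute_op C S" for C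
    unfolding commute_op_def
  proof
    fix x assume x: "x \<in> car X"
    have l: "linop C" using C by (simp add: bounded_op_linop)
    have "cvg X (\<lambda>k. C (?p k x)) (C (Y x))" using bounded_op_cvg[OF C(1) Y[OF x]] .
    moreover have "cvg X (\<lambda>k. C (?p k x)) (Y (C x))"
      using Y[OF linop_mem[OF l x]] pop_commute[OF l _ x] C(2) by (simp add: commute_op_def)
    ultimately show "C (Y x) = Y (C x)" by (rule cvg_unique)
  qed
  show thesis by (rule that[OF lin Ys Yb eq comm])
qed

end

text \<open>Rescale by a norm bound \<open>c\<close>: \<open>S = 1 - T / c\<close> is a contraction,
  and \<open>(1 - Y)^2 = 1 - S = T / c\<close> makes \<open>sqrt c (1 - Y)\<close> a root of
  \<open>T\<close>. The statement on commuting operators is what uniqueness rests on.\<close>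

lemma sqrt_exists:
  assumes T: "pos_op T"
  obtains Q where "pos_op Q" "\<And>x. x \<in> car X \<Longrightarrow> Q (Q x) = T x"
    "\<And>C. bounded_op C \<Longrightarrow> commute_op C T \<Longrightarrow> commute_op C Q"
proof -
  obtain c where c: "c > 0" "\<And>x. x \<in> car X \<Longrightarrow> ipnorm X (T x) \<le> c * ipnorm X x"
    using T by (auto simp: pos_op_def bounded_op_def)
  have lin: "linop T" and sym: "symm_op T" using T by (auto simp: pos_opD)
  define S where "S x = x - of_real (1/c) *\<^sub>C T x" for x
  have S: "linop S" using lin
    by (auto simp: S_def linop_def scaleC_add_right complex_vector.scale_right_diff_distrib
        complex_vector.scale_left_commute)
  have Ssym: "symm_op S" using sym lin by (auto simp: symm_op_def S_def ip_linear linop_mem)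
  \<comment> \<open>In the expansion of \<open>|S x|^2\<close> the quadratic term is at most
    \<open>Re (ip X x (T x)) / c\<close>, half of what the linear term subtracts.\<close>
  have contr: "ipnorm X (S x) \<le> ipnorm X x" if x: "x \<in> car X" for x
  proof -
    have m: "T x \<in> car X" using lin x by (rule linop_mem)
    have "(ipnorm X (S x))\<^sup>2 = (ipnorm X x)\<^sup>2 - 2 / c * Re (ip X x (T x)) + (ipnorm X (T x))\<^sup>2 / c\<^sup>2"
      using x m c(1) unfolding S_def by (subst norm_diff_sq) (auto simp: ip_linear norm_scale power_divide norm_divide)
    also have "\<dots> \<le> (ipnorm X x)\<^sup>2 - 2 / c * Re (ip X x (T x)) + c * Re (ip X x (T x)) / c\<^sup>2"
      using pos_op_norm_bound[OF T c(2) x] c(1) by (simp add: divide_right_mono)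
    also have "\<dots> = (ipnorm X x)\<^sup>2 - 1 / c * Re (ip X x (T x))" using c(1) by (simp add: field_simps power2_eq_square)
    also have "\<dots> \<le> (ipnorm X x)\<^sup>2" using T x c(1) by (simp add: pos_op_def)
    finally show ?thesis by (rule power2_le_imp_le) (use x in simp)
  qed
  obtain Y where Y: "linop Y" "symm_op Y" "\<And>x. x \<in> car X \<Longrightarrow> ipnorm X (Y x) \<le> ipnorm X x"
    "\<And>x. x \<in> car X \<Longrightarrow> 2 *\<^sub>C Y x = S x + Y (Y x)"
    and Yc: "\<And>C. bounded_op C \<Longrightarrow> commute_op C S \<Longrightarrow> commute_op C Y"
    by (rule sqrt_iteration_limit[OF S contr Ssym]) blast+
  have Ym: "Y x \<in> car X" if "x \<in> car X" for x using Y(1) that by (rule linop_mem)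
  define s where "s = complex_of_real (sqrt c)"
  have ss: "s * s = of_real c" using c(1) by (simp add: s_def flip: of_real_mult)
  define Q where "Q x = s *\<^sub>C (x - Y x)" for x
  have Ql: "linop Q" using Y(1)
    by (auto simp: Q_def linop_def scaleC_add_right complex_vector.scale_right_diff_distrib
        scaleC_scaleC mult.commute)
  have "ipnorm X (Q x) \<le> (2 * sqrt c) * ipnorm X x" if x: "x \<in> car X" for x
  proof -
    have "ipnorm X (Q x) = sqrt c * ipnorm X (x - Y x)" using x Ym c(1) by (simp add: Q_def s_def norm_scale)
    also have "ipnorm X (x - Y x) \<le> ipnorm X x + ipnorm X x"
      using norm_triangle[of x "- Y x"] Y(3)[OF x] x Ym by (simp add: norm_neg)
    finally show ?thesis using c(1) by (simp add: mult_left_mono)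
  qed
  then have Qb: "bounded_op Q" using Ql c(1) by (auto simp: bounded_op_def intro!: exI[of _ "2 * sqrt c"])
  have Qs: "symm_op Q" using Y(2) Ym by (auto simp: symm_op_def Q_def ip_linear s_def)
  have Qp: "0 \<le> Re (ip X x (Q x))" if x: "x \<in> car X" for x
  proof -
    have "Re (ip X x (Y x)) \<le> ipnorm X x * ipnorm X (Y x)"
      using Cauchy_Schwarz[OF x Ym[OF x]] complex_Re_le_cmod order_trans by blast
    also have "\<dots> \<le> (ipnorm X x)\<^sup>2" using Y(3)[OF x] x by (simp add: power2_eq_square mult_left_mono)
    finally show ?thesis using x Ym c(1) by (simp add: Q_def s_def ip_linear norm_sq)
  qed
  have QQ: "Q (Q x) = T x" if x: "x \<in> car X" for x
  proof -
    have two: "2 *\<^sub>C Y x = Y x + Y x" using scaleC_add_left[of 1 1 "Y x"] by (simp add: scaleC_one)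
    have "Y (Q x) = s *\<^sub>C (Y x - Y (Y x))"
      using x Ym by (simp add: Q_def linop_scale[OF Y(1)] linop_diff[OF Y(1)])
    then have "Q (Q x) = s *\<^sub>C s *\<^sub>C (x - Y x - (Y x - Y (Y x)))"
      unfolding Q_def[of "Q x"] by (simp only: Q_def[of x] complex_vector.scale_right_diff_distrib)
    also have "\<dots> = (s * s) *\<^sub>C (x - 2 *\<^sub>C Y x + Y (Y x))"
      unfolding two scaleC_scaleC by (simp add: diff_diff_eq2 diff_diff_eq add_diff_eq diff_add_eq)
    also have "x - 2 *\<^sub>C Y x + Y (Y x) = of_real (1/c) *\<^sub>C T x" unfolding Y(4)[OF x] by (simp add: S_def)
    finally show ?thesis using c(1) by (simp add: ss scaleC_scaleC scaleC_one)
  qed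
  have comm: "commute_op C Q" if C: "bounded_op C" "commute_op C T" for C
  proof -
    have l: "linop C" using C by (simp add: bounded_op_linop)
    have "commute_op C S"
      using l C(2) lin by (simp add: S_def linop_diff linop_scale linop_mem commute_op_def)
    then show ?thesis using Yc[OF C(1)] l Ym by (simp add: Q_def linop_scale linop_diff commute_op_def)
  qed
  show thesis by (rule that[OF _ QQ comm]) (use Qb Qs Qp in \<open>auto simp: pos_op_def\<close>)
qed

text \<open>Both operators are compared with the root \<open>R\<close> from
  \<open>sqrt_exists\<close>. A root \<open>C\<close> commutes with \<open>T\<close>, hence with
  \<open>R\<close>, so \<open>(R + C) (R - C) = 0\<close>. For \<open>y = (R - C) x\<close> the
  nonnegative numbers \<open>ip X y (R y)\<close> and \<open>ip X y (C y)\<close> add up to zero;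
  hence \<open>R y = 0\<close>, and \<open>R\<close> is injective.\<close>

lemma sqrt_unique:
  assumes B: "pos_op B" and inj: "\<And>x. x \<in> car X \<Longrightarrow> B x = 0 \<Longrightarrow> x = 0"
    and Q: "linop Q" "symm_op Q" "\<And>x. x \<in> car X \<Longrightarrow> 0 \<le> Re (ip X x (Q x))"
    and eq: "\<And>x. x \<in> car X \<Longrightarrow> Q (Q x) = B (B x)" and x: "x \<in> car X"
  shows "Q x = B x"
proof -
  define T where "T x = B (B x)" for x
  have Bb: "bounded_op B" and Bl: "linop B" and Bs: "symm_op B" using B by (auto simp: pos_opD)
  have Bpos: "0 \<le> Re (ip X x (B x))" if "x \<in> car X" for x using B that by (simp add: pos_op_def)
  have BB: "ip X (B x) y = ip X x (B y)" if "x \<in> car X" "y \<in> car X" for x y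
    using Bs that by (simp add: symm_op_def)
  have "0 \<le> Re (ip X x (T x))" if "x \<in> car X" for x
    using BB[of x "B x"] that linop_mem[OF Bl that] ip_nonneg[of "B x"] by (simp add: T_def del: ip_nonneg)
  then have Tpos: "pos_op T"
    using bounded_op_comp[OF Bb Bb] BB Bl unfolding pos_op_def T_def
    by (simp add: symm_op_def linop_mem)
  obtain c where c: "c > 0" "\<And>x. x \<in> car X \<Longrightarrow> ipnorm X (B x) \<le> c * ipnorm X x"
    using Bb by (auto simp: bounded_op_def)
  \<comment> \<open>Symmetry and equal squares give \<open>Q x\<close> and \<open>B x\<close> the
    same norm, so \<open>Q\<close> inherits boundedness from \<open>B\<close>.\<close>
  have Qn: "ipnorm X (Q x) = ipnorm X (B x)" if x: "x \<in> car X" for x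
  proof -
    have "ip X (Q x) (Q x) = ip X (B x) (B x)"
      using Q(1,2) Bs Bl eq x by (simp add: symm_op_def linop_mem)
    then show ?thesis by (simp add: ipnorm_def)
  qed
  have Qb: "bounded_op Q" using Q(1) c Qn by (auto simp: bounded_op_def)
  obtain R where R: "pos_op R" "\<And>x. x \<in> car X \<Longrightarrow> R (R x) = T x"
    and comm: "\<And>C. bounded_op C \<Longrightarrow> commute_op C T \<Longrightarrow> commute_op C R"
    by (rule sqrt_exists[OF Tpos]) blast
  have Rl: "linop R" using R by (auto simp: pos_opD)
  have Rinj: "x = 0" if x: "x \<in> car X" "R x = 0" for x
  proof -
    have "B (B x) = 0" using R(2)[OF x(1)] x(2) Rl by (simp add: T_def linop_0)
    then show ?thesis using inj[OF linop_mem[OF Bl x(1)]] inj[OF x(1)] by blast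
  qed
  have unique: "C x = R x"
    if C: "bounded_op C" "symm_op C" "\<And>x. x \<in> car X \<Longrightarrow> 0 \<le> Re (ip X x (C x))"
      "\<And>x. x \<in> car X \<Longrightarrow> C (C x) = T x" and x: "x \<in> car X" for C x
  proof -
    have Cl: "linop C" using C by (simp add: bounded_op_linop)
    have "C (T y) = T (C y)" if "y \<in> car X" for y
      using C(4)[OF linop_mem[OF Cl that]] C(4)[OF that] by metis
    then have CR: "C (R x) = R (C x)" using comm[OF C(1)] x by (simp add: commute_op_def)
    define y where "y = R x - C x"
    have y: "y \<in> car X" using x Rl Cl by (simp add: y_def linop_mem)
    have "R y + C y = 0"
      using x Rl Cl CR C(4) R(2) by (simp add: y_def linop_diff linop_mem)
    then have "ip X y (R y) + ip X y (C y) = 0"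
      using y Rl Cl ip_add_right[of y "R y" "C y"] by (simp add: linop_mem)
    then have "Re (ip X y (R y)) + Re (ip X y (C y)) = 0" by (metis plus_complex.sel(1) zero_complex.sel(1))
    then have 0: "Re (ip X y (R y)) = 0" using C(3)[OF y] R(1) y by (simp add: pos_op_def add_nonneg_eq_0_iff)
    obtain d where "\<And>x. x \<in> car X \<Longrightarrow> ipnorm X (R x) \<le> d * ipnorm X x"
      using R(1) by (auto simp: pos_op_def bounded_op_def)
    then have "(ipnorm X (R y))\<^sup>2 \<le> d * Re (ip X y (R y))" using pos_op_norm_bound[OF R(1) _ y] by blast
    then have "R y = 0" using 0 y Rl by (simp add: linop_mem)
    then have "y = 0" using Rinj y by blast
    then show ?thesis by (simp add: y_def)
  qed
  show ?thesis
    using unique[OF Qb Q(2,3) _ x] unique[OF Bb Bs Bpos _ x] eq by (simp add: T_def)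
qed

end

section \<open>Self-adjoint operators and their resolvents\<close>

lemma subspace_relI:
  assumes "(0, 0) \<in> A" "\<And>a b c d. (a, b) \<in> A \<Longrightarrow> (c, d) \<in> A \<Longrightarrow> (a + c, b + d) \<in> A"
    "\<And>r a b. (a, b) \<in> A \<Longrightarrow> (r *\<^sub>C a, r *\<^sub>C b) \<in> A"
  shows "complex_vector.subspace (A :: ('v::complex_vector \<times> 'w::complex_vector) set)"
  using assms by (auto simp: complex_vector.subspace_def scaleC_prod_def zero_prod_def)

lemma subspace_rel_0: "complex_vector.subspace A \<Longrightarrow> (0, 0) \<in> (A :: ('v::complex_vector \<times> 'w::complex_vector) set)"
  by (auto simp: complex_vector.subspace_def zero_prod_def)

lemma subspace_rel_add: "complex_vector.subspace (A :: ('v::complex_vector \<times> 'w::complex_vector) set) \<Longrightarrow>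
    (a, b) \<in> A \<Longrightarrow> (c, d) \<in> A \<Longrightarrow> (a + c, b + d) \<in> A"
  using complex_vector.subspace_add[of A "(a, b)" "(c, d)"] by simp

lemma subspace_rel_scale: "complex_vector.subspace (A :: ('v::complex_vector \<times> 'w::complex_vector) set) \<Longrightarrow>
    (a, b) \<in> A \<Longrightarrow> (r *\<^sub>C a, r *\<^sub>C b) \<in> A"
  using complex_vector.subspace_scale[of A "(a, b)" r] by (simp add: scaleC_prod_def)

lemma subspace_rel_diff: "complex_vector.subspace (A :: ('v::complex_vector \<times> 'w::complex_vector) set) \<Longrightarrow>
    (a, b) \<in> A \<Longrightarrow> (c, d) \<in> A \<Longrightarrow> (a - c, b - d) \<in> A"
  using complex_vector.subspace_diff[of A "(a, b)" "(c, d)"] by simp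

lemma subspace_rel_converse:
  "complex_vector.subspace (A :: ('v::complex_vector \<times> 'w::complex_vector) set) \<Longrightarrow> complex_vector.subspace (A\<inverse>)"
  by (rule subspace_relI) (auto intro: subspace_rel_0 subspace_rel_add subspace_rel_scale)

text \<open>The adjoint condition is symmetric in the two members of a pair. This reduces
  self-adjointness of an unbounded inverse to that of a bounded operator.\<close>

lemma adjoint_converse: "adjoint_relation Y X (A\<inverse>) = (adjoint_relation X Y A)\<inverse>"
proof (intro set_eqI, clarify)
  fix x y
  show "(x, y) \<in> adjoint_relation Y X (A\<inverse>) \<longleftrightarrow> (x, y) \<in> (adjoint_relation X Y A)\<inverse>"
    unfolding adjoint_relation_def converse_iff mem_Collect_eq case_prod_conv Ball_def split_paired_All
    by metis
qed

lemma relpow_converse: "((A :: 'a rel)\<inverse>) ^^ n = (A ^^ n)\<inverse>"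
  by (induction n) (simp_all add: converse_relcomp[symmetric] relpow_commute)

context hilbert
begin

section \<open>Graphs of everywhere defined operators and their square roots\<close>

definition gr :: "('v \<Rightarrow> 'v) \<Rightarrow> 'v rel" where
  "gr T = {(x, T x) | x. x \<in> car X}"

lemma gr_iff [simp]: "(x, y) \<in> gr T \<longleftrightarrow> x \<in> car X \<and> y = T x"
  by (auto simp: gr_def)

lemma gr_cong: "(\<And>x. x \<in> car X \<Longrightarrow> T x = U x) \<Longrightarrow> gr T = gr U"
  by (auto simp: gr_def)

lemma linear_relation_gr: "linop T \<Longrightarrow> linear_relation X X (gr T)"
  by (auto simp: linear_relation_def linop_def linop_0 linop_scale intro!: subspace_relI)

lemma linear_relation_gr_converse: "linop T \<Longrightarrow> linear_relation X X ((gr T)\<inverse>)"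
  using linear_relation_gr[of T] by (auto simp: linear_relation_def intro: subspace_rel_converse)

lemma adjoint_gr: "linop T \<Longrightarrow> symm_op T \<Longrightarrow> adjoint_relation X X (gr T) = gr T"
proof (intro set_eqI, clarify)
  fix y x
  assume T: "linop T" "symm_op T"
  show "(y, x) \<in> adjoint_relation X X (gr T) \<longleftrightarrow> (y, x) \<in> gr T"
  proof
    assume "(y, x) \<in> adjoint_relation X X (gr T)"
    then have *: "y \<in> car X" "x \<in> car X" "\<And>u. u \<in> car X \<Longrightarrow> ip X (T u) y = ip X u x"
      by (auto simp: adjoint_relation_def)
    then have "x = T y" using T by (intro ip_eqI) (auto simp: linop_mem symm_op_def)
    then show "(y, x) \<in> gr T" using * by simp
  qed (use T in \<open>auto simp: adjoint_relation_def linop_mem symm_op_def\<close>)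
qed

text \<open>A vector orthogonal to the range of a symmetric \<open>T\<close> is annihilated by
  \<open>T\<close>.\<close>

lemma dense_in_range:
  assumes T: "linop T" "symm_op T" and inj: "\<And>x. x \<in> car X \<Longrightarrow> T x = 0 \<Longrightarrow> x = 0"
  shows "dense_in (T ` car X)"
proof (rule dense_if_trivial_complement)
  show "T ` car X \<subseteq> car X" using T by (auto simp: linop_mem)
  show "complex_vector.subspace (T ` car X)"
    unfolding complex_vector.subspace_def
  proof (intro conjI ballI allI)
    show "0 \<in> T ` car X" using linop_0[OF T(1)] by (metis image_eqI zero_mem)
    show "x + y \<in> T ` car X" if "x \<in> T ` car X" "y \<in> T ` car X" for x y
      using that linop_add[OF T(1)] by (metis (no_types, lifting) add_mem image_iff)
    show "c *\<^sub>C x \<in> T ` car X" if "x \<in> T ` car X" for c x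
      using that linop_scale[OF T(1)] by (metis (no_types, lifting) scale_mem image_iff)
  qed
  fix y assume y: "y \<in> car X" "\<And>u. u \<in> T ` car X \<Longrightarrow> ip X y u = 0"
  have m: "T y \<in> car X" using T y by (simp add: linop_mem)
  have "ip X (T y) (T y) = 0" using T(2) y m unfolding symm_op_def by auto
  then have "ipnorm X (T y) = 0" by (simp add: ipnorm_def)
  then show "y = 0" using inj y m by simp
qed

lemma selfadjoint_gr: "linop T \<Longrightarrow> symm_op T \<Longrightarrow> selfadjoint_operator X (gr T)"
proof -
  assume T: "linop T" "symm_op T"
  have "Domain (gr T) = car X" by auto
  then have "densely_defined X (gr T)"
    by (auto simp: densely_defined_def dense_subset_iff dense_in_def intro: cvg_const)
  then show ?thesis
    using linear_relation_gr[OF T(1)] adjoint_gr[OF T]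
    by (auto simp: selfadjoint_operator_def linear_operator_def single_valued_def)
qed

lemma selfadjoint_gr_converse:
  assumes T: "linop T" "symm_op T" and inj: "\<And>x. x \<in> car X \<Longrightarrow> T x = 0 \<Longrightarrow> x = 0"
  shows "selfadjoint_operator X ((gr T)\<inverse>)"
proof -
  have "Domain ((gr T)\<inverse>) = T ` car X" by auto
  then have d: "densely_defined X ((gr T)\<inverse>)"
    using dense_in_range[OF T inj] by (simp add: densely_defined_def dense_subset_iff)
  have "x = y" if "x \<in> car X" "y \<in> car X" "T x = T y" for x y
    using inj[of "x - y"] that T by (simp add: linop_diff)
  then show ?thesis
    using d linear_relation_gr_converse[OF T(1)] adjoint_gr[OF T]
    by (auto simp: selfadjoint_operator_def linear_operator_def single_valued_def adjoint_converse)
qed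

text \<open>\<open>Q O Q\<close> is everywhere defined, so \<open>Q\<close> is. By symmetry a
  \<open>y\<close> with \<open>(0, y)\<close> in \<open>Q\<close> is orthogonal to the whole domain,
  hence zero. Thus \<open>Q\<close> is the graph of a function and \<open>sqrt_unique\<close>
  applies to it.\<close>

lemma sqrt_relation_unique:
  assumes B: "pos_op B" and inj: "\<And>x. x \<in> car X \<Longrightarrow> B x = 0 \<Longrightarrow> x = 0"
    and Q: "linear_relation X X Q" "Q \<subseteq> adjoint_relation X X Q" "nonneg_operator X Q"
    and QQ: "Q O Q = gr (\<lambda>x. B (B x))"
  shows "Q = gr B"
proof -
  have sub: "complex_vector.subspace Q" and QX: "\<And>x y. (x, y) \<in> Q \<Longrightarrow> x \<in> car X \<and> y \<in> car X"
    using Q(1) by (auto simp: linear_relation_def)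
  have dom: "\<exists>y. (x, y) \<in> Q" if "x \<in> car X" for x
  proof -
    have "(x, B (B x)) \<in> Q O Q" using that QQ by simp
    then show ?thesis by auto
  qed
  have symQ: "ip X v y = ip X u x" if "(u, v) \<in> Q" "(y, x) \<in> Q" for u v x y
    using Q(2) that by (fastforce simp: adjoint_relation_def)
  have "y = 0" if "(0, y) \<in> Q" for y
  proof (rule ip_eqI)
    fix z assume "z \<in> car X"
    then obtain w where w: "(z, w) \<in> Q" using dom by blast
    then show "ip X z y = ip X z 0" using symQ[OF w that] QX by simp
  qed (use QX that in auto)
  then have sv: "y = y'" if "(x, y) \<in> Q" "(x, y') \<in> Q" for x y y'
    using subspace_rel_diff[OF sub that] by fastforce
  define q where "q x = (THE y. (x, y) \<in> Q)" for x
  have q: "(x, y) \<in> Q \<longleftrightarrow> x \<in> car X \<and> y = q x" for x y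
    unfolding q_def using dom sv QX by (metis the_equality)
  have ql: "linop q"
    unfolding linop_def
  proof (intro conjI ballI allI)
    show "q x \<in> car X" if "x \<in> car X" for x using QX q that by blast
    show "q (x + y) = q x + q y" if "x \<in> car X" "y \<in> car X" for x y
      using subspace_rel_add[OF sub, of x "q x" y "q y"] q that by simp
    show "q (a *\<^sub>C x) = a *\<^sub>C q x" if "x \<in> car X" for a x
      using subspace_rel_scale[OF sub, of x "q x" a] q that by simp
  qed
  have qs: "symm_op q" using symQ q by (auto simp: symm_op_def)
  have qp: "0 \<le> Re (ip X x (q x))" if "x \<in> car X" for x
    using Q(3) q that by (fastforce simp: nonneg_operator_def)
  have qq: "q (q x) = B (B x)" if "x \<in> car X" for x
  proof -
    have "(x, q (q x)) \<in> Q O Q" using q that linop_mem[OF ql] by blast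
    then show ?thesis using QQ by simp
  qed
  have "q x = B x" if "x \<in> car X" for x by (rule sqrt_unique[OF B inj ql qs qp qq that])
  then show ?thesis using q by (auto simp: gr_def)
qed

lemma sqrt_operator_gr:
  assumes B: "pos_op B" and inj: "\<And>x. x \<in> car X \<Longrightarrow> B x = 0 \<Longrightarrow> x = 0"
  shows "sqrt_operator X (gr (\<lambda>x. B (B x))) = gr B"
  unfolding sqrt_operator_def
proof (rule the_equality)
  have lin: "linop B" and sym: "symm_op B" using B by (auto simp: pos_opD)
  have "gr B O gr B = gr (\<lambda>x. B (B x))" using lin by (auto simp: linop_mem relcomp_unfold)
  moreover have "nonneg_operator X (gr B)" using B by (auto simp: nonneg_operator_def pos_op_def)
  ultimately show "selfadjoint_operator X (gr B) \<and> nonneg_operator X (gr B) \<and> gr B O gr B = gr (\<lambda>x. B (B x))"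
    using selfadjoint_gr[OF lin sym] by blast
next
  fix Q assume "selfadjoint_operator X Q \<and> nonneg_operator X Q \<and> Q O Q = gr (\<lambda>x. B (B x))"
  then show "Q = gr B"
    by (intro sqrt_relation_unique[OF B inj]) (auto simp: selfadjoint_operator_def linear_operator_def)
qed

text \<open>The converse of a nonnegative self-adjoint root is again symmetric and nonnegative and
  is a root of the bounded operator, which reduces uniqueness to
  \<open>sqrt_relation_unique\<close>.\<close>

lemma sqrt_operator_gr_converse:
  assumes B: "pos_op B" and inj: "\<And>x. x \<in> car X \<Longrightarrow> B x = 0 \<Longrightarrow> x = 0"
  shows "sqrt_operator X ((gr (\<lambda>x. B (B x)))\<inverse>) = (gr B)\<inverse>"
  unfolding sqrt_operator_def
proof (rule the_equality)
  have lin: "linop B" and sym: "symm_op B" using B by (auto simp: pos_opD)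
  have "(gr B)\<inverse> O (gr B)\<inverse> = (gr (\<lambda>x. B (B x)))\<inverse>" using lin by (auto simp: linop_mem relcomp_unfold)
  moreover have "nonneg_operator X ((gr B)\<inverse>)" using B by (auto simp: nonneg_operator_def pos_op_def symm_op_def)
  ultimately show "selfadjoint_operator X ((gr B)\<inverse>) \<and> nonneg_operator X ((gr B)\<inverse>) \<and>
      (gr B)\<inverse> O (gr B)\<inverse> = (gr (\<lambda>x. B (B x)))\<inverse>"
    using selfadjoint_gr_converse[OF lin sym inj] by blast
next
  fix Q assume Q: "selfadjoint_operator X Q \<and> nonneg_operator X Q \<and> Q O Q = (gr (\<lambda>x. B (B x)))\<inverse>"
  have lr: "linear_relation X X Q" and adj: "adjoint_relation X X Q = Q"
    using Q by (auto simp: selfadjoint_operator_def linear_operator_def)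
  have "0 \<le> Re (ip X y x)" if xy: "(x, y) \<in> Q" for x y
  proof -
    have "x \<in> car X" "y \<in> car X" using lr xy by (auto simp: linear_relation_def)
    then have "Re (ip X y x) = Re (ip X x y)" using ip_cnj[of x y] by simp
    then show ?thesis using Q xy by (fastforce simp: nonneg_operator_def)
  qed
  then have "nonneg_operator X (Q\<inverse>)" by (auto simp: nonneg_operator_def)
  moreover have "Q\<inverse> O Q\<inverse> = gr (\<lambda>x. B (B x))"
    using Q by (metis converse_converse converse_relcomp)
  moreover have "linear_relation X X (Q\<inverse>)" using lr by (auto simp: linear_relation_def intro: subspace_rel_converse)
  ultimately have "Q\<inverse> = gr B"
    by (intro sqrt_relation_unique[OF B inj]) (auto simp: adjoint_converse adj)
  then show "Q = (gr B)\<inverse>" by auto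
qed

section \<open>Powers of an operator\<close>

lemma linop_funpow: "linop T \<Longrightarrow> linop (T ^^ n)"
  by (induction n) (auto simp: linop_def)

lemma bounded_op_funpow: "bounded_op T \<Longrightarrow> bounded_op (T ^^ n)"
proof (induction n)
  case 0
  then show ?case using bounded_op_id by (simp add: id_def)
next
  case (Suc n)
  then show ?case using bounded_op_comp[of T "T ^^ n"] by (simp add: comp_def)
qed

lemma symm_op_funpow: "linop T \<Longrightarrow> symm_op T \<Longrightarrow> symm_op (T ^^ n)"
proof (induction n)
  case (Suc n)
  show ?case
    unfolding symm_op_def
  proof (intro ballI)
    fix x y assume xy: "x \<in> car X" "y \<in> car X"
    have "ip X (T ((T ^^ n) x)) y = ip X ((T ^^ n) x) (T y)"
      using Suc xy linop_mem[OF linop_funpow[OF Suc.prems(1)] xy(1)] by (simp add: symm_op_def)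
    also have "\<dots> = ip X x ((T ^^ n) (T y))" using Suc xy by (simp add: symm_op_def linop_mem)
    finally show "ip X ((T ^^ Suc n) x) y = ip X x ((T ^^ Suc n) y)" by (simp add: funpow_swap1)
  qed
qed (simp add: symm_op_def)

text \<open>Induction in steps of two: symmetry moves one factor to the left, so the form of
  \<open>T ^^ (k + 2)\<close> at \<open>x\<close> is the form of \<open>T ^^ k\<close> at
  \<open>T x\<close>.\<close>

lemma pos_op_funpow: assumes T: "pos_op T" shows "pos_op (T ^^ n)"
proof -
  have lin: "linop T" and sym: "symm_op T" using T by (auto simp: pos_opD)
  have "0 \<le> Re (ip X x ((T ^^ n) x))" if "x \<in> car X" for x
    using that
  proof (induction n arbitrary: x rule: less_induct)
    case (less n)
    consider "n = 0" | "n = 1" | k where "n = Suc (Suc k)" by (metis One_nat_def not0_implies_Suc)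
    then show ?case
    proof cases
      case 3
      have m: "(T ^^ k) (T x) \<in> car X" "T x \<in> car X"
        using linop_funpow[OF lin] lin less.prems by (auto simp: linop_mem)
      have "ip X x ((T ^^ n) x) = ip X (T x) ((T ^^ k) (T x))"
        using 3 sym m less.prems by (simp add: symm_op_def funpow_swap1)
      then show ?thesis using less.IH[of k "T x"] 3 m by simp
    qed (use less T in \<open>auto simp: pos_op_def\<close>)
  qed
  then show ?thesis
    using T by (simp add: pos_op_def bounded_op_funpow symm_op_funpow lin)
qed

lemma inj_funpow:
  assumes "linop T" "\<And>x. x \<in> car X \<Longrightarrow> T x = 0 \<Longrightarrow> x = 0" "x \<in> car X" "(T ^^ n) x = 0"
  shows "x = 0"
  using assms(4) by (induction n) (use assms linop_mem[OF linop_funpow[OF assms(1)]] in auto)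

lemma funpow_square:
  assumes P: "linop P" "\<And>x. x \<in> car X \<Longrightarrow> P (P x) = R x" and x: "x \<in> car X"
  shows "(P ^^ n) ((P ^^ n) x) = (R ^^ n) x"
proof (induction n)
  case (Suc n)
  have m: "(P ^^ n) ((P ^^ n) x) \<in> car X" using linop_mem[OF linop_funpow[OF P(1)]] x by blast
  have "(P ^^ Suc n) ((P ^^ Suc n) x) = P (P ((P ^^ n) ((P ^^ n) x)))" by (simp add: funpow_swap1)
  also have "\<dots> = R ((R ^^ n) x)" using P(2)[OF m] Suc by simp
  finally show ?case by simp
qed simp

text \<open>The exponent 0 is excluded because the zeroth relational power is the identity on the
  whole type, not on the carrier.\<close>

lemma relpow_gr: "linop T \<Longrightarrow> gr T ^^ Suc n = gr (T ^^ Suc n)"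
proof (induction n)
  case 0
  then show ?case by auto
next
  case (Suc n)
  have "gr T ^^ Suc (Suc n) = gr T O gr T ^^ Suc n" by (simp only: relpow.simps(2)[of "Suc n"] relpow_commute)
  also have "\<dots> = gr T O gr (T ^^ Suc n)" by (simp only: Suc)
  also have "\<dots> = gr (T ^^ Suc (Suc n))"
    using linop_mem[OF Suc.prems] by (auto simp: relcomp_unfold funpow_swap1)
  finally show ?case .
qed

text \<open>If no bound works, suitable vectors rescaled to \<open>|T u| = 1\<close> tend to zero.
  The resolvent set is defined by sequential continuity, and this turns it into a norm
  bound.\<close>

lemma bounded_op_if_continuous:
  assumes T: "linop T" and cont: "\<And>u. cvg X u 0 \<Longrightarrow> cvg X (\<lambda>i. T (u i)) 0"
  shows "bounded_op T"
proof (rule ccontr)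
  assume "\<not> bounded_op T"
  then have "\<exists>x\<in>car X. real (Suc n) * ipnorm X x < ipnorm X (T x)" for n
    using T by (force simp: bounded_op_def not_le)
  then obtain x where x: "\<And>n. x n \<in> car X" "\<And>n. real (Suc n) * ipnorm X (x n) < ipnorm X (T (x n))"
    by metis
  define r where "r n = ipnorm X (T (x n))" for n
  have r: "r n > 0" for n using x(2)[of n] x(1)[of n] by (smt (verit) norm_ge_0 mult_nonneg_nonneg of_nat_0_le_iff r_def)
  define u where "u n = of_real (1 / r n) *\<^sub>C x n" for n
  have "cvg X u 0"
  proof (rule cvg_bound[where e = "\<lambda>n. 1 / real (Suc n)"])
    show "ipnorm X (u n - 0) \<le> 1 / real (Suc n)" for n
    proof -
      have "ipnorm X (u n) = ipnorm X (x n) / r n" using x(1) r[of n] by (simp add: u_def norm_scale norm_divide)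
      moreover have "real (Suc n) * ipnorm X (x n) \<le> r n" using x(2)[of n] by (simp add: r_def)
      ultimately show ?thesis using r[of n] by (simp add: pos_divide_le_eq pos_le_divide_eq mult.commute del: of_nat_Suc)
    qed
    show "(\<lambda>n. 1 / real (Suc n)) \<longlonglongrightarrow> 0"
      using LIMSEQ_inverse_real_of_nat by (simp add: inverse_eq_divide)
  qed (use x in \<open>auto simp: u_def\<close>)
  then have "(\<lambda>n. ipnorm X (T (u n))) \<longlonglongrightarrow> 0" using cvg_norm[OF cont] by fastforce
  moreover have "ipnorm X (T (u n)) = 1" for n
    using x(1) r[of n] T by (simp add: u_def linop_scale norm_scale linop_mem norm_divide flip: r_def)
  ultimately show False by (simp add: LIMSEQ_const_iff)
qed

text \<open>The origin of the parametrisation by \<open>s = (L - z) x\<close>: since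
  \<open>(L - z)\<inverse>\<close> is everywhere defined, all of \<open>L\<close> is swept out by
  \<open>s\<close> in the carrier. \<open>R\<close> is symmetric because \<open>z\<close> is real
  and injective because \<open>L\<close> is single valued.\<close>

lemma resolvent_representation:
  assumes L: "selfadjoint_operator X L" and z: "of_real z \<in> resolvent_set X L"
  obtains R where "bounded_op R" "symm_op R" "\<And>s. s \<in> car X \<Longrightarrow> R s = 0 \<Longrightarrow> s = 0"
    "L = {(R s, s + of_real z *\<^sub>C R s) | s. s \<in> car X}"
proof -
  define T where "T = resolvent L (of_real z)"
  have T: "(s, x) \<in> T \<longleftrightarrow> (x, s + of_real z *\<^sub>C x) \<in> L" for s x
    by (auto simp: T_def resolvent_def rel_shift_def algebra_simps)
  have b: "linear_operator X X T" "Domain T = car X"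
    "\<And>u v. (\<And>i. (u i, v i) \<in> T) \<Longrightarrow> cvg X u 0 \<Longrightarrow> cvg X v 0"
    using z by (auto simp: resolvent_set_def T_def bounded_everywhere_defined_def ip_converges_iff_cvg)
  have sub: "complex_vector.subspace T" and TX: "T \<subseteq> car X \<times> car X" and sv: "single_valued T"
    using b(1) by (auto simp: linear_operator_def linear_relation_def)
  define R where "R s = (THE x. (s, x) \<in> T)" for s
  have R: "(s, x) \<in> T \<longleftrightarrow> s \<in> car X \<and> x = R s" for s x
  proof
    assume "(s, x) \<in> T"
    then show "s \<in> car X \<and> x = R s" using TX sv unfolding R_def by (auto simp: single_valued_def intro!: the_equality[symmetric])
  next
    assume *: "s \<in> car X \<and> x = R s"
    then obtain x' where x': "(s, x') \<in> T" using b(2) by blast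
    then have "R s = x'" unfolding R_def using sv by (auto simp: single_valued_def)
    then show "(s, x) \<in> T" using * x' by simp
  qed
  have lin: "linop R"
    unfolding linop_def
  proof (intro conjI ballI allI)
    show "R x \<in> car X" if "x \<in> car X" for x using TX R that by blast
    show "R (x + y) = R x + R y" if "x \<in> car X" "y \<in> car X" for x y
      using subspace_rel_add[OF sub, of x "R x" y "R y"] R that by simp
    show "R (a *\<^sub>C x) = a *\<^sub>C R x" if "x \<in> car X" for a x
      using subspace_rel_scale[OF sub, of x "R x" a] R that by simp
  qed
  have "cvg X (\<lambda>i. R (u i)) 0" if u: "cvg X u 0" for u
    by (rule b(3)[OF _ u]) (use u R in \<open>auto simp: cvg_def\<close>)
  then have bd: "bounded_op R" by (rule bounded_op_if_continuous[OF lin])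
  have Leq: "(x, y) \<in> L \<longleftrightarrow> (\<exists>s\<in>car X. x = R s \<and> y = s + of_real z *\<^sub>C R s)" for x y
  proof
    assume "(x, y) \<in> L"
    then have "(y - of_real z *\<^sub>C x, x) \<in> T" by (simp add: T)
    then show "\<exists>s\<in>car X. x = R s \<and> y = s + of_real z *\<^sub>C R s" using R by force
  qed (use R T in blast)
  have Ladj: "ip X v y = ip X u x" if "(u, v) \<in> L" "(y, x) \<in> L" for u v x y
    using L that by (force simp: selfadjoint_operator_def adjoint_relation_def)
  have "symm_op R"
    unfolding symm_op_def
  proof (intro ballI)
    fix s t assume st: "s \<in> car X" "t \<in> car X"
    then have m: "R s \<in> car X" "R t \<in> car X" using lin by (auto simp: linop_mem)
    have "ip X (s + of_real z *\<^sub>C R s) (R t) = ip X (R s) (t + of_real z *\<^sub>C R t)"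
      by (rule Ladj) (use st Leq in auto)
    then show "ip X (R s) t = ip X s (R t)" using st m by (simp add: ip_linear)
  qed
  moreover have "s = 0" if s: "s \<in> car X" "R s = 0" for s
  proof -
    have "(0, s) \<in> L" using s Leq[of 0 s] by (force simp: complex_vector.scale_zero_right)
    moreover have "(0, 0) \<in> L" using Leq[of 0 0] linop_0[OF lin] by (force simp: complex_vector.scale_zero_right)
    ultimately show "s = 0" using L by (auto simp: selfadjoint_operator_def linear_operator_def single_valued_def)
  qed
  moreover have "L = {(R s, s + of_real z *\<^sub>C R s) | s. s \<in> car X}" using Leq by auto
  ultimately show thesis using that bd by blast
qed

text \<open>
  If the best lower bound \<open>b\<close> of \<open>L\<close> were at most \<open>z\<close>, then \<open>b\<close> would lie in the resolvent set, and the
  Cauchy--Schwarz inequality for the nonnegative operator \<open>(L - b)\<inverse>\<close> would improve the bound.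
\<close>

lemma lower_bound_of_spectrum:
  assumes L: "selfadjoint_operator X L" and lower: "lower_semibounded X L"
    and res: "\<And>t. t \<le> z \<Longrightarrow> of_real t \<in> resolvent_set X L" and xy: "(x, y) \<in> L"
  shows "z * (ipnorm X x)\<^sup>2 \<le> Re (ip X x y)"
proof -
  have LX: "x \<in> car X \<and> y \<in> car X" if "(x, y) \<in> L" for x y
    using L that by (auto simp: selfadjoint_operator_def linear_operator_def linear_relation_def)
  \<comment> \<open>\<open>A\<close> consists of all lower bounds of the form; it is nonempty and
    closed downwards, so it is bounded above by \<open>z\<close> once \<open>z\<close> is not in
    it.\<close>
  define A where "A = {a. \<forall>(x, y)\<in>L. a * (ipnorm X x)\<^sup>2 \<le> Re (ip X x y)}"
  have down: "a \<in> A" if "b \<in> A" "a \<le> b" for a b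
    unfolding A_def
  proof (clarify)
    fix x y assume "(x, y) \<in> L"
    then have "b * (ipnorm X x)\<^sup>2 \<le> Re (ip X x y)" using that(1) by (auto simp: A_def)
    moreover have "a * (ipnorm X x)\<^sup>2 \<le> b * (ipnorm X x)\<^sup>2" using that(2) by (intro mult_right_mono) auto
    ultimately show "a * (ipnorm X x)\<^sup>2 \<le> Re (ip X x y)" by linarith
  qed
  obtain a0 where a0: "a0 \<in> A" using lower by (auto simp: lower_semibounded_def A_def)
  have "z \<in> A"
  proof (rule ccontr)
    assume z: "z \<notin> A"
    have ub: "a \<le> z" if "a \<in> A" for a using down[OF that, of z] z by force
    have bdd: "bdd_above A" by (rule bdd_aboveI[OF ub])
    define b where "b = Sup A"
    have "b \<le> z" unfolding b_def using a0 ub by (intro cSup_least) auto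
    have b: "b * (ipnorm X x)\<^sup>2 \<le> Re (ip X x y)" if xy: "(x, y) \<in> L" for x y
    proof (cases "x = 0")
      case True
      then show ?thesis using LX[OF xy] by simp
    next
      case False
      then have pos: "0 < (ipnorm X x)\<^sup>2" using LX[OF xy] by simp
      have "b \<le> Re (ip X x y) / (ipnorm X x)\<^sup>2"
        unfolding b_def using a0 xy pos by (intro cSup_least) (auto simp: A_def pos_le_divide_eq)
      then show ?thesis using pos by (simp add: pos_le_divide_eq)
    qed
    obtain R where R: "bounded_op R" "symm_op R" "L = {(R s, s + of_real b *\<^sub>C R s) | s. s \<in> car X}"
      by (rule resolvent_representation[OF L res[OF \<open>b \<le> z\<close>]]) blast
    have Rl: "linop R" using R by (simp add: bounded_op_linop)
    have split: "Re (ip X (R s) (s + of_real b *\<^sub>C R s)) = Re (ip X s (R s)) + b * (ipnorm X (R s))\<^sup>2" if "s \<in> car X" for s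
      using that R(2) linop_mem[OF Rl that] by (simp add: ip_linear symm_op_def norm_sq)
    have "0 \<le> Re (ip X s (R s))" if "s \<in> car X" for s
      using b[of "R s" "s + of_real b *\<^sub>C R s"] R(3) split[OF that] that by auto
    then have pos: "pos_op R" using R by (simp add: pos_op_def)
    obtain c where c: "c > 0" "\<And>x. x \<in> car X \<Longrightarrow> ipnorm X (R x) \<le> c * ipnorm X x"
      using R(1) by (auto simp: bounded_op_def)
    \<comment> \<open>\<open>pos_op_norm_bound\<close> bounds \<open>|R s|^2 / c\<close> by the form
      of \<open>R\<close> at \<open>s\<close>; with \<open>x = R s\<close> this says that
      \<open>L - b\<close> is bounded below by \<open>1 / c\<close>.\<close>
    have "b + 1 / c \<in> A"
      unfolding A_def
    proof (clarify)
      fix x y assume "(x, y) \<in> L"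
      then obtain s where s: "s \<in> car X" "x = R s" "y = s + of_real b *\<^sub>C R s" using R(3) by blast
      have "(ipnorm X (R s))\<^sup>2 / c \<le> Re (ip X s (R s))"
        using pos_op_norm_bound[OF pos c(2) s(1)] c(1) by (simp add: pos_divide_le_eq mult.commute)
      then show "(b + 1 / c) * (ipnorm X x)\<^sup>2 \<le> Re (ip X x y)"
        using split[OF s(1)] s by (simp add: distrib_right)
    qed
    then have "b + 1 / c \<le> b" unfolding b_def using bdd by (rule cSup_upper)
    then show False using c(1) by simp
  qed
  then show ?thesis using xy by (auto simp: A_def)
qed

text \<open>All real numbers up to \<open>z\<close> lie in the resolvent set, which makes
  \<open>R = (L - z)\<inverse>\<close> nonnegative. Every half power is then a power of its root
  \<open>P\<close>, with a converse for nonnegative exponents.\<close>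

lemma b_half_representation:
  assumes L: "selfadjoint_operator X L" and lower: "lower_semibounded X L"
    and z: "ereal z < (INF w\<in>spectrum_set X L. ereal (Re w))"
  obtains P R where "pos_op P" "linop R" "symm_op R" "\<And>x. x \<in> car X \<Longrightarrow> P (P x) = R x"
    "\<And>x. x \<in> car X \<Longrightarrow> R x = 0 \<Longrightarrow> x = 0" "L = {(R s, s + of_real z *\<^sub>C R s) | s. s \<in> car X}"
    "\<And>n. b_half X L z n = (if 0 \<le> n then (gr (P ^^ nat n))\<inverse> else gr (P ^^ nat (- n)))"
proof -
  have res: "of_real t \<in> resolvent_set X L" if "t \<le> z" for t
  proof (rule ccontr)
    assume "of_real t \<notin> resolvent_set X L"
    then have "(INF w\<in>spectrum_set X L. ereal (Re w)) \<le> ereal (Re (complex_of_real t))"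
      by (intro INF_lower) (simp add: spectrum_set_def)
    then have "ereal z < ereal t" using z by (metis Re_complex_of_real less_le_trans)
    then show False using that by simp
  qed
  obtain R where R: "bounded_op R" "symm_op R" "\<And>s. s \<in> car X \<Longrightarrow> R s = 0 \<Longrightarrow> s = 0"
    "L = {(R s, s + of_real z *\<^sub>C R s) | s. s \<in> car X}"
    by (rule resolvent_representation[OF L res[OF order_refl]]) blast
  have Rl: "linop R" using R by (simp add: bounded_op_linop)
  have "0 \<le> Re (ip X s (R s))" if s: "s \<in> car X" for s
  proof -
    have "z * (ipnorm X (R s))\<^sup>2 \<le> Re (ip X (R s) (s + of_real z *\<^sub>C R s))"
      by (rule lower_bound_of_spectrum[OF L lower res]) (use R(4) s in auto)
    then show ?thesis using s R(2) linop_mem[OF Rl s] by (simp add: ip_linear symm_op_def norm_sq)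
  qed
  then have "pos_op R" using R by (simp add: pos_op_def)
  then obtain P where P: "pos_op P" "\<And>x. x \<in> car X \<Longrightarrow> P (P x) = R x"
    by (rule sqrt_exists) blast
  have Pl: "linop P" using P by (simp add: pos_opD)
  have Pinj: "x = 0" if "x \<in> car X" "P x = 0" for x
    using R(3)[of x] P(2)[of x] that linop_0[OF Pl] by simp
  have shift: "rel_shift L (of_real z) = (gr R)\<inverse>"
  proof (intro set_eqI, clarify)
    fix x y
    have "(x, y) \<in> rel_shift L (of_real z) \<longleftrightarrow> (x, y + of_real z *\<^sub>C x) \<in> L"
      by (auto simp: rel_shift_def algebra_simps)
    also have "\<dots> \<longleftrightarrow> (x, y) \<in> (gr R)\<inverse>"
      unfolding R(4) by auto
    finally show "(x, y) \<in> rel_shift L (of_real z) \<longleftrightarrow> (x, y) \<in> (gr R)\<inverse>" .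
  qed
  \<comment> \<open>\<open>P ^^ n\<close> is a nonnegative injective operator with square
    \<open>R ^^ n\<close>, so it serves as the \<open>B\<close> of the two root lemmas.\<close>
  have pw: "gr (R ^^ n) = gr (\<lambda>x. (P ^^ n) ((P ^^ n) x))" for n
    by (rule gr_cong) (simp add: funpow_square[OF Pl P(2)])
  have sqrt_c: "sqrt_operator X ((gr (R ^^ k))\<inverse>) = (gr (P ^^ k))\<inverse>" for k
    unfolding pw by (rule sqrt_operator_gr_converse[OF pos_op_funpow[OF P(1)]]) (rule inj_funpow[OF Pl Pinj])
  have sqrt: "sqrt_operator X (gr (R ^^ k)) = gr (P ^^ k)" for k
    unfolding pw by (rule sqrt_operator_gr[OF pos_op_funpow[OF P(1)]]) (rule inj_funpow[OF Pl Pinj])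
  have b: "b_half X L z n = (if 0 \<le> n then (gr (P ^^ nat n))\<inverse> else gr (P ^^ nat (- n)))" for n
  proof -
    consider "n = 0" | k where "n = int (Suc k)" | k where "n = - int (Suc k)"
      by (metis int_cases3 gr0_implies_Suc)
    then show ?thesis
    proof cases
      \<comment> \<open>For exponent 0 \<open>int_power\<close> is the identity on the carrier,
        which equals both its root and its converse.\<close>
      case 1
      have "int_power X (rel_shift L (of_real z)) n = (gr (R ^^ 0))\<inverse>"
        using 1 by (auto simp: int_power_def)
      then show ?thesis using 1 sqrt_c[of 0] by (simp add: b_half_def)
    next
      case 2
      then have n: "nat n = Suc k" "0 < n" by auto
      have "int_power X (rel_shift L (of_real z)) n = (gr (R ^^ Suc k))\<inverse>"
        using n by (simp add: int_power_def shift relpow_converse relpow_gr[OF Rl] del: relpow.simps funpow.simps)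
      then show ?thesis
        using n sqrt_c[of "Suc k"] by (simp add: b_half_def del: funpow.simps)
    next
      case 3
      then have n: "nat (- n) = Suc k" "n < 0" by auto
      have "int_power X (rel_shift L (of_real z)) n = gr (R ^^ Suc k)"
        using n by (simp add: int_power_def shift relpow_converse relpow_gr[OF Rl] del: relpow.simps funpow.simps)
      then show ?thesis
        using n sqrt[of "Suc k"] by (simp add: b_half_def del: funpow.simps)
    qed
  qed
  show thesis by (rule that[OF P(1) Rl R(2) P(2) R(3) R(4) b])
qed

end

section \<open>Unitary extension of isometric relations\<close>

text \<open>Abstracts the half power regarded as a map from \<open>H n\<close> to
  \<open>H 0\<close>: defined on a dense subspace, with dense range, and preserving inner products.
  Its closure is then unitary.\<close>

locale isometric_relation = X: hilbert X + Y: hilbert Y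
  for X :: "'v::complex_vector ipspace" and Y :: "'w::complex_vector ipspace" +
  fixes E :: "('v \<times> 'w) set"
  assumes linear: "linear_relation X Y E"
    and dense_Domain: "X.dense_in (Domain E)"
    and dense_Range: "Y.dense_in (Range E)"
    and isometric: "(x, y) \<in> E \<Longrightarrow> (x', y') \<in> E \<Longrightarrow> ip X x x' = ip Y y y'"
begin

abbreviation "F \<equiv> continuous_extension X Y E"
abbreviation "V \<equiv> rel_app F"

lemma E_mem: "(x, y) \<in> E \<Longrightarrow> x \<in> car X" "(x, y) \<in> E \<Longrightarrow> y \<in> car Y"
  and E_subspace: "complex_vector.subspace E"
  using linear by (auto simp: linear_relation_def)

lemma F_iff: "(x, y) \<in> F \<longleftrightarrow> (\<exists>u v. (\<forall>i. (u i, v i) \<in> E) \<and> cvg X u x \<and> cvg Y v y)"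
  by (simp add: continuous_extension_def X.ip_converges_iff_cvg Y.ip_converges_iff_cvg)

lemma E_subset_F: "(x, y) \<in> E \<Longrightarrow> (x, y) \<in> F"
  unfolding F_iff using E_mem
  by (intro exI[of _ "\<lambda>_. x"] exI[of _ "\<lambda>_. y"]) (auto intro: X.cvg_const Y.cvg_const)

lemma norm_E: "(x, y) \<in> E \<Longrightarrow> ipnorm X x = ipnorm Y y"
  using isometric by (simp add: ipnorm_def)

text \<open>An isometry maps an approximating sequence to a Cauchy sequence, which converges by
  completeness of the target.\<close>

lemma F_total: assumes "x \<in> car X" shows "\<exists>y. (x, y) \<in> F"
proof -
  obtain u where u: "\<And>i. u i \<in> Domain E" "cvg X u x"
    using dense_Domain assms unfolding X.dense_in_def by blast
  then have "\<forall>i. \<exists>v. (u i, v) \<in> E" by blast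
  then obtain v where v: "\<And>i. (u i, v i) \<in> E" by metis
  have "\<exists>y. cvg Y v y"
  proof (rule Y.complete)
    fix e :: real assume "e > 0"
    then obtain N where "\<And>i j. i \<ge> N \<Longrightarrow> j \<ge> N \<Longrightarrow> ipnorm X (u i - u j) < e"
      using X.cvg_Cauchy[OF u(2)] by blast
    moreover have "ipnorm X (u i - u j) = ipnorm Y (v i - v j)" for i j
      by (rule norm_E[OF subspace_rel_diff[OF E_subspace v v]])
    ultimately show "\<exists>N. \<forall>i\<ge>N. \<forall>j\<ge>N. ipnorm Y (v i - v j) < e" by auto
  qed (use E_mem v in blast)
  then show ?thesis using u v F_iff by blast
qed

lemma F_onto: assumes "y \<in> car Y" shows "\<exists>x. (x, y) \<in> F"
proof -
  obtain v where v: "\<And>i. v i \<in> Range E" "cvg Y v y"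
    using dense_Range assms unfolding Y.dense_in_def by blast
  then have "\<forall>i. \<exists>u. (u, v i) \<in> E" by blast
  then obtain u where u: "\<And>i. (u i, v i) \<in> E" by metis
  have "\<exists>x. cvg X u x"
  proof (rule X.complete)
    fix e :: real assume "e > 0"
    then obtain N where "\<And>i j. i \<ge> N \<Longrightarrow> j \<ge> N \<Longrightarrow> ipnorm Y (v i - v j) < e"
      using Y.cvg_Cauchy[OF v(2)] by blast
    moreover have "ipnorm X (u i - u j) = ipnorm Y (v i - v j)" for i j
      by (rule norm_E[OF subspace_rel_diff[OF E_subspace u u]])
    ultimately show "\<exists>N. \<forall>i\<ge>N. \<forall>j\<ge>N. ipnorm X (u i - u j) < e" by auto
  qed (use E_mem u in blast)
  then show ?thesis using u v F_iff by blast
qed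

lemma F_isometric: assumes "(x, y) \<in> F" "(x', y') \<in> F" shows "ip X x x' = ip Y y y'"
proof -
  obtain u v where uv: "\<And>i. (u i, v i) \<in> E" "cvg X u x" "cvg Y v y" using assms(1) F_iff by blast
  obtain u' v' where uv': "\<And>i. (u' i, v' i) \<in> E" "cvg X u' x'" "cvg Y v' y'" using assms(2) F_iff by blast
  have "(\<lambda>i. ip X (u i) (u' i)) \<longlonglongrightarrow> ip X x x'" by (rule X.cvg_ip[OF uv(2) uv'(2)])
  moreover have "(\<lambda>i. ip X (u i) (u' i)) \<longlonglongrightarrow> ip Y y y'"
    using Y.cvg_ip[OF uv(3) uv'(3)] isometric[OF uv(1) uv'(1)] by simp
  ultimately show ?thesis by (rule LIMSEQ_unique)
qed

lemma F_mem: "(x, y) \<in> F \<Longrightarrow> x \<in> car X" "(x, y) \<in> F \<Longrightarrow> y \<in> car Y"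
  unfolding F_iff cvg_def by auto

lemma F_add: "(x, y) \<in> F \<Longrightarrow> (x', y') \<in> F \<Longrightarrow> (x + x', y + y') \<in> F"
proof -
  assume "(x, y) \<in> F" "(x', y') \<in> F"
  then obtain u v u' v' where uv: "\<And>i. (u i, v i) \<in> E" "cvg X u x" "cvg Y v y"
    "\<And>i. (u' i, v' i) \<in> E" "cvg X u' x'" "cvg Y v' y'" unfolding F_iff by blast
  then show ?thesis
    unfolding F_iff
    by (intro exI[of _ "\<lambda>i. u i + u' i"] exI[of _ "\<lambda>i. v i + v' i"])
      (auto intro: X.cvg_add Y.cvg_add subspace_rel_add[OF E_subspace])
qed

lemma F_scale: "(x, y) \<in> F \<Longrightarrow> (a *\<^sub>C x, a *\<^sub>C y) \<in> F"
proof -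
  assume "(x, y) \<in> F"
  then obtain u v where uv: "\<And>i. (u i, v i) \<in> E" "cvg X u x" "cvg Y v y" unfolding F_iff by blast
  then show ?thesis
    unfolding F_iff
    by (intro exI[of _ "\<lambda>i. a *\<^sub>C u i"] exI[of _ "\<lambda>i. a *\<^sub>C v i"])
      (auto intro: X.cvg_scale Y.cvg_scale subspace_rel_scale[OF E_subspace])
qed

lemma F_unique: assumes "(x, y) \<in> F" "(x, y') \<in> F" shows "y = y'"
proof -
  have "(x - x, y - y') \<in> F"
    using F_add[OF assms(1) F_scale[OF assms(2), of "-1"]]
    by (simp add: complex_vector.scale_minus_left scaleC_one)
  then have "ip Y (y - y') (y - y') = 0" using F_isometric[of "x - x" "y - y'" "x - x"] by simp
  then have "ipnorm Y (y - y') = 0" by (simp add: ipnorm_def)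
  then show ?thesis using F_mem assms by simp
qed

lemma F_V: "(x, y) \<in> F \<longleftrightarrow> x \<in> car X \<and> y = V x"
proof
  assume *: "(x, y) \<in> F"
  then have "V x = y" unfolding rel_app_def using F_unique by blast
  then show "x \<in> car X \<and> y = V x" using * F_mem by blast
next
  assume *: "x \<in> car X \<and> y = V x"
  then obtain y' where y': "(x, y') \<in> F" using F_total by blast
  then have "V x = y'" unfolding rel_app_def using F_unique by blast
  then show "(x, y) \<in> F" using * y' by simp
qed

lemma V_E: "(x, y) \<in> E \<Longrightarrow> V x = y"
  using E_subset_F[of x y] F_V[of x y] by simp

lemma V_mem: "x \<in> car X \<Longrightarrow> V x \<in> car Y"
  using F_V F_mem by blast

lemma V_add: "x \<in> car X \<Longrightarrow> x' \<in> car X \<Longrightarrow> V (x + x') = V x + V x'"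
  using F_V F_add by metis

lemma V_scale: "x \<in> car X \<Longrightarrow> V (a *\<^sub>C x) = a *\<^sub>C V x"
  using F_V F_scale by metis

lemma V_ip: "x \<in> car X \<Longrightarrow> x' \<in> car X \<Longrightarrow> ip Y (V x) (V x') = ip X x x'"
  using F_V F_isometric by metis

lemma V_onto: "y \<in> car Y \<Longrightarrow> \<exists>x\<in>car X. V x = y"
  using F_V F_onto by metis

end

section \<open>The scale of spaces\<close>

text \<open>
  Here \<open>R = (L - z\<^sub>1)\<inverse>\<close> and \<open>P\<close> is its square root. The unitary maps \<open>V n\<close> from \<open>H n\<close> onto \<open>H 0\<close> turn
  the inclusion \<open>H (n + 1) \<subseteq> H n\<close> into \<open>P\<close> and the action of \<open>L\<close> on \<open>H n\<close> into \<open>L\<close>.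
\<close>

locale scale =
  fixes H :: "int \<Rightarrow> 'v::complex_vector ipspace"
    and L :: "'v rel"
    and z1 :: real
    and P R :: "'v \<Rightarrow> 'v"
  assumes scale: "hilbert_scale H L z1"
    and P: "hilbert.pos_op (H 0) P"
    and R: "hilbert.linop (H 0) R" "hilbert.symm_op (H 0) R"
    and PP: "x \<in> car (H 0) \<Longrightarrow> P (P x) = R x"
    and R_inj: "x \<in> car (H 0) \<Longrightarrow> R x = 0 \<Longrightarrow> x = 0"
    and L_eq: "L = {(R s, s + of_real z1 *\<^sub>C R s) | s. s \<in> car (H 0)}"
    and b_half: "b_half (H 0) L z1 n =
      (if 0 \<le> n then (hilbert.gr (H 0) (P ^^ nat n))\<inverse> else hilbert.gr (H 0) (P ^^ nat (- n)))"
begin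

lemma hilbert_H: "hilbert (H n)"
  using scale by unfold_locales (simp add: hilbert_scale_def)

sublocale H: hilbert "H n" for n
  by (rule hilbert_H)

abbreviation "b \<equiv> b_half (H 0) L z1"

lemma P_lin: "H.linop 0 P" and P_bounded: "H.bounded_op 0 P" and P_symm: "H.symm_op 0 P"
  using P by (auto simp: H.pos_opD)

lemma P_mem [simp]: "x \<in> car (H 0) \<Longrightarrow> P x \<in> car (H 0)"
  using P_lin by (rule H.linop_mem)

lemma R_mem [simp]: "x \<in> car (H 0) \<Longrightarrow> R x \<in> car (H 0)"
  using R(1) by (rule H.linop_mem)

lemma pow_lin: "H.linop 0 (P ^^ k)"
  using P_lin by (rule H.linop_funpow)

lemma pow_mem [simp]: "x \<in> car (H 0) \<Longrightarrow> (P ^^ k) x \<in> car (H 0)"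
  using pow_lin by (rule H.linop_mem)

lemma P_inj: "x \<in> car (H 0) \<Longrightarrow> P x = 0 \<Longrightarrow> x = 0"
  using R_inj[of x] PP[of x] H.linop_0[OF P_lin] by simp

lemma pow_0: "x \<in> car (H 0) \<Longrightarrow> (P ^^ k) x = 0 \<Longrightarrow> x = 0"
  by (rule H.inj_funpow[OF P_lin P_inj])

lemma pow_inj: "x \<in> car (H 0) \<Longrightarrow> y \<in> car (H 0) \<Longrightarrow> (P ^^ k) x = (P ^^ k) y \<Longrightarrow> x = y"
  using pow_0[of "x - y" k] H.linop_diff[OF pow_lin, of x y k] by simp

lemma pow_dense: "H.dense_in 0 ((P ^^ k) ` car (H 0))"
  by (rule H.dense_in_range[OF pow_lin H.symm_op_funpow[OF P_lin P_symm]]) (rule pow_0)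

lemma pow_R: "x \<in> car (H 0) \<Longrightarrow> (P ^^ k) (R x) = R ((P ^^ k) x)"
  by (simp flip: PP) (simp add: funpow_swap1)

lemma R_bounded: "H.bounded_op 0 R"
proof -
  obtain c where c: "c > 0" "\<And>x. x \<in> car (H 0) \<Longrightarrow> ipnorm (H 0) (P (P x)) \<le> c * ipnorm (H 0) x"
    using H.bounded_op_comp[OF P_bounded P_bounded] by (auto simp: H.bounded_op_def)
  then show ?thesis using R PP by (auto simp: H.bounded_op_def)
qed

text \<open>The intersection treats both signs at once: for \<open>n \<ge> 0\<close> the space
  \<open>H n\<close> is the domain and lies in \<open>H 0\<close>, while for \<open>n < 0\<close> it
  contains \<open>H 0\<close>, on all of which \<open>b n\<close> is defined.\<close>

lemma Domain_b: "Domain (b n) = car (H 0) \<inter> car (H n)"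
  and inclusion: "car (H (n + 1)) \<subseteq> car (H n)"
  and inclusion_cvg: "cvg (H (n + 1)) u x \<Longrightarrow> cvg (H n) u x"
  and dense_H0: "n < 0 \<Longrightarrow> H.dense_in n (car (H 0))"
  and ip_b: "f \<in> car (H 0) \<Longrightarrow> f \<in> car (H n) \<Longrightarrow> g \<in> car (H 0) \<Longrightarrow> g \<in> car (H n) \<Longrightarrow>
    ip (H n) f g = ip (H 0) (rel_app (b n) f) (rel_app (b n) g)"
proof -
  have nonneg: "car (H n) = Domain (b n)" if "0 \<le> n"
    using scale that unfolding hilbert_scale_def by blast
  show dense: "H.dense_in n (car (H 0))" if "n < 0"
    using scale that unfolding hilbert_scale_def H.dense_subset_iff by blast
  show "Domain (b n) = car (H 0) \<inter> car (H n)"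
  proof (cases "0 \<le> n")
    case True
    then have "Domain (b n) \<subseteq> car (H 0)" by (auto simp: b_half)
    then show ?thesis using nonneg[OF True] by auto
  next
    case False
    then show ?thesis using dense by (auto simp: b_half H.dense_in_def)
  qed
  show "car (H (n + 1)) \<subseteq> car (H n)" "cvg (H (n + 1)) u x \<Longrightarrow> cvg (H n) u x"
    using scale unfolding hilbert_scale_def H.ip_converges_iff_cvg by blast+
  show "ip (H n) f g = ip (H 0) (rel_app (b n) f) (rel_app (b n) g)"
    if "f \<in> car (H 0)" "f \<in> car (H n)" "g \<in> car (H 0)" "g \<in> car (H n)"
    using scale that unfolding hilbert_scale_def by blast
qed

lemma inclusion_add: "car (H (n + int k)) \<subseteq> car (H n)"
proof (induction k)
  case (Suc k)
  then show ?case using inclusion[of "n + int k"] by (simp add: add.assoc add.commute[of 1] subset_trans)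
qed simp

lemma inclusion_le: "n \<le> k \<Longrightarrow> x \<in> car (H k) \<Longrightarrow> x \<in> car (H n)"
  using inclusion_add[of n "nat (k - n)"] by auto

text \<open>One of \<open>nat n\<close> and \<open>nat (- n)\<close> is zero, so a single equation
  describes powers and inverse powers alike.\<close>

lemma b_iff: "(x, y) \<in> b n \<longleftrightarrow> x \<in> car (H 0) \<and> y \<in> car (H 0) \<and> (P ^^ nat n) y = (P ^^ nat (- n)) x"
  by (auto simp: b_half)

lemma rel_app_b: "(x, y) \<in> b n \<Longrightarrow> rel_app (b n) x = y"
  unfolding rel_app_def
proof (rule the_equality)
  fix y' assume "(x, y) \<in> b n" "(x, y') \<in> b n"
  then show "y' = y" unfolding b_iff using pow_inj[of y' y "nat n"] by simp
qed

text \<open>For \<open>n < 0\<close> the domain is dense because \<open>H n\<close> is a completion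
  of \<open>H 0\<close>, and the range because it is the range of a power of \<open>P\<close>. For
  \<open>n \<ge> 0\<close> domain and range are the full spaces.\<close>

lemma isometric_b: "isometric_relation (H n) (H 0) (b n)"
proof unfold_locales
  have mem: "x \<in> car (H n)" if "(x, y) \<in> b n" for x y using that Domain_b[of n] by blast
  show "linear_relation (H n) (H 0) (b n)"
    unfolding linear_relation_def
  proof
    show "b n \<subseteq> car (H n) \<times> car (H 0)" using mem b_iff by auto
    show "complex_vector.subspace (b n)"
      by (rule subspace_relI)
        (auto simp: b_iff H.linop_0[OF pow_lin] H.linop_add[OF pow_lin] H.linop_scale[OF pow_lin])
  qed
  show "H.dense_in n (Domain (b n))"
  proof (cases "n < 0")
    case True
    then show ?thesis using dense_H0[OF True] Domain_b[of n] by (simp add: H.dense_in_def Int_absorb2)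
  next
    case False
    then have "car (H n) \<subseteq> car (H 0)" using inclusion_le[of 0 n] by auto
    then show ?thesis using Domain_b[of n] H.cvg_const by (auto simp: H.dense_in_def)
  qed
  show "H.dense_in 0 (Range (b n))"
  proof (cases "n < 0")
    case True
    then have "Range (b n) = (P ^^ nat (- n)) ` car (H 0)" by (auto simp: b_half)
    then show ?thesis using pow_dense by simp
  next
    case False
    then have "Range (b n) = car (H 0)" by (auto simp: b_half)
    then show ?thesis using H.cvg_const by (auto simp: H.dense_in_def)
  qed
  show "ip (H n) x x' = ip (H 0) y y'" if "(x, y) \<in> b n" "(x', y') \<in> b n" for x y x' y'
    using ip_b[of x n x'] that mem b_iff rel_app_b by metis
qed

sublocale b: isometric_relation "H n" "H 0" "b n" for n
  by (rule isometric_b)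

section \<open>The unitary maps onto \<open>H 0\<close>\<close>

definition V :: "int \<Rightarrow> 'v \<Rightarrow> 'v" where
  "V n = rel_app (continuous_extension (H n) (H 0) (b n))"

lemma scale_b_half_V: "rel_app (scale_b_half H L z1 n n) = V n"
  by (simp add: scale_b_half_def V_def)

lemma V_mem [simp]: "x \<in> car (H n) \<Longrightarrow> V n x \<in> car (H 0)"
  and V_add: "x \<in> car (H n) \<Longrightarrow> x' \<in> car (H n) \<Longrightarrow> V n (x + x') = V n x + V n x'"
  and V_scale: "x \<in> car (H n) \<Longrightarrow> V n (a *\<^sub>C x) = a *\<^sub>C V n x"
  and V_ip: "x \<in> car (H n) \<Longrightarrow> x' \<in> car (H n) \<Longrightarrow> ip (H 0) (V n x) (V n x') = ip (H n) x x'"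
  and V_onto: "y \<in> car (H 0) \<Longrightarrow> \<exists>x\<in>car (H n). V n x = y"
  unfolding V_def by (fact b.V_mem b.V_add b.V_scale b.V_ip b.V_onto)+

lemma V_zero [simp]: "V n 0 = 0"
  using V_scale[of 0 n 0] by (simp add: complex_vector.scale_zero_left)

lemma V_diff: "x \<in> car (H n) \<Longrightarrow> x' \<in> car (H n) \<Longrightarrow> V n (x - x') = V n x - V n x'"
  using V_add[of "x - x'" n x'] by simp

lemma V_sum: "(\<And>i. i \<in> A \<Longrightarrow> f i \<in> car (H n)) \<Longrightarrow> V n (sum f A) = (\<Sum>i\<in>A. V n (f i))"
  by (induction A rule: infinite_finite_induct) (auto simp: V_add)

lemma V_norm: "x \<in> car (H n) \<Longrightarrow> ipnorm (H 0) (V n x) = ipnorm (H n) x"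
  by (simp add: ipnorm_def V_ip)

lemma V_inj: "x \<in> car (H n) \<Longrightarrow> y \<in> car (H n) \<Longrightarrow> V n x = V n y \<longleftrightarrow> x = y"
  using V_norm[of "x - y" n] V_diff[of x n y] by auto

lemma V_cvg_iff: "(\<And>i. u i \<in> car (H n)) \<Longrightarrow> x \<in> car (H n) \<Longrightarrow> cvg (H 0) (\<lambda>i. V n (u i)) (V n x) \<longleftrightarrow> cvg (H n) u x"
  by (simp add: cvg_def V_norm flip: V_diff)

lemma V_cvg: "cvg (H n) u x \<Longrightarrow> cvg (H 0) (\<lambda>i. V n (u i)) (V n x)"
  using V_cvg_iff[of u n x] by (simp add: cvg_def)

lemma V_pow: "x \<in> car (H 0) \<Longrightarrow> x \<in> car (H n) \<Longrightarrow> (P ^^ nat n) (V n x) = (P ^^ nat (- n)) x"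
proof -
  assume "x \<in> car (H 0)" "x \<in> car (H n)"
  then obtain y where y: "(x, y) \<in> b n" using Domain_b[of n] by blast
  then have "V n x = y" unfolding V_def by (rule b.V_E)
  then show ?thesis using y b_iff by simp
qed

text \<open>For \<open>n \<ge> 0\<close> all vectors lie in \<open>H 0\<close> and a power of the
  injective \<open>P\<close> can be cancelled. For \<open>n < 0\<close> the identity holds on
  \<open>H 0\<close> and extends by continuity of the inclusion of \<open>H (n + 1)\<close> in
  \<open>H n\<close>.\<close>

lemma V_step: assumes x: "x \<in> car (H (n + 1))" shows "V n x = P (V (n + 1) x)"
proof (cases "0 \<le> n")
  case True
  have m: "x \<in> car (H 0)" "x \<in> car (H n)" using inclusion_le[of 0 "n + 1" x] inclusion_le[of n "n + 1" x] True x by auto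
  have "nat (n + 1) = Suc (nat n)" using True by simp
  then have "(P ^^ nat n) (V n x) = (P ^^ nat n) (P (V (n + 1) x))"
    using V_pow[OF m] V_pow[OF m(1) x] True by (simp add: funpow_swap1)
  then show ?thesis by (rule pow_inj[rotated 2]) (use m x in auto)
next
  case False
  have H0: "V n x = P (V (n + 1) x)" if m: "x \<in> car (H 0)" for x
  proof -
    have "x \<in> car (H n)" "x \<in> car (H (n + 1))" using inclusion_le[of n 0] inclusion_le[of "n + 1" 0] False m by auto
    moreover have "nat (- n) = Suc (nat (- (n + 1)))" "nat n = 0" "nat (n + 1) = 0" using False by auto
    ultimately show ?thesis using V_pow[OF m, of n] V_pow[OF m, of "n + 1"] by simp
  qed
  obtain u where u: "\<And>i. u i \<in> car (H 0)" "cvg (H (n + 1)) u x"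
  proof (cases "n + 1 = 0")
    case True
    then show thesis using that[of "\<lambda>_. x"] x H.cvg_const by simp
  next
    case ne: False
    then have "H.dense_in (n + 1) (car (H 0))" using dense_H0 False by simp
    then have "\<exists>u. (\<forall>i. u i \<in> car (H 0)) \<and> cvg (H (n + 1)) u x" using x unfolding H.dense_in_def by blast
    then show thesis using that by blast
  qed
  have "cvg (H 0) (\<lambda>i. V n (u i)) (V n x)" by (rule V_cvg[OF inclusion_cvg[OF u(2)]])
  moreover have "cvg (H 0) (\<lambda>i. V n (u i)) (P (V (n + 1) x))"
    using H.bounded_op_cvg[OF P_bounded V_cvg[OF u(2)]] H0[OF u(1)] by simp
  ultimately show ?thesis by (rule H.cvg_unique)
qed

lemma V_pow_step: "x \<in> car (H (n + int k)) \<Longrightarrow> V n x = (P ^^ k) (V (n + int k) x)"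
proof (induction k)
  case (Suc k)
  have e: "n + int (Suc k) = (n + int k) + 1" by simp
  have x: "x \<in> car (H ((n + int k) + 1))" using Suc.prems by (simp only: e)
  then have "x \<in> car (H (n + int k))" using inclusion by blast
  then show ?case using Suc.IH V_step[OF x] by (simp only: e funpow.simps funpow_swap1 comp_def)
qed simp

text \<open>Surjectivity of \<open>V (n + 1)\<close> supplies a vector with image \<open>t\<close>,
  and injectivity of \<open>V n\<close> identifies it with \<open>x\<close>. Regularity in the scale
  is thus read off from the range of \<open>P\<close>.\<close>

lemma mem_step: assumes "x \<in> car (H n)" "t \<in> car (H 0)" "V n x = P t"
  shows "x \<in> car (H (n + 1)) \<and> V (n + 1) x = t"
proof -
  obtain y where y: "y \<in> car (H (n + 1))" "V (n + 1) y = t" using V_onto assms(2) by blast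
  then have "V n y = V n x" using V_step assms(3) by simp
  then have "y = x" using V_inj y(1) inclusion assms(1) by blast
  then show ?thesis using y by simp
qed

lemma mem_pow_step: "x \<in> car (H n) \<Longrightarrow> t \<in> car (H 0) \<Longrightarrow> V n x = (P ^^ k) t \<Longrightarrow>
    x \<in> car (H (n + int k)) \<and> V (n + int k) x = t"
proof (induction k arbitrary: t)
  case (Suc k)
  have e: "n + int (Suc k) = (n + int k) + 1" by simp
  have "V n x = (P ^^ k) (P t)" using Suc.prems by (simp add: funpow_swap1)
  then have "x \<in> car (H (n + int k)) \<and> V (n + int k) x = P t" using Suc.IH[of "P t"] Suc.prems by simp
  then show ?case unfolding e using mem_step Suc.prems(2) by blast
qed simp

lemma R_eq: "x \<in> car (H 0) \<Longrightarrow> R x = (P ^^ 2) x"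
  using PP[of x] by (simp add: numeral_2_eq_2)

lemma V_step2: "x \<in> car (H (n + 2)) \<Longrightarrow> V n x = R (V (n + 2) x)"
  using V_pow_step[of x n 2] R_eq by simp

lemma mem_step2: "x \<in> car (H n) \<Longrightarrow> t \<in> car (H 0) \<Longrightarrow> V n x = R t \<Longrightarrow>
    x \<in> car (H (n + 2)) \<and> V (n + 2) x = t"
  using mem_pow_step[of x n t 2] R_eq by simp

lemma L_iff: "(x, y) \<in> L \<longleftrightarrow> (\<exists>s\<in>car (H 0). x = R s \<and> y = s + of_real z1 *\<^sub>C R s)"
  by (auto simp: L_eq)

section \<open>The action of \<open>L\<close> on the scale\<close>

lemma V_R:
  assumes "s \<in> car (H 0)" "s \<in> car (H n)" "R s \<in> car (H n)"
  shows "V n (R s) = R (V n s)"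
proof (rule pow_inj)
  show "(P ^^ nat n) (V n (R s)) = (P ^^ nat n) (R (V n s))"
    using assms V_pow[of "R s" n] V_pow[of s n] by (simp add: pow_R)
qed (use assms in auto)

lemma R_mem_H: assumes "s \<in> car (H 0)" "s \<in> car (H n)" shows "R s \<in> car (H n)"
proof (cases "0 \<le> n")
  case True
  have "V 0 x = x" if "x \<in> car (H 0)" for x using V_pow[of x 0] that by simp
  moreover have "s = (P ^^ nat n) (V n s)" using V_pow[OF assms] True by simp
  then have "R s = (P ^^ nat n) (R (V n s))" using pow_R[of "V n s"] assms by simp
  ultimately show ?thesis using mem_pow_step[of "R s" 0 "R (V n s)" "nat n"] assms True by simp
next
  case False
  then show ?thesis using inclusion_le[of n 0] assms by simp
qed

text \<open>Removes the closure hidden in \<open>scale_op\<close>. In one direction the identity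
  \<open>V n u = R (V n v - z1 V n u)\<close> passes to the limit, as \<open>R\<close> is bounded.
  In the other, \<open>s\<close> is approximated by vectors in the range of a high power of
  \<open>P\<close>; the corresponding elements of the scale lie in \<open>H 0\<close>, where
  \<open>L\<close> itself acts.\<close>

lemma scale_op_iff:
  "(x, y) \<in> scale_op H L n \<longleftrightarrow> x \<in> car (H n) \<and> y \<in> car (H n) \<and> (V n x, V n y) \<in> L"
proof
  assume "(x, y) \<in> scale_op H L n"
  then obtain u v where uv: "\<And>i. (u i, v i) \<in> L" "cvg (H (n + 2)) u x" "cvg (H n) v y"
    by (auto simp: scale_op_def continuous_extension_def H.ip_converges_iff_cvg)
  have "cvg (H (n + 1)) u x" using uv(2) inclusion_cvg[of "n + 1"] by (simp add: add.assoc)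
  then have u: "cvg (H n) u x" by (rule inclusion_cvg)
  have xm: "x \<in> car (H n)" "y \<in> car (H n)" and um: "\<And>i. u i \<in> car (H n)" "\<And>i. v i \<in> car (H n)"
    using u uv(3) by (auto simp: cvg_def)
  define s where "s = V n y - of_real z1 *\<^sub>C V n x"
  have "V n (u i) = R (V n (v i) - of_real z1 *\<^sub>C V n (u i))" for i
  proof -
    obtain s where s: "s \<in> car (H 0)" "u i = R s" "v i = s + of_real z1 *\<^sub>C R s" using uv(1) L_iff by blast
    then have s': "s = v i - of_real z1 *\<^sub>C u i" by simp
    then have sn: "s \<in> car (H n)" using um by simp
    have "V n (u i) = R (V n s)" using V_R[OF s(1) sn] um(1)[of i] s(2) by simp
    moreover have "V n s = V n (v i) - of_real z1 *\<^sub>C V n (u i)" using um by (simp add: s' V_diff V_scale)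
    ultimately show ?thesis by simp
  qed
  moreover have "cvg (H 0) (\<lambda>i. R (V n (v i) - of_real z1 *\<^sub>C V n (u i))) (R s)"
    unfolding s_def by (intro H.bounded_op_cvg[OF R_bounded] H.cvg_diff H.cvg_scale V_cvg u uv(3))
  ultimately have "V n x = R s" using V_cvg[OF u] H.cvg_unique by simp
  then have "(V n x, V n y) \<in> L" unfolding L_iff using xm by (intro bexI[of _ s]) (auto simp: s_def)
  then show "x \<in> car (H n) \<and> y \<in> car (H n) \<and> (V n x, V n y) \<in> L" using xm by simp
next
  assume "x \<in> car (H n) \<and> y \<in> car (H n) \<and> (V n x, V n y) \<in> L"
  then obtain s where s: "s \<in> car (H 0)" "V n x = R s" "V n y = s + of_real z1 *\<^sub>C R s"
    and x: "x \<in> car (H n)" and y: "y \<in> car (H n)" using L_iff by blast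
  have x2: "x \<in> car (H (n + 2))" "V (n + 2) x = s" using mem_step2[OF x s(1,2)] by auto
  \<comment> \<open>\<open>N\<close> is so large that \<open>n + N\<close> is nonnegative: whatever
    \<open>V n\<close> or \<open>V (n + 2)\<close> maps into the range of \<open>P ^^ N\<close> lies
    in \<open>H 0\<close>.\<close>
  define N where "N = nat \<bar>n\<bar> + 2"
  obtain w where w: "\<And>i. w i \<in> (P ^^ N) ` car (H 0)" "cvg (H 0) w s"
    using pow_dense[of N] s(1) unfolding H.dense_in_def by blast
  have wm: "w i \<in> car (H 0)" for i using w(1)[of i] by auto
  have "\<forall>i. \<exists>r\<in>car (H n). V n r = w i" using V_onto wm by blast
  then obtain r where r: "\<And>i. r i \<in> car (H n)" "\<And>i. V n (r i) = w i" by metis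
  have "\<forall>i. \<exists>u\<in>car (H (n + 2)). V (n + 2) u = w i" using V_onto wm by blast
  then obtain u where u: "\<And>i. u i \<in> car (H (n + 2))" "\<And>i. V (n + 2) (u i) = w i" by metis
  have r0: "r i \<in> car (H 0)" for i
  proof -
    have "r i \<in> car (H (n + int N))" using mem_pow_step[OF r(1)] w(1)[of i] r(2)[of i] by fastforce
    then show ?thesis by (rule inclusion_le[rotated]) (simp add: N_def)
  qed
  have u0: "u i \<in> car (H 0)" for i
  proof -
    have "u i \<in> car (H (n + 2 + int N))" using mem_pow_step[OF u(1)] w(1)[of i] u(2)[of i] by fastforce
    then show ?thesis by (rule inclusion_le[rotated]) (simp add: N_def)
  qed
  have un: "u i \<in> car (H n)" for i using inclusion_le[of n "n + 2"] u(1) by simp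
  have ur: "u i = R (r i)" for i
  proof -
    have "V n (u i) = V n (R (r i))"
      using V_step2[OF u(1)] u(2) V_R[OF r0 r(1) R_mem_H[OF r0 r(1)]] r(2) by simp
    then show ?thesis using V_inj un R_mem_H[OF r0 r(1)] by blast
  qed
  have "(u i, r i + of_real z1 *\<^sub>C u i) \<in> L" for i
    unfolding L_iff by (rule bexI[OF _ r0]) (simp add: ur)
  moreover have "cvg (H (n + 2)) u x"
    using V_cvg_iff[of u "n + 2" x] u x2 w(2) by simp
  moreover have "cvg (H n) (\<lambda>i. r i + of_real z1 *\<^sub>C u i) y"
  proof -
    have "cvg (H 0) (\<lambda>i. w i + of_real z1 *\<^sub>C R (w i)) (s + of_real z1 *\<^sub>C R s)"
      by (intro H.cvg_add H.cvg_scale H.bounded_op_cvg[OF R_bounded] w(2))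
    moreover have "V n (r i + of_real z1 *\<^sub>C u i) = w i + of_real z1 *\<^sub>C R (w i)" for i
      using V_step2[OF u(1)] u(2) r un by (simp add: V_add V_scale)
    ultimately show ?thesis using V_cvg_iff[of "\<lambda>i. r i + of_real z1 *\<^sub>C u i" n y] r(1) un y s(3) by simp
  qed
  ultimately show "(x, y) \<in> scale_op H L n"
    unfolding scale_op_def continuous_extension_def H.ip_converges_iff_cvg mem_Collect_eq case_prod_conv
    by (intro exI[of _ u] exI[of _ "\<lambda>i. r i + of_real z1 *\<^sub>C u i"]) simp
qed

end

section \<open>Pontryagin spaces\<close>

lemma innerI: "inner_space X \<Longrightarrow> inner_prod X"
  by unfold_locales

lemma hilbertI: "hilbert_space X \<Longrightarrow> hilbert X"
  by unfold_locales

context inner_prod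
begin

section \<open>Orthogonal sets for an indefinite form\<close>

lemma span_mem: "B \<subseteq> car X \<Longrightarrow> x \<in> complex_vector.span B \<Longrightarrow> x \<in> car X"
  using complex_vector.span_minimal[OF _ subspace] by blast

lemma ip_span_zero:
  assumes B: "B \<subseteq> car X" and y: "y \<in> car X" "\<And>b. b \<in> B \<Longrightarrow> ip X y b = 0" and x: "x \<in> complex_vector.span B"
  shows "ip X y x = 0"
proof -
  have "complex_vector.span B \<subseteq> {x \<in> car X. ip X y x = 0}"
    by (rule complex_vector.span_minimal) (use B y in \<open>auto simp: complex_vector.subspace_def ip_linear\<close>)
  then show ?thesis using x by blast
qed

text \<open>Polarisation: \<open>x + y\<close> yields the sum of the two mixed products,
  \<open>x + \<i> y\<close> their difference.\<close>

lemma orthogonal_if_isotropic: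
  assumes iso: "\<And>v. v \<in> D \<Longrightarrow> ip X v v = 0" and D: "complex_vector.subspace D" "D \<subseteq> car X"
    and xy: "x \<in> D" "y \<in> D"
  shows "ip X x y = 0"
proof -
  have m: "x \<in> car X" "y \<in> car X" using D xy by auto
  have "ip X (x + y) (x + y) = 0" using iso complex_vector.subspace_add[OF D(1) xy] by blast
  then have 1: "ip X x y + ip X y x = 0" using m iso xy by (simp add: ip_linear add.commute)
  have "ip X (x + \<i> *\<^sub>C y) (x + \<i> *\<^sub>C y) = 0"
    using iso complex_vector.subspace_add[OF D(1) xy(1) complex_vector.subspace_scale[OF D(1) xy(2)]] by blast
  then have "\<i> * (ip X x y - ip X y x) = 0" using m iso xy by (simp add: ip_linear algebra_simps)
  then have "ip X x y - ip X y x = 0" by simp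
  with 1 show ?thesis by (simp add: eq_neg_iff_add_eq_0)
qed

text \<open>Splitting off a non-isotropic vector reduces the number of spanning vectors, by exchange.\<close>

lemma orthogonal_spanning_set:
  assumes "finite B" "B \<subseteq> car X"
  shows "\<exists>E. finite E \<and> complex_vector.span E = complex_vector.span B \<and>
    (\<forall>e\<in>E. \<forall>e'\<in>E. e \<noteq> e' \<longrightarrow> ip X e e' = 0)"
  using assms
proof (induction "card B" arbitrary: B rule: less_induct)
  case less
  have sub: "complex_vector.span B \<subseteq> car X" using span_mem[OF less.prems(2)] by blast
  show ?case
  proof (cases "\<forall>v\<in>complex_vector.span B. ip X v v = 0")
    case True
    have "ip X e e' = 0" if "e \<in> B" "e' \<in> B" for e e'
      by (rule orthogonal_if_isotropic[OF _ complex_vector.subspace_span sub])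
        (use True that complex_vector.span_base in auto)
    then show ?thesis using less.prems by blast
  next
    case False
    then obtain v where v: "v \<in> complex_vector.span B" "ip X v v \<noteq> 0" by blast
    have vX: "v \<in> car X" using v sub by blast
    have v0: "v \<noteq> 0" using v vX by auto
    \<comment> \<open>Minimality of \<open>C\<close> means that \<open>v\<close> leaves the span
      when any \<open>b0\<close> is removed, so such a \<open>b0\<close> can be exchanged for
      \<open>v\<close>.\<close>
    define C where "C = (ARG_MIN card C. C \<subseteq> B \<and> v \<in> complex_vector.span C)"
    have C: "C \<subseteq> B \<and> v \<in> complex_vector.span C"
      and C_min: "\<And>D. D \<subseteq> B \<and> v \<in> complex_vector.span D \<Longrightarrow> card C \<le> card D"
      using arg_min_nat_lemma[of "\<lambda>C. C \<subseteq> B \<and> v \<in> complex_vector.span C" B card] v(1)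
      unfolding C_def by blast+
    have finC: "finite C" using C less.prems finite_subset by blast
    have "C \<noteq> {}" using C v0 by auto
    then obtain b0 where b0: "b0 \<in> C" by blast
    have "v \<notin> complex_vector.span (C - {b0})"
      using C_min[of "C - {b0}"] C card_Diff1_less[OF finC b0] by auto
    then have "b0 \<in> complex_vector.span (insert v (C - {b0}))"
      using complex_vector.in_span_delete[of v C b0] C by blast
    then have b0s: "b0 \<in> complex_vector.span (insert v (B - {b0}))"
      using complex_vector.span_mono[of "insert v (C - {b0})" "insert v (B - {b0})"] C by blast
    have span_eq: "complex_vector.span (insert v (B - {b0})) = complex_vector.span B"
    proof (rule antisym)
      show "complex_vector.span (insert v (B - {b0})) \<subseteq> complex_vector.span B"
        using v(1) by (intro complex_vector.span_minimal) (auto intro: complex_vector.span_base)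
      show "complex_vector.span B \<subseteq> complex_vector.span (insert v (B - {b0}))"
      proof (intro complex_vector.span_minimal complex_vector.subspace_span subsetI)
        fix x assume "x \<in> B"
        then show "x \<in> complex_vector.span (insert v (B - {b0}))"
          using b0s by (cases "x = b0") (auto intro: complex_vector.span_base)
      qed
    qed
    \<comment> \<open>The Gram-Schmidt step: \<open>p\<close> removes the component along
      \<open>v\<close>, which is possible because \<open>ip X v v\<close> is nonzero.\<close>
    define p where "p x = x - (ip X v x / ip X v v) *\<^sub>C v" for x
    define B1 where "B1 = p ` (B - {b0})"
    have pm: "p x \<in> car X" and pv: "ip X v (p x) = 0" if "x \<in> car X" for x
      using that vX v by (auto simp: p_def ip_linear)
    have B1: "finite B1" "B1 \<subseteq> car X" using less.prems pm by (auto simp: B1_def)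
    have "card B1 \<le> card (B - {b0})" unfolding B1_def using less.prems by (intro card_image_le) auto
    also have "\<dots> < card B" using b0 C less.prems by (intro card_Diff1_less) auto
    finally have "card B1 < card B" .
    from less.hyps[OF this B1] obtain E where E0: "finite E \<and> complex_vector.span E = complex_vector.span B1 \<and>
        (\<forall>e\<in>E. \<forall>e'\<in>E. e \<noteq> e' \<longrightarrow> ip X e e' = 0)" ..
    then have E: "finite E" "complex_vector.span E = complex_vector.span B1"
      "\<And>e e'. e \<in> E \<Longrightarrow> e' \<in> E \<Longrightarrow> e \<noteq> e' \<Longrightarrow> ip X e e' = 0"
      by auto
    have EX: "e \<in> car X" and Ev: "ip X v e = 0" if "e \<in> E" for e
    proof -
      have "e \<in> complex_vector.span B1" using E(2) that complex_vector.span_base by blast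
      then show "e \<in> car X" "ip X v e = 0"
        using span_mem[OF B1(2)] ip_span_zero[OF B1(2) vX] pv less.prems by (auto simp: B1_def)
    qed
    have "ip X e v = 0" if "e \<in> E" for e using ip_cnj[OF vX EX[OF that]] Ev[OF that] by simp
    then have "\<forall>e\<in>insert v E. \<forall>e'\<in>insert v E. e \<noteq> e' \<longrightarrow> ip X e e' = 0" using E Ev by auto
    moreover have "complex_vector.span (insert v E) = complex_vector.span B"
    proof -
      have "complex_vector.span (insert v E) = complex_vector.span (insert v B1)"
        using E(2) by (simp add: complex_vector.span_insert)
      also have "\<dots> = complex_vector.span (insert v (B - {b0}))"
      proof (rule antisym)
        have vs: "v \<in> complex_vector.span (insert v A)" for A by (simp add: complex_vector.span_base)
        show "complex_vector.span (insert v B1) \<subseteq> complex_vector.span (insert v (B - {b0}))"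
          by (intro complex_vector.span_minimal complex_vector.subspace_span)
            (auto simp: B1_def p_def vs intro!: complex_vector.span_diff complex_vector.span_scale intro: complex_vector.span_base)
        show "complex_vector.span (insert v (B - {b0})) \<subseteq> complex_vector.span (insert v B1)"
        proof (intro complex_vector.span_minimal complex_vector.subspace_span subsetI)
          fix x assume "x \<in> insert v (B - {b0})"
          moreover have "x = p x + (ip X v x / ip X v v) *\<^sub>C v" by (simp add: p_def)
          ultimately show "x \<in> complex_vector.span (insert v B1)"
            using vs complex_vector.span_add[OF complex_vector.span_base[of "p x" "insert v B1"] complex_vector.span_scale[OF vs]]
            by (metis B1_def imageI insert_iff)
        qed
      qed
      finally show ?thesis using span_eq by simp
    qed
    ultimately show ?thesis using E(1) by blast
  qed
qed

text \<open>A nonzero isotropic member of an orthogonal spanning set would be orthogonal to the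
  whole span, which nondegeneracy excludes; deleting 0 is enough.\<close>

lemma orthogonal_basis:
  assumes B: "finite B" "B \<subseteq> car X"
    and nondeg: "\<And>x. x \<in> complex_vector.span B \<Longrightarrow> (\<And>y. y \<in> complex_vector.span B \<Longrightarrow> ip X x y = 0) \<Longrightarrow> x = 0"
  obtains E where "finite E" "E \<subseteq> car X" "complex_vector.span E = complex_vector.span B"
    "\<And>e e'. e \<in> E \<Longrightarrow> e' \<in> E \<Longrightarrow> e \<noteq> e' \<Longrightarrow> ip X e e' = 0" "\<And>e. e \<in> E \<Longrightarrow> ip X e e \<noteq> 0"
proof -
  from orthogonal_spanning_set[OF B] obtain E where "finite E \<and> complex_vector.span E = complex_vector.span B \<and>
      (\<forall>e\<in>E. \<forall>e'\<in>E. e \<noteq> e' \<longrightarrow> ip X e e' = 0)" ..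
  then have E: "finite E" "complex_vector.span E = complex_vector.span B"
    "\<And>e e'. e \<in> E \<Longrightarrow> e' \<in> E \<Longrightarrow> e \<noteq> e' \<Longrightarrow> ip X e e' = 0"
    by auto
  have EX: "E \<subseteq> car X" using E(2) complex_vector.span_base span_mem[OF B(2)] by blast
  have nz: "ip X e e \<noteq> 0" if e: "e \<in> E" "e \<noteq> 0" for e
  proof
    assume "ip X e e = 0"
    then have "ip X e e' = 0" if "e' \<in> E" for e' using E(3) e that by (cases "e = e'") auto
    then have "ip X e y = 0" if "y \<in> complex_vector.span B" for y
      using ip_span_zero[OF EX _ _, of e y] e EX that E(2) by auto
    then have "e = 0" using nondeg[of e] E(2) e complex_vector.span_base by blast
    then show False using e by simp
  qed
  show thesis
    by (rule that[of "E - {0}"]) (use nz E EX complex_vector.span_delete_0[of E] in auto)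
qed

end

text \<open>The square of \<open>q + c e\<close> is the square of \<open>q\<close> plus
  \<open>|c|^2 r\<close>, so a Cauchy sequence has Cauchy components, and completeness of
  \<open>Q\<close> and of the complex numbers combine.\<close>

lemma hilbert_add_vector:
  assumes inn: "inner_space X" and Q: "Q \<subseteq> car X" "hilbert_space \<lparr>car = Q, ip = ip X\<rparr>"
    and e: "e \<in> car X" "\<And>q. q \<in> Q \<Longrightarrow> ip X q e = 0" "0 < Re (ip X e e)"
  shows "hilbert_space \<lparr>car = {q + c *\<^sub>C e | q c. q \<in> Q}, ip = ip X\<rparr>"
proof -
  interpret inner_prod X by (rule innerI[OF inn])
  let ?Q = "\<lparr>car = Q, ip = ip X\<rparr>"
  interpret Q: hilbert ?Q by (rule hilbertI[OF Q(2)])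
  let ?Y = "\<lparr>car = {q + c *\<^sub>C e | q c. q \<in> Q}, ip = ip X\<rparr>"
  have QX: "q \<in> car X" if "q \<in> Q" for q using Q that by blast
  have eq: "ip X e q = 0" if "q \<in> Q" for q using ip_cnj[OF QX[OF that] e(1)] e(2)[OF that] by simp
  define r where "r = Re (ip X e e)"
  have r: "r > 0" "ip X e e = of_real r" using e ip_self[OF e(1)] by (auto simp: r_def)
  have sub: "complex_vector.subspace (car ?Y)"
    unfolding complex_vector.subspace_def
  proof (intro conjI ballI allI)
    show "0 \<in> car ?Y"
      using Q.zero_mem by (auto intro!: exI[of _ 0] simp: complex_vector.scale_zero_left)
    fix x assume "x \<in> car ?Y"
    then obtain q c where x: "q \<in> Q" "x = q + c *\<^sub>C e" by auto
    show "a *\<^sub>C x \<in> car ?Y" for a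
      using Q.scale_mem[of q a] x by (auto simp: scaleC_add_right scaleC_scaleC)
    fix y assume "y \<in> car ?Y"
    then obtain q' c' where y: "q' \<in> Q" "y = q' + c' *\<^sub>C e" by auto
    have "x + y = (q + q') + (c + c') *\<^sub>C e" using x y by (simp add: scaleC_add_left)
    moreover have "q + q' \<in> Q" using Q.add_mem[of q q'] x y by simp
    ultimately have "\<exists>q c. x + y = q + c *\<^sub>C e \<and> q \<in> Q" by blast
    then show "x + y \<in> car ?Y" by simp
  qed
  have YX: "x \<in> car X" if "x \<in> car ?Y" for x using that QX e by auto
  have ip_sq: "ip X (q + c *\<^sub>C e) (q + c *\<^sub>C e) = ip X q q + of_real ((cmod c)\<^sup>2 * r)" if "q \<in> Q" for q c
    using that QX e eq r complex_norm_square[of c] by (simp add: ip_linear mult_ac)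
  have norm_sq: "(ipnorm X (q + c *\<^sub>C e))\<^sup>2 = (ipnorm X q)\<^sup>2 + (cmod c)\<^sup>2 * r" if "q \<in> Q" for q c
    using Q.ip_nonneg[of q] that r unfolding ipnorm_def ip_sq[OF that] by (simp del: Q.ip_nonneg)
  show ?thesis
    unfolding hilbert_space_def
  proof (intro conjI ballI allI impI)
    show "inner_space ?Y"
      unfolding inner_space_def
    proof (intro conjI ballI allI)
      show "ip ?Y y x = cnj (ip ?Y x y)" if "x \<in> car ?Y" "y \<in> car ?Y" for x y
        using ip_cnj[OF YX YX, OF that] by simp
    qed (use sub YX in \<open>simp_all add: ip_linear\<close>)
    show "0 < Re (ip ?Y x x)" if xY: "x \<in> car ?Y" "x \<noteq> 0" for x
    proof -
      obtain q c where x: "q \<in> Q" "x = q + c *\<^sub>C e" using xY by auto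
      have "q \<noteq> 0 \<or> c \<noteq> 0" using xY(2) x by (auto simp: complex_vector.scale_zero_left)
      then show ?thesis
        using x Q.ip_pos[of q] Q.ip_nonneg[of q] r ip_sq[OF x(1), of c]
        by (cases "c = 0") (auto simp: add_nonneg_pos simp del: Q.ip_nonneg)
    qed
    fix u :: "nat \<Rightarrow> 'a"
    assume "(\<forall>i. u i \<in> car ?Y) \<and> (\<forall>e>0. \<exists>N. \<forall>i\<ge>N. \<forall>j\<ge>N. ipnorm ?Y (u i - u j) < e)"
    then have uY: "\<And>i. u i \<in> car ?Y" and Cauchy: "\<And>e. e > 0 \<Longrightarrow> \<exists>N. \<forall>i\<ge>N. \<forall>j\<ge>N. ipnorm X (u i - u j) < e"
      by (auto simp: ipnorm_def)
    have "\<forall>i. \<exists>q c. q \<in> Q \<and> u i = q + c *\<^sub>C e"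
    proof
      show "\<exists>q c. q \<in> Q \<and> u i = q + c *\<^sub>C e" for i using uY[of i] by auto
    qed
    then obtain q c where qc: "\<And>i. q i \<in> Q" "\<And>i. u i = q i + c i *\<^sub>C e" by metis
    have diff: "u i - u j = (q i - q j) + (c i - c j) *\<^sub>C e" for i j
      by (simp add: qc complex_vector.scale_left_diff_distrib)
    have qd: "q i - q j \<in> Q" for i j using Q.diff_mem[of "q i" "q j"] qc by simp
    have le: "ipnorm X (q i - q j) \<le> ipnorm X (u i - u j)" "cmod (c i - c j) * sqrt r \<le> ipnorm X (u i - u j)" for i j
    proof -
      have n: "0 \<le> ipnorm X (u i - u j)"
        unfolding diff ipnorm_def ip_sq[OF qd] using Q.ip_nonneg[of "q i - q j"] qd r by (simp del: Q.ip_nonneg)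
      show "ipnorm X (q i - q j) \<le> ipnorm X (u i - u j)"
        by (rule power2_le_imp_le[OF _ n]) (use norm_sq[OF qd, of i j "c i - c j"] r diff in simp)
      show "cmod (c i - c j) * sqrt r \<le> ipnorm X (u i - u j)"
        by (rule power2_le_imp_le[OF _ n])
          (use norm_sq[OF qd, of i j "c i - c j"] r diff in \<open>simp add: power_mult_distrib\<close>)
    qed
    have "\<exists>x. cvg ?Q q x"
    proof (rule Q.complete)
      fix d :: real assume "d > 0"
      then obtain N where N: "\<And>i j. i \<ge> N \<Longrightarrow> j \<ge> N \<Longrightarrow> ipnorm X (u i - u j) < d" using Cauchy by blast
      have "ipnorm ?Q (q i - q j) < d" if "i \<ge> N" "j \<ge> N" for i j
        using order.strict_trans1[OF le(1) N[OF that]] by (simp add: ipnorm_def)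
      then show "\<exists>N. \<forall>i\<ge>N. \<forall>j\<ge>N. ipnorm ?Q (q i - q j) < d" by blast
    qed (use qc in simp)
    then obtain q0 where q0: "cvg ?Q q q0" ..
    have "Cauchy c"
    proof (rule CauchyI)
      fix d :: real assume "d > 0"
      then obtain N where N: "\<And>i j. i \<ge> N \<Longrightarrow> j \<ge> N \<Longrightarrow> ipnorm X (u i - u j) < d * sqrt r"
        using Cauchy[of "d * sqrt r"] r by auto
      have "cmod (c i - c j) < d" if "i \<ge> N" "j \<ge> N" for i j
        using order.strict_trans1[OF le(2) N[OF that]] r by simp
      then show "\<exists>M. \<forall>m\<ge>M. \<forall>n\<ge>M. cmod (c m - c n) < d" by blast
    qed
    then obtain c0 where c0: "c \<longlonglongrightarrow> c0" using Cauchy_convergent convergent_def by blast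
    have q0Q: "q0 \<in> Q" using q0 by (simp add: cvg_def)
    have "(\<lambda>i. ipnorm ?Y (u i - (q0 + c0 *\<^sub>C e))) \<longlonglongrightarrow> 0"
    proof -
      have "ipnorm ?Y (u i - (q0 + c0 *\<^sub>C e)) = sqrt ((ipnorm ?Q (q i - q0))\<^sup>2 + (cmod (c i - c0))\<^sup>2 * r)" for i
      proof -
        have qd: "q i - q0 \<in> Q" using Q.diff_mem[of "q i" q0] qc q0Q by simp
        have e: "u i - (q0 + c0 *\<^sub>C e) = (q i - q0) + (c i - c0) *\<^sub>C e"
          by (simp add: qc complex_vector.scale_left_diff_distrib)
        have "ipnorm ?Y (u i - (q0 + c0 *\<^sub>C e)) = sqrt (Re (ip X (q i - q0) (q i - q0)) + (cmod (c i - c0))\<^sup>2 * r)"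
          unfolding e ipnorm_def using ip_sq[OF qd, of "c i - c0"] by simp
        also have "Re (ip X (q i - q0) (q i - q0)) = (ipnorm ?Q (q i - q0))\<^sup>2"
          using Q.norm_sq[of "q i - q0"] qd by simp
        finally show ?thesis .
      qed
      moreover have "(\<lambda>i. sqrt ((ipnorm ?Q (q i - q0))\<^sup>2 + (cmod (c i - c0))\<^sup>2 * r)) \<longlonglongrightarrow> sqrt (0\<^sup>2 + (cmod 0)\<^sup>2 * r)"
        using q0 c0 by (intro tendsto_intros) (auto simp: cvg_def LIM_zero)
      ultimately show ?thesis by simp
    qed
    then show "\<exists>x\<in>car ?Y. (\<lambda>i. ipnorm ?Y (u i - x)) \<longlonglongrightarrow> 0" using q0Q by auto
  qed
qed

lemma hilbert_zero: "hilbert_space \<lparr>car = {0}, ip = ip X\<rparr>" if "inner_space (X :: 'v::complex_vector ipspace)"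
proof -
  interpret inner_prod X by (rule innerI[OF that])
  show ?thesis by (auto simp: hilbert_space_def inner_space_def ipnorm_def complex_vector.subspace_def)
qed

lemma hilbert_add_span:
  assumes inn: "inner_space X" and Q: "Q \<subseteq> car X" "hilbert_space \<lparr>car = Q, ip = ip X\<rparr>"
    and E: "finite E" "E \<subseteq> car X" "\<And>e q. e \<in> E \<Longrightarrow> q \<in> Q \<Longrightarrow> ip X q e = 0"
      "\<And>e e'. e \<in> E \<Longrightarrow> e' \<in> E \<Longrightarrow> e \<noteq> e' \<Longrightarrow> ip X e e' = 0" "\<And>e. e \<in> E \<Longrightarrow> 0 < Re (ip X e e)"
  shows "hilbert_space \<lparr>car = {q + s | q s. q \<in> Q \<and> s \<in> complex_vector.span E}, ip = ip X\<rparr>"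
  using E
proof (induction E rule: finite_induct)
  case empty
  then show ?case using Q by simp
next
  case (insert e E)
  interpret inner_prod X by (rule innerI[OF inn])
  let ?Q = "{q + s | q s. q \<in> Q \<and> s \<in> complex_vector.span E}"
  have sm: "s \<in> car X" if "s \<in> complex_vector.span E" for s using span_mem[of E s] insert.prems that by blast
  have QX: "?Q \<subseteq> car X" using Q(1) sm by auto
  have h: "hilbert_space \<lparr>car = ?Q, ip = ip X\<rparr>" using insert by blast
  have orth: "ip X x e = 0" if "x \<in> ?Q" for x
  proof -
    obtain q s where x: "x = q + s" "q \<in> Q" "s \<in> complex_vector.span E" using \<open>x \<in> ?Q\<close> by blast
    have eX: "e \<in> car X" using insert.prems by simp
    have "ip X e s = 0"
      by (rule ip_span_zero[OF _ eX _ x(3)]) (use insert in auto)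
    then have "ip X s e = 0" using ip_cnj[OF eX sm[OF x(3)]] by simp
    moreover have "q \<in> car X" using x Q by blast
    ultimately show ?thesis using x insert.prems eX sm by (simp add: ip_linear)
  qed
  have "{q + c *\<^sub>C e | q c. q \<in> ?Q} = {q + s | q s. q \<in> Q \<and> s \<in> complex_vector.span (insert e E)}"
  proof (intro set_eqI iffI)
    fix x assume "x \<in> {q + c *\<^sub>C e | q c. q \<in> ?Q}"
    then obtain q s c where x: "x = q + (s + c *\<^sub>C e)" "q \<in> Q" "s \<in> complex_vector.span E"
      by (auto simp: add.assoc)
    have "s + c *\<^sub>C e \<in> complex_vector.span (insert e E)"
      using x(3) unfolding complex_vector.span_insert by (intro CollectI exI[of _ c]) simp
    then show "x \<in> {q + s | q s. q \<in> Q \<and> s \<in> complex_vector.span (insert e E)}" using x by blast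
  next
    fix x assume "x \<in> {q + s | q s. q \<in> Q \<and> s \<in> complex_vector.span (insert e E)}"
    then obtain q s c where x: "x = q + s" "q \<in> Q" "s - c *\<^sub>C e \<in> complex_vector.span E"
      by (auto simp: complex_vector.span_insert)
    have "x = (q + (s - c *\<^sub>C e)) + c *\<^sub>C e" using x by simp
    then show "x \<in> {q + c *\<^sub>C e | q c. q \<in> ?Q}" using x by blast
  qed
  then show ?case
    using hilbert_add_vector[OF inn QX h, of e] orth insert.prems by simp
qed

text \<open>The form on the finite-dimensional summand is diagonalised. Basis vectors of positive
  square are added to \<open>Q\<close>, those of negative square span the negative part.\<close>

lemma pontryagin_space_sum:
  assumes inn: "inner_space X" and Q: "Q \<subseteq> car X" "hilbert_space \<lparr>car = Q, ip = ip X\<rparr>"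
    and B: "finite B" "B \<subseteq> car X" "\<And>q b. q \<in> Q \<Longrightarrow> b \<in> B \<Longrightarrow> ip X q b = 0"
    and sum: "\<And>x. x \<in> car X \<Longrightarrow> \<exists>q\<in>Q. \<exists>k\<in>complex_vector.span B. x = q + k"
    and nondeg: "\<And>x. x \<in> complex_vector.span B \<Longrightarrow> (\<And>y. y \<in> complex_vector.span B \<Longrightarrow> ip X x y = 0) \<Longrightarrow> x = 0"
  shows "pontryagin_space X"
proof -
  interpret inner_prod X by (rule innerI[OF inn])
  obtain E where E: "finite E" "E \<subseteq> car X" "complex_vector.span E = complex_vector.span B"
    "\<And>e e'. e \<in> E \<Longrightarrow> e' \<in> E \<Longrightarrow> e \<noteq> e' \<Longrightarrow> ip X e e' = 0" "\<And>e. e \<in> E \<Longrightarrow> ip X e e \<noteq> 0"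
    by (rule orthogonal_basis[OF B(1,2) nondeg]) blast+
  define Ep where "Ep = {e \<in> E. 0 < Re (ip X e e)}"
  define En where "En = {e \<in> E. Re (ip X e e) < 0}"
  have "Re (ip X e e) \<noteq> 0" if "e \<in> E" for e
    using E(5)[OF that] ip_self[of e] E(2) that by auto
  then have EE: "E = Ep \<union> En" by (auto simp: Ep_def En_def neq_iff)
  have fin: "finite Ep" "finite En" "Ep \<subseteq> car X" "En \<subseteq> car X" using E by (auto simp: Ep_def En_def)
  \<comment> \<open>For the negated form the vectors of \<open>En\<close> have positive square, so
    \<open>hilbert_add_span\<close>, starting from the zero space, applies to them too.\<close>
  let ?X' = "\<lparr>car = car X, ip = (\<lambda>x y. - ip X x y)\<rparr>"
  have inn': "inner_space ?X'"
    unfolding inner_space_def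
  proof (intro conjI ballI allI)
    show "ip ?X' y x = cnj (ip ?X' x y)" if "x \<in> car ?X'" "y \<in> car ?X'" for x y
      using ip_cnj[of x y] that by simp
  qed (use subspace in \<open>auto simp: ip_linear\<close>)
  let ?P = "{q + s | q s. q \<in> Q \<and> s \<in> complex_vector.span Ep}"
  let ?N = "complex_vector.span En"
  have Qe: "ip X q e = 0" if "e \<in> E" "q \<in> Q" for e q
  proof (rule ip_span_zero[OF B(2)])
    show "e \<in> complex_vector.span B" using E(3) that complex_vector.span_base by blast
  qed (use that Q B in auto)
  have P: "hilbert_space \<lparr>car = ?P, ip = ip X\<rparr>"
    by (rule hilbert_add_span[OF inn Q fin(1,3)]) (use Qe E in \<open>auto simp: Ep_def\<close>)
  have "hilbert_space \<lparr>car = {q + s | q s. q \<in> {0} \<and> s \<in> complex_vector.span En}, ip = ip ?X'\<rparr>"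
    by (rule hilbert_add_span[OF inn' _ hilbert_zero[OF inn'] fin(2)]) (use fin E in \<open>auto simp: En_def\<close>)
  then have N: "hilbert_space \<lparr>car = ?N, ip = (\<lambda>x y. - ip X x y)\<rparr>" by simp
  have sm: "s \<in> car X" if "s \<in> complex_vector.span Ep \<or> s \<in> ?N" for s
    using span_mem[OF fin(3)] span_mem[OF fin(4)] that by blast
  have "fundamental_decomposition X ?P ?N"
    unfolding fundamental_decomposition_def
  proof (intro conjI ballI P N)
    show "?P \<subseteq> car X" "?N \<subseteq> car X" using sm Q by auto
    show "\<exists>B. finite B \<and> ?N = complex_vector.span B" using fin by blast
  next
    fix x assume "x \<in> car X"
    then obtain q k where x: "q \<in> Q" "k \<in> complex_vector.span B" "x = q + k" using sum by blast
    then have "k \<in> complex_vector.span (Ep \<union> En)" using E(3) EE by simp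
    then obtain kp kn where k: "kp \<in> complex_vector.span Ep" "kn \<in> ?N" "k = kp + kn"
      unfolding complex_vector.span_Un by blast
    then have "x = (q + kp) + kn" using x by (simp add: add.assoc)
    then show "\<exists>p\<in>?P. \<exists>n\<in>?N. x = p + n" using x k by blast
  next
    fix p n assume p: "p \<in> ?P" and n: "n \<in> ?N"
    from p obtain q s where qs: "p = q + s" "q \<in> Q" "s \<in> complex_vector.span Ep" by blast
    have "ip X q n = 0" by (rule ip_span_zero[OF fin(4) _ _ n]) (use qs Q Qe in \<open>auto simp: En_def\<close>)
    moreover have "ip X s n = 0"
    proof (rule ip_span_zero[OF fin(4) _ _ n])
      show sX: "s \<in> car X" using sm qs by blast
      fix e assume e: "e \<in> En"
      then have eX: "e \<in> car X" using fin by blast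
      have "ip X e s = 0"
      proof (rule ip_span_zero[OF fin(3) eX _ qs(3)])
        show "ip X e b = 0" if "b \<in> Ep" for b
          using e that E(4)[of e b] by (cases "e = b") (auto simp: Ep_def En_def)
      qed
      then show "ip X s e = 0" using ip_cnj[OF eX sX] by simp
    qed
    ultimately show "ip X p n = 0" using qs sm Q n by (auto simp: ip_linear subset_iff)
  qed
  then show ?thesis using inn by (auto simp: pontryagin_space_def)
qed

text \<open>In an orthogonal basis the square of \<open>u i\<close> is a finite sum of products of
  coordinates, each of which is controlled by an inner product with a fixed vector.\<close>

lemma finite_dimensional_weak_convergence:
  assumes h: "hilbert_space X" and B: "finite B" "car X = complex_vector.span B"
    and u: "\<And>i. u i \<in> car X" and weak: "\<And>y. y \<in> car X \<Longrightarrow> (\<lambda>i. ip X y (u i)) \<longlonglongrightarrow> 0"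
  shows "(\<lambda>i. ip X (u i) (u i :: 'v::complex_vector)) \<longlonglongrightarrow> 0"
proof -
  interpret hilbert X by (rule hilbertI[OF h])
  have BX: "B \<subseteq> car X" using B complex_vector.span_superset by simp
  have nd: "x = 0" if "x \<in> complex_vector.span B" "\<And>y. y \<in> complex_vector.span B \<Longrightarrow> ip X x y = 0" for x
    using that(2)[OF that(1)] that(1) ip_pos[of x] B by (cases "x = 0") auto
  obtain E where E: "finite E" "E \<subseteq> car X" "complex_vector.span E = complex_vector.span B"
    "\<And>e e'. e \<in> E \<Longrightarrow> e' \<in> E \<Longrightarrow> e \<noteq> e' \<Longrightarrow> ip X e e' = 0" "\<And>e. e \<in> E \<Longrightarrow> ip X e e \<noteq> 0"
    by (rule orthogonal_basis[OF B(1) BX nd]) blast+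
  have exp: "x = (\<Sum>e\<in>E. (ip X e x / ip X e e) *\<^sub>C e)" if x: "x \<in> car X" for x
  proof -
    let ?y = "\<Sum>e\<in>E. (ip X e x / ip X e e) *\<^sub>C e"
    have y: "?y \<in> car X" using E by (intro sum_mem) auto
    have e: "ip X e (x - ?y) = 0" if e: "e \<in> E" for e
    proof -
      have "ip X e ?y = (\<Sum>e'\<in>E. ip X e' x / ip X e' e' * ip X e e')"
        using e E(2) by (subst ip_sum_right) (auto simp: ip_linear subset_iff)
      also have "\<dots> = (\<Sum>e'\<in>E. if e' = e then ip X e x else 0)"
        using e E(4,5) by (intro sum.cong) auto
      also have "\<dots> = ip X e x" using e E(1) by simp
      finally show ?thesis using e E(2) x y by (simp add: ip_linear subset_iff)
    qed
    have d: "x - ?y \<in> car X" using x y by simp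
    have "ip X (x - ?y) e = 0" if "e \<in> E" for e using ip_cnj[of e "x - ?y"] e[OF that] that E(2) d by auto
    then have "ip X (x - ?y) (x - ?y) = 0"
      using ip_span_zero[OF E(2) d, of "x - ?y"] d B E(3) by simp
    then have "x - ?y = 0" using ip_pos[OF d] by (cases "x - ?y = 0") auto
    then show ?thesis by simp
  qed
  have "ip X (u i) (u i) = (\<Sum>e\<in>E. ip X e (u i) / ip X e e * cnj (ip X e (u i)))" for i
  proof -
    have "ip X (u i) (u i) = ip X (u i) (\<Sum>e\<in>E. (ip X e (u i) / ip X e e) *\<^sub>C e)" using exp[OF u[of i]] by simp
    also have "\<dots> = (\<Sum>e\<in>E. ip X e (u i) / ip X e e * ip X (u i) e)"
      using E(2) u by (subst ip_sum_right) (auto simp: ip_linear subset_iff)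
    also have "\<dots> = (\<Sum>e\<in>E. ip X e (u i) / ip X e e * cnj (ip X e (u i)))"
    proof (rule sum.cong[OF refl])
      fix e assume "e \<in> E"
      then have "ip X (u i) e = cnj (ip X e (u i))" using E(2) by (intro ip_cnj u) auto
      then show "ip X e (u i) / ip X e e * ip X (u i) e = ip X e (u i) / ip X e e * cnj (ip X e (u i))" by simp
    qed
    finally show ?thesis .
  qed
  moreover have "(\<lambda>i. \<Sum>e\<in>E. ip X e (u i) / ip X e e * cnj (ip X e (u i))) \<longlonglongrightarrow> (\<Sum>e\<in>E. 0 / ip X e e * cnj 0)"
    using E(2,5) by (intro tendsto_intros weak) auto
  ultimately show ?thesis by simp
qed

text \<open>In particular convergence does not depend on the choice of the fundamental decomposition.\<close>

lemma ip_converges_iff: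
  assumes X: "pontryagin_space X"
  shows "ip_converges X u x \<longleftrightarrow> (\<forall>i. u i \<in> car X) \<and> x \<in> car X \<and>
    (\<lambda>i. ip X (u i - x) (u i - x)) \<longlonglongrightarrow> 0 \<and> (\<forall>y\<in>car X. (\<lambda>i. ip X y (u i - x)) \<longlonglongrightarrow> 0)"
proof -
  interpret inner_prod X using X by (intro innerI) (simp add: pontryagin_space_def)
  have fd: "hilbert \<lparr>car = P, ip = ip X\<rparr>" "hilbert \<lparr>car = N, ip = (\<lambda>x y. - ip X x y)\<rparr>"
    "P \<subseteq> car X" "N \<subseteq> car X" "\<And>x. x \<in> car X \<Longrightarrow> \<exists>p\<in>P. \<exists>n\<in>N. x = p + n"
    "\<And>p n. p \<in> P \<Longrightarrow> n \<in> N \<Longrightarrow> ip X p n = 0" "\<And>p n. p \<in> P \<Longrightarrow> n \<in> N \<Longrightarrow> ip X n p = 0"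
    if f: "fundamental_decomposition X P N" for P N
  proof -
    show 1: "P \<subseteq> car X" "N \<subseteq> car X" "\<And>x. x \<in> car X \<Longrightarrow> \<exists>p\<in>P. \<exists>n\<in>N. x = p + n"
      "hilbert \<lparr>car = P, ip = ip X\<rparr>" "hilbert \<lparr>car = N, ip = (\<lambda>x y. - ip X x y)\<rparr>"
      using f by (auto simp: fundamental_decomposition_def intro: hilbertI)
    show 2: "ip X p n = 0" if "p \<in> P" "n \<in> N" for p n
      using f that by (auto simp: fundamental_decomposition_def)
    show "ip X n p = 0" if "p \<in> P" "n \<in> N" for p n
      using ip_cnj[of p n] 2[OF that] 1 that by auto
  qed
  show ?thesis
  proof
    assume "ip_converges X u x"
    then obtain P N p n where *: "\<forall>i. u i \<in> car X" "x \<in> car X" "fundamental_decomposition X P N"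
      and pn': "\<forall>i. p i \<in> P \<and> n i \<in> N \<and> u i - x = p i + n i"
      and lim: "(\<lambda>i. sqrt (Re (ip X (p i) (p i)) - Re (ip X (n i) (n i)))) \<longlonglongrightarrow> 0"
      unfolding ip_converges_def by blast
    from pn' have pn: "\<And>i. p i \<in> P" "\<And>i. n i \<in> N" "\<And>i. u i - x = p i + n i" by auto
    note f = fd[OF *(3)]
    let ?P = "\<lparr>car = P, ip = ip X\<rparr>" and ?N = "\<lparr>car = N, ip = (\<lambda>x y. - ip X x y)\<rparr>"
    interpret P: hilbert ?P by (rule f)
    interpret N: hilbert ?N by (rule f)
    have P0: "0 \<in> P" and N0: "0 \<in> N" using P.zero_mem N.zero_mem by auto
    have pp: "0 \<le> Re (ip X (p i) (p i))" and nn: "Re (ip X (n i) (n i)) \<le> 0" for i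
      using P.ip_nonneg[of "p i"] N.ip_nonneg[of "n i"] pn by (simp_all del: P.ip_nonneg N.ip_nonneg)
    have "cvg ?P p 0"
      by (rule P.cvg_bound[OF _ _ _ lim]) (use pn P0 nn in \<open>auto simp: ipnorm_def\<close>)
    moreover have "cvg ?N n 0"
      by (rule N.cvg_bound[OF _ _ _ lim]) (use pn N0 pp in \<open>auto simp: ipnorm_def\<close>)
    ultimately have c: "cvg ?P p 0" "cvg ?N n 0" by auto
    have lp: "(\<lambda>i. ip X (p i) (p i)) \<longlonglongrightarrow> 0" using P.cvg_ip[OF c(1) c(1)] P0 P.ip_zero_left[of 0] by simp
    have ln: "(\<lambda>i. ip X (n i) (n i)) \<longlonglongrightarrow> 0"
      using tendsto_minus[OF N.cvg_ip[OF c(2) c(2)]] N0 N.ip_zero_left[of 0] by simp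
    have mem: "p i \<in> car X" "n i \<in> car X" for i using f pn by auto
    have "(\<lambda>i. ip X (u i - x) (u i - x)) \<longlonglongrightarrow> 0"
      using tendsto_add[OF lp ln] pn mem f(6,7) by (simp add: ip_linear)
    moreover have "(\<lambda>i. ip X y (u i - x)) \<longlonglongrightarrow> 0" if yX: "y \<in> car X" for y
    proof -
      obtain py ny where y: "py \<in> P" "ny \<in> N" "y = py + ny" using f(5)[OF yX] by blast
      have ym: "py \<in> car X" "ny \<in> car X" using f y by auto
      have 1: "(\<lambda>i. ip X py (p i)) \<longlonglongrightarrow> 0" using P.cvg_ip[OF P.cvg_const c(1), of py] y ym by simp
      have 2: "(\<lambda>i. ip X ny (n i)) \<longlonglongrightarrow> 0"
        using tendsto_minus[OF N.cvg_ip[OF N.cvg_const c(2), of ny]] y ym by simp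
      have "ip X y (u i - x) = ip X py (p i) + ip X ny (n i)" for i
        using pn(1)[of i] pn(2)[of i] pn(3)[of i] y ym mem[of i] f(6)[of py "n i"] f(7)[of "p i" ny] by (simp add: ip_linear)
      then show ?thesis using tendsto_add[OF 1 2] by simp
    qed
    ultimately show "(\<forall>i. u i \<in> car X) \<and> x \<in> car X \<and>
        (\<lambda>i. ip X (u i - x) (u i - x)) \<longlonglongrightarrow> 0 \<and> (\<forall>y\<in>car X. (\<lambda>i. ip X y (u i - x)) \<longlonglongrightarrow> 0)"
      using * by blast
  next
    assume *: "(\<forall>i. u i \<in> car X) \<and> x \<in> car X \<and>
      (\<lambda>i. ip X (u i - x) (u i - x)) \<longlonglongrightarrow> 0 \<and> (\<forall>y\<in>car X. (\<lambda>i. ip X y (u i - x)) \<longlonglongrightarrow> 0)"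
    obtain P N where F: "fundamental_decomposition X P N" using X by (auto simp: pontryagin_space_def)
    note f = fd[OF F]
    let ?P = "\<lparr>car = P, ip = ip X\<rparr>" and ?N = "\<lparr>car = N, ip = (\<lambda>x y. - ip X x y)\<rparr>"
    interpret P: hilbert ?P by (rule f)
    interpret N: hilbert ?N by (rule f)
    have "\<forall>i. \<exists>p n. p \<in> P \<and> n \<in> N \<and> u i - x = p + n" using f(5) * by (metis diff_mem)
    then obtain p n where pn: "\<And>i. p i \<in> P" "\<And>i. n i \<in> N" "\<And>i. u i - x = p i + n i" by metis
    have mem: "p i \<in> car X" "n i \<in> car X" for i using f pn by auto
    obtain B where B: "finite B" "N = complex_vector.span B" using F by (auto simp: fundamental_decomposition_def)
    \<comment> \<open>On the finite-dimensional negative part weak convergence already gives norm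
      convergence; subtracting it from the square of \<open>u i - x\<close> leaves the square of
      \<open>p i\<close>.\<close>
    have "(\<lambda>i. ip ?N (n i) (n i)) \<longlonglongrightarrow> 0"
    proof (rule finite_dimensional_weak_convergence[OF N.hilbert B(1)])
      fix y assume "y \<in> car ?N"
      then have y: "y \<in> N" "y \<in> car X" using f by auto
      have "ip X y (u i - x) = ip X y (n i)" for i
        using pn[of i] y mem[of i] f(7)[of "p i" y] by (simp add: ip_linear)
      moreover have "(\<lambda>i. ip X y (u i - x)) \<longlonglongrightarrow> 0" using * y by blast
      ultimately have "(\<lambda>i. ip X y (n i)) \<longlonglongrightarrow> 0" by simp
      from tendsto_minus[OF this] show "(\<lambda>i. ip ?N y (n i)) \<longlonglongrightarrow> 0" by simp
    qed (use B pn in auto)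
    then have ln: "(\<lambda>i. ip X (n i) (n i)) \<longlonglongrightarrow> 0" using tendsto_minus_cancel_left[of "\<lambda>i. ip X (n i) (n i)" 0] by simp
    have "ip X (u i - x) (u i - x) = ip X (p i) (p i) + ip X (n i) (n i)" for i
      using pn[of i] mem[of i] f(6,7) by (simp add: ip_linear)
    then have "(\<lambda>i. ip X (p i) (p i) + ip X (n i) (n i) - ip X (n i) (n i)) \<longlonglongrightarrow> 0 - 0"
      using * by (intro tendsto_diff ln) simp
    then have lp: "(\<lambda>i. ip X (p i) (p i)) \<longlonglongrightarrow> 0" by simp
    have "(\<lambda>i. sqrt (Re (ip X (p i) (p i)) - Re (ip X (n i) (n i)))) \<longlonglongrightarrow> sqrt (Re 0 - Re 0)"
      by (intro tendsto_intros lp ln)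
    then show "ip_converges X u x" using * F pn unfolding ip_converges_def
      by (intro conjI exI[of _ P] exI[of _ N] exI[of _ p] exI[of _ n]) auto
  qed
qed

section \<open>Coordinate spaces and products\<close>

lemma scaleC_complex_eq [simp]: "a *\<^sub>C (b :: complex) = a * b"
  by (simp add: scaleC_complex_def)

lemma scaleC_fun_apply [simp]: "(a *\<^sub>C f) i = a *\<^sub>C f i"
  by (simp add: scaleC_fun_def)

lemma sum_fun_apply: "(\<Sum>a\<in>A. f a) i = (\<Sum>a\<in>A. f a i)"
  by (induction A rule: infinite_finite_induct) auto

lemma coord_mem_iff: "x \<in> car (coord_space I) \<longleftrightarrow> (\<forall>i. i \<notin> I \<longrightarrow> x i = 0)"
  by (simp add: coord_space_def)

lemma coord_ip: "ip (coord_space I) x y = (\<Sum>i\<in>I. cnj (x i) * y i)"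
  by (simp add: coord_space_def)

lemma inner_coord: "inner_space (coord_space I)"
  unfolding inner_space_def
  by (auto simp: coord_mem_iff coord_ip complex_vector.subspace_def sum.distrib algebra_simps sum_distrib_left)

definition unit_vec :: "'i \<Rightarrow> 'i \<Rightarrow> complex" where
  "unit_vec i = (\<lambda>j. if j = i then 1 else 0)"

lemma unit_vec_mem: "i \<in> I \<Longrightarrow> unit_vec i \<in> car (coord_space I)"
  by (auto simp: coord_mem_iff unit_vec_def)

lemma coord_ip_unit: "finite I \<Longrightarrow> i \<in> I \<Longrightarrow> ip (coord_space I) (unit_vec i) x = x i"
  by (simp add: coord_ip unit_vec_def if_distrib[of cnj] if_distrib[of "\<lambda>z. z * _"] cong: if_cong)

lemma coord_expand:
  assumes "finite I" "x \<in> car (coord_space I)"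
  shows "x = (\<Sum>i\<in>I. x i *\<^sub>C unit_vec i)"
proof
  fix j
  have "(\<Sum>i\<in>I. x i *\<^sub>C unit_vec i) j = (\<Sum>i\<in>I. if i = j then x j else 0)"
    unfolding sum_fun_apply by (intro sum.cong) (auto simp: unit_vec_def)
  then show "x j = (\<Sum>i\<in>I. x i *\<^sub>C unit_vec i) j" using assms by (auto simp: coord_mem_iff)
qed

text \<open>Obtained by adjoining the orthonormal unit vectors to the zero space.\<close>

lemma hilbert_coord:
  assumes I: "finite I"
  shows "hilbert_space (coord_space I)"
proof -
  interpret inner_prod "coord_space I" by (rule innerI[OF inner_coord])
  let ?E = "unit_vec ` I"
  have E: "?E \<subseteq> car (coord_space I)" by (auto simp: unit_vec_mem)
  have "hilbert_space \<lparr>car = {q + s | q s. q \<in> {0} \<and> s \<in> complex_vector.span ?E}, ip = ip (coord_space I)\<rparr>"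
    by (rule hilbert_add_span[OF inner_coord _ hilbert_zero[OF inner_coord] _ E])
      (use I E in \<open>auto simp: coord_ip_unit, auto simp: unit_vec_def\<close>)
  moreover have "{q + s | q s. q \<in> {0} \<and> s \<in> complex_vector.span ?E} = car (coord_space I)"
  proof -
    have "x \<in> complex_vector.span ?E" if "x \<in> car (coord_space I)" for x
      by (subst coord_expand[OF I that])
        (intro complex_vector.span_sum complex_vector.span_scale complex_vector.span_base imageI)
    then show ?thesis using span_mem[OF E] by auto
  qed
  ultimately have "hilbert_space \<lparr>car = car (coord_space I), ip = ip (coord_space I)\<rparr>" by simp
  moreover have "\<lparr>car = car (coord_space I), ip = ip (coord_space I)\<rparr> = coord_space I" by (simp add: coord_space_def)
  ultimately show ?thesis by (simp only:)
qed

lemma cvg_coord_iff: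
  assumes I: "finite I" and u: "\<And>k. u k \<in> car (coord_space I)" and x: "x \<in> car (coord_space I)"
  shows "cvg (coord_space I) u x \<longleftrightarrow> (\<forall>i\<in>I. (\<lambda>k. u k i) \<longlonglongrightarrow> x i)"
proof -
  interpret hilbert "coord_space I" by (rule hilbertI[OF hilbert_coord[OF I]])
  show ?thesis
  proof
    assume c: "cvg (coord_space I) u x"
    show "\<forall>i\<in>I. (\<lambda>k. u k i) \<longlonglongrightarrow> x i"
    proof
      fix i assume i: "i \<in> I"
      show "(\<lambda>k. u k i) \<longlonglongrightarrow> x i"
        using cvg_ip[OF cvg_const[OF unit_vec_mem[OF i]] c] I i by (simp add: coord_ip_unit)
    qed
  next
    assume *: "\<forall>i\<in>I. (\<lambda>k. u k i) \<longlonglongrightarrow> x i"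
    have "(\<lambda>k. sqrt (Re (\<Sum>i\<in>I. cnj (u k i - x i) * (u k i - x i)))) \<longlonglongrightarrow> sqrt (Re (\<Sum>i\<in>I. cnj (x i - x i) * (x i - x i)))"
      using * by (intro tendsto_intros) auto
    then show "cvg (coord_space I) u x"
      using u x by (simp add: cvg_def ipnorm_def coord_ip)
  qed
qed

section \<open>Matrices as operators\<close>

lemma mat_app_mem [simp]: "mat_app I A x \<in> car (coord_space I)"
  by (simp add: coord_mem_iff mat_app_def)

lemma mat_app_add: "mat_app I A (x + y) = mat_app I A x + mat_app I A y"
  by (auto simp: mat_app_def fun_eq_iff algebra_simps sum.distrib)

lemma mat_app_scale: "mat_app I A (a *\<^sub>C x) = a *\<^sub>C mat_app I A x"
  by (auto simp: mat_app_def fun_eq_iff sum_distrib_left mult_ac)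

lemma mat_app_diff: "mat_app I A (x - y) = mat_app I A x - mat_app I A y"
  using mat_app_add[of I A "x - y" y] by simp

lemma mat_app_zero [simp]: "mat_app I A 0 = 0"
  using mat_app_diff[of I A 0 0] by simp

lemma mat_app_cong: "mat_eq_on I A B \<Longrightarrow> mat_app I A x = mat_app I B x"
  by (auto simp: mat_app_def mat_eq_on_def fun_eq_iff)

lemma mat_app_mat_prod:
  assumes "finite I" shows "mat_app I A (mat_app I B x) = mat_app I (mat_prod I A B) x"
proof
  fix i
  have "(\<Sum>j\<in>I. A i j * (\<Sum>k\<in>I. B j k * x k)) = (\<Sum>j\<in>I. \<Sum>k\<in>I. A i j * B j k * x k)"
    by (simp add: sum_distrib_left mult.assoc)
  also have "\<dots> = (\<Sum>k\<in>I. \<Sum>j\<in>I. A i j * B j k * x k)" by (rule sum.swap)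
  finally show "mat_app I A (mat_app I B x) i = mat_app I (mat_prod I A B) x i"
    by (simp add: mat_app_def mat_prod_def sum_distrib_right cong: sum.cong)
qed

lemma mat_app_one:
  assumes "finite I" "x \<in> car (coord_space I)"
  shows "mat_app I (\<lambda>i j. if i = j then 1 else 0) x = x"
  using assms by (auto simp: mat_app_def fun_eq_iff coord_mem_iff if_distrib[of "\<lambda>z. z * _"] cong: if_cong)

lemma mat_app_adjoint:
  "ip (coord_space I) (mat_app I A x) y = ip (coord_space I) x (mat_app I (mat_adjoint A) y)"
proof -
  have "ip (coord_space I) (mat_app I A x) y = (\<Sum>i\<in>I. \<Sum>j\<in>I. cnj (A i j) * cnj (x j) * y i)"
    by (simp add: coord_ip mat_app_def sum_distrib_right)
  also have "\<dots> = (\<Sum>j\<in>I. \<Sum>i\<in>I. cnj (A i j) * cnj (x j) * y i)" by (rule sum.swap)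
  also have "\<dots> = ip (coord_space I) x (mat_app I (mat_adjoint A) y)"
    by (simp add: coord_ip mat_app_def mat_adjoint_def sum_distrib_left mult_ac)
  finally show ?thesis .
qed

lemma mat_invertibleE:
  assumes "mat_invertible I A" "finite I"
  obtains B where "\<And>x. x \<in> car (coord_space I) \<Longrightarrow> mat_app I A (mat_app I B x) = x"
    "\<And>x. x \<in> car (coord_space I) \<Longrightarrow> mat_app I B (mat_app I A x) = x"
proof -
  obtain B where B: "mat_eq_on I (mat_prod I A B) (\<lambda>i j. if i = j then 1 else 0)"
    "mat_eq_on I (mat_prod I B A) (\<lambda>i j. if i = j then 1 else 0)"
    using assms(1) by (auto simp: mat_invertible_def)
  show thesis
    by (rule that[of B]) (simp_all add: mat_app_mat_prod[OF assms(2)] mat_app_cong[OF B(1)] mat_app_cong[OF B(2)] mat_app_one[OF assms(2)])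
qed

text \<open>A definite inner product on pairs. Density of the domain of \<open>A_min\<close> is
  shown by an orthogonality argument in this space, where Riesz is available, and only then carried
  over to the indefinite form.\<close>

definition prod_space ::
    "'v::complex_vector ipspace \<Rightarrow> 'w::complex_vector ipspace \<Rightarrow> ('v \<times> 'w) ipspace" where
  "prod_space X Y = \<lparr>car = car X \<times> car Y, ip = (\<lambda>p q. ip X (fst p) (fst q) + ip Y (snd p) (snd q))\<rparr>"

lemma hilbert_prod_space:
  assumes "hilbert_space X" "hilbert_space Y"
  shows "hilbert_space (prod_space X Y)"
    and "(\<And>i. u i \<in> car X) \<Longrightarrow> (\<And>i. v i \<in> car Y) \<Longrightarrow> cvg (prod_space X Y) (\<lambda>i. (u i, v i)) (x, y) \<Longrightarrow> cvg X u x \<and> cvg Y v y"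
proof -
  interpret X: hilbert X by (rule hilbertI[OF assms(1)])
  interpret Y: hilbert Y by (rule hilbertI[OF assms(2)])
  let ?Z = "prod_space X Y"
  have norm: "ipnorm ?Z p = sqrt ((ipnorm X (fst p))\<^sup>2 + (ipnorm Y (snd p))\<^sup>2)" if "p \<in> car ?Z" for p
    using that by (auto simp: ipnorm_def prod_space_def)
  have diff: "p - q \<in> car ?Z" if "p \<in> car ?Z" "q \<in> car ?Z" for p q using that by (auto simp: prod_space_def)
  have le: "ipnorm X (fst p) \<le> ipnorm ?Z p" "ipnorm Y (snd p) \<le> ipnorm ?Z p" if "p \<in> car ?Z" for p
    unfolding norm[OF that] using that by (auto simp: prod_space_def intro: real_le_rsqrt)
  have conv: "cvg X (\<lambda>i. fst (w i)) x \<and> cvg Y (\<lambda>i. snd (w i)) y" if c: "cvg ?Z w (x, y)" for w x y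
  proof -
    have w: "\<And>i. w i \<in> car ?Z" "(x, y) \<in> car ?Z" and l: "(\<lambda>i. ipnorm ?Z (w i - (x, y))) \<longlonglongrightarrow> 0"
      using c by (auto simp: cvg_def)
    have m: "fst (w i) \<in> car X" "snd (w i) \<in> car Y" for i using w(1)[of i] by (auto simp: prod_space_def)
    show ?thesis
    proof
      show "cvg X (\<lambda>i. fst (w i)) x"
        by (rule X.cvg_bound[OF m(1) _ _ l]) (use w le(1)[OF diff[OF w]] in \<open>auto simp: prod_space_def\<close>)
      show "cvg Y (\<lambda>i. snd (w i)) y"
        by (rule Y.cvg_bound[OF m(2) _ _ l]) (use w le(2)[OF diff[OF w]] in \<open>auto simp: prod_space_def\<close>)
    qed
  qed
  show "cvg X u x \<and> cvg Y v y" if "\<And>i. u i \<in> car X" "\<And>i. v i \<in> car Y" "cvg ?Z (\<lambda>i. (u i, v i)) (x, y)"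
    using conv[OF that(3)] by simp
  show "hilbert_space ?Z"
    unfolding hilbert_space_def
  proof (intro conjI ballI allI impI)
    show "inner_space ?Z"
      unfolding inner_space_def
    proof (intro conjI ballI allI)
      show "complex_vector.subspace (car ?Z)"
        by (auto simp: complex_vector.subspace_def prod_space_def scaleC_prod_def zero_prod_def)
      show "ip ?Z q p = cnj (ip ?Z p q)" if "p \<in> car ?Z" "q \<in> car ?Z" for p q
        using X.ip_cnj[of "fst p" "fst q"] Y.ip_cnj[of "snd p" "snd q"] that by (auto simp: prod_space_def)
    qed (auto simp: prod_space_def X.ip_linear Y.ip_linear scaleC_prod_def algebra_simps)
    show "0 < Re (ip ?Z p p)" if "p \<in> car ?Z" "p \<noteq> 0" for p
    proof -
      have m: "fst p \<in> car X" "snd p \<in> car Y" using that by (auto simp: prod_space_def)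
      show ?thesis
      proof (cases "fst p = 0")
        case True
        then have "snd p \<noteq> 0" using that(2) by (auto simp: prod_eq_iff)
        then show ?thesis using Y.ip_pos[OF m(2)] True by (simp add: prod_space_def)
      next
        case False
        then show ?thesis using X.ip_pos[OF m(1)] Y.ip_nonneg[OF m(2)] by (simp add: prod_space_def add_pos_nonneg del: Y.ip_nonneg)
      qed
    qed
    fix w :: "nat \<Rightarrow> 'a \<times> 'b"
    assume a: "(\<forall>i. w i \<in> car ?Z) \<and> (\<forall>e>0. \<exists>N. \<forall>i\<ge>N. \<forall>j\<ge>N. ipnorm ?Z (w i - w j) < e)"
    then have w: "w i \<in> car ?Z" for i by blast
    have m: "fst (w i) \<in> car X" "snd (w i) \<in> car Y" for i using w[of i] by (auto simp: prod_space_def)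
    have "\<exists>x. cvg X (\<lambda>i. fst (w i)) x"
    proof (rule X.complete[OF m(1)])
      fix e :: real assume "e > 0"
      then obtain N where "\<forall>i\<ge>N. \<forall>j\<ge>N. ipnorm ?Z (w i - w j) < e" using a by blast
      then show "\<exists>N. \<forall>i\<ge>N. \<forall>j\<ge>N. ipnorm X (fst (w i) - fst (w j)) < e"
        using order.strict_trans1[OF le(1)[OF diff[OF w w]]] by (metis fst_diff)
    qed
    then obtain x where x: "cvg X (\<lambda>i. fst (w i)) x" ..
    have "\<exists>y. cvg Y (\<lambda>i. snd (w i)) y"
    proof (rule Y.complete[OF m(2)])
      fix e :: real assume "e > 0"
      then obtain N where "\<forall>i\<ge>N. \<forall>j\<ge>N. ipnorm ?Z (w i - w j) < e" using a by blast
      then show "\<exists>N. \<forall>i\<ge>N. \<forall>j\<ge>N. ipnorm Y (snd (w i) - snd (w j)) < e"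
        using order.strict_trans1[OF le(2)[OF diff[OF w w]]] by (metis snd_diff)
    qed
    then obtain y where y: "cvg Y (\<lambda>i. snd (w i)) y" ..
    have xy: "(x, y) \<in> car ?Z" using x y by (auto simp: cvg_def prod_space_def)
    have "(\<lambda>i. sqrt ((ipnorm X (fst (w i) - x))\<^sup>2 + (ipnorm Y (snd (w i) - y))\<^sup>2)) \<longlonglongrightarrow> sqrt (0\<^sup>2 + 0\<^sup>2)"
      using x y by (intro tendsto_intros) (auto simp: cvg_def)
    then have "(\<lambda>i. ipnorm ?Z (w i - (x, y))) \<longlonglongrightarrow> 0"
      using norm[OF diff[OF w xy]] by simp
    then show "\<exists>p\<in>car ?Z. (\<lambda>i. ipnorm ?Z (w i - p)) \<longlonglongrightarrow> 0" using xy by blast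
  qed
qed

lemma hilbert_image:
  assumes X: "hilbert_space X"
    and add: "\<And>x y. x \<in> car X \<Longrightarrow> y \<in> car X \<Longrightarrow> f (x + y) = f x + f y"
    and scale: "\<And>a x. x \<in> car X \<Longrightarrow> f (a *\<^sub>C x) = a *\<^sub>C f x"
    and ip: "\<And>x y. x \<in> car X \<Longrightarrow> y \<in> car X \<Longrightarrow> g (f x) (f y) = ip X x y"
  shows "hilbert_space \<lparr>car = f ` car X, ip = g\<rparr>"
proof -
  interpret hilbert X by (rule hilbertI[OF X])
  let ?Y = "\<lparr>car = f ` car X, ip = g\<rparr>"
  have f0: "f 0 = 0" using scale[of 0 0] by (simp add: complex_vector.scale_zero_left)
  have diff: "f x - f y = f (x - y)" if "x \<in> car X" "y \<in> car X" for x y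
    using add[of "x - y" y] that by (simp add: algebra_simps)
  have norm: "ipnorm ?Y (f x) = ipnorm X x" if "x \<in> car X" for x using ip that by (simp add: ipnorm_def)
  show ?thesis
    unfolding hilbert_space_def
  proof (intro conjI ballI allI impI)
    show "inner_space ?Y"
      unfolding inner_space_def
    proof (intro conjI ballI allI)
      show "complex_vector.subspace (car ?Y)"
        unfolding complex_vector.subspace_def
      proof (intro conjI ballI allI)
        show "0 \<in> car ?Y" using f0 by (simp add: image_iff) (metis zero_mem)
        show "x + y \<in> car ?Y" if "x \<in> car ?Y" "y \<in> car ?Y" for x y
          using that by (auto simp flip: add)
        show "c *\<^sub>C x \<in> car ?Y" if "x \<in> car ?Y" for c x using that by (auto simp flip: scale)
      qed
      show "ip ?Y y x = cnj (ip ?Y x y)" if "x \<in> car ?Y" "y \<in> car ?Y" for x y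
        using that by (auto simp: ip intro: ip_cnj)
    qed (auto simp: ip ip_linear simp flip: add scale)
    show "0 < Re (ip ?Y y y)" if y: "y \<in> car ?Y" "y \<noteq> 0" for y
    proof -
      obtain x where "x \<in> car X" "y = f x" "x \<noteq> 0" using y f0 by auto
      then show ?thesis using ip_pos by (simp add: ip)
    qed
    fix u :: "nat \<Rightarrow> 'b"
    assume a: "(\<forall>i. u i \<in> car ?Y) \<and> (\<forall>e>0. \<exists>N. \<forall>i\<ge>N. \<forall>j\<ge>N. ipnorm ?Y (u i - u j) < e)"
    then have "\<forall>i. \<exists>x. x \<in> car X \<and> u i = f x" by auto
    then obtain x where x: "\<And>i. x i \<in> car X" "\<And>i. u i = f (x i)" by metis
    have un: "ipnorm ?Y (u i - u j) = ipnorm X (x i - x j)" for i j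
      using x norm by (simp add: diff)
    have "\<exists>y. cvg X x y" by (rule complete) (use a x un in auto)
    then obtain y where y: "cvg X x y" ..
    then have "(\<lambda>i. ipnorm ?Y (u i - f y)) \<longlonglongrightarrow> 0" using x norm by (simp add: diff cvg_def)
    then show "\<exists>x\<in>car ?Y. (\<lambda>i. ipnorm ?Y (u i - x)) \<longlonglongrightarrow> 0" using y by (auto simp: cvg_def)
  qed
qed

lemma mat_app_cvg:
  assumes I: "finite I" and u: "cvg (coord_space I) u x"
  shows "cvg (coord_space I) (\<lambda>k. mat_app I A (u k)) (mat_app I A x)"
proof -
  have m: "\<And>k. u k \<in> car (coord_space I)" "x \<in> car (coord_space I)" using u by (auto simp: cvg_def)
  have l: "(\<lambda>k. u k i) \<longlonglongrightarrow> x i" if "i \<in> I" for i using u cvg_coord_iff[OF I, of u x] m that by simp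
  show ?thesis
    by (subst cvg_coord_iff[OF I]) (simp, simp, auto simp: mat_app_def intro!: tendsto_intros l)
qed

section \<open>The model\<close>

text \<open>
  An abstract copy of the A-model: the space \<open>Y\<close> is coordinatised by \<open>W\<close>, and \<open>L\<close> is parametrised by
  \<open>s = (L - z\<^sub>1) u\<close>, so that no domain conditions occur.
\<close>

locale model = X: hilbert X for X :: "'v::complex_vector ipspace" +
  fixes R :: "'v \<Rightarrow> 'v" and z1 :: real and m :: nat and S :: "'s set" and SJ :: "('s \<times> nat) set" and a :: "'s \<Rightarrow> 'v"
    and \<G> :: "('s \<times> nat) \<Rightarrow> ('s \<times> nat) \<Rightarrow> complex"
    and W :: "'v \<Rightarrow> ('s \<times> nat \<Rightarrow> complex) \<Rightarrow> 'y::complex_vector"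
    and Y :: "'y ipspace" and \<Gamma>0 \<Gamma>1 :: "'y \<Rightarrow> 's \<Rightarrow> complex"
  assumes R_bounded: "X.bounded_op R" and R_symm: "X.symm_op R"
    and R_inj: "s \<in> car X \<Longrightarrow> R s = 0 \<Longrightarrow> s = 0"
    and m: "1 \<le> m" and S: "finite S" "S \<noteq> {}"
    and SJ: "SJ = S \<times> {1..m}"
    and a_mem: "\<sigma> \<in> S \<Longrightarrow> a \<sigma> \<in> car X"
    and indep: "c \<in> car (coord_space S) \<Longrightarrow> s \<in> car X \<Longrightarrow> (\<Sum>\<sigma>\<in>S. c \<sigma> *\<^sub>C a \<sigma>) = R s \<Longrightarrow> c = 0"
    and G_inv: "mat_invertible SJ \<G>"
    and G_herm: "mat_eq_on SJ (mat_adjoint \<G>) \<G>"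
    and G_comm: "mat_eq_on SJ
      (mat_prod SJ \<G> (A_model.M_d z1 m))
      (mat_prod SJ (mat_adjoint (A_model.M_d z1 m)) \<G>)"
    and W_add: "u \<in> car X \<Longrightarrow> u' \<in> car X \<Longrightarrow> \<xi> \<in> car (coord_space SJ) \<Longrightarrow>
      \<xi>' \<in> car (coord_space SJ) \<Longrightarrow> W (u + u') (\<xi> + \<xi>') = W u \<xi> + W u' \<xi>'"
    and W_scale: "u \<in> car X \<Longrightarrow> \<xi> \<in> car (coord_space SJ) \<Longrightarrow> W (r *\<^sub>C u) (r *\<^sub>C \<xi>) = r *\<^sub>C W u \<xi>"
    and W_inj: "u \<in> car X \<Longrightarrow> \<xi> \<in> car (coord_space SJ) \<Longrightarrow> W u \<xi> = 0 \<Longrightarrow> u = 0 \<and> \<xi> = 0"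
    and car_Y: "car Y = {W u \<xi> | u \<xi>. u \<in> car X \<and> \<xi> \<in> car (coord_space SJ)}"
    and ip_Y: "u \<in> car X \<Longrightarrow> u' \<in> car X \<Longrightarrow> \<xi> \<in> car (coord_space SJ) \<Longrightarrow>
      \<xi>' \<in> car (coord_space SJ) \<Longrightarrow>
      ip Y (W u \<xi>) (W u' \<xi>') = ip X u u' + ip (coord_space SJ) \<xi> (mat_app SJ \<G> \<xi>')"
    and \<Gamma>0: "s \<in> car X \<Longrightarrow> c \<in> car (coord_space S) \<Longrightarrow> \<xi> \<in> car (coord_space SJ) \<Longrightarrow>
      \<Gamma>0 (W (R s + (\<Sum>\<sigma>\<in>S. c \<sigma> *\<^sub>C a \<sigma>)) \<xi>) = c"
    and \<Gamma>1: "s \<in> car X \<Longrightarrow> c \<in> car (coord_space S) \<Longrightarrow> \<xi> \<in> car (coord_space SJ) \<Longrightarrow>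
      \<Gamma>1 (W (R s + (\<Sum>\<sigma>\<in>S. c \<sigma> *\<^sub>C a \<sigma>)) \<xi>)
        = (\<lambda>\<sigma>. if \<sigma> \<in> S then ip X (a \<sigma>) s else 0) - A_model.block_m m (mat_app SJ \<G> \<xi>)"
begin

abbreviation "C \<equiv> coord_space SJ"
abbreviation "Cd \<equiv> coord_space S"
abbreviation "M \<equiv> mat_app SJ (A_model.M_d z1 m)"
abbreviation "G \<equiv> mat_app SJ \<G>"
abbreviation "\<eta> \<equiv> A_model.eta m"
abbreviation "block \<equiv> A_model.block_m m"

definition ac :: "('s \<Rightarrow> complex) \<Rightarrow> 'v" where
  "ac c = (\<Sum>\<sigma>\<in>S. c \<sigma> *\<^sub>C a \<sigma>)"

text \<open>The duality pairing of the functionals with \<open>f\<close>, expressed by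
  \<open>s = (L - z1) f\<close> in the coordinates of \<open>H 0\<close>; as an operator it is the
  adjoint of \<open>ac\<close>.\<close>

definition \<Lambda> :: "'v \<Rightarrow> 's \<Rightarrow> complex" where
  "\<Lambda> s = (\<lambda>\<sigma>. if \<sigma> \<in> S then ip X (a \<sigma>) s else 0)"

definition x_of :: "'v \<Rightarrow> ('s \<Rightarrow> complex) \<Rightarrow> ('s \<times> nat \<Rightarrow> complex) \<Rightarrow> 'y" where
  "x_of s c \<xi> = W (R s + ac c) \<xi>"

definition y_of :: "'v \<Rightarrow> ('s \<Rightarrow> complex) \<Rightarrow> ('s \<times> nat \<Rightarrow> complex) \<Rightarrow> 'y" where
  "y_of s c \<xi> = W (s + of_real z1 *\<^sub>C (R s + ac c)) (M \<xi> + \<eta> c)"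

definition A_max :: "'y rel" where
  "A_max = {(x_of s c \<xi>, y_of s c \<xi>) | s c \<xi>. s \<in> car X \<and> c \<in> car Cd \<and> \<xi> \<in> car C}"

definition A_min :: "'y rel" where
  "A_min = {(x, y) \<in> A_max. \<Gamma>0 x = 0 \<and> \<Gamma>1 x = 0}"

definition A_ext :: "('s \<Rightarrow> complex) rel \<Rightarrow> 'y rel" where
  "A_ext \<Theta> = {(x, y) \<in> A_max. (\<Gamma>0 x, \<Gamma>1 x) \<in> \<Theta>}"

definition A0 :: "'y rel" where
  "A0 = A_ext ({0} \<times> car Cd)"

definition Lrel :: "'v rel" where
  "Lrel = {(R s, s + of_real z1 *\<^sub>C R s) | s. s \<in> car X}"

subsection \<open>Linear algebra of the coordinates\<close>

lemma finite_SJ [simp]: "finite SJ"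
  using S SJ by simp

sublocale C: hilbert C
  by (rule hilbertI[OF hilbert_coord[OF finite_SJ]])

sublocale Cd: hilbert Cd
  by (rule hilbertI[OF hilbert_coord[OF S(1)]])

lemma R_lin: "X.linop R" and R_mem [simp]: "s \<in> car X \<Longrightarrow> R s \<in> car X"
  using R_bounded by (auto simp: X.bounded_op_def X.linop_mem)

lemmas R_add = X.linop_add[OF R_lin] and R_scale = X.linop_scale[OF R_lin] and R_diff = X.linop_diff[OF R_lin]
  and R_0 [simp] = X.linop_0[OF R_lin]

lemma R_neg: "s \<in> car X \<Longrightarrow> R (- s) = - R s"
  using R_diff[of 0 s] by simp

lemma R_ip: "s \<in> car X \<Longrightarrow> t \<in> car X \<Longrightarrow> ip X (R s) t = ip X s (R t)"
  using R_symm by (simp add: X.symm_op_def)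

lemma ac_mem [simp]: "ac c \<in> car X"
  unfolding ac_def by (intro X.sum_mem X.scale_mem a_mem)

lemma ac_add: "ac (c + d) = ac c + ac d"
  by (simp add: ac_def scaleC_add_left sum.distrib)

lemma ac_scale: "ac (r *\<^sub>C c) = r *\<^sub>C ac c"
  by (simp add: ac_def complex_vector.scale_sum_right scaleC_scaleC)

lemma ac_diff: "ac (c - d) = ac c - ac d"
  using ac_add[of "c - d" d] by simp

lemma ac_0 [simp]: "ac 0 = 0"
  using ac_diff[of 0 0] by simp

lemma ac_inj: "c \<in> car Cd \<Longrightarrow> s \<in> car X \<Longrightarrow> ac c = R s \<Longrightarrow> c = 0"
  using indep by (simp add: ac_def)

lemma \<eta>_mem [simp]: "c \<in> car Cd \<Longrightarrow> \<eta> c \<in> car C"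
  using m by (auto simp: coord_mem_iff A_model.eta_def SJ)

lemma \<eta>_add: "\<eta> (c + d) = \<eta> c + \<eta> d"
  by (auto simp: A_model.eta_def fun_eq_iff)

lemma \<eta>_scale: "\<eta> (r *\<^sub>C c) = r *\<^sub>C \<eta> c"
  by (auto simp: A_model.eta_def fun_eq_iff)

lemma \<eta>_0 [simp]: "\<eta> 0 = 0"
  by (auto simp: A_model.eta_def fun_eq_iff)

lemma block_\<eta> [simp]: "block (\<eta> c) = c"
  by (auto simp: A_model.eta_def A_model.block_m_def fun_eq_iff)

lemma block_mem [simp]: "\<xi> \<in> car C \<Longrightarrow> block \<xi> \<in> car Cd"
  by (auto simp: coord_mem_iff A_model.block_m_def SJ)

lemma block_add: "block (\<xi> + \<zeta>) = block \<xi> + block \<zeta>"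
  by (auto simp: A_model.block_m_def fun_eq_iff)

lemma block_0 [simp]: "block 0 = 0"
  by (auto simp: A_model.block_m_def fun_eq_iff)

text \<open>Says that \<open>block\<close> is the adjoint of \<open>\<eta>\<close>; this is how
  \<open>block (G \<xi>)\<close> enters \<open>\<Gamma>1\<close>.\<close>

lemma ip_\<eta>: "ip C (\<eta> c) v = ip Cd c (block v)"
proof -
  have "ip C (\<eta> c) v = (\<Sum>\<sigma>\<in>S. \<Sum>j\<in>{1..m}. if j = m then cnj (c \<sigma>) * v (\<sigma>, m) else 0)"
    unfolding coord_ip sum.cartesian_product SJ by (intro sum.cong) (auto simp: A_model.eta_def)
  also have "\<dots> = ip Cd c (block v)"
    using m by (simp add: coord_ip A_model.block_m_def)
  finally show ?thesis .
qed

lemma ip_\<eta>_right: "c \<in> car Cd \<Longrightarrow> v \<in> car C \<Longrightarrow> ip C v (\<eta> c) = ip Cd (block v) c"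
  using C.ip_cnj[of "\<eta> c" v] Cd.ip_cnj[of c "block v"] by (simp add: ip_\<eta>)

lemma \<Lambda>_mem [simp]: "\<Lambda> s \<in> car Cd"
  by (simp add: coord_mem_iff \<Lambda>_def)

lemma \<Lambda>_add: "s \<in> car X \<Longrightarrow> t \<in> car X \<Longrightarrow> \<Lambda> (s + t) = \<Lambda> s + \<Lambda> t"
  by (auto simp: \<Lambda>_def fun_eq_iff X.ip_linear a_mem)

lemma \<Lambda>_scale: "s \<in> car X \<Longrightarrow> \<Lambda> (r *\<^sub>C s) = r *\<^sub>C \<Lambda> s"
  by (auto simp: \<Lambda>_def fun_eq_iff X.ip_linear a_mem)

lemma \<Lambda>_0 [simp]: "\<Lambda> 0 = 0"
  by (auto simp: \<Lambda>_def fun_eq_iff a_mem)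

lemma ip_ac: "c \<in> car Cd \<Longrightarrow> s \<in> car X \<Longrightarrow> ip X (ac c) s = ip Cd c (\<Lambda> s)"
  unfolding ac_def by (subst X.ip_sum_left) (auto simp: a_mem X.ip_linear coord_ip \<Lambda>_def)

lemma ip_ac_right: "c \<in> car Cd \<Longrightarrow> s \<in> car X \<Longrightarrow> ip X s (ac c) = ip Cd (\<Lambda> s) c"
  using X.ip_cnj[of "ac c" s] Cd.ip_cnj[of c "\<Lambda> s"] by (simp add: ip_ac)

lemma G_symm: "ip C (G \<xi>) \<zeta> = ip C \<xi> (G \<zeta>)"
  by (simp add: mat_app_adjoint mat_app_cong[OF G_herm])

text \<open>The commutation hypothesis on \<open>\<G>\<close> in the form used below:
  \<open>M\<close> is symmetric for the inner product given by \<open>\<G>\<close>.\<close>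

lemma GM: "ip C (M \<xi>) (G \<zeta>) = ip C \<xi> (G (M \<zeta>))"
  by (simp add: mat_app_adjoint mat_app_mat_prod mat_app_cong[OF G_comm])

definition Gi :: "('s \<times> nat \<Rightarrow> complex) \<Rightarrow> 's \<times> nat \<Rightarrow> complex" where
  "Gi = mat_app SJ (SOME B. \<forall>x\<in>car C. G (mat_app SJ B x) = x \<and> mat_app SJ B (G x) = x)"

lemma G_Gi: "x \<in> car C \<Longrightarrow> G (Gi x) = x" and Gi_G: "x \<in> car C \<Longrightarrow> Gi (G x) = x"
proof -
  have ex: "\<exists>B. \<forall>x\<in>car C. G (mat_app SJ B x) = x \<and> mat_app SJ B (G x) = x"
    using mat_invertibleE[OF G_inv finite_SJ] by metis
  have *: "\<forall>x\<in>car C. G (Gi x) = x \<and> Gi (G x) = x"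
    unfolding Gi_def by (rule someI_ex[OF ex])
  show "x \<in> car C \<Longrightarrow> G (Gi x) = x" "x \<in> car C \<Longrightarrow> Gi (G x) = x" using * by auto
qed

lemma Gi_mem [simp]: "Gi x \<in> car C"
  by (simp add: Gi_def)

text \<open>A row of the Jordan block has an entry on the diagonal and, except for the last row, a 1
  next to it.\<close>

lemma M_apply: "(\<sigma>, j) \<in> SJ \<Longrightarrow>
    M \<xi> (\<sigma>, j) = of_real z1 * \<xi> (\<sigma>, j) + (if j < m then \<xi> (\<sigma>, Suc j) else 0)"
proof -
  assume *: "(\<sigma>, j) \<in> SJ"
  have "M \<xi> (\<sigma>, j) = (\<Sum>(\<sigma>', j')\<in>SJ. if \<sigma>' = \<sigma> then A_model.M_mat z1 m j j' * \<xi> (\<sigma>, j') else 0)"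
    using * by (auto simp: mat_app_def A_model.M_d_def intro!: sum.cong)
  also have "\<dots> = (\<Sum>\<sigma>'\<in>S. \<Sum>j'\<in>{1..m}. if \<sigma>' = \<sigma> then A_model.M_mat z1 m j j' * \<xi> (\<sigma>, j') else 0)"
    by (simp add: sum.cartesian_product SJ)
  also have "\<dots> = (\<Sum>\<sigma>'\<in>S. if \<sigma>' = \<sigma> then (\<Sum>j'\<in>{1..m}. A_model.M_mat z1 m j j' * \<xi> (\<sigma>, j')) else 0)"
    by (intro sum.cong) auto
  also have "\<dots> = (\<Sum>j'\<in>{1..m}. A_model.M_mat z1 m j j' * \<xi> (\<sigma>, j'))"
    using * S by (simp add: SJ)
  also have "\<dots> = (\<Sum>j'\<in>{1..m}. (if j' = j then of_real z1 * \<xi> (\<sigma>, j') else 0)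
      + (if j' = Suc j then (if j < m then \<xi> (\<sigma>, j') else 0) else 0))"
    using * by (intro sum.cong) (auto simp: A_model.M_mat_def algebra_simps SJ)
  also have "\<dots> = of_real z1 * \<xi> (\<sigma>, j) + (if j < m then \<xi> (\<sigma>, Suc j) else 0)"
    using * by (simp add: sum.distrib SJ)
  finally show ?thesis .
qed

subsection \<open>The coordinatised space\<close>

lemma W_0 [simp]: "W 0 0 = 0"
  using W_scale[of 0 0 0] by (simp add: complex_vector.scale_zero_left)

lemma W_diff: "u \<in> car X \<Longrightarrow> u' \<in> car X \<Longrightarrow> \<xi> \<in> car C \<Longrightarrow> \<xi>' \<in> car C \<Longrightarrow> W (u - u') (\<xi> - \<xi>') = W u \<xi> - W u' \<xi>'"
  using W_add[of "u - u'" u' "\<xi> - \<xi>'" \<xi>'] by simp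

lemma W_eq_iff: "u \<in> car X \<Longrightarrow> u' \<in> car X \<Longrightarrow> \<xi> \<in> car C \<Longrightarrow> \<xi>' \<in> car C \<Longrightarrow> W u \<xi> = W u' \<xi>' \<longleftrightarrow> u = u' \<and> \<xi> = \<xi>'"
  using W_diff[of u u' \<xi> \<xi>'] W_inj[of "u - u'" "\<xi> - \<xi>'"] by auto

lemma W_mem [simp]: "u \<in> car X \<Longrightarrow> \<xi> \<in> car C \<Longrightarrow> W u \<xi> \<in> car Y"
  by (auto simp: car_Y)

lemma Y_cases: assumes "y \<in> car Y" obtains u \<xi> where "u \<in> car X" "\<xi> \<in> car C" "y = W u \<xi>"
  using assms by (auto simp: car_Y)

lemma inner_Y: "inner_space Y"
  unfolding inner_space_def
proof (intro conjI ballI allI)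
  show "complex_vector.subspace (car Y)"
    unfolding complex_vector.subspace_def
  proof (intro conjI ballI allI)
    show "0 \<in> car Y" using W_mem[of 0 0] by simp
    fix x assume x: "x \<in> car Y"
    then obtain u \<xi> where u: "u \<in> car X" "\<xi> \<in> car C" "x = W u \<xi>" by (rule Y_cases)
    show "r *\<^sub>C x \<in> car Y" for r using u W_scale[of u \<xi> r] W_mem[of "r *\<^sub>C u" "r *\<^sub>C \<xi>"] by simp
    fix y assume "y \<in> car Y"
    then obtain v \<zeta> where v: "v \<in> car X" "\<zeta> \<in> car C" "y = W v \<zeta>" by (rule Y_cases)
    show "x + y \<in> car Y" using u v W_add[of u v \<xi> \<zeta>] W_mem[of "u + v" "\<xi> + \<zeta>"] by simp
  qed
next
  fix x y assume x: "x \<in> car Y" and y: "y \<in> car Y"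
  from x obtain u \<xi> where u: "u \<in> car X" "\<xi> \<in> car C" "x = W u \<xi>" by (rule Y_cases)
  from y obtain v \<zeta> where v: "v \<in> car X" "\<zeta> \<in> car C" "y = W v \<zeta>" by (rule Y_cases)
  show "ip Y y x = cnj (ip Y x y)"
    using u v X.ip_cnj[of u v] C.ip_cnj[of "G \<xi>" \<zeta>] by (simp add: ip_Y G_symm)
  show "ip Y x (r *\<^sub>C y) = r * ip Y x y" for r
    using u v by (simp add: ip_Y flip: W_scale) (simp add: mat_app_scale C.ip_linear X.ip_linear algebra_simps)
  fix z assume "z \<in> car Y"
  then obtain w \<theta> where w: "w \<in> car X" "\<theta> \<in> car C" "z = W w \<theta>" by (rule Y_cases)
  show "ip Y x (y + z) = ip Y x y + ip Y x z"
    using u v w by (simp add: ip_Y flip: W_add) (simp add: mat_app_add C.ip_linear X.ip_linear)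
qed

sublocale Y: inner_prod Y
  by (rule innerI[OF inner_Y])

text \<open>\<open>Y\<close> is the orthogonal sum of a copy of \<open>X\<close> and a copy of
  \<open>C\<close>; the form on the latter is nondegenerate because \<open>\<G>\<close> is
  invertible.\<close>

lemma pontryagin_Y: "pontryagin_space Y"
proof (rule pontryagin_space_sum[OF inner_Y, of "(\<lambda>u. W u 0) ` car X" "W 0 ` unit_vec ` SJ"])
  let ?B = "W 0 ` unit_vec ` SJ"
  show "(\<lambda>u. W u 0) ` car X \<subseteq> car Y" by auto
  show "hilbert_space \<lparr>car = (\<lambda>u. W u 0) ` car X, ip = ip Y\<rparr>"
  proof (rule hilbert_image[OF X.hilbert])
    show "W (x + y) 0 = W x 0 + W y 0" if "x \<in> car X" "y \<in> car X" for x y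
      using W_add[of x y 0 0] that by simp
    show "W (r *\<^sub>C x) 0 = r *\<^sub>C W x 0" if "x \<in> car X" for r x
      using W_scale[of x 0 r] that by (simp add: complex_vector.scale_zero_right)
  qed (simp add: ip_Y)
  show fin: "finite ?B" by simp
  show BY: "?B \<subseteq> car Y" by (auto simp: unit_vec_mem)
  show "ip Y q b = 0" if "q \<in> (\<lambda>u. W u 0) ` car X" "b \<in> ?B" for q b
    using that by (auto simp: ip_Y unit_vec_mem)
  have W0_add: "W 0 (\<xi> + \<zeta>) = W 0 \<xi> + W 0 \<zeta>" if "\<xi> \<in> car C" "\<zeta> \<in> car C" for \<xi> \<zeta>
    using W_add[of 0 0 \<xi> \<zeta>] that by simp
  have W0_scale: "W 0 (r *\<^sub>C \<xi>) = r *\<^sub>C W 0 \<xi>" if "\<xi> \<in> car C" for r \<xi>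
    using W_scale[of 0 \<xi> r] that by (simp add: complex_vector.scale_zero_right)
  have W0_sum: "W 0 (sum f A) = (\<Sum>i\<in>A. W 0 (f i))" if "\<And>i. i \<in> A \<Longrightarrow> f i \<in> car C" for f and A :: "('s \<times> nat) set"
    using that by (induction A rule: infinite_finite_induct) (auto simp: W0_add)
  have span: "complex_vector.span ?B = W 0 ` car C"
  proof
    show "complex_vector.span ?B \<subseteq> W 0 ` car C"
    proof (rule complex_vector.span_minimal)
      show "?B \<subseteq> W 0 ` car C" by (auto simp: unit_vec_mem)
      show "complex_vector.subspace (W 0 ` car C)"
        unfolding complex_vector.subspace_def
      proof (intro conjI ballI allI)
        show "0 \<in> W 0 ` car C" using W_0 by (metis C.zero_mem image_eqI)
        show "x + y \<in> W 0 ` car C" if "x \<in> W 0 ` car C" "y \<in> W 0 ` car C" for x y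
          using that by (auto simp flip: W0_add)
        show "r *\<^sub>C x \<in> W 0 ` car C" if "x \<in> W 0 ` car C" for r x
          using that by (auto simp flip: W0_scale)
      qed
    qed
    show "W 0 ` car C \<subseteq> complex_vector.span ?B"
    proof clarify
      fix \<xi> assume xi: "\<xi> \<in> car C"
      have "W 0 \<xi> = (\<Sum>\<alpha>\<in>SJ. \<xi> \<alpha> *\<^sub>C W 0 (unit_vec \<alpha>))"
        by (subst coord_expand[OF finite_SJ xi], subst W0_sum) (simp_all add: unit_vec_mem W0_scale)
      also have "\<dots> \<in> complex_vector.span ?B"
        by (intro complex_vector.span_sum complex_vector.span_scale complex_vector.span_base imageI)
      finally show "W 0 \<xi> \<in> complex_vector.span ?B" .
    qed
  qed
  show "\<exists>q\<in>(\<lambda>u. W u 0) ` car X. \<exists>k\<in>complex_vector.span ?B. x = q + k" if x: "x \<in> car Y" for x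
  proof -
    obtain u \<xi> where u: "u \<in> car X" "\<xi> \<in> car C" "x = W u \<xi>" by (rule Y_cases[OF x])
    then have "x = W u 0 + W 0 \<xi>" using W_add[of u 0 0 \<xi>] by simp
    then show ?thesis using u unfolding span by blast
  qed
  fix x assume "x \<in> complex_vector.span ?B" and orth: "\<And>y. y \<in> complex_vector.span ?B \<Longrightarrow> ip Y x y = 0"
  then obtain \<xi> where x: "\<xi> \<in> car C" "x = W 0 \<xi>" unfolding span by blast
  have "\<xi> = 0"
  proof (rule C.ip_eqI_left)
    fix z assume z: "z \<in> car C"
    have "ip C \<xi> (G (Gi z)) = 0" using orth[of "W 0 (Gi z)"] x span by (simp add: ip_Y)
    then show "ip C \<xi> z = ip C 0 z" using z by (simp add: G_Gi)
  qed (use x in auto)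
  then show "x = 0" using x by simp
qed

text \<open>Testing with \<open>Gi (unit_vec \<alpha>)\<close> undoes \<open>\<G>\<close> and
  isolates one coordinate of \<open>\<xi> i - \<zeta>\<close>. Once the finite-dimensional part
  converges, it can be subtracted from the square, and the norm of \<open>u i - p\<close>
  remains.\<close>

lemma W_converges_iff:
  assumes u: "\<And>i. u i \<in> car X" "p \<in> car X" and \<xi>: "\<And>i. \<xi> i \<in> car C" "\<zeta> \<in> car C"
  shows "ip_converges Y (\<lambda>i. W (u i) (\<xi> i)) (W p \<zeta>) \<longleftrightarrow> cvg X u p \<and> cvg C \<xi> \<zeta>"
proof -
  have conv: "ip_converges Y (\<lambda>i. W (u i) (\<xi> i)) (W p \<zeta>) \<longleftrightarrow>
      (\<lambda>i. ip X (u i - p) (u i - p) + ip C (\<xi> i - \<zeta>) (G (\<xi> i - \<zeta>))) \<longlonglongrightarrow> 0 \<and>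
      (\<forall>v\<in>car X. \<forall>\<theta>\<in>car C. (\<lambda>i. ip X v (u i - p) + ip C \<theta> (G (\<xi> i - \<zeta>))) \<longlonglongrightarrow> 0)"
  proof -
    have d: "W (u i) (\<xi> i) - W p \<zeta> = W (u i - p) (\<xi> i - \<zeta>)" for i using assms by (simp add: W_diff)
    have "(\<forall>y\<in>car Y. (\<lambda>i. ip Y y (W (u i - p) (\<xi> i - \<zeta>))) \<longlonglongrightarrow> 0) \<longleftrightarrow>
        (\<forall>v\<in>car X. \<forall>\<theta>\<in>car C. (\<lambda>i. ip Y (W v \<theta>) (W (u i - p) (\<xi> i - \<zeta>))) \<longlonglongrightarrow> 0)"
      unfolding car_Y by blast
    then show ?thesis
      unfolding ip_converges_iff[OF pontryagin_Y] d using assms by (simp add: ip_Y)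
  qed
  show ?thesis
  proof
    assume "ip_converges Y (\<lambda>i. W (u i) (\<xi> i)) (W p \<zeta>)"
    then have 1: "(\<lambda>i. ip X (u i - p) (u i - p) + ip C (\<xi> i - \<zeta>) (G (\<xi> i - \<zeta>))) \<longlonglongrightarrow> 0"
      and 2: "\<And>v \<theta>. v \<in> car X \<Longrightarrow> \<theta> \<in> car C \<Longrightarrow> (\<lambda>i. ip X v (u i - p) + ip C \<theta> (G (\<xi> i - \<zeta>))) \<longlonglongrightarrow> 0"
      unfolding conv by auto
    have "\<forall>\<alpha>\<in>SJ. (\<lambda>i. (\<xi> i - \<zeta>) \<alpha>) \<longlonglongrightarrow> 0 \<alpha>"
    proof
      fix \<alpha> assume al: "\<alpha> \<in> SJ"
      have "ip C (Gi (unit_vec \<alpha>)) (G (\<xi> i - \<zeta>)) = (\<xi> i - \<zeta>) \<alpha>" for i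
        by (simp add: G_Gi unit_vec_mem[OF al] coord_ip_unit[OF finite_SJ al] flip: G_symm)
      then show "(\<lambda>i. (\<xi> i - \<zeta>) \<alpha>) \<longlonglongrightarrow> 0 \<alpha>" using 2[of 0 "Gi (unit_vec \<alpha>)"] u by simp
    qed
    then have c0: "cvg C (\<lambda>i. \<xi> i - \<zeta>) 0" by (subst cvg_coord_iff) (use \<xi> in auto)
    have "(\<lambda>i. ip C (\<xi> i - \<zeta>) (G (\<xi> i - \<zeta>))) \<longlonglongrightarrow> ip C 0 (G 0)"
      by (rule C.cvg_ip[OF c0 mat_app_cvg[OF finite_SJ c0]])
    from tendsto_diff[OF 1 this] have "(\<lambda>i. ip X (u i - p) (u i - p)) \<longlonglongrightarrow> 0" by simp
    then have "(\<lambda>i. sqrt (Re (ip X (u i - p) (u i - p)))) \<longlonglongrightarrow> sqrt (Re 0)" by (intro tendsto_intros)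
    then have "cvg X u p" using u by (simp add: cvg_def ipnorm_def)
    moreover have "cvg C \<xi> \<zeta>" using c0 C.cvg_diff_iff[of \<xi> \<zeta>] \<xi> by simp
    ultimately show "cvg X u p \<and> cvg C \<xi> \<zeta>" ..
  next
    assume "cvg X u p \<and> cvg C \<xi> \<zeta>"
    then have c: "cvg X (\<lambda>i. u i - p) 0" "cvg C (\<lambda>i. \<xi> i - \<zeta>) 0"
      using X.cvg_diff_iff[of u p] C.cvg_diff_iff[of \<xi> \<zeta>] u \<xi> by auto
    note cG = mat_app_cvg[OF finite_SJ c(2), of \<G>]
    show "ip_converges Y (\<lambda>i. W (u i) (\<xi> i)) (W p \<zeta>)"
      unfolding conv
    proof (intro conjI ballI)
      show "(\<lambda>i. ip X (u i - p) (u i - p) + ip C (\<xi> i - \<zeta>) (G (\<xi> i - \<zeta>))) \<longlonglongrightarrow> 0"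
        using tendsto_add[OF X.cvg_ip[OF c(1) c(1)] C.cvg_ip[OF c(2) cG]] by simp
      show "(\<lambda>i. ip X v (u i - p) + ip C \<theta> (G (\<xi> i - \<zeta>))) \<longlonglongrightarrow> 0" if "v \<in> car X" "\<theta> \<in> car C" for v \<theta>
        using tendsto_add[OF X.cvg_ip[OF X.cvg_const[OF that(1)] c(1)] C.cvg_ip[OF C.cvg_const[OF that(2)] cG]] that by simp
    qed
  qed
qed

subsection \<open>The boundary triple\<close>

lemma \<Gamma>0_x [simp]: "s \<in> car X \<Longrightarrow> c \<in> car Cd \<Longrightarrow> \<xi> \<in> car C \<Longrightarrow> \<Gamma>0 (x_of s c \<xi>) = c"
  using \<Gamma>0 by (simp add: x_of_def ac_def)

lemma \<Gamma>1_x [simp]: "s \<in> car X \<Longrightarrow> c \<in> car Cd \<Longrightarrow> \<xi> \<in> car C \<Longrightarrow> \<Gamma>1 (x_of s c \<xi>) = \<Lambda> s - block (G \<xi>)"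
  using \<Gamma>1 by (simp add: x_of_def ac_def \<Lambda>_def)

lemma A_max_iff: "(x, y) \<in> A_max \<longleftrightarrow> (\<exists>s c \<xi>. s \<in> car X \<and> c \<in> car Cd \<and> \<xi> \<in> car C \<and> x = x_of s c \<xi> \<and> y = y_of s c \<xi>)"
  by (auto simp: A_max_def)

lemma A_maxE:
  assumes "(x, y) \<in> A_max"
  obtains s c \<xi> where "s \<in> car X" "c \<in> car Cd" "\<xi> \<in> car C" "x = x_of s c \<xi>" "y = y_of s c \<xi>"
  using assms by (auto simp: A_max_iff)

lemma x_of_mem [simp]: "s \<in> car X \<Longrightarrow> \<xi> \<in> car C \<Longrightarrow> x_of s c \<xi> \<in> car Y"
  by (simp add: x_of_def)

lemma y_of_mem [simp]: "s \<in> car X \<Longrightarrow> c \<in> car Cd \<Longrightarrow> \<xi> \<in> car C \<Longrightarrow> y_of s c \<xi> \<in> car Y"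
  by (simp add: y_of_def)

text \<open>The singular part \<open>ac c\<close> and the regular part \<open>R s\<close> separate
  because \<open>ac\<close> meets the range of \<open>R\<close> only in 0.\<close>

lemma x_of_eq_iff:
  assumes "s \<in> car X" "c \<in> car Cd" "\<xi> \<in> car C" "s' \<in> car X" "c' \<in> car Cd" "\<xi>' \<in> car C"
  shows "x_of s c \<xi> = x_of s' c' \<xi>' \<longleftrightarrow> s = s' \<and> c = c' \<and> \<xi> = \<xi>'"
proof
  assume "x_of s c \<xi> = x_of s' c' \<xi>'"
  then have e: "R s + ac c = R s' + ac c'" "\<xi> = \<xi>'" using assms by (auto simp: x_of_def W_eq_iff)
  then have "ac (c - c') = R (s' - s)" using assms by (simp add: ac_diff R_diff algebra_simps)
  then have "c - c' = 0" using assms by (intro ac_inj) auto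
  then have c: "c = c'" by simp
  then have "R (s - s') = 0" using e assms by (simp add: R_diff)
  then have "s - s' = 0" using R_inj[of "s - s'"] assms by simp
  then show "s = s' \<and> c = c' \<and> \<xi> = \<xi>'" using c e by simp
qed simp

lemma x_of_add: "s \<in> car X \<Longrightarrow> \<xi> \<in> car C \<Longrightarrow> s' \<in> car X \<Longrightarrow> \<xi>' \<in> car C \<Longrightarrow>
    x_of (s + s') (c + c') (\<xi> + \<xi>') = x_of s c \<xi> + x_of s' c' \<xi>'"
  by (simp add: x_of_def R_add ac_add flip: W_add) (simp add: add_ac)

lemma x_of_scale: "s \<in> car X \<Longrightarrow> \<xi> \<in> car C \<Longrightarrow> x_of (r *\<^sub>C s) (r *\<^sub>C c) (r *\<^sub>C \<xi>) = r *\<^sub>C x_of s c \<xi>"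
  by (simp add: x_of_def R_scale ac_scale scaleC_add_right flip: W_scale)

lemma y_of_add: "s \<in> car X \<Longrightarrow> c \<in> car Cd \<Longrightarrow> \<xi> \<in> car C \<Longrightarrow> s' \<in> car X \<Longrightarrow> c' \<in> car Cd \<Longrightarrow> \<xi>' \<in> car C \<Longrightarrow>
    y_of (s + s') (c + c') (\<xi> + \<xi>') = y_of s c \<xi> + y_of s' c' \<xi>'"
  by (simp add: y_of_def R_add ac_add mat_app_add \<eta>_add scaleC_add_right flip: W_add) (simp add: add_ac)

lemma y_of_scale: "s \<in> car X \<Longrightarrow> c \<in> car Cd \<Longrightarrow> \<xi> \<in> car C \<Longrightarrow> y_of (r *\<^sub>C s) (r *\<^sub>C c) (r *\<^sub>C \<xi>) = r *\<^sub>C y_of s c \<xi>"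
  by (simp add: y_of_def R_scale ac_scale mat_app_scale \<eta>_scale flip: W_scale)
    (simp add: scaleC_add_right scaleC_scaleC mult.commute)

lemma A_max_I [simp]: "s \<in> car X \<Longrightarrow> c \<in> car Cd \<Longrightarrow> \<xi> \<in> car C \<Longrightarrow> (x_of s c \<xi>, y_of s c \<xi>) \<in> A_max"
  by (auto simp: A_max_iff)

lemma A_max_linear: "linear_operator Y Y A_max"
  unfolding linear_operator_def linear_relation_def
proof (intro conjI)
  show "A_max \<subseteq> car Y \<times> car Y" by (auto elim!: A_maxE)
  show "complex_vector.subspace A_max"
  proof (rule subspace_relI)
    show "(0, 0) \<in> A_max" using A_max_I[of 0 0 0] by (simp add: x_of_def y_of_def complex_vector.scale_zero_right)
    show "(x + x', y + y') \<in> A_max" if xy: "(x, y) \<in> A_max" "(x', y') \<in> A_max" for x y x' y'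
      using xy by (elim A_maxE) (simp flip: x_of_add y_of_add)
    show "(r *\<^sub>C x, r *\<^sub>C y) \<in> A_max" if xy: "(x, y) \<in> A_max" for r x y
      using xy by (elim A_maxE) (simp flip: x_of_scale y_of_scale)
  qed
  show "single_valued A_max"
    unfolding single_valued_def by (auto elim!: A_maxE simp: x_of_eq_iff)
qed

text \<open>The terms with \<open>z1\<close> cancel since \<open>z1\<close> is real, those with
  \<open>R s\<close> by symmetry of \<open>R\<close>, and those with \<open>M\<close> by
  \<open>GM\<close>. What is left pairs \<open>ac\<close> with \<open>s\<close> and
  \<open>\<eta>\<close> with \<open>G \<xi>\<close>, that is, \<open>c\<close> with the two summands
  of \<open>\<Gamma>1\<close>.\<close>

lemma Green:
  assumes "s \<in> car X" "c \<in> car Cd" "\<xi> \<in> car C" "s' \<in> car X" "c' \<in> car Cd" "\<xi>' \<in> car C"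
  shows "ip Y (x_of s c \<xi>) (y_of s' c' \<xi>') - ip Y (y_of s c \<xi>) (x_of s' c' \<xi>')
    = ip Cd c (\<Lambda> s' - block (G \<xi>')) - ip Cd (\<Lambda> s - block (G \<xi>)) c'"
proof -
  let ?u = "R s + ac c" and ?u' = "R s' + ac c'"
  have "ip Y (x_of s c \<xi>) (y_of s' c' \<xi>') - ip Y (y_of s c \<xi>) (x_of s' c' \<xi>')
      = (ip X ?u (s' + of_real z1 *\<^sub>C ?u') - ip X (s + of_real z1 *\<^sub>C ?u) ?u')
        + (ip C \<xi> (G (M \<xi>' + \<eta> c')) - ip C (M \<xi> + \<eta> c) (G \<xi>'))"
    using assms by (simp add: x_of_def y_of_def ip_Y)
  also have "ip X ?u (s' + of_real z1 *\<^sub>C ?u') - ip X (s + of_real z1 *\<^sub>C ?u) ?u' = ip X ?u s' - ip X s ?u'"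
    using assms by (simp add: X.ip_add_right[of ?u s'] X.ip_add_left[of s _ ?u'] X.ip_scale_left X.ip_scale_right)
  also have "\<dots> = ip Cd c (\<Lambda> s') - ip Cd (\<Lambda> s) c'"
    using assms by (simp add: X.ip_linear R_ip ip_ac ip_ac_right)
  also have "ip C \<xi> (G (M \<xi>' + \<eta> c')) - ip C (M \<xi> + \<eta> c) (G \<xi>')
      = ip Cd (block (G \<xi>)) c' - ip Cd c (block (G \<xi>'))"
    using assms G_symm[of \<xi> "\<eta> c'"] by (simp add: mat_app_add C.ip_linear GM ip_\<eta> ip_\<eta>_right)
  finally show ?thesis using assms by (simp add: Cd.ip_linear algebra_simps)
qed

lemma A_min_iff: "(x, y) \<in> A_min \<longleftrightarrow> (\<exists>s \<xi>. s \<in> car X \<and> \<xi> \<in> car C \<and> x = x_of s 0 \<xi> \<and> y = y_of s 0 \<xi> \<and> \<Lambda> s = block (G \<xi>))"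
proof
  assume A: "(x, y) \<in> A_min"
  then have "(x, y) \<in> A_max" by (simp add: A_min_def)
  then obtain s c \<xi> where s: "s \<in> car X" "c \<in> car Cd" "\<xi> \<in> car C" "x = x_of s c \<xi>" "y = y_of s c \<xi>"
    by (rule A_maxE)
  then have "c = 0" "\<Lambda> s = block (G \<xi>)" using A by (auto simp: A_min_def)
  then show "\<exists>s \<xi>. s \<in> car X \<and> \<xi> \<in> car C \<and> x = x_of s 0 \<xi> \<and> y = y_of s 0 \<xi> \<and> \<Lambda> s = block (G \<xi>)"
    using s by blast
qed (auto simp: A_min_def)

lemma A0_iff: "(x, y) \<in> A0 \<longleftrightarrow> (\<exists>s \<xi>. s \<in> car X \<and> \<xi> \<in> car C \<and> x = x_of s 0 \<xi> \<and> y = y_of s 0 \<xi>)"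
proof
  assume A: "(x, y) \<in> A0"
  then have "(x, y) \<in> A_max" by (simp add: A0_def A_ext_def)
  then obtain s c \<xi> where s: "s \<in> car X" "c \<in> car Cd" "\<xi> \<in> car C" "x = x_of s c \<xi>" "y = y_of s c \<xi>"
    by (rule A_maxE)
  then have "c = 0" using A by (auto simp: A0_def A_ext_def)
  then show "\<exists>s \<xi>. s \<in> car X \<and> \<xi> \<in> car C \<and> x = x_of s 0 \<xi> \<and> y = y_of s 0 \<xi>"
    using s by blast
qed (auto simp: A0_def A_ext_def)

lemma x_of_0: "x_of s 0 \<xi> = W (R s) \<xi>" and y_of_0: "y_of s 0 \<xi> = W (s + of_real z1 *\<^sub>C R s) (M \<xi>)"
  by (auto simp: x_of_def y_of_def)

text \<open>Vectors whose components \<open>(\<sigma>, m)\<close> vanish are tested first; they force \<open>\<delta>\<close> into the range of \<open>\<eta>\<close>.\<close>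

lemma in_range_\<eta>:
  assumes \<delta>: "\<delta> \<in> car C" and orth: "\<And>\<theta>. \<theta> \<in> car C \<Longrightarrow> block \<theta> = 0 \<Longrightarrow> ip C \<theta> \<delta> = 0"
  shows "\<delta> = \<eta> (block \<delta>)"
proof
  fix \<alpha> :: "'s \<times> nat"
  obtain \<sigma> j where a: "\<alpha> = (\<sigma>, j)" by (cases \<alpha>)
  show "\<delta> \<alpha> = \<eta> (block \<delta>) \<alpha>"
  proof (cases "\<alpha> \<in> SJ \<and> j \<noteq> m")
    case True
    then have "block (unit_vec \<alpha>) = 0" using a by (auto simp: A_model.block_m_def unit_vec_def fun_eq_iff)
    then have "\<delta> \<alpha> = 0" using orth[OF unit_vec_mem] True coord_ip_unit[OF finite_SJ] by simp
    then show ?thesis using True a by (simp add: A_model.eta_def)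
  next
    case False
    then show ?thesis using \<delta> a by (auto simp: A_model.eta_def A_model.block_m_def coord_mem_iff SJ)
  qed
qed

lemma adjoint_A_min: "adjoint_relation Y Y A_min = A_max"
proof (intro set_eqI, clarify)
  fix y y'
  show "(y, y') \<in> adjoint_relation Y Y A_min \<longleftrightarrow> (y, y') \<in> A_max"
  proof
    assume "(y, y') \<in> A_max"
    then obtain s c \<xi> where y: "s \<in> car X" "c \<in> car Cd" "\<xi> \<in> car C" "y = x_of s c \<xi>" "y' = y_of s c \<xi>"
      by (rule A_maxE)
    have "ip Y v y = ip Y u y'" if uv: "(u, v) \<in> A_min" for u v
    proof -
      obtain s' \<xi>' where u: "s' \<in> car X" "\<xi>' \<in> car C" "u = x_of s' 0 \<xi>'" "v = y_of s' 0 \<xi>'" "\<Lambda> s' = block (G \<xi>')"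
        using uv A_min_iff by blast
      then show ?thesis using Green[of s' 0 \<xi>' s c \<xi>] y by simp
    qed
    then show "(y, y') \<in> adjoint_relation Y Y A_min" using y by (auto simp: adjoint_relation_def)
  next
    assume adj: "(y, y') \<in> adjoint_relation Y Y A_min"
    then obtain p \<zeta> where p: "p \<in> car X" "\<zeta> \<in> car C" "y = W p \<zeta>"
      by (auto simp: adjoint_relation_def elim: Y_cases)
    from adj obtain p' \<zeta>' where p': "p' \<in> car X" "\<zeta>' \<in> car C" "y' = W p' \<zeta>'"
      by (auto simp: adjoint_relation_def elim: Y_cases)
    define \<delta> where "\<delta> = \<zeta>' - M \<zeta>"
    have \<delta>: "\<delta> \<in> car C" using p' by (simp add: \<delta>_def)
    \<comment> \<open>Testing against an element of \<open>A_min\<close> and moving \<open>R\<close>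
      and \<open>M\<close> to the other side produces one identity; \<open>\<delta>\<close> measures
      how far \<open>\<zeta>'\<close> is from \<open>M \<zeta>\<close>.\<close>
    have key: "ip C (G \<xi>) \<delta> = ip X s (p + of_real z1 *\<^sub>C R p - R p')"
      if s: "s \<in> car X" "\<xi> \<in> car C" "\<Lambda> s = block (G \<xi>)" for s \<xi>
    proof -
      have "ip Y (y_of s 0 \<xi>) y = ip Y (x_of s 0 \<xi>) y'"
        using adj s by (fastforce simp: adjoint_relation_def A_min_iff)
      then have "ip X (s + of_real z1 *\<^sub>C R s) p + ip C (M \<xi>) (G \<zeta>) = ip X (R s) p' + ip C \<xi> (G \<zeta>')"
        using s p p' by (simp add: x_of_0 y_of_0 ip_Y)
      then have "ip C \<xi> (G \<zeta>') - ip C \<xi> (G (M \<zeta>)) = ip X s p + of_real z1 * ip X s (R p) - ip X s (R p')"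
        using s p p' by (simp add: GM X.ip_linear R_ip algebra_simps)
      moreover have "ip C (G \<xi>) \<delta> = ip C \<xi> (G \<zeta>') - ip C \<xi> (G (M \<zeta>))"
        using s p' by (simp add: G_symm \<delta>_def mat_app_diff C.ip_linear)
      ultimately show ?thesis using s p p' by (simp add: X.ip_linear)
    qed
    \<comment> \<open>With \<open>s = 0\<close> the boundary condition only asks
      \<open>block (G \<xi>) = 0\<close>, and since \<open>\<G>\<close> is invertible
      \<open>G \<xi>\<close> runs through all such \<open>\<theta>\<close>.\<close>
    have "ip C \<theta> \<delta> = 0" if "\<theta> \<in> car C" "block \<theta> = 0" for \<theta>
      using key[of 0 "Gi \<theta>"] that p p' by (simp add: G_Gi)
    then have d: "\<delta> = \<eta> (block \<delta>)" by (rule in_range_\<eta>[OF \<delta>])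
    define c where "c = block \<delta>"
    have c: "c \<in> car Cd" "\<zeta>' = M \<zeta> + \<eta> c" using \<delta> d by (auto simp: c_def \<delta>_def algebra_simps)
    \<comment> \<open>Now \<open>s\<close> is arbitrary: the choice
      \<open>G \<xi> = \<eta> (\<Lambda> s)\<close> meets the boundary condition because
      \<open>block\<close> inverts \<open>\<eta>\<close>.\<close>
    have "ac c = p + of_real z1 *\<^sub>C R p - R p'"
    proof (rule X.ip_eqI)
      fix s assume s: "s \<in> car X"
      have "ip X s (p + of_real z1 *\<^sub>C R p - R p') = ip C (\<eta> (\<Lambda> s)) \<delta>"
        using key[of s "Gi (\<eta> (\<Lambda> s))"] s by (simp add: G_Gi)
      also have "\<dots> = ip X s (ac c)" using s c by (simp add: ip_\<eta> ip_ac_right c_def)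
      finally show "ip X s (ac c) = ip X s (p + of_real z1 *\<^sub>C R p - R p')" ..
    qed (use p p' in auto)
    \<comment> \<open>Solved for \<open>p\<close>, the identity exhibits the parameter of
      \<open>y\<close>: it is \<open>p' - z1 p\<close>, which would be \<open>s\<close> for an
      element of \<open>A_max\<close>.\<close>
    then have e: "p = R (p' - of_real z1 *\<^sub>C p) + ac c" using p p' by (simp add: R_diff R_scale)
    have "y = x_of (p' - of_real z1 *\<^sub>C p) c \<zeta>" using e p by (simp add: x_of_def)
    moreover have "y' = y_of (p' - of_real z1 *\<^sub>C p) c \<zeta>" using e[symmetric] p' c by (simp add: y_of_def)
    ultimately show "(y, y') \<in> A_max" using p p' c by simp
  qed
qed

text \<open>A vector \<open>(p, \<zeta>)\<close> orthogonal to the domain is tested with the same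
  two families as in \<open>adjoint_A_min\<close>. They give \<open>Gi \<zeta> = \<eta> c\<close>
  and \<open>ac c = R (- p)\<close>, so \<open>c = 0\<close> by independence and
  \<open>p = 0\<close> because \<open>R\<close> is injective.\<close>

lemma A_min_dense: "densely_defined Y A_min"
proof -
  let ?Z = "prod_space X C"
  note Z = hilbert_prod_space[OF X.hilbert C.hilbert]
  interpret Z: hilbert ?Z by (rule hilbertI[OF Z(1)])
  define D where "D = {(R s, \<xi>) | s \<xi>. s \<in> car X \<and> \<xi> \<in> car C \<and> \<Lambda> s = block (G \<xi>)}"
  have "Z.dense_in D"
  proof (rule Z.dense_if_trivial_complement)
    show "D \<subseteq> car ?Z" by (auto simp: D_def prod_space_def)
    show "complex_vector.subspace D"
    proof (rule subspace_relI)
      show "(0, 0) \<in> D" unfolding D_def by (intro CollectI exI[of _ 0]) simp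
      show "(x + x', y + y') \<in> D" if xy: "(x, y) \<in> D" "(x', y') \<in> D" for x y x' y'
      proof -
        obtain s s' where s: "x = R s" "x' = R s'" "s \<in> car X" "s' \<in> car X" "y \<in> car C" "y' \<in> car C"
          "\<Lambda> s = block (G y)" "\<Lambda> s' = block (G y')" using xy by (auto simp: D_def)
        then show ?thesis unfolding D_def
          by (intro CollectI exI[of _ "s + s'"] exI[of _ "y + y'"]) (simp add: R_add \<Lambda>_add mat_app_add block_add)
      qed
      show "(r *\<^sub>C x, r *\<^sub>C y) \<in> D" if xy: "(x, y) \<in> D" for r x y
      proof -
        obtain s where s: "x = R s" "s \<in> car X" "y \<in> car C" "\<Lambda> s = block (G y)" using xy by (auto simp: D_def)
        then show ?thesis unfolding D_def
          by (intro CollectI exI[of _ "r *\<^sub>C s"] exI[of _ "r *\<^sub>C y"])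
            (auto simp: R_scale \<Lambda>_scale mat_app_scale A_model.block_m_def fun_eq_iff)
      qed
    qed
    fix y assume y: "y \<in> car ?Z" and orth: "\<And>u. u \<in> D \<Longrightarrow> ip ?Z y u = 0"
    obtain p \<zeta> where p: "y = (p, \<zeta>)" "p \<in> car X" "\<zeta> \<in> car C" using y by (auto simp: prod_space_def)
    have key: "ip X (R p) s + ip C (Gi \<zeta>) \<theta> = 0" if s: "s \<in> car X" "\<theta> \<in> car C" "block \<theta> = \<Lambda> s" for s \<theta>
    proof -
      have "(R s, Gi \<theta>) \<in> D" using s by (auto simp: D_def G_Gi)
      then have "ip X p (R s) + ip C \<zeta> (Gi \<theta>) = 0" using orth[of "(R s, Gi \<theta>)"] by (simp add: p prod_space_def)
      moreover have "ip C \<zeta> (Gi \<theta>) = ip C (Gi \<zeta>) \<theta>"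
        using G_symm[of "Gi \<zeta>" "Gi \<theta>"] s p by (simp add: G_Gi)
      ultimately show ?thesis using s p by (simp add: R_ip)
    qed
    have "ip C \<theta> (Gi \<zeta>) = 0" if "\<theta> \<in> car C" "block \<theta> = 0" for \<theta>
      using key[of 0 \<theta>] that p C.ip_cnj[of "Gi \<zeta>" \<theta>] by simp
    then have k: "Gi \<zeta> = \<eta> (block (Gi \<zeta>))" by (intro in_range_\<eta>) auto
    define c where "c = block (Gi \<zeta>)"
    have c: "c \<in> car Cd" by (simp add: c_def)
    have "ac c = R (- p)"
    proof (rule X.ip_eqI_left)
      fix s assume s: "s \<in> car X"
      have "ip X (R p) s + ip C (\<eta> c) (\<eta> (\<Lambda> s)) = 0"
        using key[of s "\<eta> (\<Lambda> s)"] s k by (simp add: c_def)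
      then show "ip X (ac c) s = ip X (R (- p)) s"
        using s c p by (simp add: ip_\<eta> ip_ac X.ip_linear R_neg eq_neg_iff_add_eq_0 add.commute)
    qed (use p in auto)
    then have c0: "c = 0" using ac_inj[OF c, of "- p"] p by simp
    then have "Gi \<zeta> = 0" using k by (simp add: c_def)
    then have "\<zeta> = 0" using G_Gi[of \<zeta>] p by simp
    moreover have "R (- p) = 0" using \<open>ac c = R (- p)\<close> c0 by simp
    then have "p = 0" using R_inj[of "- p"] p by simp
    ultimately show "y = 0" using p by (simp add: zero_prod_def)
  qed
  note dense = this
  show ?thesis
    unfolding densely_defined_def dense_subset_def
  proof (intro conjI ballI)
    show "Domain A_min \<subseteq> car Y" by (auto simp: A_min_iff)
    fix x assume "x \<in> car Y"
    then obtain p \<zeta> where p: "p \<in> car X" "\<zeta> \<in> car C" "x = W p \<zeta>" by (rule Y_cases)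
    then have "(p, \<zeta>) \<in> car ?Z" by (simp add: prod_space_def)
    then obtain w where w: "\<And>i. w i \<in> D" "cvg ?Z w (p, \<zeta>)" using dense unfolding Z.dense_in_def by blast
    have "\<exists>s \<xi>. s \<in> car X \<and> \<xi> \<in> car C \<and> w i = (R s, \<xi>) \<and> \<Lambda> s = block (G \<xi>)" for i
      using w(1)[of i] by (auto simp: D_def)
    then obtain s \<xi> where s: "\<And>i. s i \<in> car X" "\<And>i. \<xi> i \<in> car C" "\<And>i. w i = (R (s i), \<xi> i)"
      "\<And>i. \<Lambda> (s i) = block (G (\<xi> i))" by metis
    have "w = (\<lambda>i. (R (s i), \<xi> i))" using s by auto
    then have "cvg X (\<lambda>i. R (s i)) p \<and> cvg C \<xi> \<zeta>" using Z(2)[of "\<lambda>i. R (s i)" \<xi> p \<zeta>] w s by simp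
    then have "ip_converges Y (\<lambda>i. x_of (s i) 0 (\<xi> i)) x"
      unfolding x_of_0 p(3) using s p by (subst W_converges_iff) auto
    moreover have "x_of (s i) 0 (\<xi> i) \<in> Domain A_min" for i using s unfolding Domain_iff A_min_iff by blast
    ultimately show "\<exists>u. (\<forall>i. u i \<in> Domain A_min) \<and> ip_converges Y u x"
      by (intro exI[of _ "\<lambda>i. x_of (s i) 0 (\<xi> i)"]) blast
  qed
qed

text \<open>The parameter \<open>s\<close> is the image minus \<open>z1\<close> times the argument
  in the first coordinate, so convergence of the pairs forces convergence of \<open>s\<close>, and
  the boundary condition is continuous in \<open>s\<close> and \<open>\<xi>\<close>.\<close>

lemma A_min_closed: "closed_relation Y Y A_min"
  unfolding closed_relation_def
proof (intro allI impI)
  fix u v x y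
  assume *: "(\<forall>i. (u i, v i) \<in> A_min) \<and> ip_converges Y u x \<and> ip_converges Y v y"
  then have "\<forall>i. \<exists>s \<xi>. s \<in> car X \<and> \<xi> \<in> car C \<and> u i = x_of s 0 \<xi> \<and> v i = y_of s 0 \<xi> \<and> \<Lambda> s = block (G \<xi>)"
    unfolding A_min_iff by blast
  then obtain s \<xi> where s: "\<And>i. s i \<in> car X" "\<And>i. \<xi> i \<in> car C" "\<And>i. u i = x_of (s i) 0 (\<xi> i)"
    "\<And>i. v i = y_of (s i) 0 (\<xi> i)" "\<And>i. \<Lambda> (s i) = block (G (\<xi> i))" by metis
  have "x \<in> car Y" "y \<in> car Y" using * by (auto simp: ip_converges_def)
  then obtain p \<zeta> p' \<zeta>' where p: "p \<in> car X" "\<zeta> \<in> car C" "x = W p \<zeta>" "p' \<in> car X" "\<zeta>' \<in> car C" "y = W p' \<zeta>'"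
    by (metis Y_cases)
  have uv: "u = (\<lambda>i. W (R (s i)) (\<xi> i))" "v = (\<lambda>i. W (s i + of_real z1 *\<^sub>C R (s i)) (M (\<xi> i)))"
    using s by (auto simp: x_of_0 y_of_0)
  have 1: "cvg X (\<lambda>i. R (s i)) p" "cvg C \<xi> \<zeta>"
    using * s p W_converges_iff[of "\<lambda>i. R (s i)" p \<xi> \<zeta>] by (auto simp: uv)
  have 2: "cvg X (\<lambda>i. s i + of_real z1 *\<^sub>C R (s i)) p'" "cvg C (\<lambda>i. M (\<xi> i)) \<zeta>'"
    using * s p W_converges_iff[of "\<lambda>i. s i + of_real z1 *\<^sub>C R (s i)" p' "\<lambda>i. M (\<xi> i)" \<zeta>'] by (auto simp: uv)
  define t where "t = p' - of_real z1 *\<^sub>C p"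
  have t: "t \<in> car X" using p by (simp add: t_def)
  have st: "cvg X s t" using X.cvg_diff[OF 2(1) X.cvg_scale[OF 1(1), of "of_real z1"]] by (simp add: t_def)
  have "p = R t" by (rule X.cvg_unique[OF 1(1) X.bounded_op_cvg[OF R_bounded st]])
  moreover have "p' = t + of_real z1 *\<^sub>C p" by (simp add: t_def)
  moreover have "\<zeta>' = M \<zeta>" by (rule C.cvg_unique[OF 2(2) mat_app_cvg[OF finite_SJ 1(2)]])
  moreover have "\<Lambda> t = block (G \<zeta>)"
  proof
    fix \<sigma>
    show "\<Lambda> t \<sigma> = block (G \<zeta>) \<sigma>"
    proof (cases "\<sigma> \<in> S")
      case True
      have "(\<lambda>i. \<Lambda> (s i) \<sigma>) \<longlonglongrightarrow> \<Lambda> t \<sigma>"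
        using X.cvg_ip[OF X.cvg_const[OF a_mem[OF True]] st] True by (simp add: \<Lambda>_def)
      moreover have "(\<lambda>i. G (\<xi> i) (\<sigma>, m)) \<longlonglongrightarrow> G \<zeta> (\<sigma>, m)"
        using mat_app_cvg[OF finite_SJ 1(2), of \<G>] cvg_coord_iff[OF finite_SJ, of "\<lambda>i. G (\<xi> i)" "G \<zeta>"] True m by (simp add: SJ)
      ultimately show ?thesis using s(5) LIMSEQ_unique by (simp add: A_model.block_m_def)
    next
      case False
      then show ?thesis by (simp add: \<Lambda>_def A_model.block_m_def mat_app_def SJ)
    qed
  qed
  ultimately show "(x, y) \<in> A_min"
    unfolding A_min_iff using t p by (intro exI[of _ t] exI[of _ \<zeta>]) (simp add: x_of_0 y_of_0)
qed

lemma A_min_subset: "A_min \<subseteq> A_max"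
  by (auto simp: A_min_def)

lemma A_min_symmetric: "symmetric_operator Y A_min"
proof -
  have sv: "single_valued A_min" using A_max_linear A_min_subset single_valued_subset
    by (auto simp: linear_operator_def)
  have "complex_vector.subspace A_min"
  proof (rule subspace_relI)
    show "(0, 0) \<in> A_min"
      unfolding A_min_iff by (intro exI[of _ 0]) (simp add: x_of_0 y_of_0 complex_vector.scale_zero_right)
    show "(x + x', y + y') \<in> A_min" if xy: "(x, y) \<in> A_min" "(x', y') \<in> A_min" for x y x' y'
    proof -
      obtain s \<xi> s' \<xi>' where s: "s \<in> car X" "\<xi> \<in> car C" "x = x_of s 0 \<xi>" "y = y_of s 0 \<xi>" "\<Lambda> s = block (G \<xi>)"
        "s' \<in> car X" "\<xi>' \<in> car C" "x' = x_of s' 0 \<xi>'" "y' = y_of s' 0 \<xi>'" "\<Lambda> s' = block (G \<xi>')"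
        using xy unfolding A_min_iff by blast
      then show ?thesis
        unfolding A_min_iff using x_of_add[of s \<xi> s' \<xi>' 0 0] y_of_add[of s 0 \<xi> s' 0 \<xi>']
        by (intro exI[of _ "s + s'"] exI[of _ "\<xi> + \<xi>'"]) (simp add: \<Lambda>_add mat_app_add block_add)
    qed
    show "(r *\<^sub>C x, r *\<^sub>C y) \<in> A_min" if xy: "(x, y) \<in> A_min" for r x y
    proof -
      obtain s \<xi> where s: "s \<in> car X" "\<xi> \<in> car C" "x = x_of s 0 \<xi>" "y = y_of s 0 \<xi>" "\<Lambda> s = block (G \<xi>)"
        using xy unfolding A_min_iff by blast
      then have "\<Lambda> (r *\<^sub>C s) = block (G (r *\<^sub>C \<xi>))"
        by (auto simp: \<Lambda>_scale mat_app_scale A_model.block_m_def fun_eq_iff)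
      then show ?thesis
        unfolding A_min_iff using s x_of_scale[of s \<xi> r 0] y_of_scale[of s 0 \<xi> r]
        by (intro exI[of _ "r *\<^sub>C s"] exI[of _ "r *\<^sub>C \<xi>"]) (simp add: complex_vector.scale_zero_right)
    qed
  qed
  moreover have "A_min \<subseteq> car Y \<times> car Y" by (auto simp: A_min_iff)
  ultimately show ?thesis
    using sv A_min_subset
    by (auto simp: symmetric_operator_def linear_operator_def linear_relation_def adjoint_A_min)
qed

lemma boundary_triple_A_min: "boundary_triple Y A_min Cd \<Gamma>0 \<Gamma>1"
  unfolding boundary_triple_def adjoint_A_min
proof (intro conjI pontryagin_Y Cd.hilbert A_min_dense A_min_closed A_min_symmetric)
  show "(\<lambda>x. (\<Gamma>0 x, \<Gamma>1 x)) ` Domain A_max = car Cd \<times> car Cd"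
  proof
    show "(\<lambda>x. (\<Gamma>0 x, \<Gamma>1 x)) ` Domain A_max \<subseteq> car Cd \<times> car Cd" by (auto elim!: A_maxE)
    show "car Cd \<times> car Cd \<subseteq> (\<lambda>x. (\<Gamma>0 x, \<Gamma>1 x)) ` Domain A_max"
    proof clarify
      fix c d assume cd: "c \<in> car Cd" "d \<in> car Cd"
      \<comment> \<open>Surjectivity needs only the finite-dimensional part: for
        \<open>s = 0\<close> the value of \<open>\<Gamma>1\<close> is
        \<open>- block (G \<xi>)\<close>, which equals \<open>d\<close> for this
        \<open>\<xi>\<close>.\<close>
      let ?x = "x_of 0 c (Gi (\<eta> (- d)))"
      have "(?x, y_of 0 c (Gi (\<eta> (- d)))) \<in> A_max" using cd by simp
      moreover have "(c, d) = (\<Gamma>0 ?x, \<Gamma>1 ?x)" using cd by (simp add: G_Gi)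
      ultimately show "(c, d) \<in> (\<lambda>x. (\<Gamma>0 x, \<Gamma>1 x)) ` Domain A_max" by blast
    qed
  qed
  show "\<forall>(f, f')\<in>A_max. \<forall>(g, g')\<in>A_max. ip Y f g' - ip Y f' g = ip Cd (\<Gamma>0 f) (\<Gamma>1 g) - ip Cd (\<Gamma>1 f) (\<Gamma>0 g)"
  proof (clarify)
    fix f f' g g' assume fg: "(f, f') \<in> A_max" "(g, g') \<in> A_max"
    from fg(1) obtain s c \<xi> where s: "s \<in> car X" "c \<in> car Cd" "\<xi> \<in> car C" "f = x_of s c \<xi>" "f' = y_of s c \<xi>"
      by (rule A_maxE)
    from fg(2) obtain t d \<zeta> where t: "t \<in> car X" "d \<in> car Cd" "\<zeta> \<in> car C" "g = x_of t d \<zeta>" "g' = y_of t d \<zeta>"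
      by (rule A_maxE)
    show "ip Y f g' - ip Y f' g = ip Cd (\<Gamma>0 f) (\<Gamma>1 g) - ip Cd (\<Gamma>1 f) (\<Gamma>0 g)"
      unfolding s(4,5) t(4,5) using Green[OF s(1-3) t(1-3)] s(1-3) t(1-3) by simp
  qed
qed

lemma A_min_subset_A0: "A_min \<subseteq> A0"
proof (clarify)
  fix x y assume "(x, y) \<in> A_min"
  then show "(x, y) \<in> A0" unfolding A_min_iff A0_iff by blast
qed

lemma A0_subset: "A0 \<subseteq> A_max"
  by (auto simp: A0_def A_ext_def)

text \<open>The adjoint is contained in the adjoint \<open>A_max\<close> of \<open>A_min\<close>.
  Elements of \<open>A0\<close> attain every value of \<open>\<Gamma>1\<close>, so Green's identity
  leaves only \<open>c = 0\<close>.\<close>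

lemma A0_selfadjoint: "selfadjoint_operator Y A0"
proof -
  have sub: "complex_vector.subspace A0"
  proof (rule subspace_relI)
    show "(0, 0) \<in> A0"
      unfolding A0_iff by (intro exI[of _ 0]) (simp add: x_of_0 y_of_0 complex_vector.scale_zero_right)
    show "(x + x', y + y') \<in> A0" if xy: "(x, y) \<in> A0" "(x', y') \<in> A0" for x y x' y'
    proof -
      obtain s \<xi> s' \<xi>' where s: "s \<in> car X" "\<xi> \<in> car C" "x = x_of s 0 \<xi>" "y = y_of s 0 \<xi>"
        "s' \<in> car X" "\<xi>' \<in> car C" "x' = x_of s' 0 \<xi>'" "y' = y_of s' 0 \<xi>'"
        using xy unfolding A0_iff by blast
      then show ?thesis
        unfolding A0_iff using x_of_add[of s \<xi> s' \<xi>' 0 0] y_of_add[of s 0 \<xi> s' 0 \<xi>']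
        by (intro exI[of _ "s + s'"] exI[of _ "\<xi> + \<xi>'"]) simp
    qed
    show "(r *\<^sub>C x, r *\<^sub>C y) \<in> A0" if xy: "(x, y) \<in> A0" for r x y
    proof -
      obtain s \<xi> where s: "s \<in> car X" "\<xi> \<in> car C" "x = x_of s 0 \<xi>" "y = y_of s 0 \<xi>"
        using xy unfolding A0_iff by blast
      then show ?thesis
        unfolding A0_iff using x_of_scale[of s \<xi> r 0] y_of_scale[of s 0 \<xi> r]
        by (intro exI[of _ "r *\<^sub>C s"] exI[of _ "r *\<^sub>C \<xi>"]) (simp add: complex_vector.scale_zero_right)
    qed
  qed
  have sv: "single_valued A0" using A_max_linear A0_subset single_valued_subset
    by (auto simp: linear_operator_def)
  have mem: "A0 \<subseteq> car Y \<times> car Y" by (auto simp: A0_iff)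
  have dense: "densely_defined Y A0"
    using A_min_dense A_min_subset_A0 mem unfolding densely_defined_def dense_subset_def by blast
  have "adjoint_relation Y Y A0 = A0"
  proof (intro set_eqI, clarify)
    fix y y'
    show "(y, y') \<in> adjoint_relation Y Y A0 \<longleftrightarrow> (y, y') \<in> A0"
    proof
      assume "(y, y') \<in> A0"
      then obtain s \<xi> where s: "s \<in> car X" "\<xi> \<in> car C" "y = x_of s 0 \<xi>" "y' = y_of s 0 \<xi>" using A0_iff by blast
      have "ip Y v y = ip Y u y'" if uv: "(u, v) \<in> A0" for u v
      proof -
        obtain s' \<xi>' where "s' \<in> car X" "\<xi>' \<in> car C" "u = x_of s' 0 \<xi>'" "v = y_of s' 0 \<xi>'"
          using uv A0_iff by blast
        then show ?thesis using Green[of s' 0 \<xi>' s 0 \<xi>] s by simp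
      qed
      then show "(y, y') \<in> adjoint_relation Y Y A0" using s by (auto simp: adjoint_relation_def)
    next
      assume adj: "(y, y') \<in> adjoint_relation Y Y A0"
      then have "(y, y') \<in> adjoint_relation Y Y A_min"
        using A_min_subset_A0 by (auto simp: adjoint_relation_def)
      then obtain s c \<xi> where y: "s \<in> car X" "c \<in> car Cd" "\<xi> \<in> car C" "y = x_of s c \<xi>" "y' = y_of s c \<xi>"
        unfolding adjoint_A_min by (rule A_maxE)
      have "c = 0"
      proof (rule Cd.ip_eqI)
        fix d assume d: "d \<in> car Cd"
        let ?\<xi> = "Gi (\<eta> (- d))"
        have "(x_of 0 0 ?\<xi>, y_of 0 0 ?\<xi>) \<in> A0" unfolding A0_iff using Gi_mem X.zero_mem by blast
        then have "ip Y (y_of 0 0 ?\<xi>) y = ip Y (x_of 0 0 ?\<xi>) y'" using adj by (auto simp: adjoint_relation_def)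
        then show "ip Cd d c = ip Cd d 0" using Green[of 0 0 ?\<xi> s c \<xi>] y d by (simp add: G_Gi)
      qed (use y in auto)
      then show "(y, y') \<in> A0" using y A0_iff by blast
    qed
  qed
  then show ?thesis
    using sub sv mem dense by (simp add: selfadjoint_operator_def linear_operator_def linear_relation_def)
qed

end

lemma resolvent_iff: "(y, x) \<in> resolvent A z \<longleftrightarrow> (x, y + z *\<^sub>C x) \<in> A"
  by (auto simp: resolvent_def rel_shift_def algebra_simps)

lemma resolvent_subspace:
  assumes "complex_vector.subspace A" shows "complex_vector.subspace (resolvent A z)"
proof (rule subspace_relI)
  show "(0, 0) \<in> resolvent A z"
    using subspace_rel_0[OF assms] by (simp add: resolvent_iff complex_vector.scale_zero_right)
  show "(x + x', y + y') \<in> resolvent A z" if "(x, y) \<in> resolvent A z" "(x', y') \<in> resolvent A z" for x y x' y'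
    using subspace_rel_add[OF assms, of y "x + z *\<^sub>C y" y' "x' + z *\<^sub>C y'"] that
    by (simp add: resolvent_iff scaleC_add_right add_ac)
  show "(r *\<^sub>C x, r *\<^sub>C y) \<in> resolvent A z" if "(x, y) \<in> resolvent A z" for r x y
    using subspace_rel_scale[OF assms, of y "x + z *\<^sub>C y" r] that
    by (simp add: resolvent_iff scaleC_add_right scaleC_scaleC mult.commute)
qed

context model
begin

subsection \<open>Resolvents\<close>

text \<open>\<open>L - z\<close> applied to \<open>R s\<close>, that is, \<open>L - z\<close> in
  terms of the parameter \<open>s = (L - z1) u\<close>.\<close>

definition D :: "complex \<Rightarrow> 'v \<Rightarrow> 'v" where
  "D z s = s - (z - of_real z1) *\<^sub>C R s"

text \<open>\<open>B\<close> stands for \<open>(L - z1) (L - z)\<inverse>\<close>; the resolvent of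
  \<open>L\<close> is \<open>R\<close> after \<open>B\<close>.\<close>

definition inv_at :: "complex \<Rightarrow> ('v \<Rightarrow> 'v) \<Rightarrow> bool" where
  "inv_at z B \<longleftrightarrow> X.bounded_op B \<and> (\<forall>t\<in>car X. D z (B t) = t) \<and> (\<forall>s\<in>car X. B (D z s) = s)"

lemma D_mem [simp]: "s \<in> car X \<Longrightarrow> D z s \<in> car X"
  by (simp add: D_def)

lemma D_linear: "X.linop (D z)"
  by (auto simp: X.linop_def D_def R_add R_scale scaleC_add_right complex_vector.scale_right_diff_distrib
      complex_vector.scale_left_commute)

lemmas D_add = X.linop_add[OF D_linear] and D_scale = X.linop_scale[OF D_linear]
  and D_diff = X.linop_diff[OF D_linear] and D_0 [simp] = X.linop_0[OF D_linear]

lemma resolvent_Lrel_iff: "(t, u) \<in> resolvent Lrel z \<longleftrightarrow> (\<exists>s\<in>car X. t = D z s \<and> u = R s)"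
proof -
  have "t + z *\<^sub>C R s = s + of_real z1 *\<^sub>C R s \<longleftrightarrow> t = D z s" for s
    by (auto simp: D_def complex_vector.scale_left_diff_distrib algebra_simps)
  then show ?thesis unfolding resolvent_iff by (auto simp: Lrel_def)
qed

lemma inv_atD:
  assumes "inv_at z B"
  shows "X.linop B" "t \<in> car X \<Longrightarrow> B t \<in> car X" "t \<in> car X \<Longrightarrow> D z (B t) = t" "s \<in> car X \<Longrightarrow> B (D z s) = s"
  using assms by (auto simp: inv_at_def X.bounded_op_def X.linop_mem)

lemma D_inj: assumes "inv_at z B" "s \<in> car X" "t \<in> car X" "D z s = D z t" shows "s = t"
  using inv_atD(4)[OF assms(1,2)] inv_atD(4)[OF assms(1,3)] unfolding assms(4) by (rule trans[OF sym])

lemma B_eq: assumes "inv_at z B" "t \<in> car X" shows "B t = t + (z - of_real z1) *\<^sub>C R (B t)"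
  using inv_atD(3)[OF assms] by (simp add: D_def algebra_simps)

text \<open>The hypothesis gives boundedness of \<open>R B\<close>, the resolvent itself. It passes
  to \<open>B\<close> through the identity \<open>B = 1 + (z - z1) R B\<close>.\<close>

lemma inv_at_exists:
  assumes "z \<in> resolvent_set X Lrel" obtains B where "inv_at z B"
proof -
  have b: "linear_operator X X (resolvent Lrel z)" "Domain (resolvent Lrel z) = car X"
    "\<And>u v. (\<And>i. (u i, v i) \<in> resolvent Lrel z) \<Longrightarrow> cvg X u 0 \<Longrightarrow> cvg X v 0"
    using assms by (auto simp: resolvent_set_def bounded_everywhere_defined_def X.ip_converges_iff_cvg)
  have "\<exists>s. s \<in> car X \<and> t = D z s" if "t \<in> car X" for t
  proof -
    have "t \<in> Domain (resolvent Lrel z)" using b(2) that by simp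
    then show ?thesis unfolding Domain_iff resolvent_Lrel_iff by blast
  qed
  then obtain B where B: "\<And>t. t \<in> car X \<Longrightarrow> B t \<in> car X" "\<And>t. t \<in> car X \<Longrightarrow> D z (B t) = t" by metis
  have inj0: "s = 0" if s: "s \<in> car X" "D z s = 0" for s
  proof -
    have "(0, R s) \<in> resolvent Lrel z" "(0, 0) \<in> resolvent Lrel z"
      unfolding resolvent_Lrel_iff using s by (force, force intro: bexI[of _ 0])
    then have "R s = 0" using b(1) by (auto simp: linear_operator_def single_valued_def)
    then show ?thesis using R_inj s by blast
  qed
  have inj: "s = t" if "s \<in> car X" "t \<in> car X" "D z s = D z t" for s t
    using inj0[of "s - t"] that by (simp add: D_diff)
  have lin: "X.linop B"
    unfolding X.linop_def
  proof (intro conjI ballI allI B(1))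
    show "B (x + y) = B x + B y" if "x \<in> car X" "y \<in> car X" for x y
      by (rule inj) (use that B in \<open>auto simp: D_add\<close>)
    show "B (r *\<^sub>C x) = r *\<^sub>C B x" if "x \<in> car X" for r x
      by (rule inj) (use that B in \<open>auto simp: D_scale\<close>)
  qed
  have BD: "B (D z s) = s" if "s \<in> car X" for s by (rule inj) (use that B in auto)
  have "X.bounded_op (\<lambda>t. R (B t))"
  proof (rule X.bounded_op_if_continuous)
    show "X.linop (\<lambda>t. R (B t))" using lin R_lin by (auto simp: X.linop_def)
    fix u assume u: "cvg X u 0"
    show "cvg X (\<lambda>i. R (B (u i))) 0"
    proof (rule b(3)[OF _ u])
      show "(u i, R (B (u i))) \<in> resolvent Lrel z" for i
        unfolding resolvent_Lrel_iff using X.cvg_mem(1)[OF u, of i] B by (intro bexI[of _ "B (u i)"]) auto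
    qed
  qed
  then obtain c where c: "c > 0" "\<And>x. x \<in> car X \<Longrightarrow> ipnorm X (R (B x)) \<le> c * ipnorm X x"
    by (auto simp: X.bounded_op_def)
  have "ipnorm X (B x) \<le> (1 + cmod (z - of_real z1) * c) * ipnorm X x" if x: "x \<in> car X" for x
  proof -
    have e: "B x = x + (z - of_real z1) *\<^sub>C R (B x)" using B(2)[OF x] by (simp add: D_def algebra_simps)
    have "ipnorm X (B x) = ipnorm X (x + (z - of_real z1) *\<^sub>C R (B x))" by (rule arg_cong[OF e])
    also have "\<dots> \<le> ipnorm X x + cmod (z - of_real z1) * ipnorm X (R (B x))"
      using X.norm_triangle[of x "(z - of_real z1) *\<^sub>C R (B x)"] x B by (simp add: X.norm_scale)
    also have "\<dots> \<le> ipnorm X x + cmod (z - of_real z1) * (c * ipnorm X x)"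
      using mult_left_mono[OF c(2)[OF x], of "cmod (z - of_real z1)"] by simp
    finally show ?thesis by (simp add: algebra_simps)
  qed
  moreover have "0 < 1 + cmod (z - of_real z1) * c" using c(1) by (simp add: add_pos_nonneg)
  ultimately have "X.bounded_op B" using lin by (auto simp: X.bounded_op_def)
  then have "inv_at z B" using B BD by (simp add: inv_at_def)
  then show thesis by (rule that)
qed

lemma resolvent_Lrel: "inv_at z B \<Longrightarrow> resolvent Lrel z = X.gr (\<lambda>t. R (B t))"
proof (intro set_eqI, clarify)
  fix t u assume B: "inv_at z B"
  show "(t, u) \<in> resolvent Lrel z \<longleftrightarrow> (t, u) \<in> X.gr (\<lambda>t. R (B t))"
    unfolding resolvent_Lrel_iff X.gr_iff
  proof
    assume "\<exists>s\<in>car X. t = D z s \<and> u = R s"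
    then show "t \<in> car X \<and> u = R (B t)" using inv_atD(4)[OF B] by auto
  next
    assume "t \<in> car X \<and> u = R (B t)"
    then show "\<exists>s\<in>car X. t = D z s \<and> u = R s"
      using inv_atD(2,3)[OF B, of t] by (intro bexI[of _ "B t"]) auto
  qed
qed

lemma ip_D: "s \<in> car X \<Longrightarrow> t \<in> car X \<Longrightarrow> ip X s (D z t) = ip X (D (cnj z) s) t"
  by (simp add: D_def X.ip_linear R_ip)

text \<open>\<open>D z\<close> is normal: its adjoint is \<open>D (cnj z)\<close>, and the two
  commute, both being polynomials in \<open>R\<close>.\<close>

lemma norm_D_cnj: assumes s: "s \<in> car X" shows "ipnorm X (D (cnj z) s) = ipnorm X (D z s)"
proof -
  have "s - w *\<^sub>C R s - w' *\<^sub>C R (s - w *\<^sub>C R s) = s - w' *\<^sub>C R s - w *\<^sub>C R (s - w' *\<^sub>C R s)" for w w'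
    using s by (simp add: R_diff R_scale complex_vector.scale_right_diff_distrib scaleC_scaleC algebra_simps)
  then have "D z (D (cnj z) s) = D (cnj z) (D z s)" unfolding D_def .
  then have "ip X (D (cnj z) s) (D (cnj z) s) = ip X (D z s) (D z s)"
    using ip_D[of s "D (cnj z) s" z] ip_D[of s "D z s" "cnj z"] s by simp
  then show ?thesis by (simp add: ipnorm_def)
qed

text \<open>The adjoint of \<open>B\<close>, which exists by the Riesz representation theorem, inverts \<open>D\<close> at \<open>cnj z\<close>.\<close>

lemma inv_at_cnj:
  assumes B: "inv_at z B" obtains B' where "inv_at (cnj z) B'"
proof -
  obtain c where c: "c > 0" "\<And>x. x \<in> car X \<Longrightarrow> ipnorm X (B x) \<le> c * ipnorm X x"
    using B by (auto simp: inv_at_def X.bounded_op_def)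
  have "\<exists>b. b \<in> car X \<and> D (cnj z) b = y" if y: "y \<in> car X" for y
  proof -
    obtain w b where b: "cvg X w b" "\<And>u. u \<in> car X \<Longrightarrow> ip X b u = ip X y (B u)"
    proof (rule X.Riesz[of "car X" "\<lambda>u. ip X y (B u)" "ipnorm X y * c"])
      show "ip X y (B (u + v)) = ip X y (B u) + ip X y (B v)" if "u \<in> car X" "v \<in> car X" for u v
        using that y inv_atD(1,2)[OF B] by (simp add: X.linop_add X.ip_linear)
      show "ip X y (B (r *\<^sub>C u)) = r * ip X y (B u)" if "u \<in> car X" for u r
        using that y inv_atD(1,2)[OF B] by (simp add: X.linop_scale X.ip_linear)
      show "cmod (ip X y (B u)) \<le> ipnorm X y * c * ipnorm X u" if u: "u \<in> car X" for u
        using order_trans[OF X.Cauchy_Schwarz[OF y inv_atD(2)[OF B u]] mult_left_mono[OF c(2)[OF u], of "ipnorm X y"]] y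
        by (simp add: mult.assoc)
    qed (use X.subspace in auto)
    have bX: "b \<in> car X" using b(1) by (rule X.cvg_mem)
    have "D (cnj z) b = y"
    proof (rule X.ip_eqI_left)
      fix s assume s: "s \<in> car X"
      show "ip X (D (cnj z) b) s = ip X y s"
        using ip_D[OF bX s, of z] b(2)[of "D z s"] s inv_atD(4)[OF B s] by simp
    qed (use bX y in auto)
    then show ?thesis using bX by blast
  qed
  then obtain B' where B': "\<And>y. y \<in> car X \<Longrightarrow> B' y \<in> car X" "\<And>y. y \<in> car X \<Longrightarrow> D (cnj z) (B' y) = y" by metis
  \<comment> \<open>Normality carries the lower bound for \<open>D z\<close>, which is the norm
    bound of \<open>B\<close>, over to \<open>D (cnj z)\<close>.\<close>
  have bound: "ipnorm X s \<le> c * ipnorm X (D (cnj z) s)" if s: "s \<in> car X" for s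
    using c(2)[of "D z s"] s inv_atD(4)[OF B s] norm_D_cnj[OF s, of z] by simp
  have inj: "s = t" if "s \<in> car X" "t \<in> car X" "D (cnj z) s = D (cnj z) t" for s t
  proof -
    have "ipnorm X (s - t) = 0" using bound[of "s - t"] that X.norm_ge_0[of "s - t"]
      by (simp add: D_diff del: X.norm_ge_0 X.norm_eq_0)
    then show ?thesis using that by simp
  qed
  have lin: "X.linop B'"
    unfolding X.linop_def
  proof (intro conjI ballI allI B'(1))
    show "B' (x + y) = B' x + B' y" if "x \<in> car X" "y \<in> car X" for x y
      by (rule inj) (use that B' in \<open>auto simp: D_add\<close>)
    show "B' (r *\<^sub>C x) = r *\<^sub>C B' x" if "x \<in> car X" for r x
      by (rule inj) (use that B' in \<open>auto simp: D_scale\<close>)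
  qed
  moreover have "ipnorm X (B' x) \<le> c * ipnorm X x" if "x \<in> car X" for x
    using bound[of "B' x"] B' that by simp
  moreover have "B' (D (cnj z) s) = s" if "s \<in> car X" for s
    by (rule inj) (use that B' in auto)
  ultimately have "inv_at (cnj z) B'" using c(1) B' by (auto simp: inv_at_def X.bounded_op_def)
  then show thesis by (rule that)
qed

section \<open>The Jordan block minus \<open>z\<close>\<close>

definition N :: "complex \<Rightarrow> ('s \<times> nat \<Rightarrow> complex) \<Rightarrow> 's \<times> nat \<Rightarrow> complex" where
  "N z \<xi> = M \<xi> - z *\<^sub>C \<xi>"

text \<open>The Neumann series of the inverse of \<open>J - w\<close> for the nilpotent shift
  \<open>J\<close> and \<open>w = z - z1\<close>, namely minus the sum of
  \<open>J^k / w^(k + 1)\<close>; it terminates.\<close>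

definition Ni :: "complex \<Rightarrow> ('s \<times> nat \<Rightarrow> complex) \<Rightarrow> 's \<times> nat \<Rightarrow> complex" where
  "Ni z \<theta> = (\<lambda>(\<sigma>, j). if (\<sigma>, j) \<in> SJ then - (\<Sum>i\<in>{j..m}. \<theta> (\<sigma>, i) / (z - of_real z1) ^ (i - j + 1)) else 0)"

lemma N_mem [simp]: "\<xi> \<in> car C \<Longrightarrow> N z \<xi> \<in> car C"
  by (simp add: N_def)

lemma Ni_mem [simp]: "Ni z \<theta> \<in> car C"
  by (auto simp: Ni_def coord_mem_iff)

lemma N_diff: "N z (\<xi> - \<zeta>) = N z \<xi> - N z \<zeta>"
  by (simp add: N_def mat_app_diff complex_vector.scale_right_diff_distrib)

lemma N_0 [simp]: "N z 0 = 0"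
  using N_diff[of z 0 0] by simp

lemma N_apply: "(\<sigma>, j) \<in> SJ \<Longrightarrow>
    N z \<xi> (\<sigma>, j) = - (z - of_real z1) * \<xi> (\<sigma>, j) + (if j < m then \<xi> (\<sigma>, Suc j) else 0)"
  by (simp add: N_def M_apply algebra_simps)

lemma N_Ni: assumes z: "z \<noteq> of_real z1" and \<theta>: "\<theta> \<in> car C" shows "N z (Ni z \<theta>) = \<theta>"
proof
  fix \<alpha> :: "'s \<times> nat"
  obtain \<sigma> j where a: "\<alpha> = (\<sigma>, j)" by (cases \<alpha>)
  define w where "w = z - of_real z1"
  have w: "w \<noteq> 0" using z by (simp add: w_def)
  show "N z (Ni z \<theta>) \<alpha> = \<theta> \<alpha>"
  proof (cases "\<alpha> \<in> SJ")
    case True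
    then have j: "(\<sigma>, j) \<in> SJ" "j \<le> m" using a by (auto simp: SJ)
    have "- w * Ni z \<theta> (\<sigma>, j) = (\<Sum>i\<in>{j..m}. \<theta> (\<sigma>, i) / w ^ (i - j))"
      using j w by (simp add: Ni_def w_def[symmetric] sum_distrib_left sum_negf)
    also have "\<dots> = \<theta> (\<sigma>, j) + (\<Sum>i\<in>{Suc j..m}. \<theta> (\<sigma>, i) / w ^ (i - j))"
      using j by (subst sum.atLeast_Suc_atMost) auto
    also have "(\<Sum>i\<in>{Suc j..m}. \<theta> (\<sigma>, i) / w ^ (i - j)) = - (if j < m then Ni z \<theta> (\<sigma>, Suc j) else 0)"
    proof (cases "j < m")
      case True
      then have "(\<sigma>, Suc j) \<in> SJ" using j by (auto simp: SJ)
      moreover have "(\<Sum>i\<in>{Suc j..m}. \<theta> (\<sigma>, i) / w ^ (i - j)) = (\<Sum>i\<in>{Suc j..m}. \<theta> (\<sigma>, i) / w ^ (i - Suc j + 1))"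
        by (intro sum.cong) (auto simp: Suc_diff_le Suc_diff_Suc)
      ultimately show ?thesis using True by (simp add: Ni_def w_def)
    qed auto
    finally show ?thesis using j by (simp add: a N_apply w_def)
  next
    case False
    then show ?thesis using \<theta> N_mem[OF Ni_mem, of z z \<theta>] by (simp add: coord_mem_iff a)
  qed
qed

text \<open>Back substitution: the last component of the difference vanishes first, then each one
  before it.\<close>

lemma N_inj: assumes z: "z \<noteq> of_real z1" and \<xi>: "\<xi> \<in> car C" "\<zeta> \<in> car C" "N z \<xi> = N z \<zeta>" shows "\<xi> = \<zeta>"
proof -
  define \<theta> where "\<theta> = \<xi> - \<zeta>"
  have t: "\<theta> \<in> car C" "N z \<theta> = 0" using \<xi> by (auto simp: \<theta>_def N_diff)
  have "\<theta> (\<sigma>, m - k) = 0" if "\<sigma> \<in> S" "k < m" for \<sigma> k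
    using that(2)
  proof (induction k)
    case 0
    have "N z \<theta> (\<sigma>, m) = 0" using t by simp
    then show ?case using N_apply[of \<sigma> m z \<theta>] that m z by (simp add: SJ)
  next
    case (Suc k)
    have s: "(\<sigma>, m - Suc k) \<in> SJ" "Suc (m - Suc k) = m - k" using that Suc.prems by (auto simp: SJ)
    have "N z \<theta> (\<sigma>, m - Suc k) = 0" using t by simp
    then show ?case using N_apply[OF s(1), of z \<theta>] s(2) Suc z by simp
  qed
  note 0 = this
  have "\<theta> \<alpha> = 0" for \<alpha>
  proof (cases "\<alpha> \<in> SJ")
    case True
    then obtain \<sigma> j where "\<alpha> = (\<sigma>, j)" "\<sigma> \<in> S" "1 \<le> j" "j \<le> m" by (auto simp: SJ)
    then show ?thesis using 0[of \<sigma> "m - j"] by simp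
  qed (use t in \<open>cases \<alpha>, auto simp: coord_mem_iff\<close>)
  then show ?thesis by (simp add: \<theta>_def fun_eq_iff)
qed

lemma Ni_N: "z \<noteq> of_real z1 \<Longrightarrow> \<xi> \<in> car C \<Longrightarrow> Ni z (N z \<xi>) = \<xi>"
  by (rule N_inj) (auto simp: N_Ni)

lemma Ni_cvg: assumes z: "z \<noteq> of_real z1" and u: "cvg C u 0" shows "cvg C (\<lambda>i. Ni z (u i)) 0"
proof -
  have l: "(\<lambda>i. u i \<alpha>) \<longlonglongrightarrow> 0" if "\<alpha> \<in> SJ" for \<alpha>
    using u cvg_coord_iff[OF finite_SJ, of u 0] that C.cvg_mem[OF u] by simp
  have "(\<lambda>i. Ni z (u i) \<alpha>) \<longlonglongrightarrow> 0" if "\<alpha> \<in> SJ" for \<alpha>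
  proof -
    obtain \<sigma> j where a: "\<alpha> = (\<sigma>, j)" by (cases \<alpha>)
    have "(\<lambda>i. - (\<Sum>k\<in>{j..m}. u i (\<sigma>, k) / (z - of_real z1) ^ (k - j + 1)))
        \<longlonglongrightarrow> - (\<Sum>k\<in>{j..m}. 0 / (z - of_real z1) ^ (k - j + 1))"
      using that a z by (intro tendsto_intros l) (auto simp: SJ)
    then show ?thesis using that a by (simp add: Ni_def)
  qed
  then show ?thesis by (subst cvg_coord_iff) auto
qed

lemma resolvent_mat_rel_iff: "(\<theta>, \<xi>) \<in> resolvent (mat_rel SJ (A_model.M_d z1 m)) z \<longleftrightarrow> \<xi> \<in> car C \<and> \<theta> = N z \<xi>"
  unfolding resolvent_iff by (auto simp: mat_rel_def N_def algebra_simps)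

lemma x_y_of: "s \<in> car X \<Longrightarrow> \<xi> \<in> car C \<Longrightarrow> y_of s 0 \<xi> - z *\<^sub>C x_of s 0 \<xi> = W (D z s) (N z \<xi>)"
  by (simp add: x_of_0 y_of_0 flip: W_scale W_diff)
    (simp add: D_def N_def complex_vector.scale_left_diff_distrib algebra_simps)

lemma resolvent_A0_iff: "(y, x) \<in> resolvent A0 z \<longleftrightarrow> (\<exists>s \<xi>. s \<in> car X \<and> \<xi> \<in> car C \<and> y = W (D z s) (N z \<xi>) \<and> x = x_of s 0 \<xi>)"
proof -
  have "y + z *\<^sub>C x_of s 0 \<xi> = y_of s 0 \<xi> \<longleftrightarrow> y = W (D z s) (N z \<xi>)" if "s \<in> car X" "\<xi> \<in> car C" for s \<xi>
    using x_y_of[OF that, of z] by (auto simp: algebra_simps)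
  then show ?thesis unfolding resolvent_iff A0_iff by blast
qed

text \<open>\<open>A0 - z\<close> is the direct sum of \<open>D z\<close> and \<open>N z\<close> in
  the parameters \<open>(s, \<xi>)\<close>. The second summand is invertible exactly for
  \<open>z \<noteq> z1\<close>; inverting the first amounts to having the resolvent of
  \<open>L\<close>.\<close>

lemma resolvent_set_A0: "resolvent_set Y A0 = resolvent_set X Lrel - {of_real z1}"
proof (intro set_eqI iffI)
  fix z assume z: "z \<in> resolvent_set Y A0"
  let ?T = "resolvent A0 z"
  have b: "linear_operator Y Y ?T" "Domain ?T = car Y"
    "\<And>u v. (\<And>i. (u i, v i) \<in> ?T) \<Longrightarrow> ip_converges Y u 0 \<Longrightarrow> ip_converges Y v 0"
    using z by (auto simp: resolvent_set_def bounded_everywhere_defined_def)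
  have sv: "x = 0" if "(0, x) \<in> ?T" for x
  proof -
    have "(0, 0) \<in> ?T" using b(1) subspace_rel_0 by (auto simp: linear_operator_def linear_relation_def)
    then show ?thesis using b(1) that by (auto simp: linear_operator_def single_valued_def)
  qed
  have "z \<noteq> of_real z1"
  proof
    assume zz: "z = of_real z1"
    obtain \<sigma> where \<sigma>: "\<sigma> \<in> S" using S by blast
    \<comment> \<open>The eigenvector of the Jordan block for \<open>z1\<close>: the shift moves the
      first component out of the index range.\<close>
    let ?e = "unit_vec (\<sigma>, 1::nat)"
    have e: "?e \<in> car C" using \<sigma> m by (intro unit_vec_mem) (simp add: SJ)
    have "N z ?e = 0"
    proof
      fix \<alpha> :: "'s \<times> nat"
      show "N z ?e \<alpha> = 0 \<alpha>"
      proof (cases "\<alpha> \<in> SJ")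
        case True
        then obtain \<tau> j where "\<alpha> = (\<tau>, j)" "(\<tau>, j) \<in> SJ" "1 \<le> j" by (auto simp: SJ)
        then show ?thesis using N_apply[of \<tau> j z ?e] zz by (simp add: unit_vec_def)
      qed (use N_mem[OF e, of z] in \<open>cases \<alpha>, simp add: coord_mem_iff\<close>)
    qed
    then have "(0, x_of 0 0 ?e) \<in> ?T"
      unfolding resolvent_A0_iff using e by (intro exI[of _ 0] exI[of _ ?e]) simp
    then have "W 0 ?e = 0" using sv by (simp add: x_of_0)
    then have "?e = 0" using W_inj[OF X.zero_mem e] by blast
    then show False by (auto simp: unit_vec_def fun_eq_iff split: if_splits)
  qed
  moreover have "z \<in> resolvent_set X Lrel"
    unfolding resolvent_set_def mem_Collect_eq bounded_everywhere_defined_def X.ip_converges_iff_cvg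
  proof (intro conjI allI impI)
    \<comment> \<open>Vectors with zero second coordinate embed the resolvent of \<open>L\<close> in
      that of \<open>A0\<close>, so its domain, uniqueness and continuity can be read off
      there.\<close>
    have T: "(W (D z s) 0, W (R s) 0) \<in> ?T" if "s \<in> car X" for s
      unfolding resolvent_A0_iff using that by (intro exI[of _ s] exI[of _ 0]) (simp add: x_of_0)
    show "linear_operator X X (resolvent Lrel z)"
      unfolding linear_operator_def linear_relation_def
    proof (intro conjI)
      show "resolvent Lrel z \<subseteq> car X \<times> car X"
      proof clarify
        fix t u assume "(t, u) \<in> resolvent Lrel z"
        then show "t \<in> car X \<and> u \<in> car X" unfolding resolvent_Lrel_iff by auto
      qed
      have "complex_vector.subspace Lrel"
      proof (rule subspace_relI)
        show "(0, 0) \<in> Lrel" unfolding Lrel_def by (intro CollectI exI[of _ 0]) (simp add: complex_vector.scale_zero_right)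
        show "(x + x', y + y') \<in> Lrel" if xy: "(x, y) \<in> Lrel" "(x', y') \<in> Lrel" for x y x' y'
        proof -
          obtain s s' where "s \<in> car X" "x = R s" "y = s + of_real z1 *\<^sub>C R s" "s' \<in> car X" "x' = R s'" "y' = s' + of_real z1 *\<^sub>C R s'"
            using xy by (auto simp: Lrel_def)
          then show ?thesis unfolding Lrel_def
            by (intro CollectI exI[of _ "s + s'"]) (simp add: R_add scaleC_add_right)
        qed
        show "(r *\<^sub>C x, r *\<^sub>C y) \<in> Lrel" if xy: "(x, y) \<in> Lrel" for r x y
        proof -
          obtain s where "s \<in> car X" "x = R s" "y = s + of_real z1 *\<^sub>C R s"
            using xy by (auto simp: Lrel_def)
          then show ?thesis unfolding Lrel_def
            by (intro CollectI exI[of _ "r *\<^sub>C s"]) (simp add: R_scale scaleC_add_right complex_vector.scale_left_commute)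
        qed
      qed
      then show "complex_vector.subspace (resolvent Lrel z)" by (rule resolvent_subspace)
      show "single_valued (resolvent Lrel z)"
        unfolding single_valued_def
      proof (intro allI impI)
        fix t u u' assume "(t, u) \<in> resolvent Lrel z" "(t, u') \<in> resolvent Lrel z"
        then obtain s s' where s: "s \<in> car X" "t = D z s" "u = R s" "s' \<in> car X" "t = D z s'" "u' = R s'"
          unfolding resolvent_Lrel_iff by blast
        then have "D z (s - s') = 0" by (simp add: D_diff)
        then have "(0, W (R (s - s')) 0) \<in> ?T" using T[of "s - s'"] s by simp
        then have "R (s - s') = 0" using sv W_inj[of "R (s - s')" 0] s by simp
        then show "u = u'" using s by (simp add: R_diff)
      qed
    qed
    show "Domain (resolvent Lrel z) = car X"
    proof (intro set_eqI iffI)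
      fix t assume "t \<in> car X"
      then have "W t 0 \<in> Domain ?T" using b(2) by simp
      then obtain s \<xi> where "s \<in> car X" "\<xi> \<in> car C" "W t 0 = W (D z s) (N z \<xi>)"
        unfolding Domain_iff resolvent_A0_iff by blast
      then have "t = D z s" using \<open>t \<in> car X\<close> by (simp add: W_eq_iff)
      then show "t \<in> Domain (resolvent Lrel z)"
        unfolding Domain_iff resolvent_Lrel_iff using \<open>s \<in> car X\<close> by blast
    next
      fix t assume "t \<in> Domain (resolvent Lrel z)"
      then show "t \<in> car X" unfolding Domain_iff resolvent_Lrel_iff by auto
    qed
    fix u v assume uv: "(\<forall>i. (u i, v i) \<in> resolvent Lrel z) \<and> cvg X u 0"
    then have "\<forall>i. \<exists>s. s \<in> car X \<and> u i = D z s \<and> v i = R s" unfolding resolvent_Lrel_iff by blast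
    then obtain s where s: "\<And>i. s i \<in> car X" "\<And>i. u i = D z (s i)" "\<And>i. v i = R (s i)" by metis
    have "ip_converges Y (\<lambda>i. W (u i) 0) (W 0 0)"
      using uv s by (subst W_converges_iff) (auto intro: C.cvg_const)
    then have "ip_converges Y (\<lambda>i. W (v i) 0) (W 0 0)"
      using b(3)[of "\<lambda>i. W (u i) 0" "\<lambda>i. W (v i) 0"] T[OF s(1)] s by simp
    then show "cvg X v 0" using W_converges_iff[of v 0 "\<lambda>_. 0" 0] s by simp
  qed
  ultimately show "z \<in> resolvent_set X Lrel - {of_real z1}" by simp
next
  fix z assume z: "z \<in> resolvent_set X Lrel - {of_real z1}"
  then have z1: "z \<noteq> of_real z1" by simp
  obtain B where B: "inv_at z B" using inv_at_exists z by blast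
  let ?T = "resolvent A0 z"
  have sub: "complex_vector.subspace A0"
    using A0_selfadjoint by (auto simp: selfadjoint_operator_def linear_operator_def linear_relation_def)
  show "z \<in> resolvent_set Y A0"
    unfolding resolvent_set_def mem_Collect_eq bounded_everywhere_defined_def
  proof (intro conjI allI impI)
    show "linear_operator Y Y ?T"
      unfolding linear_operator_def linear_relation_def
    proof (intro conjI)
      show "?T \<subseteq> car Y \<times> car Y"
      proof clarify
        fix y x assume "(y, x) \<in> ?T"
        then show "y \<in> car Y \<and> x \<in> car Y" unfolding resolvent_A0_iff by auto
      qed
      show "complex_vector.subspace ?T" by (rule resolvent_subspace[OF sub])
      show "single_valued ?T"
        unfolding single_valued_def
      proof (intro allI impI)
        fix y x x' assume "(y, x) \<in> ?T" "(y, x') \<in> ?T"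
        then obtain s \<xi> s' \<xi>' where s: "s \<in> car X" "\<xi> \<in> car C" "y = W (D z s) (N z \<xi>)" "x = x_of s 0 \<xi>"
          "s' \<in> car X" "\<xi>' \<in> car C" "y = W (D z s') (N z \<xi>')" "x' = x_of s' 0 \<xi>'"
          unfolding resolvent_A0_iff by blast
        then have "D z s = D z s'" "N z \<xi> = N z \<xi>'" using W_eq_iff[of "D z s" "D z s'" "N z \<xi>" "N z \<xi>'"] by auto
        then show "x = x'" using s D_inj[OF B, of s s'] N_inj[OF z1, of \<xi> \<xi>'] by simp
      qed
    qed
    show "Domain ?T = car Y"
    proof (intro set_eqI iffI)
      fix y assume "y \<in> car Y"
      then obtain t \<theta> where t: "t \<in> car X" "\<theta> \<in> car C" "y = W t \<theta>" by (rule Y_cases)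
      have "(y, x_of (B t) 0 (Ni z \<theta>)) \<in> ?T"
        unfolding resolvent_A0_iff using t inv_atD(2,3)[OF B, of t] N_Ni[OF z1]
        by (intro exI[of _ "B t"] exI[of _ "Ni z \<theta>"]) simp
      then show "y \<in> Domain ?T" by blast
    next
      fix y assume "y \<in> Domain ?T"
      then show "y \<in> car Y" unfolding Domain_iff resolvent_A0_iff by auto
    qed
    fix u v assume uv: "(\<forall>i. (u i, v i) \<in> ?T) \<and> ip_converges Y u 0"
    then have "\<forall>i. \<exists>s \<xi>. s \<in> car X \<and> \<xi> \<in> car C \<and> u i = W (D z s) (N z \<xi>) \<and> v i = x_of s 0 \<xi>"
      unfolding resolvent_A0_iff by blast
    then obtain s \<xi> where s: "\<And>i. s i \<in> car X" "\<And>i. \<xi> i \<in> car C" "\<And>i. u i = W (D z (s i)) (N z (\<xi> i))"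
      "\<And>i. v i = x_of (s i) 0 (\<xi> i)" by metis
    have "u = (\<lambda>i. W (D z (s i)) (N z (\<xi> i)))" using s by auto
    then have c: "cvg X (\<lambda>i. D z (s i)) 0" "cvg C (\<lambda>i. N z (\<xi> i)) 0"
      using uv W_converges_iff[of "\<lambda>i. D z (s i)" 0 "\<lambda>i. N z (\<xi> i)" 0] s by auto
    have "cvg X (\<lambda>i. R (B (D z (s i)))) (R (B 0))"
      using X.bounded_op_cvg[OF R_bounded X.bounded_op_cvg[OF _ c(1)]] B by (simp add: inv_at_def)
    then have 1: "cvg X (\<lambda>i. R (s i)) 0" using inv_atD(4)[OF B] s X.linop_0[OF inv_atD(1)[OF B]] by simp
    have 2: "cvg C \<xi> 0" using Ni_cvg[OF z1 c(2)] Ni_N[OF z1] s by simp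
    have "v = (\<lambda>i. W (R (s i)) (\<xi> i))" using s by (auto simp: x_of_0)
    then show "ip_converges Y v 0"
      using W_converges_iff[of "\<lambda>i. R (s i)" 0 \<xi> 0] 1 2 s by simp
  qed
qed

subsection \<open>Gamma field, Weyl function and Krein's resolvent formula\<close>

text \<open>The solution of \<open>N z \<xi> = - \<eta> c\<close>: the last component is
  \<open>c / (z - z1)\<close>, and every step towards the first one divides by \<open>z - z1\<close>
  again.\<close>

definition \<xi>c :: "complex \<Rightarrow> ('s \<Rightarrow> complex) \<Rightarrow> 's \<times> nat \<Rightarrow> complex" where
  "\<xi>c z c = (\<lambda>(\<sigma>, j). if (\<sigma>, j) \<in> SJ then c \<sigma> / (z - of_real z1) ^ (m - j + 1) else 0)"

text \<open>The element of the kernel of \<open>A_max - z\<close> whose value under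
  \<open>\<Gamma>0\<close> is \<open>c\<close>.\<close>

definition gvec :: "complex \<Rightarrow> ('v \<Rightarrow> 'v) \<Rightarrow> ('s \<Rightarrow> complex) \<Rightarrow> 'y" where
  "gvec z B c = x_of ((z - of_real z1) *\<^sub>C B (ac c)) c (\<xi>c z c)"

lemma \<xi>c_mem [simp]: "\<xi>c z c \<in> car C"
  by (auto simp: \<xi>c_def coord_mem_iff)

lemma N_\<xi>c: assumes z: "z \<noteq> of_real z1" and c: "c \<in> car Cd" shows "N z (\<xi>c z c) = - \<eta> c"
proof
  fix \<alpha> :: "'s \<times> nat"
  obtain \<sigma> j where a: "\<alpha> = (\<sigma>, j)" by (cases \<alpha>)
  define w where "w = z - of_real z1"
  have w: "w \<noteq> 0" using z by (simp add: w_def)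
  show "N z (\<xi>c z c) \<alpha> = (- \<eta> c) \<alpha>"
  proof (cases "\<alpha> \<in> SJ")
    case True
    then have j: "(\<sigma>, j) \<in> SJ" "\<sigma> \<in> S" "1 \<le> j" "j \<le> m" using a by (auto simp: SJ)
    show ?thesis
    proof (cases "j = m")
      case True
      then show ?thesis using j w by (simp add: a N_apply \<xi>c_def A_model.eta_def flip: w_def)
    next
      case False
      then have "(\<sigma>, Suc j) \<in> SJ" "m - j = Suc (m - Suc j)" "j < m" using j by (auto simp: SJ)
      then show ?thesis using j w False by (simp add: a N_apply \<xi>c_def A_model.eta_def flip: w_def)
    qed
  next
    case False
    then show ?thesis using N_mem[OF \<xi>c_mem, of z z c] \<eta>_mem[OF c] by (simp add: coord_mem_iff a)
  qed
qed

text \<open>The eigenvalue equation splits into \<open>D z s = (z - z1) ac c\<close> and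
  \<open>N z \<xi> = - \<eta> c\<close>, each of which determines its unknown from
  \<open>c\<close>.\<close>

lemma kernel_iff:
  assumes B: "inv_at z B" and z: "z \<noteq> of_real z1"
  shows "(x, z *\<^sub>C x) \<in> A_max \<longleftrightarrow> (\<exists>c\<in>car Cd. x = gvec z B c)"
proof -
  have *: "y_of s c \<xi> = z *\<^sub>C x_of s c \<xi> \<longleftrightarrow> s = (z - of_real z1) *\<^sub>C B (ac c) \<and> \<xi> = \<xi>c z c"
    if s: "s \<in> car X" "c \<in> car Cd" "\<xi> \<in> car C" for s c \<xi>
  proof -
    have "y_of s c \<xi> = z *\<^sub>C x_of s c \<xi> \<longleftrightarrow>
        s + of_real z1 *\<^sub>C (R s + ac c) = z *\<^sub>C (R s + ac c) \<and> M \<xi> + \<eta> c = z *\<^sub>C \<xi>"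
      using s by (simp add: x_of_def y_of_def W_eq_iff flip: W_scale)
    also have "s + of_real z1 *\<^sub>C (R s + ac c) = z *\<^sub>C (R s + ac c) \<longleftrightarrow> D z s = (z - of_real z1) *\<^sub>C ac c"
      by (auto simp: D_def scaleC_add_right complex_vector.scale_left_diff_distrib algebra_simps)
    also have "\<dots> \<longleftrightarrow> s = (z - of_real z1) *\<^sub>C B (ac c)"
    proof
      assume "D z s = (z - of_real z1) *\<^sub>C ac c"
      then have "B (D z s) = (z - of_real z1) *\<^sub>C B (ac c)"
        using X.linop_scale[OF inv_atD(1)[OF B]] by simp
      then show "s = (z - of_real z1) *\<^sub>C B (ac c)" using inv_atD(4)[OF B s(1)] by simp
    qed (use inv_atD(2,3)[OF B] in \<open>simp add: D_scale\<close>)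
    also have "M \<xi> + \<eta> c = z *\<^sub>C \<xi> \<longleftrightarrow> N z \<xi> = N z (\<xi>c z c)"
      unfolding N_\<xi>c[OF z s(2)] by (auto simp: N_def algebra_simps eq_neg_iff_add_eq_0)
    also have "\<dots> \<longleftrightarrow> \<xi> = \<xi>c z c" using N_inj[OF z s(3) \<xi>c_mem] by auto
    finally show ?thesis .
  qed
  show ?thesis
  proof
    assume "(x, z *\<^sub>C x) \<in> A_max"
    then obtain s c \<xi> where s: "s \<in> car X" "c \<in> car Cd" "\<xi> \<in> car C" "x = x_of s c \<xi>" "z *\<^sub>C x = y_of s c \<xi>"
      by (rule A_maxE)
    then show "\<exists>c\<in>car Cd. x = gvec z B c" using *[OF s(1-3)] by (auto simp: gvec_def)
  next
    assume "\<exists>c\<in>car Cd. x = gvec z B c"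
    then obtain c where c: "c \<in> car Cd" "x = gvec z B c" by blast
    let ?s = "(z - of_real z1) *\<^sub>C B (ac c)"
    have "y_of ?s c (\<xi>c z c) = z *\<^sub>C x" using *[of ?s c "\<xi>c z c"] c inv_atD(2)[OF B] by (simp add: gvec_def)
    then show "(x, z *\<^sub>C x) \<in> A_max"
      using A_max_I[of ?s c "\<xi>c z c"] c inv_atD(2)[OF B] by (simp add: gvec_def)
  qed
qed

lemma \<Gamma>_gvec:
  assumes B: "inv_at z B" and c: "c \<in> car Cd"
  shows "\<Gamma>0 (gvec z B c) = c" "\<Gamma>1 (gvec z B c) = \<Lambda> ((z - of_real z1) *\<^sub>C B (ac c)) - block (G (\<xi>c z c))"
  using inv_atD(2)[OF B] c by (auto simp: gvec_def)

lemma gamma_field_iff: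
  assumes "inv_at z B" "z \<noteq> of_real z1"
  shows "(c, x) \<in> gamma_field A_max \<Gamma>0 z \<longleftrightarrow> c \<in> car Cd \<and> x = gvec z B c"
  unfolding gamma_field_def using kernel_iff[OF assms] \<Gamma>_gvec(1)[OF assms(1)] by auto

lemma weyl_function_iff:
  assumes "inv_at z B" "z \<noteq> of_real z1"
  shows "(c, d) \<in> weyl_function A_max \<Gamma>0 \<Gamma>1 z \<longleftrightarrow> c \<in> car Cd \<and> d = \<Gamma>1 (gvec z B c)"
  unfolding weyl_function_def using gamma_field_iff[OF assms] by auto

text \<open>The first summand is \<open>\<Lambda>\<close> at the regular parameter of
  \<open>gvec\<close>, the second is \<open>- block (G \<xi>)\<close> at its finite-dimensional
  coordinates \<open>\<xi>c\<close>.\<close>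

lemma weyl_function_mat:
  assumes B: "inv_at z B" and z: "z \<noteq> of_real z1"
  shows "weyl_function A_max \<Gamma>0 \<Gamma>1 z = mat_rel S (\<lambda>\<sigma> \<sigma>'. (z - of_real z1) * ip X (a \<sigma>) (B (a \<sigma>'))
    - (\<Sum>j\<in>{1..m}. \<G> (\<sigma>, m) (\<sigma>', j) / (z - of_real z1) ^ (m - j + 1)))" (is "_ = mat_rel S ?Q")
proof -
  have "\<Gamma>1 (gvec z B c) = mat_app S ?Q c" if c: "c \<in> car Cd" for c
  proof
    fix \<sigma>
    show "\<Gamma>1 (gvec z B c) \<sigma> = mat_app S ?Q c \<sigma>"
    proof (cases "\<sigma> \<in> S")
      case True
      have "B (ac c) = (\<Sum>\<sigma>'\<in>S. c \<sigma>' *\<^sub>C B (a \<sigma>'))"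
        unfolding ac_def by (subst X.linop_sum[OF inv_atD(1)[OF B]]) (auto simp: a_mem X.linop_scale[OF inv_atD(1)[OF B]])
      then have "ip X (a \<sigma>) (B (ac c)) = (\<Sum>\<sigma>'\<in>S. c \<sigma>' * ip X (a \<sigma>) (B (a \<sigma>')))"
        using True by (simp add: X.ip_sum_right a_mem inv_atD(2)[OF B] X.ip_linear)
      then have 1: "\<Lambda> ((z - of_real z1) *\<^sub>C B (ac c)) \<sigma>
          = (\<Sum>\<sigma>'\<in>S. (z - of_real z1) * ip X (a \<sigma>) (B (a \<sigma>')) * c \<sigma>')"
        using True by (simp add: \<Lambda>_def X.ip_linear a_mem inv_atD(2)[OF B] sum_distrib_left mult_ac)
      have "G (\<xi>c z c) (\<sigma>, m) = (\<Sum>(\<sigma>', j)\<in>SJ. \<G> (\<sigma>, m) (\<sigma>', j) * (c \<sigma>' / (z - of_real z1) ^ (m - j + 1)))"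
      proof -
        have "(\<sigma>, m) \<in> SJ" using True m by (simp add: SJ)
        then show ?thesis by (auto simp: mat_app_def \<xi>c_def intro!: sum.cong)
      qed
      also have "\<dots> = (\<Sum>\<sigma>'\<in>S. \<Sum>j\<in>{1..m}. \<G> (\<sigma>, m) (\<sigma>', j) * (c \<sigma>' / (z - of_real z1) ^ (m - j + 1)))"
        unfolding SJ sum.cartesian_product ..
      finally have 2: "block (G (\<xi>c z c)) \<sigma>
          = (\<Sum>\<sigma>'\<in>S. (\<Sum>j\<in>{1..m}. \<G> (\<sigma>, m) (\<sigma>', j) / (z - of_real z1) ^ (m - j + 1)) * c \<sigma>')"
        by (simp add: A_model.block_m_def sum_distrib_right)
      show ?thesis
        using True 1 2 \<Gamma>_gvec(2)[OF B c]
        by (simp add: mat_app_def sum_subtractf left_diff_distrib)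
    next
      case False
      then show ?thesis using \<Gamma>_gvec(2)[OF B c]
        by (simp add: mat_app_def \<Lambda>_def A_model.block_m_def SJ)
    qed
  qed
  then show ?thesis
    using weyl_function_iff[OF B z] by (auto simp: mat_rel_def)
qed

text \<open>Green's identity for a kernel vector at \<open>cnj z\<close> and an element
  \<open>x0\<close> of \<open>A0\<close>: the adjoint of the gamma field maps
  \<open>(A0 - z) x0\<close> to \<open>\<Gamma>1 x0\<close>.\<close>

lemma adjoint_gamma_iff:
  assumes B: "inv_at z B" and z: "z \<noteq> of_real z1" and s: "s \<in> car X" "\<xi> \<in> car C"
  shows "(W (D z s) (N z \<xi>), d) \<in> adjoint_relation Cd Y (gamma_field A_max \<Gamma>0 (cnj z)) \<longleftrightarrow> d = \<Gamma>1 (x_of s 0 \<xi>)"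
proof -
  \<comment> \<open>The gamma field at \<open>cnj z\<close> consists of kernel vectors at
    \<open>cnj z\<close>, so \<open>D\<close> has to be inverted there as well.\<close>
  obtain B' where B': "inv_at (cnj z) B'" using inv_at_cnj[OF B] .
  have z': "cnj z \<noteq> of_real z1" using z by (metis complex_cnj_cnj complex_cnj_complex_of_real)
  have key: "ip Y (gvec (cnj z) B' c) (W (D z s) (N z \<xi>)) = ip Cd c (\<Gamma>1 (x_of s 0 \<xi>))" if c: "c \<in> car Cd" for c
  proof -
    define t where "t = (cnj z - of_real z1) *\<^sub>C B' (ac c)"
    have t: "t \<in> car X" using inv_atD(2)[OF B'] by (simp add: t_def)
    have g: "gvec (cnj z) B' c = x_of t c (\<xi>c (cnj z) c)" by (simp add: gvec_def t_def)
    have "(gvec (cnj z) B' c, cnj z *\<^sub>C gvec (cnj z) B' c) \<in> A_max" using kernel_iff[OF B' z'] c by blast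
    moreover have "(gvec (cnj z) B' c, y_of t c (\<xi>c (cnj z) c)) \<in> A_max" using g t c by simp
    ultimately have y: "y_of t c (\<xi>c (cnj z) c) = cnj z *\<^sub>C x_of t c (\<xi>c (cnj z) c)"
      using A_max_linear unfolding linear_operator_def single_valued_def g by blast
    have "ip Y (x_of t c (\<xi>c (cnj z) c)) (y_of s 0 \<xi> - z *\<^sub>C x_of s 0 \<xi>)
        = ip Y (x_of t c (\<xi>c (cnj z) c)) (y_of s 0 \<xi>) - ip Y (cnj z *\<^sub>C x_of t c (\<xi>c (cnj z) c)) (x_of s 0 \<xi>)"
      using s t c by (simp add: Y.ip_linear)
    also have "\<dots> = ip Cd c (\<Lambda> s - block (G \<xi>))"
      using Green[of t c "\<xi>c (cnj z) c" s 0 \<xi>] s t c by (simp add: y)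
    finally show ?thesis using s by (simp add: g x_y_of)
  qed
  have d1: "\<Gamma>1 (x_of s 0 \<xi>) \<in> car Cd" using s by simp
  have "(W (D z s) (N z \<xi>), d) \<in> adjoint_relation Cd Y (gamma_field A_max \<Gamma>0 (cnj z)) \<longleftrightarrow>
      d \<in> car Cd \<and> (\<forall>c\<in>car Cd. ip Cd c (\<Gamma>1 (x_of s 0 \<xi>)) = ip Cd c d)"
  proof -
    have "(\<forall>(c, v)\<in>gamma_field A_max \<Gamma>0 (cnj z). ip Y v (W (D z s) (N z \<xi>)) = ip Cd c d) \<longleftrightarrow>
        (\<forall>c\<in>car Cd. ip Y (gvec (cnj z) B' c) (W (D z s) (N z \<xi>)) = ip Cd c d)"
      unfolding Ball_def split_paired_All gamma_field_iff[OF B' z'] by auto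
    also have "\<dots> \<longleftrightarrow> (\<forall>c\<in>car Cd. ip Cd c (\<Gamma>1 (x_of s 0 \<xi>)) = ip Cd c d)"
      by (intro ball_cong refl) (simp only: key)
    finally show ?thesis unfolding adjoint_relation_def using s by simp
  qed
  also have "\<dots> \<longleftrightarrow> d = \<Gamma>1 (x_of s 0 \<xi>)"
    using Cd.ip_eqI[of d "\<Gamma>1 (x_of s 0 \<xi>)"] d1 by metis
  finally show ?thesis .
qed

lemma \<Gamma>_add:
  assumes "(x, y) \<in> A_max" "(x', y') \<in> A_max"
  shows "\<Gamma>0 (x + x') = \<Gamma>0 x + \<Gamma>0 x'" "\<Gamma>1 (x + x') = \<Gamma>1 x + \<Gamma>1 x'"
proof -
  from assms(1) obtain s c \<xi> where s: "s \<in> car X" "c \<in> car Cd" "\<xi> \<in> car C" "x = x_of s c \<xi>"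
    by (rule A_maxE)
  from assms(2) obtain t d \<zeta> where t: "t \<in> car X" "d \<in> car Cd" "\<zeta> \<in> car C" "x' = x_of t d \<zeta>"
    by (rule A_maxE)
  have x: "x + x' = x_of (s + t) (c + d) (\<xi> + \<zeta>)" unfolding s(4) t(4) using s(1-3) t(1-3) by (simp add: x_of_add)
  show "\<Gamma>0 (x + x') = \<Gamma>0 x + \<Gamma>0 x'" unfolding x unfolding s(4) t(4) using s(1-3) t(1-3) by simp
  show "\<Gamma>1 (x + x') = \<Gamma>1 x + \<Gamma>1 x'" unfolding x unfolding s(4) t(4) using s(1-3) t(1-3)
    by (simp add: \<Lambda>_add mat_app_add block_add)
qed

text \<open>A solution of \<open>(A_ext \<Theta> - z) x = y\<close> differs from
  \<open>x0 = (A0 - z)\<inverse> y\<close> by a kernel vector with \<open>\<Gamma>0\<close>-value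
  \<open>c\<close>. Then \<open>\<Gamma>0 x = c\<close> and
  \<open>\<Gamma>1 x = \<Gamma>1 x0 + M c\<close>, so the boundary condition says that
  \<open>(c, \<Gamma>1 x0)\<close> lies in \<open>\<Theta> - M\<close>, and
  \<open>\<Gamma>1 x0\<close> is the adjoint gamma field at \<open>y\<close>. Every step can be
  reversed.\<close>

lemma Krein:
  assumes z: "z \<in> resolvent_set Y A0"
  shows "resolvent (A_ext \<Theta>) z = rel_plus (resolvent A0 z)
    (adjoint_relation Cd Y (gamma_field A_max \<Gamma>0 (cnj z)) O (rel_minus \<Theta> (weyl_function A_max \<Gamma>0 \<Gamma>1 z))\<inverse> O gamma_field A_max \<Gamma>0 z)"
proof -
  have z1: "z \<noteq> of_real z1" and "z \<in> resolvent_set X Lrel" using z resolvent_set_A0 by auto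
  then obtain B where B: "inv_at z B" using inv_at_exists by blast
  have sub: "complex_vector.subspace A_max" and AY: "A_max \<subseteq> car Y \<times> car Y"
    using A_max_linear by (auto simp: linear_operator_def linear_relation_def)
  show ?thesis (is "_ = ?rhs")
  proof (intro set_eqI, clarify)
    fix y x
    show "(y, x) \<in> resolvent (A_ext \<Theta>) z \<longleftrightarrow> (y, x) \<in> ?rhs"
    proof
      assume "(y, x) \<in> resolvent (A_ext \<Theta>) z"
      then have x: "(x, y + z *\<^sub>C x) \<in> A_max" "(\<Gamma>0 x, \<Gamma>1 x) \<in> \<Theta>" by (auto simp: resolvent_iff A_ext_def)
      then have m: "x \<in> car Y" "y + z *\<^sub>C x \<in> car Y" using AY by auto
      have "y = (y + z *\<^sub>C x) - z *\<^sub>C x" by simp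
      then have "y \<in> car Y" using m by (metis Y.diff_mem Y.scale_mem)
      then have "y \<in> Domain (resolvent A0 z)"
        using z by (simp add: resolvent_set_def bounded_everywhere_defined_def)
      then obtain s \<xi> where s: "s \<in> car X" "\<xi> \<in> car C" "y = W (D z s) (N z \<xi>)"
        unfolding Domain_iff resolvent_A0_iff by blast
      let ?x0 = "x_of s 0 \<xi>"
      have x0: "(y, ?x0) \<in> resolvent A0 z" unfolding resolvent_A0_iff using s by blast
      then have x0m: "(?x0, y + z *\<^sub>C ?x0) \<in> A_max" using A0_subset by (auto simp: resolvent_iff)
      have "(x - ?x0, z *\<^sub>C (x - ?x0)) \<in> A_max"
        using subspace_rel_diff[OF sub x(1) x0m] by (simp add: complex_vector.scale_right_diff_distrib)
      moreover from this obtain c where c: "c \<in> car Cd" "x - ?x0 = gvec z B c" using kernel_iff[OF B z1] by blast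
      ultimately have g: "(gvec z B c, z *\<^sub>C gvec z B c) \<in> A_max" by simp
      have xs: "x = ?x0 + gvec z B c" using c by (simp add: algebra_simps)
      have "\<Gamma>0 x = c" "\<Gamma>1 x = \<Gamma>1 ?x0 + \<Gamma>1 (gvec z B c)"
        unfolding xs using \<Gamma>_add[OF x0m g] \<Gamma>_gvec(1)[OF B c(1)] s by auto
      then have "(c, \<Gamma>1 ?x0) \<in> rel_minus \<Theta> (weyl_function A_max \<Gamma>0 \<Gamma>1 z)"
        using x(2) weyl_function_iff[OF B z1] c unfolding rel_minus_def
        by (intro CollectI exI[of _ c] exI[of _ "\<Gamma>1 x"] exI[of _ "\<Gamma>1 (gvec z B c)"]) simp
      moreover have "(y, \<Gamma>1 ?x0) \<in> adjoint_relation Cd Y (gamma_field A_max \<Gamma>0 (cnj z))"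
        using adjoint_gamma_iff[OF B z1 s(1,2)] s by simp
      moreover have "(c, gvec z B c) \<in> gamma_field A_max \<Gamma>0 z" using gamma_field_iff[OF B z1] c by simp
      ultimately show "(y, x) \<in> ?rhs" using x0 xs unfolding rel_plus_def by blast
    next
      assume "(y, x) \<in> ?rhs"
      then obtain x0 v d c where r: "x = x0 + v" "(y, x0) \<in> resolvent A0 z"
        "(y, d) \<in> adjoint_relation Cd Y (gamma_field A_max \<Gamma>0 (cnj z))"
        "(c, d) \<in> rel_minus \<Theta> (weyl_function A_max \<Gamma>0 \<Gamma>1 z)" "(c, v) \<in> gamma_field A_max \<Gamma>0 z"
        unfolding rel_plus_def by blast
      obtain s \<xi> where s: "s \<in> car X" "\<xi> \<in> car C" "y = W (D z s) (N z \<xi>)" "x0 = x_of s 0 \<xi>"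
        using r(2) unfolding resolvent_A0_iff by blast
      have d: "d = \<Gamma>1 x0" using r(3) adjoint_gamma_iff[OF B z1 s(1,2)] s by simp
      have c: "c \<in> car Cd" "v = gvec z B c" using r(5) gamma_field_iff[OF B z1] by auto
      obtain c' w where w: "d = c' - w" "(c, c') \<in> \<Theta>" "(c, w) \<in> weyl_function A_max \<Gamma>0 \<Gamma>1 z"
        using r(4) unfolding rel_minus_def by blast
      have w': "w = \<Gamma>1 v" using w(3) weyl_function_iff[OF B z1] c by simp
      have x0m: "(x0, y + z *\<^sub>C x0) \<in> A_max" using r(2) A0_subset by (auto simp: resolvent_iff)
      have vm: "(v, z *\<^sub>C v) \<in> A_max" using kernel_iff[OF B z1] c by blast
      have "(x, y + z *\<^sub>C x) \<in> A_max"
        using subspace_rel_add[OF sub x0m vm] r(1) by (simp add: scaleC_add_right add.assoc)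
      moreover have "\<Gamma>0 x = c" "\<Gamma>1 x = c'"
        using \<Gamma>_add[OF x0m vm] r(1) s c \<Gamma>_gvec(1)[OF B c(1)] w(1) w' d by (auto simp: algebra_simps)
      ultimately show "(y, x) \<in> resolvent (A_ext \<Theta>) z" using w(2) by (simp add: resolvent_iff A_ext_def)
    qed
  qed
qed

end

section \<open>The A-model\<close>

locale A_model_scale = scale H L z1 P R
  for H :: "int \<Rightarrow> 'v::complex_vector ipspace" and L z1 P R +
  fixes m :: nat and S :: "'s set" and \<phi> :: "'s \<Rightarrow> 'v" and \<G> :: "('s \<times> nat) \<Rightarrow> ('s \<times> nat) \<Rightarrow> complex"
  assumes m: "1 \<le> m"
    and S: "finite S" "S \<noteq> {}"
    and \<phi>: "\<sigma> \<in> S \<Longrightarrow> \<phi> \<sigma> \<in> car (H (- int m - 2))"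
    and \<phi>_indep: "c \<in> car (coord_space S) \<Longrightarrow>
      (\<Sum>\<sigma>\<in>S. c \<sigma> *\<^sub>C \<phi> \<sigma>) \<in> car (H (- int m - 1)) \<Longrightarrow> c = 0"
    and G_inv: "mat_invertible (S \<times> {1..m}) \<G>"
    and G_herm: "mat_eq_on (S \<times> {1..m}) (mat_adjoint \<G>) \<G>"
    and G_comm: "mat_eq_on (S \<times> {1..m})
      (mat_prod (S \<times> {1..m}) \<G> (A_model.M_d z1 m))
      (mat_prod (S \<times> {1..m}) (mat_adjoint (A_model.M_d z1 m)) \<G>)"
begin

declare One_nat_def [simp del]

sublocale A: A_model H L z1 m S \<phi> \<G> .

abbreviation "n0 \<equiv> - int m - 2"
abbreviation "C \<equiv> coord_space (S \<times> {1..m})"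
abbreviation "Cd \<equiv> coord_space S"

text \<open>The same vector is the image of \<open>h_vec (\<sigma>, m + 1)\<close> under
  \<open>V m\<close>; in this role it describes the singular part of the domain of
  \<open>A_max\<close>.\<close>

definition a :: "'s \<Rightarrow> 'v" where
  "a \<sigma> = V n0 (\<phi> \<sigma>)"

definition ac :: "('s \<Rightarrow> complex) \<Rightarrow> 'v" where
  "ac c = (\<Sum>\<sigma>\<in>S. c \<sigma> *\<^sub>C a \<sigma>)"

definition Vi :: "int \<Rightarrow> 'v \<Rightarrow> 'v" where
  "Vi n y = (SOME x. x \<in> car (H n) \<and> V n x = y)"

definition K :: "('s \<times> nat \<Rightarrow> complex) \<Rightarrow> 'v" where
  "K \<xi> = (\<Sum>\<alpha>\<in>S \<times> {1..m}. \<xi> \<alpha> *\<^sub>C A.h_vec \<alpha>)"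

definition W :: "'v \<Rightarrow> ('s \<times> nat \<Rightarrow> complex) \<Rightarrow> 'v" where
  "W u \<xi> = Vi (int m) u + K \<xi>"

lemma finite_SJ: "finite (S \<times> {1..m})"
  using S by simp

interpretation C: hilbert C
  by (rule hilbertI[OF hilbert_coord[OF finite_SJ]])

interpretation Cd: hilbert Cd
  by (rule hilbertI[OF hilbert_coord[OF S(1)]])

lemma Vi: "y \<in> car (H 0) \<Longrightarrow> Vi n y \<in> car (H n)" "y \<in> car (H 0) \<Longrightarrow> V n (Vi n y) = y"
proof -
  have "Vi n y \<in> car (H n) \<and> V n (Vi n y) = y" if "y \<in> car (H 0)"
    unfolding Vi_def by (rule someI_ex) (use V_onto[OF that, of n] in blast)
  then show "y \<in> car (H 0) \<Longrightarrow> Vi n y \<in> car (H n)" "y \<in> car (H 0) \<Longrightarrow> V n (Vi n y) = y" by auto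
qed

lemma Vi_V: "x \<in> car (H n) \<Longrightarrow> Vi n (V n x) = x"
  using Vi[of "V n x" n] V_inj[of "Vi n (V n x)" n x] by simp

lemma Vi_add: "x \<in> car (H 0) \<Longrightarrow> y \<in> car (H 0) \<Longrightarrow> Vi n (x + y) = Vi n x + Vi n y"
  using V_inj[of "Vi n (x + y)" n "Vi n x + Vi n y"] by (simp add: Vi V_add)

lemma Vi_scale: "x \<in> car (H 0) \<Longrightarrow> Vi n (r *\<^sub>C x) = r *\<^sub>C Vi n x"
  using V_inj[of "Vi n (r *\<^sub>C x)" n "r *\<^sub>C Vi n x"] by (simp add: Vi V_scale)

lemma Vi_0 [simp]: "Vi n 0 = 0"
  using Vi_V[of 0 n] by simp

lemma a_mem [simp]: "\<sigma> \<in> S \<Longrightarrow> a \<sigma> \<in> car (H 0)"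
  using \<phi> by (simp add: a_def)

lemma ac_mem [simp]: "ac c \<in> car (H 0)"
  unfolding ac_def by (intro H.sum_mem H.scale_mem a_mem)

text \<open>If the combination lies in the range of \<open>R = P^2\<close>, the functional lies two
  steps higher, in \<open>H (- m)\<close>, and so in \<open>H (- m - 1)\<close>, where no nontrivial
  combination exists.\<close>

lemma a_indep:
  assumes c: "c \<in> car Cd" and s: "s \<in> car (H 0)" and eq: "(\<Sum>\<sigma>\<in>S. c \<sigma> *\<^sub>C a \<sigma>) = R s"
  shows "c = 0"
proof -
  let ?f = "\<Sum>\<sigma>\<in>S. c \<sigma> *\<^sub>C \<phi> \<sigma>"
  have f: "?f \<in> car (H n0)" by (intro H.sum_mem H.scale_mem \<phi>)
  have "V n0 ?f = (\<Sum>\<sigma>\<in>S. c \<sigma> *\<^sub>C a \<sigma>)" by (subst V_sum) (auto simp: \<phi> V_scale a_def)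
  then have "?f \<in> car (H (n0 + 2))" using mem_step2[OF f s] eq by simp
  then have "?f \<in> car (H (- int m - 1))" by (rule inclusion_le[rotated]) simp
  then show ?thesis using \<phi>_indep[OF c] by blast
qed

lemma Rpow_mem [simp]: "x \<in> car (H 0) \<Longrightarrow> (R ^^ k) x \<in> car (H 0)"
  by (rule H.linop_mem[OF H.linop_funpow[OF R(1)]])

lemmas Rpow_add = H.linop_add[OF H.linop_funpow[OF R(1)]]
  and Rpow_scale = H.linop_scale[OF H.linop_funpow[OF R(1)]]
  and Rpow_sum = H.linop_sum[OF H.linop_funpow[OF R(1)]]

lemma Rpow_eq: "x \<in> car (H 0) \<Longrightarrow> (R ^^ k) x = (P ^^ (2 * k)) x"
  using H.funpow_square[OF P_lin PP, of x k] by (simp add: mult_2 funpow_add)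

text \<open>\<open>H m\<close> and the vectors \<open>h_vec\<close> are compared inside
  \<open>H (- m - 2)\<close>. From \<open>m\<close> down to \<open>- m - 2\<close> there are
  \<open>2 (m + 1)\<close> steps, hence the power \<open>m + 1\<close> of \<open>R\<close>.\<close>

lemma V_n0: "x \<in> car (H (int m)) \<Longrightarrow> x \<in> car (H n0)" "x \<in> car (H (int m)) \<Longrightarrow> V n0 x = (R ^^ Suc m) (V (int m) x)"
proof -
  have e: "n0 + int (2 * Suc m) = int m" by simp
  show "x \<in> car (H (int m)) \<Longrightarrow> x \<in> car (H n0)" using inclusion_le[of n0 "int m" x] by simp
  show "x \<in> car (H (int m)) \<Longrightarrow> V n0 x = (R ^^ Suc m) (V (int m) x)"
    using V_pow_step[of x n0 "2 * Suc m"] unfolding e by (simp only: Rpow_eq V_mem)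
qed

subsection \<open>Resolvents on the scale\<close>

lemma resolvent_scale_op_iff:
  "(x, y) \<in> resolvent (scale_op H L n) z \<longleftrightarrow> x \<in> car (H n) \<and> y \<in> car (H n) \<and> (V n x, V n y) \<in> resolvent L z"
proof -
  have "x + z *\<^sub>C y \<in> car (H n) \<longleftrightarrow> x \<in> car (H n)" if y: "y \<in> car (H n)"
  proof
    assume "x + z *\<^sub>C y \<in> car (H n)"
    then have "x + z *\<^sub>C y - z *\<^sub>C y \<in> car (H n)" using y by (intro H.diff_mem H.scale_mem)
    then show "x \<in> car (H n)" by simp
  qed (use y in simp)
  then show ?thesis
    unfolding resolvent_iff scale_op_iff by (auto simp: V_add V_scale)
qed

lemma rel_app_resolvent:
  assumes T: "resolvent L z = H.gr 0 T" "\<And>t. t \<in> car (H 0) \<Longrightarrow> T t \<in> car (H 0)" and x: "x \<in> car (H n)"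
  shows "rel_app (resolvent (scale_op H L n) z) x = Vi n (T (V n x))"
  unfolding rel_app_def
proof (rule the_equality)
  show "(x, Vi n (T (V n x))) \<in> resolvent (scale_op H L n) z"
    unfolding resolvent_scale_op_iff T(1) using x T(2) by (simp add: Vi)
  fix y assume "(x, y) \<in> resolvent (scale_op H L n) z"
  then show "y = Vi n (T (V n x))" unfolding resolvent_scale_op_iff T(1) using Vi_V[of y n] by simp
qed

lemma resolvent_L_z1: "resolvent L (of_real z1) = H.gr 0 R"
proof (intro set_eqI, clarify)
  fix t u
  show "(t, u) \<in> resolvent L (of_real z1) \<longleftrightarrow> (t, u) \<in> H.gr 0 R"
    unfolding resolvent_iff L_iff H.gr_iff by auto
qed

lemma resolvent_power_iff:
  assumes x: "x \<in> car (H n)"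
  shows "(x, y) \<in> resolvent (scale_op H L n) (of_real z1) ^^ j \<longleftrightarrow> y \<in> car (H n) \<and> V n y = (R ^^ j) (V n x)"
proof (induction j arbitrary: y)
  case 0
  show ?case using V_inj[of y n x] x by auto
next
  case (Suc j)
  have "(x, y) \<in> resolvent (scale_op H L n) (of_real z1) ^^ Suc j \<longleftrightarrow>
      (\<exists>w. w \<in> car (H n) \<and> V n w = (R ^^ j) (V n x) \<and> y \<in> car (H n) \<and> V n y = R (V n w))"
  proof -
    have step: "(w, y) \<in> resolvent (scale_op H L n) (of_real z1) \<longleftrightarrow> w \<in> car (H n) \<and> y \<in> car (H n) \<and> V n y = R (V n w)" for w
      by (auto simp: resolvent_scale_op_iff resolvent_L_z1)
    show ?thesis
      unfolding relpow.simps relcomp_unfold mem_Collect_eq case_prod_conv Suc step by blast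
  qed
  also have "\<dots> \<longleftrightarrow> y \<in> car (H n) \<and> V n y = (R ^^ Suc j) (V n x)"
    using V_onto[OF Rpow_mem[OF V_mem[OF x], where k = j], where n = n] by auto
  finally show ?case .
qed

lemma h_vec: assumes "\<sigma> \<in> S"
  shows "A.h_vec (\<sigma>, j) \<in> car (H n0)" "V n0 (A.h_vec (\<sigma>, j)) = (R ^^ j) (a \<sigma>)"
proof -
  let ?h = "Vi n0 ((R ^^ j) (a \<sigma>))"
  have a: "(R ^^ j) (a \<sigma>) \<in> car (H 0)" using assms by simp
  have "A.h_vec (\<sigma>, j) = ?h"
    unfolding A.h_vec_def case_prod_conv rel_app_def resolvent_power_iff[OF \<phi>[OF assms]] a_def[symmetric]
  proof (rule the_equality)
    fix y assume "y \<in> car (H n0) \<and> V n0 y = (R ^^ j) (a \<sigma>)"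
    then show "y = ?h" using Vi_V[of y n0] by simp
  qed (use Vi[OF a] in simp)
  then show "A.h_vec (\<sigma>, j) \<in> car (H n0)" "V n0 (A.h_vec (\<sigma>, j)) = (R ^^ j) (a \<sigma>)"
    using Vi[OF a] by auto
qed

text \<open>The \<open>m + 1\<close> resolvents raise the regularity by \<open>2 (m + 1)\<close>
  steps, from \<open>- m - 2\<close> exactly to \<open>m\<close>.\<close>

lemma h_vec_top: assumes s: "\<sigma> \<in> S"
  shows "A.h_vec (\<sigma>, m + 1) \<in> car (H (int m))" "V (int m) (A.h_vec (\<sigma>, m + 1)) = a \<sigma>"
proof -
  have e: "n0 + int (2 * (m + 1)) = int m" by simp
  have "V n0 (A.h_vec (\<sigma>, m + 1)) = (P ^^ (2 * (m + 1))) (a \<sigma>)"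
    using h_vec(2)[OF s, of "m + 1"] Rpow_eq[OF a_mem[OF s], of "m + 1"] by simp
  from mem_pow_step[OF h_vec(1)[OF s] a_mem[OF s] this]
  show "A.h_vec (\<sigma>, m + 1) \<in> car (H (int m))" "V (int m) (A.h_vec (\<sigma>, m + 1)) = a \<sigma>" unfolding e by auto
qed

lemma h_top: "A.h_top c \<in> car (H (int m))" "V (int m) (A.h_top c) = ac c"
proof -
  show "A.h_top c \<in> car (H (int m))" unfolding A.h_top_def using h_vec_top(1) by (intro H.sum_mem H.scale_mem) auto
  show "V (int m) (A.h_top c) = ac c"
    unfolding A.h_top_def ac_def using h_vec_top by (subst V_sum) (auto simp: V_scale)
qed

lemma h_top_Vi: "A.h_top c = Vi (int m) (ac c)"
  using Vi_V[OF h_top(1)] h_top(2) by simp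

subsection \<open>Coordinates\<close>

lemma K_mem: "K \<xi> \<in> car (H n0)"
  unfolding K_def by (intro H.sum_mem H.scale_mem) (auto simp: h_vec)

lemma K_add: "K (\<xi> + \<zeta>) = K \<xi> + K \<zeta>"
  by (simp add: K_def scaleC_add_left sum.distrib)

lemma K_scale: "K (r *\<^sub>C \<xi>) = r *\<^sub>C K \<xi>"
  by (simp add: K_def complex_vector.scale_sum_right scaleC_scaleC)

lemma K_diff: "K (\<xi> - \<zeta>) = K \<xi> - K \<zeta>"
  using K_add[of "\<xi> - \<zeta>" \<zeta>] by simp

lemma V_K: "V n0 (K \<xi>) = (\<Sum>j\<in>{1..m}. (R ^^ j) (ac (\<lambda>\<sigma>. \<xi> (\<sigma>, j))))"
proof -
  have "V n0 (K \<xi>) = (\<Sum>(\<sigma>, j)\<in>S \<times> {1..m}. \<xi> (\<sigma>, j) *\<^sub>C (R ^^ j) (a \<sigma>))"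
    unfolding K_def by (subst V_sum) (auto simp: h_vec V_scale intro!: sum.cong)
  also have "\<dots> = (\<Sum>\<sigma>\<in>S. \<Sum>j\<in>{1..m}. \<xi> (\<sigma>, j) *\<^sub>C (R ^^ j) (a \<sigma>))" by (simp only: sum.cartesian_product)
  also have "\<dots> = (\<Sum>j\<in>{1..m}. \<Sum>\<sigma>\<in>S. \<xi> (\<sigma>, j) *\<^sub>C (R ^^ j) (a \<sigma>))" by (rule sum.swap)
  also have "\<dots> = (\<Sum>j\<in>{1..m}. (R ^^ j) (ac (\<lambda>\<sigma>. \<xi> (\<sigma>, j))))"
    unfolding ac_def by (intro sum.cong refl, subst Rpow_sum) (auto simp: Rpow_scale)
  finally show ?thesis .
qed

text \<open>The terms vanish one after the other: the first one lies in the range of \<open>R\<close>.\<close>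

lemma Rpow_independent:
  fixes v :: "nat \<Rightarrow> 'v"
  assumes "u \<in> car (H 0)" "\<And>j. j \<in> {1..k} \<Longrightarrow> v j \<in> car (H 0)"
    "\<And>j s. j \<in> {1..k} \<Longrightarrow> s \<in> car (H 0) \<Longrightarrow> v j = R s \<Longrightarrow> v j = 0"
    "(R ^^ Suc k) u + (\<Sum>j\<in>{1..k}. (R ^^ j) (v j)) = 0"
  shows "\<forall>j\<in>{1..k}. v j = 0"
  using assms(2-4)
proof (induction k arbitrary: v)
  case (Suc k)
  have bm: "v 1 \<in> car (H 0)" "\<And>j. j \<in> {1..k} \<Longrightarrow> v (Suc j) \<in> car (H 0)" using Suc.prems(1) by auto
  \<comment> \<open>With this \<open>t\<close> the assumed equation is
    \<open>R (v 1 + R t) = 0\<close>. Hence \<open>v 1 = R (- t)\<close> lies in the range of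
    \<open>R\<close> and vanishes, and \<open>R t = 0\<close> is the equation for the remaining
    terms.\<close>
  define t where "t = (R ^^ k) u + (\<Sum>j\<in>{1..k}. (R ^^ (j - 1)) (v (Suc j)))"
  have t: "t \<in> car (H 0)" using assms(1) bm unfolding t_def by (intro H.add_mem H.sum_mem) auto
  have Rt: "R t = (R ^^ Suc k) u + (\<Sum>j\<in>{1..k}. (R ^^ j) (v (Suc j)))"
  proof -
    have "R t = R ((R ^^ k) u) + (\<Sum>j\<in>{1..k}. R ((R ^^ (j - 1)) (v (Suc j))))"
      unfolding t_def using assms(1) bm
      by (subst H.linop_add[OF R(1)]) (auto intro!: H.sum_mem H.linop_sum[OF R(1)])
    also have "(\<Sum>j\<in>{1..k}. R ((R ^^ (j - 1)) (v (Suc j)))) = (\<Sum>j\<in>{1..k}. (R ^^ j) (v (Suc j)))"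
    proof (intro sum.cong refl)
      fix j assume "j \<in> {1..k}"
      then obtain i where "j = Suc i" by (cases j) auto
      then show "R ((R ^^ (j - 1)) (v (Suc j))) = (R ^^ j) (v (Suc j))" by simp
    qed
    finally show ?thesis by simp
  qed
  have "(\<Sum>j\<in>{1..Suc k}. (R ^^ j) (v j)) = R (v 1) + (\<Sum>j\<in>{1..k}. (R ^^ Suc j) (v (Suc j)))"
  proof -
    have "(\<Sum>j\<in>{1..Suc k}. (R ^^ j) (v j)) = (R ^^ 1) (v 1) + (\<Sum>j\<in>{Suc 1..Suc k}. (R ^^ j) (v j))"
      by (rule sum.atLeast_Suc_atMost) simp
    then show ?thesis unfolding sum.shift_bounds_cl_Suc_ivl by (simp add: One_nat_def)
  qed
  moreover have "(\<Sum>j\<in>{1..k}. (R ^^ Suc j) (v (Suc j))) = R (\<Sum>j\<in>{1..k}. (R ^^ j) (v (Suc j)))"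
    using bm by (subst H.linop_sum[OF R(1)]) auto
  ultimately have sum: "(\<Sum>j\<in>{1..Suc k}. (R ^^ j) (v j)) = R (v 1) + R (\<Sum>j\<in>{1..k}. (R ^^ j) (v (Suc j)))" by simp
  have "R (v 1 + R t) = R (v 1) + (R ((R ^^ Suc k) u) + R (\<Sum>j\<in>{1..k}. (R ^^ j) (v (Suc j))))"
  proof -
    have s: "(\<Sum>j\<in>{1..k}. (R ^^ j) (v (Suc j))) \<in> car (H 0)" using bm by (intro H.sum_mem Rpow_mem) auto
    have u: "(R ^^ Suc k) u \<in> car (H 0)" using assms(1) by (rule Rpow_mem)
    show ?thesis
      unfolding Rt H.linop_add[OF R(1) bm(1) H.add_mem[OF u s]] H.linop_add[OF R(1) u s] ..
  qed
  also have "\<dots> = (R ^^ Suc (Suc k)) u + (\<Sum>j\<in>{1..Suc k}. (R ^^ j) (v j))"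
    unfolding sum funpow.simps(2)[of "Suc k"] comp_def by (simp only: add_ac)
  finally have "R (v 1 + R t) = 0" using Suc.prems(3) by simp
  then have z: "v 1 + R t = 0" using R_inj[of "v 1 + R t"] bm t by simp
  have "R (- t) = - R t" using t H.linop_diff[OF R(1), of 0 t] H.linop_0[OF R(1)] by simp
  with eq_neg_iff_add_eq_0[THEN iffD2, OF z] have "v 1 = R (- t)" by simp
  then have b1: "v 1 = 0" using Suc.prems(2)[of 1 "- t"] t by simp
  then have eq: "(R ^^ Suc k) u + (\<Sum>j\<in>{1..k}. (R ^^ j) (v (Suc j))) = 0" using z Rt by simp
  have "\<forall>j\<in>{1..k}. v (Suc j) = 0"
  proof (rule Suc.IH[OF bm(2) _ eq])
    show "v (Suc j) = 0" if "j \<in> {1..k}" "s \<in> car (H 0)" "v (Suc j) = R s" for j s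
      by (rule Suc.prems(2)[OF _ that(2,3)]) (use that(1) in simp)
  qed
  then show ?case using b1 by (metis Suc_le_mono atLeastAtMost_iff le_0_eq not0_implies_Suc not_less_eq_eq One_nat_def)
qed simp

lemma V_W: "u \<in> car (H 0) \<Longrightarrow> W u \<xi> \<in> car (H n0)"
  "u \<in> car (H 0) \<Longrightarrow> V n0 (W u \<xi>) = (R ^^ Suc m) u + (\<Sum>j\<in>{1..m}. (R ^^ j) (ac (\<lambda>\<sigma>. \<xi> (\<sigma>, j))))"
  using V_n0[OF Vi(1)[of u "int m"]] K_mem[of \<xi>] by (auto simp: W_def V_add Vi V_K simp del: funpow.simps)

text \<open>In \<open>H (- m - 2)\<close> the equation is a vanishing combination of powers of
  \<open>R\<close>, whose coefficients \<open>ac\<close> of the columns of \<open>\<xi>\<close> lie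
  in the range of \<open>R\<close> only if they are zero; \<open>Rpow_independent\<close> removes
  them.\<close>

lemma W_inj: assumes u: "u \<in> car (H 0)" and \<xi>: "\<xi> \<in> car C" and W: "W u \<xi> = 0"
  shows "u = 0 \<and> \<xi> = 0"
proof -
  let ?b = "\<lambda>j. ac (\<lambda>\<sigma>. \<xi> (\<sigma>, j))"
  have eq: "(R ^^ Suc m) u + (\<Sum>j\<in>{1..m}. (R ^^ j) (?b j)) = 0" using V_W(2)[OF u, of \<xi>] W by simp
  have col: "(\<lambda>\<sigma>. \<xi> (\<sigma>, j)) \<in> car Cd" for j using \<xi> by (simp add: coord_mem_iff)
  have 0: "(\<lambda>\<sigma>. \<xi> (\<sigma>, j)) = 0" if "?b j = R s" "s \<in> car (H 0)" for j s
    using a_indep[OF col that(2)] that(1) by (simp add: ac_def)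
  have "\<forall>j\<in>{1..m}. ?b j = 0"
  proof (rule Rpow_independent[OF u _ _ eq])
    show "?b j = 0" if "?b j = R s" "s \<in> car (H 0)" for j s
      unfolding 0[OF that] by (simp add: ac_def complex_vector.scale_zero_left)
  qed simp
  note b = this
  have "\<xi> \<alpha> = 0" for \<alpha>
  proof (cases "\<alpha> \<in> S \<times> {1..m}")
    case True
    then obtain \<sigma> j where al: "\<alpha> = (\<sigma>, j)" "j \<in> {1..m}" by auto
    then have "?b j = R 0" using b H.linop_0[OF R(1)] by simp
    then have "(\<lambda>\<sigma>. \<xi> (\<sigma>, j)) = 0" using 0 by simp
    then show ?thesis using al by (simp add: fun_eq_iff)
  qed (use \<xi> in \<open>cases \<alpha>, auto simp: coord_mem_iff\<close>)
  then have "\<xi> = 0" by (simp add: fun_eq_iff)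
  moreover have "(R ^^ Suc m) u = 0" using eq b H.linop_0[OF H.linop_funpow[OF R(1)]] by (simp del: funpow.simps)
  then have "u = 0" using H.inj_funpow[OF R(1) R_inj u] by blast
  ultimately show ?thesis by blast
qed

lemma W_add: "u \<in> car (H 0) \<Longrightarrow> u' \<in> car (H 0) \<Longrightarrow> W (u + u') (\<xi> + \<xi>') = W u \<xi> + W u' \<xi>'"
  by (simp add: W_def Vi_add K_add)

lemma W_scale: "u \<in> car (H 0) \<Longrightarrow> W (r *\<^sub>C u) (r *\<^sub>C \<xi>) = r *\<^sub>C W u \<xi>"
  by (simp add: W_def Vi_scale K_scale scaleC_add_right)

lemma W_eq_iff:
  assumes "u \<in> car (H 0)" "u' \<in> car (H 0)" "\<xi> \<in> car C" "\<xi>' \<in> car C"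
  shows "W u \<xi> = W u' \<xi>' \<longleftrightarrow> u = u' \<and> \<xi> = \<xi>'"
proof
  assume "W u \<xi> = W u' \<xi>'"
  then have "W (u - u') (\<xi> - \<xi>') = 0" using W_add[of "u - u'" u' "\<xi> - \<xi>'" \<xi>'] assms by simp
  then have "u - u' = 0 \<and> \<xi> - \<xi>' = 0" using assms by (intro W_inj) simp_all
  then show "u = u' \<and> \<xi> = \<xi>'" by simp
qed simp

lemma W_H: "f \<in> car (H (int m)) \<Longrightarrow> f + K \<xi> = W (V (int m) f) \<xi>"
  by (simp add: W_def Vi_V)

lemma K_A_eq: "A.K_A = K ` car C"
proof
  show "A.K_A \<subseteq> K ` car C"
    unfolding A.K_A_def
  proof (rule complex_vector.span_minimal)
    show "A.h_vec ` (S \<times> {1..m}) \<subseteq> K ` car C"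
    proof
      fix x assume "x \<in> A.h_vec ` (S \<times> {1..m})"
      then obtain \<alpha> where al: "\<alpha> \<in> S \<times> {1..m}" "x = A.h_vec \<alpha>" by blast
      have "K (unit_vec \<alpha>) = (\<Sum>\<beta>\<in>S \<times> {1..m}. if \<beta> = \<alpha> then A.h_vec \<alpha> else 0)"
        unfolding K_def by (intro sum.cong) (auto simp: unit_vec_def scaleC_one complex_vector.scale_zero_left)
      then have "x = K (unit_vec \<alpha>)" using al finite_SJ by simp
      then show "x \<in> K ` car C" using unit_vec_mem[OF al(1)] by blast
    qed
    show "complex_vector.subspace (K ` car C)"
      unfolding complex_vector.subspace_def
    proof (intro conjI ballI allI)
      show "0 \<in> K ` car C" using K_diff[of 0 0] by (metis C.zero_mem diff_self image_eqI)
      show "x + y \<in> K ` car C" if "x \<in> K ` car C" "y \<in> K ` car C" for x y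
        using that C.add_mem by (auto simp flip: K_add)
      show "r *\<^sub>C x \<in> K ` car C" if "x \<in> K ` car C" for r x
        using that C.scale_mem by (auto simp flip: K_scale)
    qed
  qed
  show "K ` car C \<subseteq> A.K_A"
    unfolding A.K_A_def K_def
    by (intro image_subsetI complex_vector.span_sum complex_vector.span_scale complex_vector.span_base imageI)
qed

lemma K_inj: "\<xi> \<in> car C \<Longrightarrow> \<zeta> \<in> car C \<Longrightarrow> K \<xi> = K \<zeta> \<longleftrightarrow> \<xi> = \<zeta>"
  using W_eq_iff[of 0 0 \<xi> \<zeta>] by (simp add: W_def)

lemma d_coord_K: "\<xi> \<in> car C \<Longrightarrow> A.d_coord (K \<xi>) = \<xi>"
  unfolding A.d_coord_def K_def[symmetric] by (rule the_equality) (auto simp: K_inj)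

section \<open>The descriptions in the model, evaluated in coordinates\<close>

lemma decomp_HA: assumes f: "f \<in> car (H (int m))" and \<xi>: "\<xi> \<in> car C"
  shows "A.decomp_HA (f + K \<xi>) = (f, K \<xi>)"
  unfolding A.decomp_HA_def
proof (rule the_equality)
  show "case (f, K \<xi>) of (f', k) \<Rightarrow> f' \<in> car (H (int m)) \<and> k \<in> A.K_A \<and> f + K \<xi> = f' + k"
    using f \<xi> K_A_eq by auto
  fix p assume "case p of (f', k) \<Rightarrow> f' \<in> car (H (int m)) \<and> k \<in> A.K_A \<and> f + K \<xi> = f' + k"
  then obtain f' \<zeta> where p: "p = (f', K \<zeta>)" "f' \<in> car (H (int m))" "\<zeta> \<in> car C" "f + K \<xi> = f' + K \<zeta>"
    unfolding K_A_eq by auto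
  then have "V (int m) f = V (int m) f' \<and> \<xi> = \<zeta>" using f \<xi> W_eq_iff by (simp add: W_H)
  then show "p = (f, K \<xi>)" using p f V_inj by simp
qed

lemma car_HA: "car A.HA = {W u \<xi> | u \<xi>. u \<in> car (H 0) \<and> \<xi> \<in> car C}"
proof
  show "car A.HA \<subseteq> {W u \<xi> | u \<xi>. u \<in> car (H 0) \<and> \<xi> \<in> car C}"
    unfolding A.HA_def K_A_eq using W_H V_mem by force
  show "{W u \<xi> | u \<xi>. u \<in> car (H 0) \<and> \<xi> \<in> car C} \<subseteq> car A.HA"
    using Vi(1) by (auto simp: A.HA_def K_A_eq W_def)
qed

lemma ip_HA: "u \<in> car (H 0) \<Longrightarrow> u' \<in> car (H 0) \<Longrightarrow> \<xi> \<in> car C \<Longrightarrow> \<xi>' \<in> car C \<Longrightarrow>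
    ip A.HA (W u \<xi>) (W u' \<xi>') = ip (H 0) u u' + ip C \<xi> (mat_app (S \<times> {1..m}) \<G> \<xi>')"
  using V_ip[of "Vi (int m) u" "int m" "Vi (int m) u'"] decomp_HA d_coord_K
  by (simp add: A.HA_def W_def A.form_A_def Vi)

lemma x_decomp:
  assumes f: "f \<in> car (H (int m + 2))"
  shows "f + A.h_top c + K \<xi> = W (R (V (int m + 2) f) + ac c) \<xi>"
proof -
  have "f \<in> car (H (int m))" using f by (rule inclusion_le[rotated]) simp
  then show ?thesis using W_H[of "f + A.h_top c" \<xi>] h_top V_step2[OF f] by (simp add: V_add)
qed

lemma x_unique:
  assumes "s \<in> car (H 0)" "c \<in> car Cd" "\<xi> \<in> car C" "s' \<in> car (H 0)" "c' \<in> car Cd" "\<xi>' \<in> car C"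
    "W (R s + ac c) \<xi> = W (R s' + ac c') \<xi>'"
  shows "s = s' \<and> c = c' \<and> \<xi> = \<xi>'"
proof -
  have e: "R s + ac c = R s' + ac c'" "\<xi> = \<xi>'" using assms W_eq_iff[of "R s + ac c" "R s' + ac c'" \<xi> \<xi>'] by auto
  have "ac (c - c') = ac c - ac c'"
    by (simp add: ac_def complex_vector.scale_left_diff_distrib sum_subtractf)
  also have "\<dots> = R (s' - s)" using e assms by (simp add: H.linop_diff[OF R(1)] algebra_simps)
  finally have "c - c' = 0" using assms by (intro a_indep[of _ "s' - s"]) (auto simp: ac_def)
  then have c: "c = c'" by simp
  then have "R (s - s') = 0" using e assms by (simp add: H.linop_diff[OF R(1)])
  then have "s - s' = 0" using R_inj[of "s - s'"] assms by simp
  then show ?thesis using c e by simp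
qed

lemma decomp_Amax:
  assumes f: "f \<in> car (H (int m + 2))" and c: "c \<in> car Cd" and \<xi>: "\<xi> \<in> car C"
  shows "A.decomp_Amax (f + A.h_top c + K \<xi>) = (f, c, K \<xi>)"
  unfolding A.decomp_Amax_def
proof (rule the_equality)
  show "case (f, c, K \<xi>) of (f', c', k) \<Rightarrow> f' \<in> car (H (int m + 2)) \<and> c' \<in> car Cd \<and> k \<in> A.K_A \<and>
      f + A.h_top c + K \<xi> = f' + A.h_top c' + k"
    using f c \<xi> K_A_eq by auto
  fix p assume "case p of (f', c', k) \<Rightarrow> f' \<in> car (H (int m + 2)) \<and> c' \<in> car Cd \<and> k \<in> A.K_A \<and>
      f + A.h_top c + K \<xi> = f' + A.h_top c' + k"
  then obtain f' c' \<zeta> where p: "p = (f', c', K \<zeta>)" "f' \<in> car (H (int m + 2))" "c' \<in> car Cd" "\<zeta> \<in> car C"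
    "f + A.h_top c + K \<xi> = f' + A.h_top c' + K \<zeta>"
    unfolding K_A_eq by auto
  then have "V (int m + 2) f = V (int m + 2) f' \<and> c = c' \<and> \<xi> = \<zeta>"
    using f c \<xi> unfolding x_decomp[OF f] x_decomp[OF p(2)] by (intro x_unique) auto
  then show "p = (f, c, K \<xi>)" using p f V_inj by simp
qed

lemma pairing: "A.pairing \<sigma> f = ip (H 0) (a \<sigma>) (V (int m + 2) f)"
  using scale_b_half_V[of n0] scale_b_half_V[of "int m + 2"] by (simp add: A.pairing_def a_def)

lemma pairing_vec: "A.pairing_vec f = (\<lambda>\<sigma>. if \<sigma> \<in> S then ip (H 0) (a \<sigma>) (V (int m + 2) f) else 0)"
  by (auto simp: A.pairing_vec_def pairing fun_eq_iff)

lemma Gamma: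
  assumes "f \<in> car (H (int m + 2))" "c \<in> car Cd" "\<xi> \<in> car C"
  shows "A.Gamma0 (f + A.h_top c + K \<xi>) = c"
    "A.Gamma1 (f + A.h_top c + K \<xi>) = A.pairing_vec f - A.block_m (mat_app (S \<times> {1..m}) \<G> \<xi>)"
  using decomp_Amax[OF assms] d_coord_K[OF assms(3)] by (auto simp: A.Gamma0_def A.Gamma1_def)

lemma W_as_decomp: "s \<in> car (H 0) \<Longrightarrow> W (R s + ac c) \<xi> = Vi (int m + 2) s + A.h_top c + K \<xi>"
  by (simp add: x_decomp Vi)

sublocale M: model "H 0" R z1 m S "S \<times> {1..m}" a \<G> W A.HA A.Gamma0 A.Gamma1
proof unfold_locales
  show "A.Gamma0 (W (R s + (\<Sum>\<sigma>\<in>S. c \<sigma> *\<^sub>C a \<sigma>)) \<xi>) = c"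
    "A.Gamma1 (W (R s + (\<Sum>\<sigma>\<in>S. c \<sigma> *\<^sub>C a \<sigma>)) \<xi>)
      = (\<lambda>\<sigma>. if \<sigma> \<in> S then ip (H 0) (a \<sigma>) s else 0) - A.block_m (mat_app (S \<times> {1..m}) \<G> \<xi>)"
    if s: "s \<in> car (H 0)" and c: "c \<in> car Cd" and \<xi>: "\<xi> \<in> car C" for s c \<xi>
    using Gamma[OF Vi(1)[OF s] c \<xi>] unfolding ac_def[symmetric] W_as_decomp[OF s] pairing_vec Vi(2)[OF s] by auto
qed (fact R_bounded R(2) R_inj m S a_mem a_indep G_inv G_herm G_comm W_inj car_HA ip_HA refl |
    (rule W_add W_scale, assumption+))+

subsection \<open>The operators of the A-model\<close>

lemma L_Lrel: "L = M.Lrel"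
  unfolding M.Lrel_def by (rule L_eq)

lemma resolvent_L_iff: "(t, u) \<in> resolvent L z \<longleftrightarrow> (\<exists>s\<in>car (H 0). t = M.D z s \<and> u = R s)"
  using M.resolvent_Lrel_iff L_Lrel by simp

text \<open>For \<open>f\<close> in \<open>H (m + 2)\<close> and \<open>s = V (m + 2) f\<close>, the
  vector \<open>L f\<close> in \<open>H m\<close> has the coordinate \<open>s + z1 R s\<close>; with
  this, both operators are the same set of pairs.\<close>

lemma A_max_eq: "A.A_max = M.A_max"
proof -
  have app: "rel_app (scale_op H L (int m)) f = Vi (int m) (V (int m + 2) f + of_real z1 *\<^sub>C R (V (int m + 2) f))"
    if f: "f \<in> car (H (int m + 2))" for f
    unfolding rel_app_def
  proof (rule the_equality)
    have fm: "f \<in> car (H (int m))" using f by (rule inclusion_le[rotated]) simp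
    show "(f, Vi (int m) (V (int m + 2) f + of_real z1 *\<^sub>C R (V (int m + 2) f))) \<in> scale_op H L (int m)"
      unfolding scale_op_iff L_iff using f fm V_step2[OF f] by (auto simp: Vi)
    fix y assume "(f, y) \<in> scale_op H L (int m)"
    then obtain s where s: "y \<in> car (H (int m))" "s \<in> car (H 0)" "V (int m) f = R s" "V (int m) y = s + of_real z1 *\<^sub>C R s"
      unfolding scale_op_iff L_iff by blast
    then have "V (int m + 2) f = s" using mem_step2[OF fm s(2,3)] by blast
    then show "y = Vi (int m) (V (int m + 2) f + of_real z1 *\<^sub>C R (V (int m + 2) f))"
      using s Vi_V[OF s(1)] by simp
  qed
  have y: "rel_app (scale_op H L (int m)) f + of_real z1 *\<^sub>C A.h_top c + K \<zeta>
      = W (s + of_real z1 *\<^sub>C (R s + ac c)) \<zeta>"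
    if "f \<in> car (H (int m + 2))" "s = V (int m + 2) f" for f c s \<zeta>
    using that by (simp add: app W_def h_top_Vi scaleC_add_right Vi_add Vi_scale add.assoc)
  have ac: "M.ac c = ac c" for c by (simp add: M.ac_def ac_def)
  have coord: "(\<exists>k'\<in>A.K_A. A.d_coord k' = \<zeta> \<and> P k') \<longleftrightarrow> P (K \<zeta>)" if "\<zeta> \<in> car C" for \<zeta> P
    unfolding K_A_eq using that by (auto simp: d_coord_K)
  show ?thesis
  proof (intro set_eqI iffI)
    fix p assume "p \<in> A.A_max"
    then obtain f c k k' where f: "f \<in> car (H (int m + 2))" "c \<in> car Cd" "k \<in> A.K_A" "k' \<in> A.K_A"
      "A.d_coord k' = mat_app (S \<times> {1..m}) A.M_d (A.d_coord k) + A.eta c"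
      "p = (f + A.h_top c + k, rel_app (scale_op H L (int m)) f + of_real z1 *\<^sub>C A.h_top c + k')"
      unfolding A.A_max_def by blast
    then obtain \<xi> \<zeta> where k: "\<xi> \<in> car C" "k = K \<xi>" "\<zeta> \<in> car C" "k' = K \<zeta>" unfolding K_A_eq by blast
    then have z: "\<zeta> = mat_app (S \<times> {1..m}) A.M_d \<xi> + A.eta c" using f(5) by (simp add: d_coord_K)
    have "p = (M.x_of (V (int m + 2) f) c \<xi>, M.y_of (V (int m + 2) f) c \<xi>)"
      unfolding f(6) k(2,4) M.x_of_def M.y_of_def ac x_decomp[OF f(1)] y[OF f(1) refl] z ..
    then show "p \<in> M.A_max" using f k by simp
  next
    fix p assume "p \<in> M.A_max"
    then obtain s c \<xi> where s: "s \<in> car (H 0)" "c \<in> car Cd" "\<xi> \<in> car C" "p = (M.x_of s c \<xi>, M.y_of s c \<xi>)"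
      unfolding M.A_max_def by blast
    define \<zeta> where "\<zeta> = mat_app (S \<times> {1..m}) A.M_d \<xi> + A.eta c"
    have z: "\<zeta> \<in> car C" unfolding \<zeta>_def by (intro C.add_mem mat_app_mem M.\<eta>_mem s)
    have f: "Vi (int m + 2) s \<in> car (H (int m + 2))" "s = V (int m + 2) (Vi (int m + 2) s)" using Vi s by auto
    have "p = (Vi (int m + 2) s + A.h_top c + K \<xi>,
        rel_app (scale_op H L (int m)) (Vi (int m + 2) s) + of_real z1 *\<^sub>C A.h_top c + K \<zeta>)"
      unfolding s(4) M.x_of_def M.y_of_def ac y[OF f] W_as_decomp[OF s(1)] \<zeta>_def ..
    moreover have "A.d_coord (K \<zeta>) = mat_app (S \<times> {1..m}) A.M_d (A.d_coord (K \<xi>)) + A.eta c"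
      using z s by (simp add: d_coord_K \<zeta>_def)
    ultimately show "p \<in> A.A_max" unfolding A.A_max_def K_A_eq using f(1) s z by blast
  qed
qed

lemma A_min_eq: "A.A_min = M.A_min" and A_ext_eq: "A.A_ext = M.A_ext"
  by (auto simp: A.A_min_def M.A_min_def A.A_ext_def M.A_ext_def A_max_eq fun_eq_iff)

lemma U_A_iff: "(x, (f, \<xi>)) \<in> A.U_A \<longleftrightarrow> f \<in> car (H (int m)) \<and> \<xi> \<in> car C \<and> x = W (V (int m) f) \<xi>"
proof
  assume "(x, (f, \<xi>)) \<in> A.U_A"
  then show "f \<in> car (H (int m)) \<and> \<xi> \<in> car C \<and> x = W (V (int m) f) \<xi>"
    unfolding A.U_A_def K_A_eq by (auto simp: d_coord_K W_H)
next
  assume "f \<in> car (H (int m)) \<and> \<xi> \<in> car C \<and> x = W (V (int m) f) \<xi>"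
  then have x: "f \<in> car (H (int m))" "\<xi> \<in> car C" "x = f + K \<xi>" by (auto simp: W_H)
  then show "(x, (f, \<xi>)) \<in> A.U_A"
    unfolding A.U_A_def K_A_eq by (intro CollectI exI[of _ f] exI[of _ "K \<xi>"]) (simp add: d_coord_K)
qed

text \<open>\<open>U_A\<close> is isometric and onto. Testing with either coordinate equal to zero
  separates the two components, and invertibility of \<open>\<G>\<close> cancels it in the second
  one.\<close>

lemma adjoint_U_A: "adjoint_relation A.HA A.HA' A.U_A = A.U_A\<inverse>"
proof (intro set_eqI, clarify)
  fix f \<zeta> x
  show "((f, \<zeta>), x) \<in> adjoint_relation A.HA A.HA' A.U_A \<longleftrightarrow> ((f, \<zeta>), x) \<in> A.U_A\<inverse>"
  proof
    assume adj: "((f, \<zeta>), x) \<in> adjoint_relation A.HA A.HA' A.U_A"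
    then have f: "f \<in> car (H (int m))" "\<zeta> \<in> car C" "x \<in> car A.HA"
      by (auto simp: adjoint_relation_def A.HA'_def)
    obtain p \<theta> where p: "p \<in> car (H 0)" "\<theta> \<in> car C" "x = W p \<theta>" using f(3) unfolding car_HA by blast
    have key: "ip (H 0) u (V (int m) f) + ip C \<xi> (M.G \<zeta>) = ip (H 0) u p + ip C \<xi> (M.G \<theta>)"
      if u: "u \<in> car (H 0)" "\<xi> \<in> car C" for u \<xi>
    proof -
      have "(W u \<xi>, (Vi (int m) u, \<xi>)) \<in> A.U_A" unfolding U_A_iff using u by (simp add: Vi)
      then have "ip A.HA' (Vi (int m) u, \<xi>) (f, \<zeta>) = ip A.HA (W u \<xi>) x"
        using adj unfolding adjoint_relation_def by blast
      then show ?thesis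
        using u p f V_ip[of "Vi (int m) u" "int m" f] by (simp add: A.HA'_def A.form_A_def ip_HA Vi)
    qed
    have "V (int m) f = p"
      by (rule H.ip_eqI[of _ 0]) (use key[of _ 0] f p in auto)
    moreover have "M.G \<zeta> = M.G \<theta>"
      by (rule C.ip_eqI) (use key[of 0] f p in auto)
    then have "\<zeta> = \<theta>" using M.Gi_G f p by metis
    ultimately show "((f, \<zeta>), x) \<in> A.U_A\<inverse>" using f p by (simp add: U_A_iff)
  next
    assume "((f, \<zeta>), x) \<in> A.U_A\<inverse>"
    then have f: "f \<in> car (H (int m))" "\<zeta> \<in> car C" "x = W (V (int m) f) \<zeta>" by (auto simp: U_A_iff)
    have "ip A.HA' (g, \<xi>) (f, \<zeta>) = ip A.HA y x" if "(y, (g, \<xi>)) \<in> A.U_A" for y g \<xi>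
      using that f V_ip[of g "int m" f] unfolding U_A_iff by (auto simp: A.HA'_def A.form_A_def ip_HA)
    moreover have "x \<in> car A.HA" using f V_mem unfolding car_HA by blast
    ultimately show "((f, \<zeta>), x) \<in> adjoint_relation A.HA A.HA' A.U_A"
      using f by (auto simp: adjoint_relation_def A.HA'_def)
  qed
qed

text \<open>Both sides are swept out by the parameters \<open>(s, \<xi>)\<close>, the argument
  having the coordinates \<open>(D z s, N z \<xi>)\<close> and the value
  \<open>(R s, \<xi>)\<close>.\<close>

lemma resolvent_A0:
  "resolvent M.A0 z = A.U_A O rel_dsum (resolvent (scale_op H L (int m)) z) (resolvent (mat_rel (S \<times> {1..m}) A.M_d) z)
    O adjoint_relation A.HA A.HA' A.U_A"
proof (intro set_eqI, clarify)
  fix y x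
  have "(y, x) \<in> A.U_A O rel_dsum (resolvent (scale_op H L (int m)) z) (resolvent (mat_rel (S \<times> {1..m}) A.M_d) z)
      O adjoint_relation A.HA A.HA' A.U_A \<longleftrightarrow>
      (\<exists>f \<theta> f' \<theta>'. (y, (f, \<theta>)) \<in> A.U_A \<and> (f, f') \<in> resolvent (scale_op H L (int m)) z \<and>
        (\<theta>, \<theta>') \<in> resolvent (mat_rel (S \<times> {1..m}) A.M_d) z \<and> (x, (f', \<theta>')) \<in> A.U_A)"
    unfolding adjoint_U_A rel_dsum_def by blast
  also have "\<dots> \<longleftrightarrow> (\<exists>s \<xi>. s \<in> car (H 0) \<and> \<xi> \<in> car C \<and> y = W (M.D z s) (M.N z \<xi>) \<and> x = M.x_of s 0 \<xi>)"
    (is "?l \<longleftrightarrow> ?r")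
  proof
    assume ?l
    then obtain f \<theta> f' \<theta>' where l: "(y, (f, \<theta>)) \<in> A.U_A" "(f, f') \<in> resolvent (scale_op H L (int m)) z"
      "(\<theta>, \<theta>') \<in> resolvent (mat_rel (S \<times> {1..m}) A.M_d) z" "(x, (f', \<theta>')) \<in> A.U_A" by blast
    obtain s where s: "s \<in> car (H 0)" "V (int m) f = M.D z s" "V (int m) f' = R s"
      using l(2) unfolding resolvent_scale_op_iff resolvent_L_iff by blast
    have "\<theta>' \<in> car C" "\<theta> = M.N z \<theta>'" using l(3) unfolding M.resolvent_mat_rel_iff by auto
    then show ?r using l(1,4) s unfolding U_A_iff by (intro exI[of _ s] exI[of _ \<theta>']) (simp add: M.x_of_0)
  next
    assume ?r
    then obtain s \<xi> where s: "s \<in> car (H 0)" "\<xi> \<in> car C" "y = W (M.D z s) (M.N z \<xi>)" "x = M.x_of s 0 \<xi>" by blast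
    have "(M.D z s, R s) \<in> resolvent L z" unfolding resolvent_L_iff using s by blast
    then have "(Vi (int m) (M.D z s), Vi (int m) (R s)) \<in> resolvent (scale_op H L (int m)) z"
      unfolding resolvent_scale_op_iff using s by (simp add: Vi)
    moreover have "(M.N z \<xi>, \<xi>) \<in> resolvent (mat_rel (S \<times> {1..m}) A.M_d) z"
      unfolding M.resolvent_mat_rel_iff using s by simp
    moreover have "(y, (Vi (int m) (M.D z s), M.N z \<xi>)) \<in> A.U_A" unfolding U_A_iff using s by (simp add: Vi)
    moreover have "(x, (Vi (int m) (R s), \<xi>)) \<in> A.U_A" unfolding U_A_iff using s by (simp add: Vi M.x_of_0)
    ultimately show ?l by blast
  qed
  also have "\<dots> \<longleftrightarrow> (y, x) \<in> resolvent M.A0 z" unfolding M.resolvent_A0_iff ..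
  finally show "(y, x) \<in> resolvent M.A0 z \<longleftrightarrow> (y, x) \<in> A.U_A O rel_dsum (resolvent (scale_op H L (int m)) z)
      (resolvent (mat_rel (S \<times> {1..m}) A.M_d) z) O adjoint_relation A.HA A.HA' A.U_A" ..
qed

text \<open>Iterating the resolvent identity \<open>(L - z)\<inverse> = R + w R (L - z)\<inverse>\<close> with \<open>w = z - z\<^sub>1\<close>; here \<open>B = (L - z\<^sub>1) (L - z)\<inverse>\<close>.\<close>

lemma iterated_resolvent_identity:
  assumes y: "y \<in> car (H 0)" "x \<in> car (H 0)" "y = x + w *\<^sub>C R y" and w: "w \<noteq> 0"
  shows "(1 / w ^ k) *\<^sub>C R y = (R ^^ Suc k) y + (\<Sum>j\<in>{1..k}. (1 / w ^ (k - j + 1)) *\<^sub>C (R ^^ j) x)"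
proof (induction k)
  case 0
  show ?case by (simp add: scaleC_one)
next
  case (Suc k)
  have "(1 / w ^ Suc k) *\<^sub>C R y = (1 / w) *\<^sub>C ((1 / w ^ k) *\<^sub>C R y)" by (simp add: scaleC_scaleC)
  also have "\<dots> = (1 / w) *\<^sub>C (R ^^ Suc k) y + (\<Sum>j\<in>{1..k}. (1 / w ^ (Suc k - j + 1)) *\<^sub>C (R ^^ j) x)"
    unfolding Suc scaleC_add_right complex_vector.scale_sum_right scaleC_scaleC
    by (intro arg_cong2[where f = "(+)"] refl sum.cong) (simp add: Suc_diff_le)
  also have "(R ^^ Suc k) y = (R ^^ Suc k) x + w *\<^sub>C (R ^^ Suc k) (R y)"
    by (subst (1) y(3)) (simp only: Rpow_add[OF y(2) H.scale_mem[OF R_mem[OF y(1)]]] Rpow_scale[OF R_mem[OF y(1)]])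
  also have "(1 / w) *\<^sub>C ((R ^^ Suc k) x + w *\<^sub>C (R ^^ Suc k) (R y)) = (1 / w) *\<^sub>C (R ^^ Suc k) x + (R ^^ Suc (Suc k)) y"
    using w by (simp add: scaleC_add_right scaleC_scaleC scaleC_one funpow_swap1)
  finally show ?case by (simp add: add_ac)
qed

section \<open>Gamma field and Weyl function of the model\<close>

lemma g_vec:
  assumes B: "M.inv_at z B" and \<sigma>: "\<sigma> \<in> S"
  shows "A.g_vec \<sigma> z \<in> car (H n0)" "V n0 (A.g_vec \<sigma> z) = R (B (a \<sigma>))"
proof -
  have "resolvent L z = H.gr 0 (\<lambda>t. R (B t))" using M.resolvent_Lrel[OF B] L_Lrel by simp
  then have "A.g_vec \<sigma> z = Vi n0 (R (B (a \<sigma>)))"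
    unfolding A.g_vec_def a_def using M.inv_atD(2)[OF B] by (intro rel_app_resolvent \<phi> \<sigma>) auto
  then show "A.g_vec \<sigma> z \<in> car (H n0)" "V n0 (A.g_vec \<sigma> z) = R (B (a \<sigma>))"
    using Vi[of "R (B (a \<sigma>))" n0] M.inv_atD(2)[OF B] \<sigma> by auto
qed

text \<open>The iterated resolvent identity with \<open>k = m\<close> splits the image of
  \<open>F_vec\<close> into a part from \<open>H m\<close> and a part from \<open>K_A\<close>. Their
  coordinates are \<open>B (ac c)\<close> and \<open>\<xi>c\<close>, those of the kernel vector, and
  \<open>V n0\<close> is injective.\<close>

lemma gvec_eq:
  assumes B: "M.inv_at z B" and z: "z \<noteq> of_real z1" and c: "c \<in> car Cd"
  shows "M.gvec z B c = (\<Sum>\<sigma>\<in>S. c \<sigma> *\<^sub>C A.F_vec \<sigma> z)"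
proof -
  define w where "w = z - of_real z1"
  have w: "w \<noteq> 0" using z by (simp add: w_def)
  have Bm: "B t \<in> car (H 0)" if "t \<in> car (H 0)" for t using M.inv_atD(2)[OF B that] .
  have ac: "M.ac c = ac c" by (simp add: M.ac_def ac_def)
  have Bac: "B (ac c) = (\<Sum>\<sigma>\<in>S. c \<sigma> *\<^sub>C B (a \<sigma>))"
    unfolding ac_def by (subst H.linop_sum[OF M.inv_atD(1)[OF B]]) (auto simp: H.linop_scale[OF M.inv_atD(1)[OF B]])
  \<comment> \<open>By \<open>B = 1 + w R B\<close> the regular and the singular part of the kernel
    vector add up to \<open>B (ac c)\<close>.\<close>
  have u: "R (w *\<^sub>C B (ac c)) + ac c = B (ac c)"
    using M.B_eq[OF B ac_mem, of c] by (simp add: w_def H.linop_scale[OF R(1)] Bm add.commute)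
  have g: "M.gvec z B c = W (B (ac c)) (M.\<xi>c z c)"
    unfolding M.gvec_def M.x_of_def ac w_def[symmetric] u ..
  have mF: "A.F_vec \<sigma> z \<in> car (H n0)" if "\<sigma> \<in> S" for \<sigma>
    unfolding A.F_vec_def using g_vec[OF B that] by simp
  have "V n0 (\<Sum>\<sigma>\<in>S. c \<sigma> *\<^sub>C A.F_vec \<sigma> z) = (\<Sum>\<sigma>\<in>S. c \<sigma> *\<^sub>C (1 / w ^ m) *\<^sub>C R (B (a \<sigma>)))"
    using mF g_vec[OF B] by (subst V_sum) (auto simp: V_scale A.F_vec_def w_def)
  also have "\<dots> = (\<Sum>\<sigma>\<in>S. c \<sigma> *\<^sub>C ((R ^^ Suc m) (B (a \<sigma>)) + (\<Sum>j\<in>{1..m}. (1 / w ^ (m - j + 1)) *\<^sub>C (R ^^ j) (a \<sigma>))))"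
  proof (intro sum.cong refl)
    fix \<sigma> assume \<sigma>: "\<sigma> \<in> S"
    have "B (a \<sigma>) = a \<sigma> + w *\<^sub>C R (B (a \<sigma>))" using M.B_eq[OF B a_mem[OF \<sigma>]] by (simp add: w_def)
    from iterated_resolvent_identity[OF Bm[OF a_mem[OF \<sigma>]] a_mem[OF \<sigma>] this w, of m]
    show "c \<sigma> *\<^sub>C (1 / w ^ m) *\<^sub>C R (B (a \<sigma>)) =
        c \<sigma> *\<^sub>C ((R ^^ Suc m) (B (a \<sigma>)) + (\<Sum>j\<in>{1..m}. (1 / w ^ (m - j + 1)) *\<^sub>C (R ^^ j) (a \<sigma>)))" by simp
  qed
  also have "\<dots> = (\<Sum>\<sigma>\<in>S. c \<sigma> *\<^sub>C (R ^^ Suc m) (B (a \<sigma>)))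
      + (\<Sum>\<sigma>\<in>S. \<Sum>j\<in>{1..m}. (c \<sigma> / w ^ (m - j + 1)) *\<^sub>C (R ^^ j) (a \<sigma>))"
    by (simp add: scaleC_add_right sum.distrib complex_vector.scale_sum_right scaleC_scaleC del: funpow.simps)
  also have "(\<Sum>\<sigma>\<in>S. c \<sigma> *\<^sub>C (R ^^ Suc m) (B (a \<sigma>))) = (R ^^ Suc m) (B (ac c))"
    unfolding Bac by (subst Rpow_sum) (auto simp: Rpow_scale Bm simp del: funpow.simps)
  also have "(\<Sum>\<sigma>\<in>S. \<Sum>j\<in>{1..m}. (c \<sigma> / w ^ (m - j + 1)) *\<^sub>C (R ^^ j) (a \<sigma>))
      = (\<Sum>j\<in>{1..m}. \<Sum>\<sigma>\<in>S. (c \<sigma> / w ^ (m - j + 1)) *\<^sub>C (R ^^ j) (a \<sigma>))" by (rule sum.swap)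
  also have "\<dots> = (\<Sum>j\<in>{1..m}. (R ^^ j) (ac (\<lambda>\<sigma>. M.\<xi>c z c (\<sigma>, j))))"
  proof (intro sum.cong refl)
    fix j assume j: "j \<in> {1..m}"
    have "ac (\<lambda>\<sigma>. M.\<xi>c z c (\<sigma>, j)) = (\<Sum>\<sigma>\<in>S. (c \<sigma> / w ^ (m - j + 1)) *\<^sub>C a \<sigma>)"
      unfolding ac_def M.\<xi>c_def w_def using j by (intro sum.cong) auto
    then show "(\<Sum>\<sigma>\<in>S. (c \<sigma> / w ^ (m - j + 1)) *\<^sub>C (R ^^ j) (a \<sigma>)) = (R ^^ j) (ac (\<lambda>\<sigma>. M.\<xi>c z c (\<sigma>, j)))"
      by (simp only:) (subst Rpow_sum, auto simp: Rpow_scale)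
  qed
  also have "(R ^^ Suc m) (B (ac c)) + \<dots> = V n0 (M.gvec z B c)"
    unfolding g by (rule V_W(2)[symmetric]) (simp add: Bm)
  finally have "V n0 (\<Sum>\<sigma>\<in>S. c \<sigma> *\<^sub>C A.F_vec \<sigma> z) = V n0 (M.gvec z B c)" .
  moreover have "M.gvec z B c \<in> car (H n0)" unfolding g by (rule V_W(1)) (simp add: Bm)
  moreover have "(\<Sum>\<sigma>\<in>S. c \<sigma> *\<^sub>C A.F_vec \<sigma> z) \<in> car (H n0)" by (intro H.sum_mem H.scale_mem mF)
  ultimately show ?thesis using V_inj by metis
qed

text \<open>The resolvent of \<open>h_vec (\<sigma>', m + 1)\<close> has the coordinate
  \<open>R (B (a \<sigma>'))\<close> in \<open>H m\<close>. It thus lies in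
  \<open>H (m + 2)\<close>, with coordinate \<open>B (a \<sigma>')\<close>, and may be paired with
  the functional.\<close>

lemma q_mat:
  assumes B: "M.inv_at z B" and s: "\<sigma>' \<in> S"
  shows "A.q_mat z \<sigma> \<sigma>' = (z - of_real z1) * ip (H 0) (a \<sigma>) (B (a \<sigma>'))"
proof -
  let ?h = "A.h_vec (\<sigma>', m + 1)"
  have Ba: "B (a \<sigma>') \<in> car (H 0)" using M.inv_atD(2)[OF B] s by simp
  have "resolvent L z = H.gr 0 (\<lambda>t. R (B t))" using M.resolvent_Lrel[OF B] L_Lrel by simp
  then have "rel_app (resolvent (scale_op H L (int m)) z) ?h = Vi (int m) (R (B (V (int m) ?h)))"
    using M.inv_atD(2)[OF B] by (intro rel_app_resolvent h_vec_top s) auto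
  then have y: "rel_app (resolvent (scale_op H L (int m)) z) ?h = Vi (int m) (R (B (a \<sigma>')))"
    unfolding h_vec_top(2)[OF s] .
  have "V (int m + 2) (Vi (int m) (R (B (a \<sigma>')))) = B (a \<sigma>')"
    using mem_step2[of "Vi (int m) (R (B (a \<sigma>')))" "int m" "B (a \<sigma>')"] Ba by (simp add: Vi)
  then show ?thesis by (simp add: A.q_mat_def pairing y)
qed

lemma weyl_function_eq:
  assumes B: "M.inv_at z B" and z: "z \<noteq> of_real z1"
  shows "weyl_function M.A_max A.Gamma0 A.Gamma1 z = mat_rel S (A.q_mat z + A.r_mat z)"
  unfolding M.weyl_function_mat[OF B z] mat_rel_def
  by (intro Collect_cong ex_cong1 conj_cong refl arg_cong2[where f = "(=)"] arg_cong2[where f = Pair] mat_app_cong)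
    (auto simp: mat_eq_on_def q_mat[OF B] A.r_mat_def)

lemma kernel_eq:
  assumes B: "M.inv_at z B" and z: "z \<noteq> of_real z1"
  shows "gamma_field M.A_max A.Gamma0 z `` car Cd = {x. (x, z *\<^sub>C x) \<in> M.A_max}"
    "{x. (x, z *\<^sub>C x) \<in> M.A_max} = {(\<Sum>\<sigma>\<in>S. c \<sigma> *\<^sub>C A.F_vec \<sigma> z) | c. True}"
proof -
  show "gamma_field M.A_max A.Gamma0 z `` car Cd = {x. (x, z *\<^sub>C x) \<in> M.A_max}"
    unfolding M.kernel_iff[OF B z] Image_def M.gamma_field_iff[OF B z] by blast
  show "{x. (x, z *\<^sub>C x) \<in> M.A_max} = {(\<Sum>\<sigma>\<in>S. c \<sigma> *\<^sub>C A.F_vec \<sigma> z) | c. True}"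
  proof (intro set_eqI iffI)
    fix x assume "x \<in> {x. (x, z *\<^sub>C x) \<in> M.A_max}"
    then show "x \<in> {(\<Sum>\<sigma>\<in>S. c \<sigma> *\<^sub>C A.F_vec \<sigma> z) | c. True}"
      using gvec_eq[OF B z] unfolding M.kernel_iff[OF B z] by blast
  next
    fix x assume "x \<in> {(\<Sum>\<sigma>\<in>S. c \<sigma> *\<^sub>C A.F_vec \<sigma> z) | c. True}"
    then obtain c where x: "x = (\<Sum>\<sigma>\<in>S. c \<sigma> *\<^sub>C A.F_vec \<sigma> z)" by blast
    \<comment> \<open>The coefficients on the right are arbitrary functions; cutting them off
      outside \<open>S\<close> leaves the sum unchanged and gives an element of
      \<open>Cd\<close>.\<close>
    define d where "d = (\<lambda>\<sigma>. if \<sigma> \<in> S then c \<sigma> else 0)"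
    have d: "d \<in> car Cd" by (simp add: d_def coord_mem_iff)
    have "x = (\<Sum>\<sigma>\<in>S. d \<sigma> *\<^sub>C A.F_vec \<sigma> z)" unfolding x d_def by (intro sum.cong) auto
    then show "x \<in> {x. (x, z *\<^sub>C x) \<in> M.A_max}"
      using gvec_eq[OF B z d] d unfolding mem_Collect_eq M.kernel_iff[OF B z] by metis
  qed
qed

lemma A_ext_extends:
  assumes "linear_relation Cd Cd \<Theta>"
  shows "M.A_min \<subseteq> M.A_ext \<Theta>" "M.A_ext \<Theta> \<subseteq> M.A_max"
proof -
  have "(0, 0) \<in> \<Theta>" using assms subspace_rel_0 by (auto simp: linear_relation_def)
  then show "M.A_min \<subseteq> M.A_ext \<Theta>" by (auto simp: M.A_min_def M.A_ext_def)
  show "M.A_ext \<Theta> \<subseteq> M.A_max" by (auto simp: M.A_ext_def)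
qed

end

theorem theorem3p2:
  fixes H :: "int \<Rightarrow> 'v::complex_vector ipspace"
    and L :: "'v rel"
    and z1 :: real
    and m :: nat
    and S :: "'s set"
    and \<phi> :: "'s \<Rightarrow> 'v"
    and \<G> :: "('s \<times> nat) \<Rightarrow> ('s \<times> nat) \<Rightarrow> complex"
  assumes scale: "hilbert_scale H L z1"
    and m: "1 \<le> m"
    and S: "finite S" "S \<noteq> {}"
    and phi: "\<forall>\<sigma>\<in>S. \<phi> \<sigma> \<in> car (H (- int m - 2)) - car (H (- int m - 1))"
    and indep: "\<forall>c\<in>car (coord_space S).
      (\<Sum>\<sigma>\<in>S. c \<sigma> *\<^sub>C \<phi> \<sigma>) \<in> car (H (- int m - 1)) \<longrightarrow> c = 0"
    and G_inv: "mat_invertible (S \<times> {1..m}) \<G>"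
    and G_herm: "mat_eq_on (S \<times> {1..m}) (mat_adjoint \<G>) \<G>"
    and G_comm: "mat_eq_on (S \<times> {1..m})
      (mat_prod (S \<times> {1..m}) \<G> (A_model.M_d z1 m))
      (mat_prod (S \<times> {1..m}) (mat_adjoint (A_model.M_d z1 m)) \<G>)"
  shows
    "let Cd = coord_space S;
         SJ = S \<times> {1..m};
         HA = A_model.HA H L z1 m S \<phi> \<G>;
         HA' = A_model.HA' H m S \<G>;
         U = A_model.U_A H L z1 m S \<phi>;
         K = A_model.K_A H L z1 m S \<phi>;
         d = A_model.d_coord H L z1 m S \<phi>;
         h_top = A_model.h_top H L z1 m S \<phi>;
         M_d = A_model.M_d z1 m;
         A_max = A_model.A_max H L z1 m S \<phi>;
         \<Gamma>0 = A_model.Gamma0 H L z1 m S \<phi>;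
         \<Gamma>1 = A_model.Gamma1 H L z1 m S \<phi> \<G>;
         A_min = A_model.A_min H L z1 m S \<phi> \<G>;
         A_ext = A_model.A_ext H L z1 m S \<phi> \<G>;
         A_0 = A_ext ({0} \<times> car Cd);
         \<gamma> = gamma_field (adjoint_relation HA HA A_min) \<Gamma>0;
         M = weyl_function (adjoint_relation HA HA A_min) \<Gamma>0 \<Gamma>1;
         F = A_model.F_vec H L z1 m \<phi>;
         q = A_model.q_mat H L z1 m \<phi>;
         r = A_model.r_mat z1 m \<G>
     in
       (\<forall>f\<in>car (H (int m + 2)). \<forall>c\<in>car Cd. \<forall>k\<in>K.
          \<Gamma>0 (f + h_top c + k) = c \<and>
          \<Gamma>1 (f + h_top c + k) =
            A_model.pairing_vec H L z1 m S \<phi> f - A_model.block_m m (mat_app SJ \<G> (d k))) \<and>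

       (densely_defined HA A_min \<and> closed_relation HA HA A_min \<and> symmetric_operator HA A_min \<and>
        adjoint_relation HA HA A_min = A_max \<and>
        boundary_triple HA A_min Cd \<Gamma>0 \<Gamma>1) \<and>

       selfadjoint_operator HA A_0 \<and> A_min \<subseteq> A_0 \<and>
       (\<forall>\<Theta>. linear_relation Cd Cd \<Theta> \<longrightarrow>
          A_min \<subseteq> A_ext \<Theta> \<and> A_ext \<Theta> \<subseteq> adjoint_relation HA HA A_min \<and>
          (\<forall>z \<in> resolvent_set HA A_0 \<inter> resolvent_set HA (A_ext \<Theta>).
             resolvent (A_ext \<Theta>) z =
               rel_plus (resolvent A_0 z)
                 (adjoint_relation Cd HA (\<gamma> (cnj z)) O (rel_minus \<Theta> (M z))\<inverse> O \<gamma> z))) \<and>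

       (resolvent_set HA A_0 = resolvent_set (H 0) L - {of_real z1} \<and>
        (\<forall>z \<in> resolvent_set HA A_0.
           resolvent A_0 z =
             U O rel_dsum (resolvent (scale_op H L (int m)) z) (resolvent (mat_rel SJ M_d) z)
               O adjoint_relation HA HA' U)) \<and>

       (\<forall>z \<in> resolvent_set HA A_0.
          \<gamma> z `` car Cd = {x. (x, z *\<^sub>C x) \<in> A_max} \<and>
          {x. (x, z *\<^sub>C x) \<in> A_max} = {(\<Sum>\<sigma>\<in>S. c \<sigma> *\<^sub>C F \<sigma> z) | c. True} \<and>
          M z = mat_rel S (q z + r z))"
proof -
  interpret H0: hilbert "H 0" using scale by (intro hilbertI) (simp add: hilbert_scale_def)
  have L: "selfadjoint_operator (H 0) L" "lower_semibounded (H 0) L"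
    "ereal z1 < (INF z\<in>spectrum_set (H 0) L. ereal (Re z))"
    using scale by (simp_all add: hilbert_scale_def)
  obtain P R where PR: "H0.pos_op P" "H0.linop R" "H0.symm_op R" "\<And>x. x \<in> car (H 0) \<Longrightarrow> P (P x) = R x"
    "\<And>x. x \<in> car (H 0) \<Longrightarrow> R x = 0 \<Longrightarrow> x = 0" "L = {(R s, s + of_real z1 *\<^sub>C R s) | s. s \<in> car (H 0)}"
    "\<And>n. b_half (H 0) L z1 n = (if 0 \<le> n then (H0.gr (P ^^ nat n))\<inverse> else H0.gr (P ^^ nat (- n)))"
    by (rule H0.b_half_representation[OF L]) blast
  interpret A_model_scale H L z1 P R m S \<phi> \<G>
  proof unfold_locales
    show "\<phi> \<sigma> \<in> car (H (- int m - 2))" if "\<sigma> \<in> S" for \<sigma> using phi that by blast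
    show "c = 0" if "c \<in> car (coord_space S)" "(\<Sum>\<sigma>\<in>S. c \<sigma> *\<^sub>C \<phi> \<sigma>) \<in> car (H (- int m - 1))" for c
      using indep that by blast
  qed (fact scale PR m S G_inv G_herm G_comm)+
  have Gam: "A.Gamma0 (f + A.h_top c + k) = c"
    "A.Gamma1 (f + A.h_top c + k) = A.pairing_vec f - A.block_m (mat_app (S \<times> {1..m}) \<G> (A.d_coord k))"
    if f: "f \<in> car (H (int m + 2))" "c \<in> car Cd" "k \<in> A.K_A" for f c k
  proof -
    obtain \<xi> where "\<xi> \<in> car C" "k = K \<xi>" using f(3) unfolding K_A_eq by blast
    then show "A.Gamma0 (f + A.h_top c + k) = c"
      "A.Gamma1 (f + A.h_top c + k) = A.pairing_vec f - A.block_m (mat_app (S \<times> {1..m}) \<G> (A.d_coord k))"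
      using Gamma[OF f(1,2)] by (simp_all add: d_coord_K)
  qed
  have res: "resolvent_set A.HA M.A0 = resolvent_set (H 0) L - {of_real z1}"
    using M.resolvent_set_A0 L_Lrel by simp
  have inv: "\<exists>B. M.inv_at z B \<and> z \<noteq> of_real z1" if "z \<in> resolvent_set A.HA M.A0" for z
  proof -
    have z: "z \<in> resolvent_set (H 0) M.Lrel" "z \<noteq> of_real z1" using that M.resolvent_set_A0 by auto
    obtain B where "M.inv_at z B" by (rule M.inv_at_exists[OF z(1)])
    then show ?thesis using z by blast
  qed
  have weyl: "gamma_field M.A_max A.Gamma0 z `` car Cd = {x. (x, z *\<^sub>C x) \<in> M.A_max} \<and>
      {x. (x, z *\<^sub>C x) \<in> M.A_max} = {(\<Sum>\<sigma>\<in>S. c \<sigma> *\<^sub>C A.F_vec \<sigma> z) | c. True} \<and>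
      weyl_function M.A_max A.Gamma0 A.Gamma1 z = mat_rel S (A.q_mat z + A.r_mat z)"
    if z: "z \<in> resolvent_set A.HA M.A0" for z
  proof -
    obtain B where B: "M.inv_at z B" "z \<noteq> of_real z1" using inv[OF z] by blast
    show ?thesis using kernel_eq[OF B] weyl_function_eq[OF B] by blast
  qed
  \<comment> \<open>Rewriting the adjoint of \<open>A_min\<close> as \<open>A_max\<close> turns the
    gamma field and the Weyl function of the statement into those already computed.\<close>
  show ?thesis
    unfolding Let_def A_min_eq A_ext_eq A_max_eq M.A0_def[symmetric] M.adjoint_A_min
  proof (intro conjI ballI allI impI)
    fix z assume z: "z \<in> resolvent_set A.HA M.A0"
    show "gamma_field M.A_max A.Gamma0 z `` car Cd = {x. (x, z *\<^sub>C x) \<in> M.A_max}"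
      "{x. (x, z *\<^sub>C x) \<in> M.A_max} = {(\<Sum>\<sigma>\<in>S. c \<sigma> *\<^sub>C A.F_vec \<sigma> z) | c. True}"
      "weyl_function M.A_max A.Gamma0 A.Gamma1 z = mat_rel S (A.q_mat z + A.r_mat z)"
      using weyl[OF z] by auto
  qed (use Gam M.A_min_dense M.A_min_closed M.A_min_symmetric M.boundary_triple_A_min M.A0_selfadjoint
      M.A_min_subset_A0 A_ext_extends M.Krein res resolvent_A0 in blast)+
qed

end
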